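(* Let $X_0:\ x_0^8+x_1^8+x_2^8+x_3^8=0$ be the octic Fermat surface in $\mathbb{P}^3$. Write $x_0^8+x_1^8=f_1f_3f_4$ and $x_2^8+x_3^8=g_1g_3g_4$ with $f_i\in\mathbb{C}[x_0,x_1]$, $g_i\in\mathbb{C}[x_2,x_3]$ homogeneous of degree $i$, and let $C_1:\ f_1=g_1=0$ and $C_2:\ f_3=g_3=0$, which are algebraic curves in $X_0$ (a line and a complete intersection of type $(3,3)$, with no intersection point). Then the local Noether-Lefschetz locus $V^{\check{\mathsf T}}_{[C_1]+r[C_2]}$, $r\in\mathbb{Q}$, $r\neq0$, is a general pencil.
   Context: Let $\check{\mathsf T}$ be the $25$-dimensional parameter space (near $0$) of the family of smooth octic surfaces $$X_t=\{f_t=0\}\subset\mathbb{P}^3,\qquad f_t:=x_0^8+x_1^8+x_2^8+x_3^8-\sum_\alpha t_\alpha x^\alpha,\quad t=(t_\alpha),$$ where $x^\alpha=x_0^{\alpha_0}x_1^{\alpha_1}x_2^{\alpha_2}x_3^{\alpha_3}$ runs through the monomials with $\alpha_0+\alpha_1=\alpha_2+\alpha_3=4$. For $\beta\in\mathbb{Z}_{\ge0}^4$ with $\beta_0+\beta_1+\beta_2+\beta_3=4$ let $$\omega_\beta:=\mathrm{Resi}\left(\frac{x_0^{\beta_0}x_1^{\beta_1}x_2^{\beta_2}x_3^{\beta_3}\sum_{i=0}^3(-1)^ix_i\widehat{dx_i}}{f_t}\right)\in H^2_{\mathrm{dR}}(X_t),$$ where $\mathrm{Resi}$ is the residue map $H^3_{\mathrm{dR}}(\mathbb{P}^3\setminus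 X_t)\to H^2_{\mathrm{dR}}(X_t)$ and $\widehat{dx_i}$ is the wedge product of the $dx_j$, $j\neq i$, in increasing order. Here $[C_i]\in H_2(X_0,\mathbb{Z})$ is the homology class of $C_i$. For a Hodge cycle $\delta_0\in H_2(X_0,\mathbb{Q})$ with parallel transport $\delta_t\in H_2(X_t,\mathbb{Q})$ for $t$ near $0$, the local Noether-Lefschetz locus $V_{\delta_0}^{\check{\mathsf T}}$ is the analytic space germ at $0\in\check{\mathsf T}$ (possibly non-reduced) defined by the ideal $$\left\langle\int_{\delta_t}\omega_\beta\ :\ \beta_0+\beta_1+\beta_2+\beta_3=4\right\rangle\subset\mathcal{O}_{\check{\mathsf T},0}.$$ For cycles combined from lines $x_0-\zeta_1x_1=x_2-\zeta_2x_3=0$, $\zeta_1^8=\zeta_2^8=-1$ (such as $[C_1]+r[C_2]$), this locus is given by $\hat h^{20}:=(\frac d2-1)^2=9$ equations ($d=8$). Terminology: the source gives no separate formal definition of "general pencil". It uses "pencil" for the family of loci $V^{\check{\mathsf T}}_{\delta_1+r\delta_2}$ as $r\in\mathbb{Q}$ varies (here $\delta_1=[C_1]$, $\delta_2=[C_2]$), and says that their tangent spaces at $0$ form a pencil with axis $T_0V^{\check{\mathsf T}}_{\delta_1}\cap T_0V^{\check{\mathsf T}}_{\delta_2}$. It uses "general" for having the maximal codimension, the number of defining equations, which in $\check{\mathsf T}$ is $\hat h^{20}=9$. *)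

theory Defs
  imports "HOL-Analysis.Analysis" "HOL-Homology.Homology"
begin

section \<open>Complex projective three-space\<close>

text \<open>Homogeneous coordinates are indexed by the four elements \<open>0, 1, 2, 3\<close> of the type \<open>4\<close>; a
  point of projective space is the punctured complex line through a nonzero vector.\<close>

definition proj :: "complex^4 \<Rightarrow> (complex^4) set" where
  "proj x = {c *s x | c. c \<noteq> 0}"

definition P3 :: "(complex^4) set topology" where
  "P3 = topology (\<lambda>U. U \<subseteq> proj ` (- {0}) \<and> open {x. x \<noteq> 0 \<and> proj x \<in> U})"

lemma openin_P3:
  "openin P3 U \<longleftrightarrow> U \<subseteq> proj ` (- {0}) \<and> open {x. x \<noteq> 0 \<and> proj x \<in> U}"
proof -
  have "istopology (\<lambda>U. U \<subseteq> proj ` (- {0}) \<and> open {x. x \<noteq> 0 \<and> proj x \<in> U})"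
    unfolding istopology_def
  proof (intro conjI allI impI)
    fix S T :: "(complex^4) set set"
    assume S: "S \<subseteq> proj ` (- {0}) \<and> open {x. x \<noteq> 0 \<and> proj x \<in> S}"
      and T: "T \<subseteq> proj ` (- {0}) \<and> open {x. x \<noteq> 0 \<and> proj x \<in> T}"
    show "S \<inter> T \<subseteq> proj ` (- {0})" using S by blast
    have "{x. x \<noteq> 0 \<and> proj x \<in> S \<inter> T}
        = {x. x \<noteq> 0 \<and> proj x \<in> S} \<inter> {x. x \<noteq> 0 \<and> proj x \<in> T}" by blast
    then show "open {x. x \<noteq> 0 \<and> proj x \<in> S \<inter> T}" using S T by (simp add: open_Int)
  next
    fix K :: "(complex^4) set set set"
    assume K: "\<forall>U\<in>K. U \<subseteq> proj ` (- {0}) \<and> open {x. x \<noteq> 0 \<and> proj x \<in> U}"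
    then show "\<Union>K \<subseteq> proj ` (- {0})" by blast
    have "{x. x \<noteq> 0 \<and> proj x \<in> \<Union>K} = (\<Union>U\<in>K. {x. x \<noteq> 0 \<and> proj x \<in> U})" by blast
    then show "open {x. x \<noteq> 0 \<and> proj x \<in> \<Union>K}" using K by auto
  qed
  then show ?thesis
    by (simp add: P3_def topology_inverse')
qed

lemma topspace_P3: "topspace P3 = proj ` (- {0})"
proof -
  have "{x. x \<noteq> 0 \<and> proj x \<in> proj ` (- {0})} = - {0}" by auto
  moreover have "open (- {0 :: complex^4})" by (simp add: open_Compl)
  ultimately have "openin P3 (proj ` (- {0}))" by (simp only: openin_P3 order_refl simp_thms)
  moreover have "topspace P3 \<subseteq> proj ` (- {0})" using openin_P3 openin_topspace by blast
  ultimately show ?thesis using openin_subset by blast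
qed

lemma quotient_map_proj: "quotient_map (top_of_set (- {0})) P3 proj"
proof -
  have "openin (top_of_set (- {0})) {x \<in> - {0}. proj x \<in> U} \<longleftrightarrow> open {x. x \<noteq> 0 \<and> proj x \<in> U}" for U
  proof -
    have "{x \<in> - {0}. proj x \<in> U} = {x. x \<noteq> 0 \<and> proj x \<in> U}" by auto
    moreover have "open (- {0 :: complex^4})" by (simp add: open_Compl)
    ultimately show ?thesis by (auto simp: openin_open_eq)
  qed
  then show ?thesis by (auto simp: quotient_map_def topspace_P3 openin_P3)
qed


section \<open>The family of octic surfaces\<close>

typedef mid_exp = "{\<alpha> :: 4 \<Rightarrow> nat. \<alpha> 0 + \<alpha> 1 = 4 \<and> \<alpha> 2 + \<alpha> 3 = 4}"
  morphisms expo Mid_exp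
  by (rule exI[of _ "\<lambda>_. 2"]) simp

lemma univ_4: "UNIV = {0, 1, 2, 3 :: 4}"
proof -
  have "(4 :: 4) = 0" by simp
  then show ?thesis using UNIV_4 by auto
qed

lemma card_mid_exps:
  "finite {\<alpha> :: 4 \<Rightarrow> nat. \<alpha> 0 + \<alpha> 1 = 4 \<and> \<alpha> 2 + \<alpha> 3 = 4} \<and>
   card {\<alpha> :: 4 \<Rightarrow> nat. \<alpha> 0 + \<alpha> 1 = 4 \<and> \<alpha> 2 + \<alpha> 3 = 4} = 25"
proof -
  let ?A = "{\<alpha> :: 4 \<Rightarrow> nat. \<alpha> 0 + \<alpha> 1 = 4 \<and> \<alpha> 2 + \<alpha> 3 = 4}"
  let ?h = "\<lambda>\<alpha> :: 4 \<Rightarrow> nat. (\<alpha> 0, \<alpha> 2)"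
  let ?k = "\<lambda>(a :: nat, b :: nat) i :: 4.
    if i = 0 then a else if i = 1 then 4 - a else if i = 2 then b else 4 - b"
  have "bij_betw ?h ?A ({..4} \<times> {..4})"
  proof (rule bij_betw_byWitness[where f' = ?k])
    show "\<forall>\<alpha>\<in>?A. ?k (?h \<alpha>) = \<alpha>"
    proof
      fix \<alpha> :: "4 \<Rightarrow> nat" assume \<alpha>: "\<alpha> \<in> ?A"
      have "?k (?h \<alpha>) i = \<alpha> i" for i
        using univ_4 \<alpha> by (cases "i = 0"; cases "i = 1"; cases "i = 2"; cases "i = 3") auto
      then show "?k (?h \<alpha>) = \<alpha>" by blast
    qed
  qed auto
  then show ?thesis
    by (simp add: bij_betw_finite bij_betw_same_card card_cartesian_product)
qed

instance mid_exp :: finite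
proof
  show "finite (UNIV :: mid_exp set)"
    using finite_imageI[OF conjunct1[OF card_mid_exps], of Mid_exp]
    unfolding type_definition.Abs_image[OF type_definition_mid_exp] .
qed

lemma card_mid_exp: "CARD(mid_exp) = 25"
  using type_definition.card[OF type_definition_mid_exp] card_mid_exps by simp

type_synonym param = "complex^mid_exp"

definition monomial :: "(4 \<Rightarrow> nat) \<Rightarrow> complex^4 \<Rightarrow> complex" where
  "monomial \<beta> x = (\<Prod>i\<in>UNIV. x $ i ^ \<beta> i)"

definition octic :: "param \<Rightarrow> complex^4 \<Rightarrow> complex" where
  "octic t x = (\<Sum>i\<in>UNIV. x $ i ^ 8) - (\<Sum>\<alpha>\<in>UNIV. t $ \<alpha> * monomial (expo \<alpha>) x)"

definition octic_points :: "param \<Rightarrow> (complex^4) set set" where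
  "octic_points t = {proj x | x. x \<noteq> 0 \<and> octic t x = 0}"

definition octic_surface :: "param \<Rightarrow> (complex^4) set topology" where
  "octic_surface t = subtopology P3 (octic_points t)"


section \<open>The residue forms and their periods\<close>

text \<open>Contracting \<open>dx\<^sub>0 \<and> dx\<^sub>1 \<and> dx\<^sub>2 \<and> dx\<^sub>3\<close> with the Euler field at \<open>x\<close> gives
  \<open>\<Sum>\<^sub>i (-1)\<^sup>i x\<^sub>i \<and>\<^sub>j\<^sub>\<noteq>\<^sub>i dx\<^sub>j\<close>, so the value of the latter on \<open>(w, u, v)\<close> is the determinant with rows
  \<open>x, w, u, v\<close>. As \<open>\<beta>\<close> has degree 4, the form
  \<open>x\<^sup>\<beta> \<Sum>\<^sub>i (-1)\<^sup>i x\<^sub>i \<and>\<^sub>j\<^sub>\<noteq>\<^sub>i dx\<^sub>j / f\<^sub>t\<close> has a simple pole along the surface, and its residue is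
  represented by the Poincare residue: the restriction to the surface of any \<open>\<eta>\<close> with
  \<open>x\<^sup>\<beta> \<Sum>\<^sub>i (-1)\<^sup>i x\<^sub>i \<and>\<^sub>j\<^sub>\<noteq>\<^sub>i dx\<^sub>j = df\<^sub>t \<and> \<eta>\<close>. Evaluated on \<open>(w, u, v)\<close> with \<open>u, v\<close> tangent
  to the cone \<open>f\<^sub>t = 0\<close>, the right-hand side is \<open>df\<^sub>t(w) \<eta>(u, v)\<close>; this gives the
  formula below, whose value does not depend on \<open>w\<close>. The form is invariant under rescaling
  of \<open>x\<close> and vanishes on the Euler field, hence lives on the projective surface.
  The normalisation by a power of \<open>2\<pi>i\<close> used by some authors does not affect the ideal of
  the Noether-Lefschetz locus.\<close>

definition residue_form ::
  "param \<Rightarrow> (4 \<Rightarrow> nat) \<Rightarrow> complex^4 \<Rightarrow> complex^4 \<Rightarrow> complex^4 \<Rightarrow> complex" where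
  "residue_form t \<beta> x u v =
    (let df = frechet_derivative (octic t) (at x); w = (SOME w. df w \<noteq> 0)
     in monomial \<beta> x *
        det ((\<chi> i. if i = 0 then x else if i = 1 then w else if i = 2 then u else v) :: complex^4^4)
        / df w)"

text \<open>Affine coordinates on the standard 2-simplex; they define its orientation.\<close>

definition triangle :: "(real \<times> real) set" where
  "triangle = {(a, b). 0 \<le> a \<and> 0 \<le> b \<and> a + b \<le> 1}"

definition barycentric :: "real \<times> real \<Rightarrow> nat \<Rightarrow> real" where
  "barycentric p i =
    (if i = 0 then 1 - fst p - snd p else if i = 1 then fst p else if i = 2 then snd p else 0)"

text \<open>A continuously differentiable lift of a singular 2-simplex to \<open>\<complex>\<^sup>4 - {0}\<close>, defined near
  the triangle, with its two partial derivatives. Since the simplex is contractible,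
  the simplices having such a lift are exactly the continuously differentiable ones.\<close>

definition C1_lift ::
  "((nat \<Rightarrow> real) \<Rightarrow> (complex^4) set) \<Rightarrow> (real \<times> real \<Rightarrow> complex^4) \<Rightarrow>
   (real \<times> real \<Rightarrow> complex^4) \<Rightarrow> (real \<times> real \<Rightarrow> complex^4) \<Rightarrow> bool" where
  "C1_lift \<sigma> g g1 g2 \<longleftrightarrow>
    (\<forall>p\<in>triangle. g p \<noteq> 0 \<and> \<sigma> (barycentric p) = proj (g p)) \<and>
    (\<exists>S. open S \<and> triangle \<subseteq> S \<and> continuous_on S g1 \<and> continuous_on S g2 \<and>
      (\<forall>p\<in>S. (g has_derivative (\<lambda>h. fst h *\<^sub>R g1 p + snd h *\<^sub>R g2 p)) (at p)))"

definition C1_simplex :: "((nat \<Rightarrow> real) \<Rightarrow> (complex^4) set) \<Rightarrow> bool" where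
  "C1_simplex \<sigma> \<longleftrightarrow> (\<exists>g g1 g2. C1_lift \<sigma> g g1 g2)"

definition simplex_integral ::
  "param \<Rightarrow> (4 \<Rightarrow> nat) \<Rightarrow> ((nat \<Rightarrow> real) \<Rightarrow> (complex^4) set) \<Rightarrow> complex" where
  "simplex_integral t \<beta> \<sigma> = (THE I. \<exists>g g1 g2. C1_lift \<sigma> g g1 g2 \<and>
     I = integral triangle (\<lambda>p. residue_form t \<beta> (g p) (g1 p) (g2 p)))"

definition chain_integral :: "param \<Rightarrow> (4 \<Rightarrow> nat) \<Rightarrow> (complex^4) set chain \<Rightarrow> complex" where
  "chain_integral t \<beta> z =
    (\<Sum>\<sigma>\<in>Poly_Mapping.keys z. of_int (Poly_Mapping.lookup z \<sigma>) * simplex_integral t \<beta> \<sigma>)"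

text \<open>The integral of \<open>\<omega>\<^sub>\<beta>\<close> over a class in \<open>H\<^sub>2(X\<^sub>t, \<int>)\<close>, computed on any continuously
  differentiable cycle in the class.\<close>

definition period :: "param \<Rightarrow> (4 \<Rightarrow> nat) \<Rightarrow> (complex^4) set chain set \<Rightarrow> complex" where
  "period t \<beta> c = (THE I. \<exists>z. singular_relcycle 2 (octic_surface t) {} z \<and>
     (\<forall>\<sigma>\<in>Poly_Mapping.keys z. C1_simplex \<sigma>) \<and>
     c = homologous_rel_set 2 (octic_surface t) {} z \<and> I = chain_integral t \<beta> z)"


section \<open>Parallel transport and the local Noether-Lefschetz locus\<close>

text \<open>The restriction of the family to the segment from \<open>0\<close> to \<open>t\<close>. When all its fibres are
  smooth, that is for \<open>t\<close> near \<open>0\<close>, it is a topologically trivial fibre bundle, and the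
  inclusions of the two end fibres induce isomorphisms in homology.\<close>

definition segment_family :: "param \<Rightarrow> (real \<times> (complex^4) set) topology" where
  "segment_family t = subtopology (prod_topology euclideanreal P3)
     {(s, q). 0 \<le> s \<and> s \<le> 1 \<and> q \<in> octic_points (s *\<^sub>R t)}"

definition transport :: "param \<Rightarrow> (complex^4) set chain set \<Rightarrow> (complex^4) set chain set" where
  "transport t c = (THE c'. c' \<in> carrier (homology_group 2 (octic_surface t)) \<and>
     hom_induced 2 (octic_surface t) {} (segment_family t) {} (Pair 1) c' =
     hom_induced 2 (octic_surface 0) {} (segment_family t) {} (Pair 0) c)"

text \<open>An element \<open>\<Sum>\<^sub>k r\<^sub>k \<otimes> c\<^sub>k\<close> of \<open>H\<^sub>2(X\<^sub>0, \<rat>) = \<rat> \<otimes> H\<^sub>2(X\<^sub>0, \<int>)\<close> is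
  given by the list of the pairs \<open>(r\<^sub>k, c\<^sub>k)\<close>. Transport and integration are additive.\<close>

type_synonym rat_class = "(rat \<times> (complex^4) set chain set) list"

definition NL_function :: "rat_class \<Rightarrow> (4 \<Rightarrow> nat) \<Rightarrow> param \<Rightarrow> complex" where
  "NL_function \<delta> \<beta> t = (\<Sum>(r, c)\<leftarrow>\<delta>. of_rat r * period t \<beta> (transport t c))"

definition quartic_exps :: "(4 \<Rightarrow> nat) set" where
  "quartic_exps = {\<beta>. (\<Sum>i\<in>UNIV. \<beta> i) = 4}"

lemma finite_quartic_exps: "finite quartic_exps"
proof (rule finite_subset)
  show "quartic_exps \<subseteq> (UNIV :: 4 set) \<rightarrow>\<^sub>E {..4}"
  proof
    fix \<beta> assume "\<beta> \<in> quartic_exps"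
    then have "\<beta> i \<le> 4" for i
      using member_le_sum[of i UNIV \<beta>] by (simp add: quartic_exps_def)
    then show "\<beta> \<in> UNIV \<rightarrow>\<^sub>E {..4}" by (simp add: PiE_UNIV_domain)
  qed
qed (simp add: finite_PiE)

text \<open>Germs at \<open>0\<close> are represented by functions, and are compared near \<open>0\<close> only.\<close>

definition holo_on :: "(complex^'n \<Rightarrow> complex) \<Rightarrow> (complex^'n) set \<Rightarrow> bool" where
  "holo_on f S \<longleftrightarrow>
    (\<forall>t\<in>S. \<exists>D. (f has_derivative D) (at t) \<and> (\<forall>c v. D (c *s v) = c * D v))"

definition germs0 :: "(complex^'n \<Rightarrow> complex) set" where
  "germs0 = {f. \<exists>U. open U \<and> 0 \<in> U \<and> holo_on f U}"

definition germ_ideal ::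
  "'b set \<Rightarrow> ('b \<Rightarrow> complex^'n \<Rightarrow> complex) \<Rightarrow> (complex^'n \<Rightarrow> complex) set" where
  "germ_ideal B F = {f \<in> germs0. \<exists>g. (\<forall>\<beta>\<in>B. g \<beta> \<in> germs0) \<and>
     (\<forall>\<^sub>F t in nhds 0. f t = (\<Sum>\<beta>\<in>B. g \<beta> t * F \<beta> t))}"

definition NL_ideal :: "rat_class \<Rightarrow> (param \<Rightarrow> complex) set" where
  "NL_ideal \<delta> = germ_ideal quartic_exps (NL_function \<delta>)"

definition NL_support :: "rat_class \<Rightarrow> param set" where
  "NL_support \<delta> = {t. \<forall>\<beta>\<in>quartic_exps. NL_function \<delta> \<beta> t = 0}"

definition tangent_space0 :: "(complex^'n \<Rightarrow> complex) set \<Rightarrow> (complex^'n) set" where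
  "tangent_space0 J = {v. \<forall>f\<in>J. frechet_derivative f (at 0) v = 0}"

text \<open>\<open>Z\<close> is near \<open>p\<close> a complex submanifold of codimension \<open>k\<close>.\<close>

definition regular_point :: "(complex^'n) set \<Rightarrow> complex^'n \<Rightarrow> nat \<Rightarrow> bool" where
  "regular_point Z p k \<longleftrightarrow> p \<in> Z \<and> (\<exists>U h. open U \<and> p \<in> U \<and>
     (\<forall>i<k. holo_on (h i) U) \<and> Z \<inter> U = {t \<in> U. \<forall>i<k. h i t = 0} \<and>
     (\<forall>a :: nat \<Rightarrow> complex. (\<forall>v. (\<Sum>i<k. a i * frechet_derivative (h i) (at p) v) = 0)
        \<longrightarrow> (\<forall>i<k. a i = 0)))"

text \<open>The dimension of an analytic set \<open>Z\<close> at \<open>0\<close> is the upper limit of its dimensions at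
  regular points tending to \<open>0\<close>; so its codimension is the least one occurring at
  regular points arbitrarily close to \<open>0\<close>.\<close>

definition codim0 :: "(complex^'n) set \<Rightarrow> nat \<Rightarrow> bool" where
  "codim0 Z k \<longleftrightarrow> (\<forall>\<epsilon>>0. \<exists>p\<in>ball 0 \<epsilon>. regular_point Z p k) \<and>
     (\<forall>j<k. \<not> (\<forall>\<epsilon>>0. \<exists>p\<in>ball 0 \<epsilon>. regular_point Z p j))"


section \<open>Curves and their homology classes\<close>

text \<open>Homogeneous polynomials of degree \<open>n\<close> in two variables, as polynomial functions.\<close>

definition binary_form :: "nat \<Rightarrow> (complex \<Rightarrow> complex \<Rightarrow> complex) \<Rightarrow> bool" where
  "binary_form n f \<longleftrightarrow> (\<exists>a. \<forall>x y. f x y = (\<Sum>k\<le>n. a k * x ^ k * y ^ (n - k)))"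

definition curve ::
  "(complex \<Rightarrow> complex \<Rightarrow> complex) \<Rightarrow> (complex \<Rightarrow> complex \<Rightarrow> complex) \<Rightarrow> (complex^4) set set" where
  "curve f g = {proj x | x. x \<noteq> 0 \<and> f (x $ 0) (x $ 1) = 0 \<and> g (x $ 2) (x $ 3) = 0}"

definition indep2 :: "complex^4 \<Rightarrow> complex^4 \<Rightarrow> bool" where
  "indep2 u v \<longleftrightarrow> (\<forall>a b. a *s u + b *s v = 0 \<longrightarrow> a = 0 \<and> b = 0)"

definition line :: "complex^4 \<Rightarrow> complex^4 \<Rightarrow> (complex^4) set set" where
  "line u v = {proj (a *s u + b *s v) | a b. (a, b) \<noteq> (0, 0)}"

definition lines :: "(complex^4) set set set" where
  "lines = {line u v | u v. indep2 u v}"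

text \<open>A parametrisation of \<open>line u v\<close> by the 2-simplex. With
  \<open>w = s\<^sub>0 + s\<^sub>1 \<zeta> + s\<^sub>2 \<zeta>\<^sup>2\<close>, \<open>\<zeta>\<close> a primitive cube root of unity, the simplex becomes the
  positively oriented triangle with vertices \<open>1, \<zeta>, \<zeta>\<^sup>2\<close> in the complex plane. On rays from its centre
  \<open>|w|\<close> increases and \<open>s\<^sub>0 s\<^sub>1 s\<^sub>2\<close> decreases to \<open>0\<close>, so \<open>w / (s\<^sub>0 s\<^sub>1 s\<^sub>2)\<close> maps the open
  triangle homeomorphically, preserving orientation, onto \<open>\<complex>\<close>, and the boundary goes to
  the point at infinity.\<close>

definition line_simplex :: "complex^4 \<Rightarrow> complex^4 \<Rightarrow> (nat \<Rightarrow> real) \<Rightarrow> (complex^4) set" where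
  "line_simplex u v = (\<lambda>s\<in>standard_simplex 2.
     proj ((of_real (s 0) + of_real (s 1) * cis (2 * pi / 3) + of_real (s 2) * cis (4 * pi / 3)) *s u
           + of_real (s 0 * s 1 * s 2) *s v))"

definition line_cycle :: "complex^4 \<Rightarrow> complex^4 \<Rightarrow> (complex^4) set chain" where
  "line_cycle u v =
    frag_of (line_simplex u v) - frag_of (\<lambda>s\<in>standard_simplex 2. proj u)"

text \<open>The fundamental class of a line, with its complex orientation; it does not depend on
  the choice of the basis.\<close>

definition line_class ::
  "(complex^4) set topology \<Rightarrow> (complex^4) set set \<Rightarrow> (complex^4) set chain set" where
  "line_class X L = (SOME c. \<exists>u v. indep2 u v \<and> L = line u v \<and>
     c = homologous_rel_set 2 X {} (line_cycle u v))"

text \<open>The class of a reduced curve is the sum of the fundamental classes of its irreducible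
  components. A curve \<open>f(x\<^sub>0, x\<^sub>1) = g(x\<^sub>2, x\<^sub>3) = 0\<close> with \<open>f\<close>, \<open>g\<close> squarefree, such as
  factors of \<open>x\<^sup>8 + y\<^sup>8\<close>, is reduced, and its components are the lines
  contained in it.\<close>

definition curve_class ::
  "(complex^4) set topology \<Rightarrow> (complex^4) set set \<Rightarrow> (complex^4) set chain set" where
  "curve_class X C = finprod (homology_group 2 X) (line_class X) {L \<in> lines. L \<subseteq> C}"


section \<open>General pencils\<close>

text \<open>General: each member has the maximal codimension 9, the number \<open>(d/2 - 1)\<^sup>2\<close>, \<open>d = 8\<close>, of
  its defining equations.\<close>

definition general_member :: "rat_class \<Rightarrow> bool" where
  "general_member \<delta> \<longleftrightarrow> codim0 (NL_support \<delta>) ((8 div 2 - 1)\<^sup>2)"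

text \<open>Pencil: the tangent spaces at \<open>0\<close> of any two members meet in the axis, the
  intersection of the tangent spaces of the loci of \<open>\<delta>\<^sub>1\<close> and \<open>\<delta>\<^sub>2\<close>.\<close>

definition general_pencil ::
  "(complex^4) set chain set \<Rightarrow> (complex^4) set chain set \<Rightarrow> bool" where
  "general_pencil \<delta>1 \<delta>2 \<longleftrightarrow>
    (\<forall>r::rat. r \<noteq> 0 \<longrightarrow> general_member [(1, \<delta>1), (r, \<delta>2)]) \<and>
    (\<forall>r r'::rat. r \<noteq> 0 \<and> r' \<noteq> 0 \<and> r \<noteq> r' \<longrightarrow>
       tangent_space0 (NL_ideal [(1, \<delta>1), (r, \<delta>2)]) \<inter> tangent_space0 (NL_ideal [(1, \<delta>1), (r', \<delta>2)])
       = tangent_space0 (NL_ideal [(1, \<delta>1)]) \<inter> tangent_space0 (NL_ideal [(1, \<delta>2)]))"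

end

theory Submission
  imports Defs
begin

text \<open>
The tube around the Fermat surface retracts onto the nearby octics: a point is moved along the
conjugate gradient by the unique small root of \<open>f\<^sub>t\<close>. This map realises parallel transport, so the
period over a transported line is the integral of a residue form over a triangle, and it is
holomorphic in \<open>t\<close>. That periods do not depend on the chosen differentiable cycle is shown with local
primitives \<open>H dB\<close> of the residue forms, whose comparison gives a cochain on the vertices of
small simplices.

For \<open>\<beta>\<^sub>0 + \<beta>\<^sub>1 \<noteq> 2\<close> the symmetry \<open>diag(i, i, 1, 1)\<close> fixes the classes of the lines and multiplies the
periods by a nontrivial fourth root of unity, so that they vanish near \<open>0\<close>. For \<open>\<beta>\<^sub>0 + \<beta>\<^sub>1 = 2\<close> the
derivative of the period over \<open>x\<^sub>0 = \<zeta> x\<^sub>1, x\<^sub>2 = \<xi> x\<^sub>3\<close> in the direction of \<open>t\<^sub>\<alpha>\<close> is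
\<open>J \<zeta>\<close> to the power \<open>\<alpha>\<^sub>0 + \<beta>\<^sub>0\<close> times \<open>\<xi>\<close> to the power \<open>\<alpha>\<^sub>2 + \<beta>\<^sub>2\<close>, where \<open>J \<noteq> 0\<close> because its integrand is a
constant times a nonnegative function. As \<open>C\<^sub>1\<close> and \<open>C\<^sub>2\<close> are unions of one and of nine lines with
distinct slopes, two Vandermonde arguments show that the nine remaining periods of \<open>C\<^sub>1 + r C\<^sub>2\<close> have
independent differentials at \<open>0\<close> for \<open>r \<noteq> 0\<close>. Hence the locus is smooth of codimension 9, and its tangent
space, the common kernel of the differentials, is linear in \<open>r\<close>.
\<close>

section \<open>Continuously differentiable maps\<close>

text \<open>The obstacle is the gap between homology and forms: classes in
  \<open>homologous_rel_set\<close> are compared through chains that are only continuous, so Stokes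
  cannot be applied to a chain bounding the difference of two differentiable cycles. Differential
  calculus is therefore confined to single simplices and to paths inside charts, and what passes to
  continuous simplices is a function of their vertices. Forms \<open>H dB\<close> with
  \<open>H\<close>, \<open>B\<close> of class C1 have merely continuous coefficients, which is why
  the formulas of Green and Poincare are proved in versions that never differentiate twice. The
  conjugate gradient is compatible with scalars and with the symmetry, and for fixed x the root
  along it is holomorphic in t. The numbers match in two places: the 1 + 3 slopes occurring in each
  pair of variables are within reach of the exponents 0 to 4 of the parameters, and the three slopes
  of \<open>f3\<close> and of \<open>g3\<close> are as many as the exponents 0 to 2 of the nine
  remaining forms.\<close>

abbreviation FD :: "('a::real_normed_vector \<Rightarrow> 'b::real_normed_vector) \<Rightarrow> 'a \<Rightarrow> 'a \<Rightarrow> 'b" where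
  "FD f x \<equiv> frechet_derivative f (at x)"

text \<open>Openness of the domain is part of the notion, and continuity of the derivative is asked
  for one direction at a time. On a Euclidean domain this gives joint continuity in point and
  direction (\<open>continuous_on_FD\<close>) and continuity in operator norm
  (\<open>C1_on_Blinfun\<close>).\<close>

definition C1_on :: "('a::real_normed_vector \<Rightarrow> 'b::real_normed_vector) \<Rightarrow> 'a set \<Rightarrow> bool" where
  "C1_on f S \<longleftrightarrow> open S \<and> (\<forall>x\<in>S. f differentiable at x) \<and> (\<forall>v. continuous_on S (\<lambda>x. FD f x v))"

lemma FD_eq: "(f has_derivative D) (at x) \<Longrightarrow> FD f x = D"
  using frechet_derivative_at by metis

lemma C1_onI:
  assumes "open S" "\<And>x. x \<in> S \<Longrightarrow> (f has_derivative D x) (at x)" "\<And>v. continuous_on S (\<lambda>x. D x v)"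
  shows "C1_on f S"
proof -
  have "FD f x = D x" if "x \<in> S" for x using assms(2)[OF that] by (rule FD_eq)
  then have "continuous_on S (\<lambda>x. FD f x v)" for v
    using assms(3)[of v] by (simp cong: continuous_on_cong)
  with assms show ?thesis by (auto simp: C1_on_def differentiable_def)
qed

lemma C1_on_open: "C1_on f S \<Longrightarrow> open S"
  by (simp add: C1_on_def)

lemma C1_on_FD_continuous: "C1_on f S \<Longrightarrow> continuous_on S (\<lambda>x. FD f x v)"
  by (simp add: C1_on_def)

lemma C1_on_has_derivative: "C1_on f S \<Longrightarrow> x \<in> S \<Longrightarrow> (f has_derivative FD f x) (at x)"
  by (simp add: C1_on_def frechet_derivative_works)

lemma C1_on_linear: "C1_on f S \<Longrightarrow> x \<in> S \<Longrightarrow> bounded_linear (FD f x)"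
  using C1_on_has_derivative has_derivative_bounded_linear by blast

lemma C1_on_continuous_on: "C1_on f S \<Longrightarrow> continuous_on S f"
  by (meson C1_on_has_derivative continuous_at_imp_continuous_on has_derivative_continuous)

lemma C1_on_subset: "C1_on f S \<Longrightarrow> open T \<Longrightarrow> T \<subseteq> S \<Longrightarrow> C1_on f T"
  by (auto simp: C1_on_def intro: continuous_on_subset)

lemma C1_on_cong:
  assumes "C1_on f S" "\<And>x. x \<in> S \<Longrightarrow> g x = f x"
  shows "C1_on g S"
proof (rule C1_onI[where D = "FD f"])
  show o: "open S" using assms(1) by (rule C1_on_open)
  fix x assume x: "x \<in> S"
  show "(g has_derivative FD f x) (at x)"
    by (rule has_derivative_transform_within_open[OF C1_on_has_derivative[OF assms(1) x] o x])
      (simp add: assms(2))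
next
  fix v show "continuous_on S (\<lambda>x. FD f x v)" using assms(1) by (simp add: C1_on_def)
qed

text \<open>Expanding the direction in the basis reduces the claim to finitely many fixed
  directions.\<close>

lemma continuous_on_FD:
  fixes f :: "'a::euclidean_space \<Rightarrow> 'b::real_normed_vector"
  assumes f: "C1_on f S" and g: "continuous_on T g" "g ` T \<subseteq> S" and w: "continuous_on T w"
  shows "continuous_on T (\<lambda>z. FD f (g z) (w z))"
proof -
  have "FD f (g z) (w z) = (\<Sum>b\<in>Basis. (w z \<bullet> b) *\<^sub>R FD f (g z) b)" if "z \<in> T" for z
  proof -
    interpret bounded_linear "FD f (g z)" using C1_on_linear[OF f] g that by blast
    have "FD f (g z) (w z) = FD f (g z) (\<Sum>b\<in>Basis. (w z \<bullet> b) *\<^sub>R b)"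
      by (simp add: euclidean_representation)
    also have "\<dots> = (\<Sum>b\<in>Basis. (w z \<bullet> b) *\<^sub>R FD f (g z) b)" by (simp add: sum scaleR)
    finally show ?thesis .
  qed
  moreover have "continuous_on T (\<lambda>z. FD f (g z) b)" for b
    using f g continuous_on_compose2[of S "\<lambda>x. FD f x b" T g] by (auto simp: C1_on_def)
  then have "continuous_on T (\<lambda>z. \<Sum>b\<in>Basis. (w z \<bullet> b) *\<^sub>R FD f (g z) b)"
    by (intro continuous_intros w)
  ultimately show ?thesis by (simp cong: continuous_on_cong)
qed

lemma C1_on_Blinfun:
  fixes f :: "'a::euclidean_space \<Rightarrow> 'b::real_normed_vector"
  assumes f: "C1_on f S"
  shows "\<And>x. x \<in> S \<Longrightarrow> blinfun_apply (Blinfun (FD f x)) = FD f x"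
    "continuous_on S (\<lambda>x. Blinfun (FD f x))"
proof -
  show *: "blinfun_apply (Blinfun (FD f x)) = FD f x" if "x \<in> S" for x
    using C1_on_linear[OF f that] by (rule bounded_linear_Blinfun_apply)
  show "continuous_on S (\<lambda>x. Blinfun (FD f x))"
    using f * by (intro continuous_on_blinfun_componentwise) (simp add: C1_on_def cong: continuous_on_cong)
qed

section \<open>Closure properties of continuous differentiability\<close>

lemma C1_on_bounded_linear: "bounded_linear f \<Longrightarrow> open S \<Longrightarrow> C1_on f S"
  by (rule C1_onI[where D = "\<lambda>_. f"]) (auto intro: bounded_linear_imp_has_derivative)

lemma C1_on_const [simp, intro]: "open S \<Longrightarrow> C1_on (\<lambda>_. c) S"
  by (rule C1_onI[where D = "\<lambda>_ _. 0"]) auto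

lemma C1_on_id [simp, intro]: "open S \<Longrightarrow> C1_on (\<lambda>x. x) S"
  by (intro C1_on_bounded_linear bounded_linear_ident)

lemma C1_on_compose:
  fixes g :: "'b::euclidean_space \<Rightarrow> 'c::real_normed_vector"
  assumes f: "C1_on f S" and g: "C1_on g T" and fT: "\<And>x. x \<in> S \<Longrightarrow> f x \<in> T"
  shows "C1_on (\<lambda>x. g (f x)) S"
proof (rule C1_onI[where D = "\<lambda>x v. FD g (f x) (FD f x v)"])
  show "open S" using f by (rule C1_on_open)
  fix x assume "x \<in> S"
  then show "((\<lambda>x. g (f x)) has_derivative (\<lambda>v. FD g (f x) (FD f x v))) (at x)"
    using has_derivative_compose[OF C1_on_has_derivative[OF f] C1_on_has_derivative[OF g]] fT by blast
next
  fix v show "continuous_on S (\<lambda>x. FD g (f x) (FD f x v))"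
    using fT by (intro continuous_on_FD[OF g] C1_on_FD_continuous f C1_on_continuous_on[OF f]) auto
qed

lemma FD_compose:
  assumes "C1_on f S" "C1_on g T" "x \<in> S" "f x \<in> T"
  shows "FD (\<lambda>x. g (f x)) x v = FD g (f x) (FD f x v)"
  using FD_eq[OF has_derivative_compose[OF C1_on_has_derivative C1_on_has_derivative]] assms by metis

lemma C1_on_linear_compose:
  assumes "bounded_linear h" and f: "C1_on f S"
  shows "C1_on (\<lambda>x. h (f x)) S"
proof (rule C1_onI[where D = "\<lambda>x v. h (FD f x v)"])
  show "open S" using f by (rule C1_on_open)
  show "((\<lambda>x. h (f x)) has_derivative (\<lambda>v. h (FD f x v))) (at x)" if "x \<in> S" for x
    using bounded_linear.has_derivative[OF assms(1) C1_on_has_derivative[OF f that]] .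
  show "continuous_on S (\<lambda>x. h (FD f x v))" for v
    using f by (intro bounded_linear.continuous_on[OF assms(1)]) (simp add: C1_on_def)
qed

lemma C1_on_bilinear:
  assumes b: "bounded_bilinear h" and f: "C1_on f S" and g: "C1_on g S"
  shows "C1_on (\<lambda>x. h (f x) (g x)) S"
proof (rule C1_onI[where D = "\<lambda>x v. h (f x) (FD g x v) + h (FD f x v) (g x)"])
  show "open S" using f by (rule C1_on_open)
  show "((\<lambda>x. h (f x) (g x)) has_derivative (\<lambda>v. h (f x) (FD g x v) + h (FD f x v) (g x))) (at x)"
    if "x \<in> S" for x
    using bounded_bilinear.FDERIV[OF b C1_on_has_derivative[OF f that] C1_on_has_derivative[OF g that]] .
  show "continuous_on S (\<lambda>x. h (f x) (FD g x v) + h (FD f x v) (g x))" for v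
    by (intro continuous_intros bounded_bilinear.continuous_on[OF b] C1_on_continuous_on[OF f]
      C1_on_continuous_on[OF g] C1_on_FD_continuous f g)
qed

lemmas C1_on_mult = C1_on_bilinear[OF bounded_bilinear_mult]
lemmas C1_on_scaleR = C1_on_bilinear[OF bounded_bilinear_scaleR]

lemma C1_on_add: "C1_on f S \<Longrightarrow> C1_on g S \<Longrightarrow> C1_on (\<lambda>x. f x + g x) S"
  by (rule C1_onI[where D = "\<lambda>x v. FD f x v + FD g x v"])
    (auto simp: C1_on_def frechet_derivative_works intro!: has_derivative_add continuous_intros)

lemma C1_on_diff: "C1_on f S \<Longrightarrow> C1_on g S \<Longrightarrow> C1_on (\<lambda>x. f x - g x) S"
  by (rule C1_onI[where D = "\<lambda>x v. FD f x v - FD g x v"])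
    (auto simp: C1_on_def frechet_derivative_works intro!: has_derivative_diff continuous_intros)

lemma C1_on_sum: "open S \<Longrightarrow> (\<And>i. i \<in> I \<Longrightarrow> C1_on (f i) S) \<Longrightarrow> C1_on (\<lambda>x. \<Sum>i\<in>I. f i x) S"
  by (induction I rule: infinite_finite_induct) (auto intro: C1_on_add)

lemma C1_on_power:
  fixes f :: "'a::real_normed_vector \<Rightarrow> 'b::real_normed_field"
  shows "C1_on f S \<Longrightarrow> C1_on (\<lambda>x. f x ^ n) S"
  by (induction n) (auto intro: C1_on_mult C1_on_open)

lemma C1_on_prod:
  fixes f :: "'i \<Rightarrow> 'a::real_normed_vector \<Rightarrow> 'b::real_normed_field"
  shows "open S \<Longrightarrow> (\<And>i. i \<in> I \<Longrightarrow> C1_on (f i) S) \<Longrightarrow> C1_on (\<lambda>x. \<Prod>i\<in>I. f i x) S"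
  by (induction I rule: infinite_finite_induct) (auto intro: C1_on_mult)

lemma C1_on_divide:
  fixes f g :: "'a::real_normed_vector \<Rightarrow> 'b::real_normed_field"
  assumes f: "C1_on f S" and g: "C1_on g S" and nz: "\<And>x. x \<in> S \<Longrightarrow> g x \<noteq> 0"
  shows "C1_on (\<lambda>x. f x / g x) S"
proof (rule C1_onI[where D = "\<lambda>x v. - f x * (inverse (g x) * FD g x v * inverse (g x)) + FD f x v / g x"])
  show "open S" using f by (rule C1_on_open)
  show "((\<lambda>x. f x / g x) has_derivative (\<lambda>v. - f x * (inverse (g x) * FD g x v * inverse (g x)) + FD f x v / g x)) (at x)"
    if "x \<in> S" for x
    using has_derivative_divide[OF C1_on_has_derivative[OF f that] C1_on_has_derivative[OF g that]] nz[OF that] by blast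
  show "continuous_on S (\<lambda>x. - f x * (inverse (g x) * FD g x v * inverse (g x)) + FD f x v / g x)" for v
    using nz by (intro continuous_intros C1_on_continuous_on[OF f]
      C1_on_continuous_on[OF g] C1_on_FD_continuous f g) auto
qed

lemma C1_on_Pair: "C1_on f S \<Longrightarrow> C1_on g S \<Longrightarrow> C1_on (\<lambda>x. (f x, g x)) S"
  by (rule C1_onI[where D = "\<lambda>x v. (FD f x v, FD g x v)"])
    (auto simp: C1_on_def frechet_derivative_works intro!: has_derivative_Pair continuous_intros)

lemma C1_on_fst: "C1_on f S \<Longrightarrow> C1_on (\<lambda>x. fst (f x)) S"
  by (rule C1_on_linear_compose[OF bounded_linear_fst])

lemma C1_on_snd: "C1_on f S \<Longrightarrow> C1_on (\<lambda>x. snd (f x)) S"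
  by (rule C1_on_linear_compose[OF bounded_linear_snd])

lemma C1_on_vec_nth: "C1_on f S \<Longrightarrow> C1_on (\<lambda>x. f x $ i) S"
  by (rule C1_on_linear_compose[OF bounded_linear_vec_nth])

lemma C1_on_cnj: "C1_on f S \<Longrightarrow> C1_on (\<lambda>x. cnj (f x)) S"
  by (rule C1_on_linear_compose[OF bounded_linear_cnj])

lemma C1_on_of_real: "C1_on f S \<Longrightarrow> C1_on (\<lambda>x. complex_of_real (f x)) S"
  by (rule C1_on_linear_compose[OF bounded_linear_of_real])

lemma has_derivative_vec_lambda:
  fixes f :: "'i::finite \<Rightarrow> 'a::real_normed_vector \<Rightarrow> 'b::euclidean_space"
  assumes "\<And>i. (f i has_derivative D i) (at x within S)"
  shows "((\<lambda>x. \<chi> i. f i x) has_derivative (\<lambda>v. \<chi> i. D i v)) (at x within S)"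
proof (subst has_derivative_componentwise_within, intro ballI)
  fix b :: "'b^'i" assume "b \<in> Basis"
  then obtain i u where b: "b = axis i u" "u \<in> Basis" by (auto simp: Basis_vec_def)
  have "((\<lambda>x. f i x \<bullet> u) has_derivative (\<lambda>v. D i v \<bullet> u)) (at x within S)"
    by (intro has_derivative_inner_left assms)
  then show "((\<lambda>x. (\<chi> i. f i x) \<bullet> b) has_derivative (\<lambda>v. (\<chi> i. D i v) \<bullet> b)) (at x within S)"
    by (simp add: b inner_axis)
qed

lemma C1_on_vec_lambda:
  fixes f :: "'i::finite \<Rightarrow> 'a::real_normed_vector \<Rightarrow> 'b::euclidean_space"
  assumes "open S" "\<And>i. C1_on (f i) S"
  shows "C1_on (\<lambda>x. \<chi> i. f i x) S"
  using assms by (intro C1_onI[where D = "\<lambda>x v. \<chi> i. FD (f i) x v"] has_derivative_vec_lambda continuous_on_vec_lambda)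
     (auto simp: C1_on_def frechet_derivative_works)

lemma C1_on_vector_mult:
  fixes c :: "'a::real_normed_vector \<Rightarrow> complex" and f :: "'a \<Rightarrow> complex^'n"
  assumes "C1_on c S" "C1_on f S" shows "C1_on (\<lambda>x. c x *s f x) S"
  unfolding vector_scalar_mult_def
  by (intro C1_on_vec_lambda C1_on_mult C1_on_vec_nth assms) (rule C1_on_open[OF assms(1)])

lemmas C1_intros = C1_on_const C1_on_id C1_on_add C1_on_diff C1_on_mult C1_on_scaleR C1_on_sum
  C1_on_power C1_on_prod C1_on_Pair C1_on_fst C1_on_snd C1_on_vec_nth C1_on_cnj C1_on_of_real
  C1_on_vector_mult

text \<open>The inverse function theorem is applied to (z, s) |-> (z, F (z, s)). The hypothesis
  \<open>lin\<close> is complex linearity in the last variable, so that one nonzero partial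
  derivative gives invertibility. The uniqueness clause with its radius later identifies a local
  solution with a globally chosen root.\<close>

lemma implicit_function:
  fixes F :: "'a::euclidean_space \<times> complex \<Rightarrow> complex"
  assumes F: "C1_on F S" and p: "(z0, s0) \<in> S" "F (z0, s0) = 0"
    and lin: "\<And>p s. p \<in> S \<Longrightarrow> FD F p (0, s) = s * FD F p (0, 1)"
    and nz: "FD F (z0, s0) (0, 1) \<noteq> 0"
  obtains Z r h where "z0 \<in> Z" "r > 0" "C1_on h Z" "h z0 = s0"
    "\<And>z. z \<in> Z \<Longrightarrow> h z \<in> ball s0 r"
    "\<And>z. z \<in> Z \<Longrightarrow> (z, h z) \<in> S" "\<And>z. z \<in> Z \<Longrightarrow> F (z, h z) = 0" "\<And>z. z \<in> Z \<Longrightarrow> FD F (z, h z) (0, 1) \<noteq> 0"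
    "\<And>z s. z \<in> Z \<Longrightarrow> s \<in> ball s0 r \<Longrightarrow> F (z, s) = 0 \<Longrightarrow> s = h z"
    "\<And>z u. z \<in> Z \<Longrightarrow> FD h z u = - FD F (z, h z) (u, 0) / FD F (z, h z) (0, 1)"
proof -
  define S' where "S' = S \<inter> {p. FD F p (0, 1) \<noteq> 0}"
  have oS: "open S" using F by (rule C1_on_open)
  have oS': "open S'"
  proof -
    have "continuous_on S (\<lambda>p. FD F p (0, 1))" using F by (rule C1_on_FD_continuous)
    then have "open ((\<lambda>p. FD F p (0, 1)) -` (- {0}) \<inter> S)"
      by (rule continuous_on_open_vimage[OF oS, THEN iffD1, rule_format, OF _ open_Compl[OF closed_singleton]])
    moreover have "S' = (\<lambda>p. FD F p (0, 1)) -` (- {0}) \<inter> S" by (auto simp: S'_def)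
    ultimately show ?thesis by (simp only:)
  qed
  have F': "C1_on F S'" using C1_on_subset[OF F oS'] by (auto simp: S'_def)
  have p': "(z0, s0) \<in> S'" using p nz by (simp add: S'_def)
  define P where "P = (\<lambda>p. (fst p, F p))"
  have PC: "C1_on P S'" unfolding P_def by (intro C1_intros F' oS')
  have FDP: "FD P p v = (fst v, FD F p v)" if "p \<in> S'" for p v
  proof -
    have "(P has_derivative (\<lambda>v. (fst v, FD F p v))) (at p)" unfolding P_def
      by (intro has_derivative_Pair C1_on_has_derivative[OF F' that] bounded_linear_imp_has_derivative bounded_linear_fst)
    then show ?thesis by (simp add: FD_eq)
  qed
  note lin' = C1_on_linear[OF F']
  define c where "c = FD F (z0, s0) (0, 1)"
  \<comment> \<open>Inverse of the derivative (u, s) |-> (u, dF(u, 0) + c s) of \<open>P\<close>,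
    found by solving for s.\<close>
  define I where "I = (\<lambda>w :: 'a \<times> complex. (fst w, (snd w - FD F (z0, s0) (fst w, 0)) / c))"
  have split: "FD F p (u, s) = FD F p (u, 0) + s * FD F p (0, 1)" if "p \<in> S'" for p u s
  proof -
    interpret bounded_linear "FD F p" using lin' that .
    have "FD F p (u, s) = FD F p ((u, 0) + (0, s))" by simp
    also have "\<dots> = FD F p (u, 0) + FD F p (0, s)" by (rule add)
    finally show ?thesis using lin[of p s] that by (simp add: S'_def)
  qed
  have blI: "bounded_linear I" unfolding I_def
  proof (intro bounded_linear_Pair bounded_linear_fst)
    have "bounded_linear (\<lambda>w :: 'a \<times> complex. FD F (z0, s0) (fst w, 0))"
      by (rule bounded_linear_compose[OF lin'[OF p']]) (intro bounded_linear_Pair bounded_linear_fst bounded_linear_zero)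
    then show "bounded_linear (\<lambda>w :: 'a \<times> complex. (snd w - FD F (z0, s0) (fst w, 0)) / c)"
      by (rule bounded_linear_compose[OF bounded_linear_divide bounded_linear_sub[OF bounded_linear_snd]])
  qed
  have invI: "Blinfun I o\<^sub>L Blinfun (FD P (z0, s0)) = id_blinfun"
  proof (rule blinfun_eqI)
    fix w :: "'a \<times> complex"
    have "c \<noteq> 0" using nz by (simp add: c_def)
    then have "I (FD P (z0, s0) w) = w"
      using split[OF p', of "fst w" "snd w"] by (simp add: FDP[OF p'] I_def c_def field_simps)
    then show "blinfun_apply (Blinfun I o\<^sub>L Blinfun (FD P (z0, s0))) w = blinfun_apply id_blinfun w"
      by (simp add: bounded_linear_Blinfun_apply[OF blI] C1_on_Blinfun(1)[OF PC p'])
  qed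
  have derP: "(P has_derivative blinfun_apply (Blinfun (FD P x))) (at x)" if "x \<in> S'" for x
    using C1_on_has_derivative[OF PC that] by (simp only: C1_on_Blinfun(1)[OF PC that])
  obtain U V g g' where UV: "open U" "U \<subseteq> S'" "(z0, s0) \<in> U" "open V" "P (z0, s0) \<in> V" "homeomorphism U V P g"
    and g': "\<And>y. y \<in> V \<Longrightarrow> (g has_derivative (g' y)) (at y)"
    by (rule inverse_function_theorem[OF oS' derP C1_on_Blinfun(2)[OF PC] p' invI]) (assumption | (rule that; assumption))+
  obtain A B where AB: "open A" "open B" "z0 \<in> A" "s0 \<in> B" "A \<times> B \<subseteq> U"
    using open_prod_elim[OF UV(1,3)] by (metis mem_Sigma_iff)
  obtain r where r: "r > 0" "ball s0 r \<subseteq> B" using AB open_contains_ball by blast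
  define h where "h = (\<lambda>z. snd (g (z, 0)))"
  define W where "W = (\<lambda>z :: 'a. (z, 0 :: complex)) -` V"
  have oW: "open W" unfolding W_def by (intro open_vimage UV continuous_intros)
  have dh: "(h has_derivative (\<lambda>u. snd (g' (z, 0) (u, 0)))) (at z)" if "z \<in> W" for z
  proof -
    have "((\<lambda>z. (z, 0 :: complex)) has_derivative (\<lambda>u. (u, 0))) (at z)"
      by (intro derivative_eq_intros | simp)+
    moreover have "(g has_derivative g' (z, 0)) (at (z, 0))" using g' that by (simp add: W_def)
    ultimately have "((\<lambda>z. g (z, 0)) has_derivative (\<lambda>u. g' (z, 0) (u, 0))) (at z)"
      using has_derivative_compose by blast
    then show ?thesis unfolding h_def by (rule has_derivative_snd)
  qed
  have ch: "continuous_on W h"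
    using dh has_derivative_continuous by (blast intro: continuous_at_imp_continuous_on)
  define Z where "Z = A \<inter> (h -` ball s0 r \<inter> W)"
  have "open (h -` ball s0 r \<inter> W)"
    by (rule continuous_on_open_vimage[OF oW, THEN iffD1, rule_format, OF ch open_ball])
  then have oZ: "open Z" unfolding Z_def using AB(1) by (rule open_Int[rotated])
  have hz0: "h z0 = s0"
    using UV homeomorphism_apply1[OF UV(6,3)] p by (simp add: h_def P_def)
  have zZ: "z0 \<in> Z" using AB UV hz0 r p by (simp add: Z_def W_def P_def)
  have gz: "g (z, 0) = (z, h z)" "(z, h z) \<in> U" "F (z, h z) = 0" if "z \<in> Z" for z
  proof -
    have V: "(z, 0) \<in> V" using that by (simp add: Z_def W_def)
    have e: "P (g (z, 0)) = (z, 0)" using homeomorphism_apply2[OF UV(6) V] .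
    then show 1: "g (z, 0) = (z, h z)" by (simp add: P_def h_def prod_eq_iff)
    show "(z, h z) \<in> U" using V UV(6) 1 unfolding homeomorphism_def by (metis image_eqI)
    show "F (z, h z) = 0" using e 1 by (simp add: P_def)
  qed
  \<comment> \<open>Differentiation of the identity F (z, h z) = 0.\<close>
  have hD: "(h has_derivative (\<lambda>u. - FD F (z, h z) (u, 0) / FD F (z, h z) (0, 1))) (at z)" if z: "z \<in> Z" for z
  proof -
    define d where "d = (\<lambda>u. snd (g' (z, 0) (u, 0)))"
    have d: "(h has_derivative d) (at z)" using dh[of z] z by (simp add: Z_def d_def)
    have S: "(z, h z) \<in> S'" using gz(2)[OF z] UV by blast
    have "((\<lambda>z. (z, h z)) has_derivative (\<lambda>u. (u, d u))) (at z)"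
      by (intro has_derivative_Pair has_derivative_ident d)
    from has_derivative_compose[OF this C1_on_has_derivative[OF F' S]]
    have 1: "((\<lambda>z. F (z, h z)) has_derivative (\<lambda>u. FD F (z, h z) (u, d u))) (at z)" .
    have 2: "((\<lambda>z. F (z, h z)) has_derivative (\<lambda>u. 0)) (at z)"
      by (rule has_derivative_transform_within_open[OF has_derivative_const oZ z]) (simp add: gz)
    have "FD F (z, h z) (u, d u) = 0" for u
      using fun_cong[OF has_derivative_unique[OF 1 2]] .
    then have "FD F (z, h z) (u, 0) + d u * FD F (z, h z) (0, 1) = 0" for u
      using split[OF S, of u "d u"] by simp
    moreover have "FD F (z, h z) (0, 1) \<noteq> 0" using S by (simp add: S'_def)
    ultimately have "d u = - FD F (z, h z) (u, 0) / FD F (z, h z) (0, 1)" for u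
      by (metis eq_divide_imp eq_neg_iff_add_eq_0 add.commute)
    then have "d = (\<lambda>u. - FD F (z, h z) (u, 0) / FD F (z, h z) (0, 1))" by (rule ext)
    then show ?thesis using d by (simp only:)
  qed
  have SZ: "(z, h z) \<in> S'" if "z \<in> Z" for z using gz(2)[OF that] UV by blast
  have "continuous_on Z h" using ch by (rule continuous_on_subset) (auto simp: Z_def)
  then have C1h: "C1_on h Z"
    using SZ by (intro C1_onI[OF oZ hD] continuous_intros continuous_on_FD[OF F'])
      (auto simp: S'_def)
  have uni: "s = h z" if "z \<in> Z" "s \<in> ball s0 r" "F (z, s) = 0" for z s
  proof -
    have "(z, s) \<in> U" using that r AB by (auto simp: Z_def)
    then have "g (P (z, s)) = (z, s)" by (rule homeomorphism_apply1[OF UV(6)])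
    then show ?thesis using that by (simp add: P_def h_def)
  qed
  show thesis
  proof (rule that[OF zZ r(1) C1h hz0])
    show "h z \<in> ball s0 r" if "z \<in> Z" for z using that by (simp add: Z_def)
    show "(z, h z) \<in> S" "FD F (z, h z) (0, 1) \<noteq> 0" if "z \<in> Z" for z using SZ[OF that] by (simp_all add: S'_def)
    show "F (z, h z) = 0" if "z \<in> Z" for z using gz(3)[OF that] .
    show "s = h z" if "z \<in> Z" "s \<in> ball s0 r" "F (z, s) = 0" for z s using uni[OF that] .
    show "FD h z u = - FD F (z, h z) (u, 0) / FD F (z, h z) (0, 1)" if "z \<in> Z" for z u
      by (simp only: FD_eq[OF hD[OF that]])
  qed
qed

section \<open>Integrals over the triangle\<close>

lemma compact_triangle: "compact triangle"
proof -
  have "triangle = {p. 0 \<le> fst p} \<inter> {p. 0 \<le> snd p} \<inter> {p. fst p + snd p \<le> 1}"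
    by (auto simp: triangle_def)
  moreover have "closed ({p :: real \<times> real. 0 \<le> fst p} \<inter> {p. 0 \<le> snd p} \<inter> {p. fst p + snd p \<le> 1})"
    by (intro closed_Int closed_Collect_le continuous_intros)
  ultimately have "closed triangle" by metis
  moreover have "triangle \<subseteq> cbox (0, 0) (1, 1)" by (auto simp: triangle_def)
  then have "bounded triangle" using bounded_cbox bounded_subset by blast
  ultimately show ?thesis using compact_eq_bounded_closed by blast
qed

lemma integrable_triangle:
  fixes q :: "real \<times> real \<Rightarrow> 'b::euclidean_space"
  assumes "continuous_on triangle q"
  shows "q integrable_on triangle"
  using set_borel_integral_eq_integral(1)[of triangle q] borel_integrable_compact[OF compact_triangle assms]
  by (simp add: set_integrable_def)

lemma triangle_param: "x \<in> {0..1} \<Longrightarrow> y \<in> {0..1} \<Longrightarrow> (x, (1 - x) * y) \<in> triangle"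
  using mult_left_le[of y "1 - x"] by (auto simp: triangle_def)

text \<open>Fubini, followed by the substitution of (1 - x) y for the inner variable; the factor 1 -
  x is its Jacobian. On the square the limits do not depend on x, so results on parameter integrals
  can be applied twice.\<close>

lemma integral_triangle:
  fixes q :: "real \<times> real \<Rightarrow> complex"
  assumes q: "continuous_on triangle q"
  shows "integral triangle q = integral {0..1} (\<lambda>x. integral {0..1} (\<lambda>y. (1 - x) *\<^sub>R q (x, (1 - x) * y)))"
proof -
  let ?f = "\<lambda>p. indicator triangle p *\<^sub>R q p"
  have int: "integrable lborel ?f" by (rule borel_integrable_compact[OF compact_triangle q])
  have "integral triangle q = (\<integral>p. ?f p \<partial>lborel)"
    using set_borel_integral_eq_integral(2)[of triangle q] int
    by (simp add: set_integrable_def set_lebesgue_integral_def)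
  also have "\<dots> = (\<integral>p. ?f p \<partial>(lborel \<Otimes>\<^sub>M lborel))" by (simp add: lborel_prod)
  also have "\<dots> = (\<integral>x. (\<integral>y. ?f (x, y) \<partial>lborel) \<partial>lborel)"
    using int by (intro lborel_pair.integral_fst'[symmetric]) (simp add: lborel_prod)
  finally have 1: "integral triangle q = (\<integral>x. (\<integral>y. ?f (x, y) \<partial>lborel) \<partial>lborel)" .
  define k where "k = (\<lambda>x. integral {0..1} (\<lambda>y. (1 - x) *\<^sub>R q (x, (1 - x) * y)))"
  have ck: "continuous_on {0..1} k"
  proof -
    have "continuous_on ({0..1} \<times> cbox 0 1) (\<lambda>(x, y). (1 - x) *\<^sub>R q (x, (1 - x) * y))"
      unfolding case_prod_beta
      by (intro continuous_intros continuous_on_compose2[OF q]) (auto intro!: triangle_param)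
    from integral_continuous_on_param[OF this] show ?thesis by (simp only: k_def cbox_interval)
  qed
  have 2: "(\<integral>y. ?f (x, y) \<partial>lborel) = indicator {0..1} x *\<^sub>R k x" for x
  proof (cases "x \<in> {0..1}")
    case True
    have cq: "continuous_on {0..1 - x} (\<lambda>y. q (x, y))"
      using True by (intro continuous_on_compose2[OF q] continuous_intros) (auto simp: triangle_def)
    have "indicator triangle (x, y) = (indicator {0..1 - x} y :: real)" for y
      using True by (auto simp: triangle_def indicator_def)
    then have e1: "(\<integral>y. ?f (x, y) \<partial>lborel) = (\<integral>y. indicator {0..1 - x} y *\<^sub>R q (x, y) \<partial>lborel)"
      by (simp only:)
    have e2: "(\<integral>y. indicator {0..1 - x} y *\<^sub>R q (x, y) \<partial>lborel) = integral {0..1 - x} (\<lambda>y. q (x, y))"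
      using set_borel_integral_eq_integral(2)[of "{0..1 - x}" "\<lambda>y. q (x, y)"] borel_integrable_compact[OF _ cq]
      by (simp add: set_integrable_def set_lebesgue_integral_def)
    have e3: "integral {0..1 - x} (\<lambda>y. q (x, y)) = k x"
    \<comment> \<open>At x = 1 the fibre is a single point and the substitution degenerates; both
      sides are then 0.\<close>
    proof (cases "x = 1")
      case False
      have "((\<lambda>y. q (x, y)) has_integral (integral {0..1 - x} (\<lambda>y. q (x, y)))) (cbox 0 (1 - x))"
        using integrable_continuous_real[OF cq] by (simp add: has_integral_integral)
      from has_integral_affinity'[OF this, of "1 - x" 0] True False
      have "((\<lambda>y. q (x, (1 - x) * y)) has_integral integral {0..1 - x} (\<lambda>y. q (x, y)) /\<^sub>R (1 - x)) {0..1}"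
        by simp
      then have "integral {0..1} (\<lambda>y. q (x, (1 - x) * y)) = integral {0..1 - x} (\<lambda>y. q (x, y)) /\<^sub>R (1 - x)"
        by (rule integral_unique)
      then have "k x = (1 - x) *\<^sub>R (integral {0..1 - x} (\<lambda>y. q (x, y)) /\<^sub>R (1 - x))"
        by (simp only: k_def integral_cmul)
      moreover have "(1 - x) * inverse (1 - x) = 1" using False by (intro right_inverse) simp
      ultimately show ?thesis by (simp only: scaleR_scaleR scaleR_one)
    next
      case True
      have "k x = 0" unfolding k_def True by simp
      then show ?thesis using True by simp
    qed
    show ?thesis by (simp only: e1 e2 e3 indicator_simps(1)[OF True] scaleR_one)
  next
    case False
    then have "indicator triangle (x, y) = (0 :: real)" for y
      by (auto simp: triangle_def indicator_def)
    then show ?thesis by (simp only: indicator_simps(2)[OF False] scaleR_zero_left Bochner_Integration.integral_zero)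
  qed
  have "integral triangle q = (\<integral>x. indicator {0..1} x *\<^sub>R k x \<partial>lborel)"
    by (simp only: 1 2)
  also have "\<dots> = integral {0..1} k"
    using set_borel_integral_eq_integral(2)[of "{0..1}" k] borel_integrable_compact[OF _ ck]
    by (simp add: set_integrable_def set_lebesgue_integral_def)
  finally show ?thesis by (simp add: k_def)
qed

lemma C1_partials:
  fixes f :: "real \<times> real \<Rightarrow> complex"
  assumes f: "C1_on f S" and p: "(s, t) \<in> S"
  shows "((\<lambda>s. f (s, t)) has_vector_derivative FD f (s, t) (1, 0)) (at s within A)"
    "((\<lambda>t. f (s, t)) has_vector_derivative FD f (s, t) (0, 1)) (at t within A)"
proof -
  interpret bounded_linear "FD f (s, t)" using C1_on_linear[OF f p] .
  have d: "(f has_derivative FD f (s, t)) (at (s, t))" using C1_on_has_derivative[OF f p] .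
  have "((\<lambda>s. (s, t)) has_derivative (\<lambda>c. (c, 0))) (at s within A)"
    by (intro has_derivative_Pair has_derivative_ident has_derivative_const)
  from has_derivative_compose[OF this d]
  have "((\<lambda>s. f (s, t)) has_derivative (\<lambda>c. FD f (s, t) (c, 0))) (at s within A)" .
  moreover have "(\<lambda>c. FD f (s, t) (c, 0)) = (\<lambda>c. c *\<^sub>R FD f (s, t) (1, 0))"
    by (rule ext, subst scaleR[symmetric]) (simp only: scaleR_Pair scaleR_zero_right real_scaleR_def mult_1_right mult_zero_right)
  ultimately show "((\<lambda>s. f (s, t)) has_vector_derivative FD f (s, t) (1, 0)) (at s within A)"
    by (simp only: has_vector_derivative_def)
  have "((\<lambda>t. (s, t)) has_derivative (\<lambda>c. (0, c))) (at t within A)"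
    by (intro has_derivative_Pair has_derivative_ident has_derivative_const)
  from has_derivative_compose[OF this d]
  have "((\<lambda>t. f (s, t)) has_derivative (\<lambda>c. FD f (s, t) (0, c))) (at t within A)" .
  moreover have "(\<lambda>c. FD f (s, t) (0, c)) = (\<lambda>c. c *\<^sub>R FD f (s, t) (0, 1))"
    by (rule ext, subst scaleR[symmetric]) (simp only: scaleR_Pair scaleR_zero_right real_scaleR_def mult_1_right mult_zero_right)
  ultimately show "((\<lambda>t. f (s, t)) has_vector_derivative FD f (s, t) (0, 1)) (at t within A)"
    by (simp only: has_vector_derivative_def)
qed

lemma continuous_on_partial:
  fixes f :: "real \<times> real \<Rightarrow> complex"
  assumes f: "C1_on f S" and g: "continuous_on T g" "\<And>z. z \<in> T \<Longrightarrow> g z \<in> S"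
  shows "continuous_on T (\<lambda>z. FD f (g z) v)" "continuous_on T (\<lambda>z. f (g z))"
  using continuous_on_compose2[OF C1_on_FD_continuous[OF f] g(1)]
    continuous_on_compose2[OF C1_on_continuous_on[OF f] g(1)] g(2) by blast+

text \<open>Green's formula for the 1-form \<open>h db\<close> on the unit square, with
  \<open>h\<close> and \<open>b\<close> only of class C1, whereas the usual proof differentiates
  \<open>b\<close> twice. Here the two factors get separate first arguments x and y, the resulting
  function \<open>W\<close> is differentiated along the diagonal, and the fundamental theorem is
  applied to s |-> \<open>W s s\<close>.\<close>

lemma integral_square_swap:
  fixes h b :: "real \<times> real \<Rightarrow> complex"
  assumes h: "C1_on h S" and b: "C1_on b S" and S: "\<And>s t. s \<in> {0..1} \<Longrightarrow> t \<in> {0..1} \<Longrightarrow> (s, t) \<in> S"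
  shows "integral {0..1} (\<lambda>s. integral {0..1} (\<lambda>t.
           FD h (s, t) (1, 0) * FD b (s, t) (0, 1) - FD h (s, t) (0, 1) * FD b (s, t) (1, 0))) =
     integral {0..1} (\<lambda>t. h (1, t) * FD b (1, t) (0, 1)) - integral {0..1} (\<lambda>t. h (0, t) * FD b (0, t) (0, 1))
     - integral {0..1} (\<lambda>s. h (s, 1) * FD b (s, 1) (1, 0)) + integral {0..1} (\<lambda>s. h (s, 0) * FD b (s, 0) (1, 0))"
proof -
  let ?hs = "\<lambda>p. FD h p (1, 0)" and ?ht = "\<lambda>p. FD h p (0, 1)"
  let ?bs = "\<lambda>p. FD b p (1, 0)" and ?bt = "\<lambda>p. FD b p (0, 1)"
  let ?I = "{0..1} :: real set"
  note cp = continuous_on_partial[OF h] continuous_on_partial[OF b]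
  have c1: "continuous_on (?I \<times> cbox 0 1) (\<lambda>(x, t). ?hs (x, t) * ?bt (y, t))"
    "continuous_on (?I \<times> cbox 0 1) (\<lambda>(x, t). h (x, t) * ?bt (y, t))"
    "continuous_on (?I \<times> cbox 0 1) (\<lambda>(x, t). ?ht (y, t) * ?bs (x, t))"
    "continuous_on (?I \<times> cbox 0 1) (\<lambda>(x, t). ?ht (y, t) * b (x, t))" if "y \<in> ?I" for y
    unfolding case_prod_beta using that
    by (intro continuous_intros cp; auto intro!: S continuous_intros)+
  have ig: "(\<lambda>t. f (x, t)) integrable_on cbox 0 1" if "continuous_on (?I \<times> cbox 0 1) f" "x \<in> ?I" for f :: "real \<times> real \<Rightarrow> complex" and x
    using that by (intro integrable_continuous continuous_on_compose2[OF that(1)] continuous_intros) auto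
  \<comment> \<open>\<open>W1\<close> is the derivative of \<open>W\<close> in x. In y the factor
    \<open>?bt\<close> cannot be differentiated, so integration by parts in t first rewrites
    \<open>W\<close> as \<open>V\<close>, whose derivative in y is \<open>V2\<close>.\<close>
  define W where "W = (\<lambda>x y. integral (cbox 0 1) (\<lambda>t. h (x, t) * ?bt (y, t)))"
  define V where "V = (\<lambda>x y. h (x, 1) * b (y, 1) - h (x, 0) * b (y, 0) - integral (cbox 0 1) (\<lambda>t. ?ht (x, t) * b (y, t)))"
  define W1 where "W1 = (\<lambda>x y. integral (cbox 0 1) (\<lambda>t. ?hs (x, t) * ?bt (y, t)))"
  define U where "U = (\<lambda>x y. integral (cbox 0 1) (\<lambda>t. ?ht (x, t) * ?bs (y, t)))"
  define V2 where "V2 = (\<lambda>x y. h (x, 1) * ?bs (y, 1) - h (x, 0) * ?bs (y, 0) - U x y)"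
  have WV: "W x y = V x y" if x: "x \<in> ?I" and y: "y \<in> ?I" for x y
  proof -
    have 1: "((\<lambda>t. h (x, t) * b (y, t)) has_vector_derivative (h (x, t) * ?bt (y, t) + ?ht (x, t) * b (y, t))) (at t within ?I)"
      if "t \<in> ?I" for t
      by (intro has_vector_derivative_mult C1_partials[OF h] C1_partials[OF b] S x y that)
    have i0: "((\<lambda>t. h (x, t) * ?bt (y, t) + ?ht (x, t) * b (y, t)) has_integral (h (x, 1) * b (y, 1) - h (x, 0) * b (y, 0))) ?I"
      by (rule fundamental_theorem_of_calculus[OF _ 1]) simp_all
    have i1: "(\<lambda>t. h (x, t) * ?bt (y, t)) integrable_on ?I" using ig[OF c1(2)[OF y] x] by simp
    have i2: "(\<lambda>t. ?ht (x, t) * b (y, t)) integrable_on ?I" using ig[OF c1(4)[OF x] y] by simp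
    have "integral ?I (\<lambda>t. h (x, t) * ?bt (y, t)) + integral ?I (\<lambda>t. ?ht (x, t) * b (y, t)) = h (x, 1) * b (y, 1) - h (x, 0) * b (y, 0)"
      by (rule trans[OF Henstock_Kurzweil_Integration.integral_add[OF i1 i2, symmetric] integral_unique[OF i0]])
    then show ?thesis by (simp add: W_def V_def algebra_simps)
  qed
  have dW: "((\<lambda>x. W x y) has_derivative (\<lambda>c. c *\<^sub>R W1 x y)) (at x within ?I)" if "x \<in> ?I" "y \<in> ?I" for x y
    unfolding W_def W1_def has_vector_derivative_def[symmetric]
  proof (rule leibniz_rule_vector_derivative[where U = ?I])
    show "((\<lambda>x. h (x, t) * ?bt (y, t)) has_vector_derivative ?hs (x, t) * ?bt (y, t)) (at x within ?I)"
      if "x \<in> ?I" "t \<in> cbox 0 1" for x t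
      using that by (intro has_vector_derivative_mult_left C1_partials[OF h] S) auto
    show "continuous_on (?I \<times> cbox 0 1) (\<lambda>(x, t). ?hs (x, t) * ?bt (y, t))" using c1(1) that by blast
    show "(\<lambda>t. h (x, t) * ?bt (y, t)) integrable_on cbox 0 1" if "x \<in> ?I" for x
      using ig[OF c1(2) that] \<open>y \<in> ?I\<close> by simp
  qed (use that in auto)
  have dU: "((\<lambda>y. integral (cbox 0 1) (\<lambda>t. ?ht (x, t) * b (y, t))) has_vector_derivative U x y) (at y within ?I)" if "x \<in> ?I" "y \<in> ?I" for x y
    unfolding U_def
  proof (rule leibniz_rule_vector_derivative[where U = ?I])
    show "((\<lambda>y. ?ht (x, t) * b (y, t)) has_vector_derivative ?ht (x, t) * ?bs (y, t)) (at y within ?I)"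
      if "y \<in> ?I" "t \<in> cbox 0 1" for y t
      using that by (intro has_vector_derivative_mult_right C1_partials[OF b] S) auto
    show "continuous_on (?I \<times> cbox 0 1) (\<lambda>(y, t). ?ht (x, t) * ?bs (y, t))" using c1(3) that by blast
    show "(\<lambda>t. ?ht (x, t) * b (y, t)) integrable_on cbox 0 1" if "y \<in> ?I" for y
      using ig[OF c1(4) that] \<open>x \<in> ?I\<close> by simp
  qed (use that in auto)
  have dV: "((\<lambda>y. V x y) has_vector_derivative V2 x y) (at y within ?I)" if "x \<in> ?I" "y \<in> ?I" for x y
    unfolding V_def V2_def
    by (rule has_vector_derivative_diff[OF has_vector_derivative_diff[OF has_vector_derivative_mult_right[OF C1_partials(1)[OF b]] has_vector_derivative_mult_right[OF C1_partials(1)[OF b]]] dU[OF that]])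
      (use that in \<open>auto intro: S\<close>)
  have dW2: "((\<lambda>y. W x y) has_derivative blinfun_apply (blinfun_scaleR_left (V2 x y))) (at y within ?I)" if "x \<in> ?I" "y \<in> ?I" for x y
  proof -
    have "((\<lambda>y. V x y) has_derivative (\<lambda>c. c *\<^sub>R V2 x y)) (at y within ?I)"
      using dV[OF that] by (simp only: has_vector_derivative_def)
    then have "((\<lambda>y. W x y) has_derivative (\<lambda>c. c *\<^sub>R V2 x y)) (at y within ?I)"
      by (rule has_derivative_transform[of y ?I "W x" "V x", OF that(2) WV[OF that(1)], rotated])
    then show ?thesis by simp
  qed
  have cV2: "continuous_on (?I \<times> ?I) (\<lambda>(x, y). V2 x y)"
  proof -
    have "continuous_on ((?I \<times> ?I) \<times> cbox 0 1) (\<lambda>(p, t). ?ht (fst p, t) * ?bs (snd p, t))"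
      unfolding case_prod_beta by (intro continuous_intros cp; auto intro!: S continuous_intros)
    from integral_continuous_on_param[OF this]
    have "continuous_on (?I \<times> ?I) (\<lambda>p. U (fst p) (snd p))" by (simp add: U_def)
    then show ?thesis unfolding V2_def case_prod_beta
      by (intro continuous_intros cp; auto intro!: S continuous_intros)
  qed
  have cV2': "continuous (at (x, y) within ?I \<times> ?I) (\<lambda>(x, y). blinfun_scaleR_left (V2 x y) :: real \<Rightarrow>\<^sub>L complex)"
    if "x \<in> ?I" "y \<in> ?I" for x y
  proof -
    have "continuous_on (?I \<times> ?I) (\<lambda>p. blinfun_scaleR_left (case p of (x, y) \<Rightarrow> V2 x y) :: real \<Rightarrow>\<^sub>L complex)"
      by (rule bounded_linear.continuous_on[OF bounded_linear_blinfun_scaleR_left cV2])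
    then show ?thesis using that by (simp add: continuous_on_eq_continuous_within case_prod_unfold)
  qed
  have dE: "((\<lambda>s. W s s) has_vector_derivative W1 s s + V2 s s) (at s within ?I)" if "s \<in> ?I" for s
  proof -
    have 1: "((\<lambda>(x, y). W x y) has_derivative (\<lambda>(tx, ty). tx *\<^sub>R W1 s s + blinfun_scaleR_left (V2 s s) ty)) (at (s, s) within ?I \<times> ?I)"
      by (rule has_derivative_partialsI[where fy = "\<lambda>x y. blinfun_scaleR_left (V2 x y)", OF dW dW2 cV2']) (use that in auto)
    have 2: "((\<lambda>s. (s, s)) has_derivative (\<lambda>c. (c, c))) (at s within ?I)"
      by (intro has_derivative_Pair has_derivative_ident)
    have 3: "((\<lambda>(x, y). W x y) has_derivative (\<lambda>(tx, ty). tx *\<^sub>R W1 s s + blinfun_scaleR_left (V2 s s) ty)) (at (s, s) within (\<lambda>s. (s, s)) ` ?I)"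
      by (rule has_derivative_subset[OF 1]) auto
    have "((\<lambda>s. case (s, s) of (x, y) \<Rightarrow> W x y) has_derivative (\<lambda>c. case (c, c) of (tx, ty) \<Rightarrow> tx *\<^sub>R W1 s s + blinfun_scaleR_left (V2 s s) ty)) (at s within ?I)"
      by (rule has_derivative_in_compose[OF 2 3])
    then show ?thesis by (simp add: has_vector_derivative_def scaleR_add_right)
  qed
  have FT: "((\<lambda>s. W1 s s + V2 s s) has_integral (W 1 1 - W 0 0)) ?I"
    by (rule fundamental_theorem_of_calculus[OF _ dE]) simp_all
  have cW1: "continuous_on ?I (\<lambda>s. W1 s s)" "continuous_on ?I (\<lambda>s. U s s)"
  proof -
    have "continuous_on (?I \<times> cbox 0 1) (\<lambda>(s, t). ?hs (s, t) * ?bt (s, t))" "continuous_on (?I \<times> cbox 0 1) (\<lambda>(s, t). ?ht (s, t) * ?bs (s, t))"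
      unfolding case_prod_beta by (intro continuous_intros cp; auto intro!: S continuous_intros)+
    from this[THEN integral_continuous_on_param] show "continuous_on ?I (\<lambda>s. W1 s s)" "continuous_on ?I (\<lambda>s. U s s)"
      by (simp_all add: W1_def U_def)
  qed
  have c3: "continuous_on ?I (\<lambda>s. h (s, 1) * ?bs (s, 1))" "continuous_on ?I (\<lambda>s. h (s, 0) * ?bs (s, 0))"
    by (intro continuous_intros cp; auto intro!: S continuous_intros)+
  note ints = integrable_continuous_real[OF cW1(1)] integrable_continuous_real[OF cW1(2)]
    integrable_continuous_real[OF c3(1)] integrable_continuous_real[OF c3(2)]
  have inner: "integral ?I (\<lambda>t. ?hs (s, t) * ?bt (s, t) - ?ht (s, t) * ?bs (s, t)) = W1 s s - U s s" if "s \<in> ?I" for s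
    unfolding W1_def U_def cbox_interval
    by (rule Henstock_Kurzweil_Integration.integral_diff)
      (use ig[OF c1(1)[OF that] that] ig[OF c1(3)[OF that] that] in simp_all)
  have "integral ?I (\<lambda>s. integral ?I (\<lambda>t. ?hs (s, t) * ?bt (s, t) - ?ht (s, t) * ?bs (s, t))) = integral ?I (\<lambda>s. W1 s s - U s s)"
    by (rule Henstock_Kurzweil_Integration.integral_cong) (rule inner)
  also have "\<dots> = integral ?I (\<lambda>s. W1 s s) - integral ?I (\<lambda>s. U s s)"
    by (rule Henstock_Kurzweil_Integration.integral_diff) (use ints in auto)
  finally have A: "integral ?I (\<lambda>s. integral ?I (\<lambda>t. ?hs (s, t) * ?bt (s, t) - ?ht (s, t) * ?bs (s, t))) = integral ?I (\<lambda>s. W1 s s) - integral ?I (\<lambda>s. U s s)" .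
  have "((\<lambda>s. W1 s s + V2 s s) has_integral (integral ?I (\<lambda>s. W1 s s) + (integral ?I (\<lambda>s. h (s, 1) * ?bs (s, 1)) - integral ?I (\<lambda>s. h (s, 0) * ?bs (s, 0)) - integral ?I (\<lambda>s. U s s)))) ?I"
    unfolding V2_def by (intro has_integral_add has_integral_diff integrable_integral ints)
  note e = has_integral_unique[OF this FT]
  have "W 1 1 = integral ?I (\<lambda>t. h (1, t) * ?bt (1, t))" "W 0 0 = integral ?I (\<lambda>t. h (0, t) * ?bt (0, t))"
    by (simp_all add: W_def)
  then show ?thesis using e unfolding A by (simp only: algebra_simps)
qed

section \<open>Line integrals of forms H dB and the formulas of Stokes and Poincare\<close>

definition lint :: "('a::real_normed_vector \<Rightarrow> complex) \<Rightarrow> ('a \<Rightarrow> complex) \<Rightarrow> 'a \<Rightarrow> 'a \<Rightarrow> complex" where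
  "lint H B a b = integral {0..1} (\<lambda>s. H (a + s *\<^sub>R (b - a)) * FD B (a + s *\<^sub>R (b - a)) (b - a))"

text \<open>The 2-form dH \<and> dB, that is, the exterior derivative of the form
  \<open>H dB\<close> integrated by \<open>lint\<close>, expressed by first derivatives
  alone.\<close>

definition wedge :: "('a::real_normed_vector \<Rightarrow> complex) \<Rightarrow> ('a \<Rightarrow> complex) \<Rightarrow> 'a \<Rightarrow> 'a \<Rightarrow> 'a \<Rightarrow> complex" where
  "wedge H B x u v = FD H x u * FD B x v - FD H x v * FD B x u"

text \<open>Green's formula is pulled back along \<open>T\<close>, which maps the unit square onto
  the triangle and collapses one side to a vertex; the factor 1 - s is the Jacobian met in
  \<open>integral_triangle\<close>.\<close>

lemma Stokes_triangle:
  fixes H B :: "real \<times> real \<Rightarrow> complex"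
  assumes H: "C1_on H S" and B: "C1_on B S" and S: "triangle \<subseteq> S"
  shows "integral triangle (\<lambda>p. wedge H B p (1, 0) (0, 1)) =
    lint H B (0, 0) (1, 0) + lint H B (1, 0) (0, 1) - lint H B (0, 0) (0, 1)"
proof -
  define T where "T = (\<lambda>p :: real \<times> real. (fst p, (1 - fst p) * snd p))"
  define S' where "S' = T -` S"
  have cT: "continuous_on UNIV T" unfolding T_def by (intro continuous_intros)
  have oS': "open S'" unfolding S'_def using continuous_on_open_vimage[of UNIV T] cT C1_on_open[OF H] by auto
  have T: "C1_on T S'" unfolding T_def by (intro C1_intros oS')
  have FDT: "FD T (s, t) (1, 0) = (1, - t)" "FD T (s, t) (0, 1) = (0, 1 - s)" for s t
  proof -
    have "(T has_derivative (\<lambda>v. (fst v, (1 - s) * snd v - fst v * t))) (at (s, t))"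
      unfolding T_def by (auto intro!: derivative_eq_intros)
    then show "FD T (s, t) (1, 0) = (1, - t)" "FD T (s, t) (0, 1) = (0, 1 - s)" by (simp_all add: FD_eq)
  qed
  define h b where "h = (\<lambda>p. H (T p))" and "b = (\<lambda>p. B (T p))"
  have h: "C1_on h S'" unfolding h_def by (rule C1_on_compose[OF T H]) (simp add: S'_def)
  have b: "C1_on b S'" unfolding b_def by (rule C1_on_compose[OF T B]) (simp add: S'_def)
  have TS: "T (s, t) \<in> S" if "s \<in> {0..1}" "t \<in> {0..1}" for s t
    using triangle_param[OF that] S by (auto simp: T_def)
  have S': "(s, t) \<in> S'" if "s \<in> {0..1}" "t \<in> {0..1}" for s t
    using TS[OF that] by (simp add: S'_def)
  have lin: "linear (FD H (T (s, t)))" "linear (FD B (T (s, t)))" if "s \<in> {0..1}" "t \<in> {0..1}" for s t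
    using C1_on_linear[OF H TS[OF that]] C1_on_linear[OF B TS[OF that]] by (simp_all add: bounded_linear.linear)
  have FDh: "FD h (s, t) (1, 0) = FD H (T (s, t)) (1, 0) - t *\<^sub>R FD H (T (s, t)) (0, 1)"
    "FD h (s, t) (0, 1) = (1 - s) *\<^sub>R FD H (T (s, t)) (0, 1)"
    "FD b (s, t) (1, 0) = FD B (T (s, t)) (1, 0) - t *\<^sub>R FD B (T (s, t)) (0, 1)"
    "FD b (s, t) (0, 1) = (1 - s) *\<^sub>R FD B (T (s, t)) (0, 1)" if "s \<in> {0..1}" "t \<in> {0..1}" for s t
  proof -
    have e: "(1, - t) = (1, 0) - t *\<^sub>R (0, 1 :: real)" "(0, 1 - s) = (1 - s) *\<^sub>R (0 :: real, 1 :: real)" by simp_all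
    have "FD h (s, t) v = FD H (T (s, t)) (FD T (s, t) v)" "FD b (s, t) v = FD B (T (s, t)) (FD T (s, t) v)" for v
      unfolding h_def b_def using FD_compose[OF T H S'[OF that] TS[OF that]] FD_compose[OF T B S'[OF that] TS[OF that]] by blast+
    then show "FD h (s, t) (1, 0) = FD H (T (s, t)) (1, 0) - t *\<^sub>R FD H (T (s, t)) (0, 1)"
      "FD h (s, t) (0, 1) = (1 - s) *\<^sub>R FD H (T (s, t)) (0, 1)"
      "FD b (s, t) (1, 0) = FD B (T (s, t)) (1, 0) - t *\<^sub>R FD B (T (s, t)) (0, 1)"
      "FD b (s, t) (0, 1) = (1 - s) *\<^sub>R FD B (T (s, t)) (0, 1)"
      using lin[OF that] by (simp_all only: FDT e linear_diff linear_scale)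
  qed
  have "continuous_on triangle (\<lambda>p. wedge H B p (1, 0) (0, 1))"
    unfolding wedge_def using S by (intro continuous_intros continuous_on_partial[OF H] continuous_on_partial[OF B]) auto
  from integral_triangle[OF this]
  have "integral triangle (\<lambda>p. wedge H B p (1, 0) (0, 1)) =
    integral {0..1} (\<lambda>s. integral {0..1} (\<lambda>t. (1 - s) *\<^sub>R wedge H B (T (s, t)) (1, 0) (0, 1)))"
    by (simp add: T_def)
  also have "\<dots> = integral {0..1} (\<lambda>s. integral {0..1} (\<lambda>t.
           FD h (s, t) (1, 0) * FD b (s, t) (0, 1) - FD h (s, t) (0, 1) * FD b (s, t) (1, 0)))"
    by (intro Henstock_Kurzweil_Integration.integral_cong) (simp add: FDh wedge_def scaleR_conv_of_real algebra_simps)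
  also have "\<dots> = integral {0..1} (\<lambda>t. h (1, t) * FD b (1, t) (0, 1)) - integral {0..1} (\<lambda>t. h (0, t) * FD b (0, t) (0, 1))
     - integral {0..1} (\<lambda>s. h (s, 1) * FD b (s, 1) (1, 0)) + integral {0..1} (\<lambda>s. h (s, 0) * FD b (s, 0) (1, 0))"
    by (rule integral_square_swap[OF h b S'])
  \<comment> \<open>The side s = 1 of the square is collapsed to the vertex (1, 0) and contributes
    nothing.\<close>
  also have "integral {0..1} (\<lambda>t. h (1, t) * FD b (1, t) (0, 1)) = integral {0..1} (\<lambda>t :: real. 0)"
    by (intro Henstock_Kurzweil_Integration.integral_cong) (simp add: FDh)
  also have "integral {0..1} (\<lambda>t. h (0, t) * FD b (0, t) (0, 1)) = lint H B (0, 0) (0, 1)"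
    unfolding lint_def by (intro Henstock_Kurzweil_Integration.integral_cong) (simp add: FDh h_def T_def)
  also have "integral {0..1} (\<lambda>s. h (s, 0) * FD b (s, 0) (1, 0)) = lint H B (0, 0) (1, 0)"
    unfolding lint_def by (intro Henstock_Kurzweil_Integration.integral_cong) (simp add: FDh h_def T_def)
  \<comment> \<open>The side t = 1 runs from (0, 1) to (1, 0), against the direction of the edge;
    the sign comes from the reversal s |-> 1 - s.\<close>
  also have "integral {0..1} (\<lambda>s. h (s, 1) * FD b (s, 1) (1, 0)) = - lint H B (1, 0) (0, 1)"
  proof -
    define k where "k = (\<lambda>s. H (1 - s, s) * FD B (1 - s, s) (- 1, 1))"
    have "FD b (s, 1) (1, 0) = - FD B (s, 1 - s) (-1, 1)" if "s \<in> {0..1}" for s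
    proof -
      have "FD B (T (s, 1)) (-1, 1) = FD B (T (s, 1)) ((0, 1) - (1, 0))" by simp
      also have "\<dots> = FD B (T (s, 1)) (0, 1) - FD B (T (s, 1)) (1, 0)"
        by (rule linear_diff) (rule lin(2)[OF that], simp)
      finally show ?thesis using that by (simp add: FDh T_def)
    qed
    then have "integral {0..1} (\<lambda>s. h (s, 1) * FD b (s, 1) (1, 0)) = integral {0..1} (\<lambda>s. - k (1 - s))"
      by (intro Henstock_Kurzweil_Integration.integral_cong) (simp add: k_def h_def T_def)
    also have "\<dots> = - integral {0..1} (\<lambda>s. k (1 - s))" by simp
    also have "integral {0..1} (\<lambda>s. k (1 - s)) = integral {0..1} k"
    proof -
      have ck: "continuous_on {0..1} k" unfolding k_def
        using S by (intro continuous_intros continuous_on_partial[OF H] continuous_on_partial[OF B]) (auto simp: triangle_def)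
      have "(k has_integral integral {0..1} k) {0..1}" using integrable_continuous_real[OF ck] by (rule integrable_integral)
      from has_integral_affinity[OF this[unfolded cbox_interval[symmetric]], of "-1" 1]
      have "((\<lambda>s. k (1 - s)) has_integral integral {0..1} k) ((\<lambda>x. - x + 1) ` {0..1})" by (simp add: algebra_simps)
      moreover have "(\<lambda>x :: real. - x + 1) ` {0..1} = {0..1}"
        by (auto simp: image_iff intro!: bexI[of _ "1 - _"])
      ultimately show ?thesis by (metis integral_unique)
    qed
    also have "integral {0..1} k = lint H B (1, 0) (0, 1)"
      unfolding lint_def k_def by (intro Henstock_Kurzweil_Integration.integral_cong) simp
    finally show ?thesis .
  qed
  finally show ?thesis by simp
qed

lemma affine_in_convex:
  fixes a u v :: "'a::real_vector"
  assumes "convex K" "a \<in> K" "a + u \<in> K" "a + v \<in> K" "p \<in> triangle"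
  shows "a + fst p *\<^sub>R u + snd p *\<^sub>R v \<in> K"
proof -
  have p: "0 \<le> fst p" "0 \<le> snd p" "fst p + snd p \<le> 1" using assms(5) by (auto simp: triangle_def)
  have "a + fst p *\<^sub>R u + snd p *\<^sub>R v = (1 - fst p - snd p) *\<^sub>R a + fst p *\<^sub>R (a + u) + snd p *\<^sub>R (a + v)"
    by (simp add: algebra_simps)
  also have "\<dots> \<in> K"
  proof -
    have "convex hull {a, a + u, a + v} \<subseteq> K" using assms(1-4) by (simp add: hull_minimal)
    moreover have "(1 - fst p - snd p) *\<^sub>R a + fst p *\<^sub>R (a + u) + snd p *\<^sub>R (a + v) \<in> convex hull {a, a + u, a + v}"
      unfolding convex_hull_3 using p by (intro CollectI exI[of _ "1 - fst p - snd p"] exI[of _ "fst p"] exI[of _ "snd p"]) simp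
    ultimately show ?thesis by blast
  qed
  finally show ?thesis .
qed

text \<open>Pullback along an affine map. Degenerate triangles are included; additivity of
  \<open>lint\<close> along collinear points is obtained from them.\<close>

lemma Stokes_affine:
  fixes H B :: "'a::euclidean_space \<Rightarrow> complex"
  assumes H: "C1_on H K" and B: "C1_on B K"
    and K: "\<And>p. p \<in> triangle \<Longrightarrow> a + fst p *\<^sub>R u + snd p *\<^sub>R v \<in> K"
  shows "integral triangle (\<lambda>p. wedge H B (a + fst p *\<^sub>R u + snd p *\<^sub>R v) u v) =
    lint H B a (a + u) + lint H B (a + u) (a + v) - lint H B a (a + v)"
proof -
  define A where "A = (\<lambda>p :: real \<times> real. a + fst p *\<^sub>R u + snd p *\<^sub>R v)"
  define S where "S = A -` K"
  have cA: "continuous_on UNIV A" unfolding A_def by (intro continuous_intros)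
  have oS: "open S" unfolding S_def using continuous_on_open_vimage[of UNIV A] cA C1_on_open[OF H] by auto
  have A: "C1_on A S" unfolding A_def by (intro C1_intros oS)
  have FDA: "FD A p w = fst w *\<^sub>R u + snd w *\<^sub>R v" for p w
  proof -
    have "(A has_derivative (\<lambda>w. fst w *\<^sub>R u + snd w *\<^sub>R v)) (at p)"
      unfolding A_def by (auto intro!: derivative_eq_intros)
    then show ?thesis by (simp add: FD_eq)
  qed
  have AS: "A p \<in> K" if "p \<in> S" for p using that by (simp add: S_def)
  have tS: "triangle \<subseteq> S" using K by (auto simp: S_def A_def)
  have HA: "C1_on (\<lambda>p. H (A p)) S" and BA: "C1_on (\<lambda>p. B (A p)) S"
    using C1_on_compose[OF A H AS] C1_on_compose[OF A B AS] by auto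
  have FDH: "FD (\<lambda>p. H (A p)) p w = FD H (A p) (fst w *\<^sub>R u + snd w *\<^sub>R v)"
    "FD (\<lambda>p. B (A p)) p w = FD B (A p) (fst w *\<^sub>R u + snd w *\<^sub>R v)" if "p \<in> S" for p w
    using FD_compose[OF A H that AS[OF that]] FD_compose[OF A B that AS[OF that]] by (simp_all add: FDA)
  have seg: "x + s *\<^sub>R (y - x) \<in> triangle" if "x \<in> triangle" "y \<in> triangle" "s \<in> {0..1}" for x y :: "real \<times> real" and s
  proof -
    have "convex triangle"
      by (auto simp: triangle_def convex_def) (smt (verit, best) distrib_left mult_left_le)
    from convexD_alt[OF this that(1,2), of s] that(3) show ?thesis by (simp add: algebra_simps)
  qed
  have l: "lint (\<lambda>p. H (A p)) (\<lambda>p. B (A p)) x y = lint H B (A x) (A y)" if "x \<in> triangle" "y \<in> triangle" for x y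
    unfolding lint_def
  proof (rule Henstock_Kurzweil_Integration.integral_cong)
    fix s :: real assume "s \<in> {0..1}"
    then have "x + s *\<^sub>R (y - x) \<in> S" using seg[OF that] tS by blast
    moreover have "A (x + s *\<^sub>R (y - x)) = A x + s *\<^sub>R (A y - A x)"
      "fst (y - x) *\<^sub>R u + snd (y - x) *\<^sub>R v = A y - A x"
      by (simp_all add: A_def algebra_simps)
    ultimately show "H (A (x + s *\<^sub>R (y - x))) * FD (\<lambda>p. B (A p)) (x + s *\<^sub>R (y - x)) (y - x) =
       H (A x + s *\<^sub>R (A y - A x)) * FD B (A x + s *\<^sub>R (A y - A x)) (A y - A x)"
      by (simp only: FDH)
  qed
  have v: "(0, 0) \<in> triangle" "(1, 0) \<in> triangle" "(0, 1) \<in> triangle" by (auto simp: triangle_def)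
  have "integral triangle (\<lambda>p. wedge H B (A p) u v) = integral triangle (\<lambda>p. wedge (\<lambda>p. H (A p)) (\<lambda>p. B (A p)) p (1, 0) (0, 1))"
    using tS by (intro Henstock_Kurzweil_Integration.integral_cong) (auto simp: wedge_def FDH)
  also have "\<dots> = lint H B (A (0, 0)) (A (1, 0)) + lint H B (A (1, 0)) (A (0, 1)) - lint H B (A (0, 0)) (A (0, 1))"
    unfolding Stokes_triangle[OF HA BA tS] by (simp only: l v)
  finally show ?thesis by (simp add: A_def)
qed

text \<open>The form H dB - H' dB' is only continuous, so closedness cannot be expressed by
  derivatives of its coefficients; equality of the two wedges together with Stokes on triangles
  replaces it. Integration from a fixed centre gives \<open>f\<close>, and continuity of the
  coefficients shows that the form is its derivative.\<close>

lemma Poincare_convex: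
  fixes H B H' B' :: "'a::euclidean_space \<Rightarrow> complex"
  assumes K: "convex K"
    and C: "C1_on H K" "C1_on B K" "C1_on H' K" "C1_on B' K"
    and eq: "\<And>x u v. x \<in> K \<Longrightarrow> wedge H B x u v = wedge H' B' x u v"
  obtains f where "\<And>x. x \<in> K \<Longrightarrow> (f has_derivative (\<lambda>v. H x * FD B x v - H' x * FD B' x v)) (at x)"
proof (cases "K = {}")
  case False
  then obtain c where c: "c \<in> K" by blast
  define e where "e = (\<lambda>x v. H x * FD B x v - H' x * FD B' x v)"
  define th where "th = (\<lambda>x y. lint H B x y - lint H' B' x y)"
  define f where "f = (\<lambda>x. th c x)"
  \<comment> \<open>Stokes on the triangle with vertices c, x, y.\<close>
  have add: "f y - f x = th x y" if "x \<in> K" "y \<in> K" for x y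
  proof -
    have in_K: "c + fst p *\<^sub>R (x - c) + snd p *\<^sub>R (y - c) \<in> K" if "p \<in> triangle" for p
      using affine_in_convex[OF K c _ _ that, of "x - c" "y - c"] \<open>x \<in> K\<close> \<open>y \<in> K\<close> by simp
    have "lint H B c x + lint H B x y - lint H B c y = lint H' B' c x + lint H' B' x y - lint H' B' c y"
      using Stokes_affine[OF C(1,2) in_K] Stokes_affine[OF C(3,4) in_K] eq[OF in_K]
      by (simp cong: Henstock_Kurzweil_Integration.integral_cong)
    then show ?thesis by (simp add: f_def th_def algebra_simps)
  qed
  have ble: "bounded_linear (e x)" if "x \<in> K" for x
    unfolding e_def using C1_on_linear[OF C(2) that] C1_on_linear[OF C(4) that]
    by (intro bounded_linear_sub bounded_linear_const_mult)
  have ce: "continuous_on T (\<lambda>z. e (g z) (w z))" if "continuous_on T g" "g ` T \<subseteq> K" "continuous_on T w" for T and g :: "real \<Rightarrow> 'a" and w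
    unfolding e_def using that
    by (intro continuous_intros continuous_on_FD[OF C(2)] continuous_on_FD[OF C(4)]
      continuous_on_compose2[OF C1_on_continuous_on[OF C(1)]] continuous_on_compose2[OF C1_on_continuous_on[OF C(3)]])
  have cb: "continuous_on K (\<lambda>x. Blinfun (e x))"
  proof (rule continuous_on_blinfun_componentwise)
    fix i :: 'a
    have "continuous_on K (\<lambda>x. e x i)"
      unfolding e_def by (intro continuous_intros C1_on_continuous_on[OF C(1)] C1_on_continuous_on[OF C(3)] C1_on_FD_continuous C)
    then show "continuous_on K (\<lambda>x. blinfun_apply (Blinfun (e x)) i)"
      by (simp add: bounded_linear_Blinfun_apply ble cong: continuous_on_cong)
  qed
  have th: "th x y = integral {0..1} (\<lambda>s. e (x + s *\<^sub>R (y - x)) (y - x))"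
    "(\<lambda>s. e (x + s *\<^sub>R (y - x)) (y - x)) integrable_on {0..1}" if "x \<in> K" "y \<in> K" for x y
  proof -
    have xy: "x + s *\<^sub>R (y - x) \<in> K" if "s \<in> {0..1}" for s
      using convexD_alt[OF K \<open>x \<in> K\<close> \<open>y \<in> K\<close>, of s] that by (simp add: algebra_simps)
    have c1: "continuous_on {0..1} (\<lambda>s. H (x + s *\<^sub>R (y - x)) * FD B (x + s *\<^sub>R (y - x)) (y - x))"
      using xy by (intro continuous_intros continuous_on_FD[OF C(2)]
      continuous_on_compose2[OF C1_on_continuous_on[OF C(1)]]) auto
    have c2: "continuous_on {0..1} (\<lambda>s. H' (x + s *\<^sub>R (y - x)) * FD B' (x + s *\<^sub>R (y - x)) (y - x))"
      using xy by (intro continuous_intros continuous_on_FD[OF C(4)]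
      continuous_on_compose2[OF C1_on_continuous_on[OF C(3)]]) auto
    note i = integrable_continuous_real[OF c1] integrable_continuous_real[OF c2]
    show "th x y = integral {0..1} (\<lambda>s. e (x + s *\<^sub>R (y - x)) (y - x))"
      unfolding th_def e_def lint_def by (rule Henstock_Kurzweil_Integration.integral_diff[OF i, symmetric])
    show "(\<lambda>s. e (x + s *\<^sub>R (y - x)) (y - x)) integrable_on {0..1}"
      unfolding e_def by (rule integrable_diff[OF i])
  qed
  have "(f has_derivative e x) (at x)" if x: "x \<in> K" for x
    unfolding has_derivative_at_alt
  proof (intro conjI allI impI)
    show "bounded_linear (e x)" by (rule ble[OF x])
    fix \<epsilon> :: real assume \<epsilon>: "\<epsilon> > 0"
    have oK: "open K" using C(1) by (rule C1_on_open)
    obtain d1 where d1: "d1 > 0" "ball x d1 \<subseteq> K" using oK x open_contains_ball by blast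
    obtain d2 where d2: "d2 > 0" "\<And>y. y \<in> K \<Longrightarrow> dist y x < d2 \<Longrightarrow> dist (Blinfun (e y)) (Blinfun (e x)) < \<epsilon>"
      using cb x \<epsilon> unfolding continuous_on_iff by blast
    show "\<exists>d>0. \<forall>y. norm (y - x) < d \<longrightarrow> norm (f y - f x - e x (y - x)) \<le> \<epsilon> * norm (y - x)"
    proof (intro exI[of _ "min d1 d2"] conjI allI impI)
      fix y assume y: "norm (y - x) < min d1 d2"
      then have yK: "y \<in> K" using d1 by (auto simp: dist_norm norm_minus_commute)
      have "norm (e (x + s *\<^sub>R (y - x)) (y - x) - e x (y - x)) \<le> \<epsilon> * norm (y - x)" if s: "s \<in> {0..1}" for s
      proof -
        have "norm (s *\<^sub>R (y - x)) \<le> norm (y - x)" using s by (simp add: mult_left_le_one_le)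
        then have *: "norm (s *\<^sub>R (y - x)) < min d1 d2" using y by linarith
        have "x + s *\<^sub>R (y - x) \<in> ball x d1" using * by (simp add: dist_norm)
        then have K': "x + s *\<^sub>R (y - x) \<in> K" using d1 by blast
        have "dist (Blinfun (e (x + s *\<^sub>R (y - x)))) (Blinfun (e x)) < \<epsilon>"
          by (rule d2(2)[OF K']) (use * in \<open>simp add: dist_norm\<close>)
        then have "norm (Blinfun (e (x + s *\<^sub>R (y - x))) - Blinfun (e x)) \<le> \<epsilon>" by (simp add: dist_norm)
        then have "norm (blinfun_apply (Blinfun (e (x + s *\<^sub>R (y - x))) - Blinfun (e x)) (y - x)) \<le> \<epsilon> * norm (y - x)"
          by (meson mult_right_mono norm_blinfun norm_ge_zero order_trans)
        then show ?thesis
          by (simp add: blinfun.diff_left bounded_linear_Blinfun_apply ble K' x)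
      qed
      then have "norm (integral {0..1} (\<lambda>s. e (x + s *\<^sub>R (y - x)) (y - x) - e x (y - x))) \<le> integral {0..1::real} (\<lambda>_. \<epsilon> * norm (y - x))"
        by (intro integral_norm_bound_integral integrable_diff th(2) x yK integrable_const_ivl)
      moreover have "integral {0..1} (\<lambda>s. e (x + s *\<^sub>R (y - x)) (y - x) - e x (y - x)) = th x y - e x (y - x)"
        using Henstock_Kurzweil_Integration.integral_diff[OF th(2)[OF x yK], of "\<lambda>_. e x (y - x)"] by (simp add: th(1)[OF x yK] integrable_const_ivl)
      ultimately show "norm (f y - f x - e x (y - x)) \<le> \<epsilon> * norm (y - x)" by (simp add: add[OF x yK])
    qed (use d1 d2 in auto)
  qed
  then show thesis using that unfolding e_def by blast
qed (use that in auto)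

section \<open>Additive functionals on chains\<close>

text \<open>The pairing of a complex valued cochain with an integral chain;
  \<open>chain_integral\<close> is the case of the cochain \<open>simplex_integral\<close>.\<close>

definition frag_ext :: "('a \<Rightarrow> complex) \<Rightarrow> ('a \<Rightarrow>\<^sub>0 int) \<Rightarrow> complex" where
  "frag_ext \<phi> c = (\<Sum>\<sigma>\<in>Poly_Mapping.keys c. of_int (Poly_Mapping.lookup c \<sigma>) * \<phi> \<sigma>)"

lemma chain_integral_eq: "chain_integral t \<beta> = frag_ext (simplex_integral t \<beta>)"
  by (simp add: fun_eq_iff chain_integral_def frag_ext_def)

lemma frag_ext_superset:
  assumes "finite S" "Poly_Mapping.keys c \<subseteq> S"
  shows "frag_ext \<phi> c = (\<Sum>\<sigma>\<in>S. of_int (Poly_Mapping.lookup c \<sigma>) * \<phi> \<sigma>)"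
  unfolding frag_ext_def by (rule sum.mono_neutral_left[OF assms]) (simp add: in_keys_iff)

lemma frag_ext_0 [simp]: "frag_ext \<phi> 0 = 0"
  by (simp add: frag_ext_def)

lemma frag_ext_add: "frag_ext \<phi> (c + d) = frag_ext \<phi> c + frag_ext \<phi> d"
proof -
  let ?S = "Poly_Mapping.keys c \<union> Poly_Mapping.keys d"
  have "Poly_Mapping.keys (c + d) \<subseteq> ?S" by (rule Poly_Mapping.keys_add)
  then show ?thesis
    by (simp add: frag_ext_superset[of ?S] lookup_add distrib_right sum.distrib)
qed

lemma frag_ext_minus: "frag_ext \<phi> (- c) = - frag_ext \<phi> c"
  by (simp add: frag_ext_def sum_negf)

lemma frag_ext_diff: "frag_ext \<phi> (c - d) = frag_ext \<phi> c - frag_ext \<phi> d"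
  using frag_ext_add[of \<phi> c "- d"] by (simp add: frag_ext_minus)

lemma frag_ext_of [simp]: "frag_ext \<phi> (frag_of \<sigma>) = \<phi> \<sigma>"
  by (simp add: frag_ext_def)

lemma frag_ext_sum: "frag_ext \<phi> (\<Sum>i\<in>I. c i) = (\<Sum>i\<in>I. frag_ext \<phi> (c i))"
  by (induction I rule: infinite_finite_induct) (auto simp: frag_ext_add)

lemma frag_ext_cong: "(\<And>\<sigma>. \<sigma> \<in> Poly_Mapping.keys c \<Longrightarrow> \<phi> \<sigma> = \<psi> \<sigma>) \<Longrightarrow> frag_ext \<phi> c = frag_ext \<psi> c"
  by (simp add: frag_ext_def)

lemma frag_ext_frag_extend:
  "frag_ext \<phi> (frag_extend h c) = frag_ext (\<lambda>\<sigma>. frag_ext \<phi> (h \<sigma>)) c"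
  by (induction c rule: frag_induction[OF subset_UNIV])
    (auto simp: frag_extend_diff frag_ext_diff)

lemma frag_ext_cmul: "frag_ext \<phi> (frag_cmul k c) = of_int k * frag_ext \<phi> c"
  by (simp add: frag_ext_superset[of "Poly_Mapping.keys c"] keys_cmul sum_distrib_left mult.assoc)

text \<open>The function on the right is the coboundary of \<open>\<phi>\<close>.\<close>

lemma frag_ext_boundary:
  assumes "p > 0"
  shows "frag_ext \<phi> (chain_boundary p c) =
    frag_ext (\<lambda>f. \<Sum>k\<le>p. (-1) ^ k * \<phi> (singular_face p k f)) c"
  using assms by (simp add: chain_boundary_def frag_ext_frag_extend frag_ext_sum frag_ext_cmul)

section \<open>Differentiation under the integral sign\<close>

lemma C1_on_integral_param:
  fixes F :: "'a::euclidean_space \<times> real \<Rightarrow> complex"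
  assumes F: "C1_on F W" and U: "open U" "convex U" and UW: "\<And>x s. x \<in> U \<Longrightarrow> s \<in> {0..1} \<Longrightarrow> (x, s) \<in> W"
  shows "C1_on (\<lambda>x. integral {0..1} (\<lambda>s. F (x, s))) U"
    "\<And>x v. x \<in> U \<Longrightarrow> FD (\<lambda>x. integral {0..1} (\<lambda>s. F (x, s))) x v = integral {0..1} (\<lambda>s. FD F (x, s) (v, 0))"
proof -
  define D where "D = (\<lambda>x s. Blinfun (\<lambda>v. FD F (x, s) (v, 0)))"
  have bl: "bounded_linear (\<lambda>v. FD F (x, s) (v, 0))" if "x \<in> U" "s \<in> {0..1}" for x s
    by (rule bounded_linear_compose[OF C1_on_linear[OF F UW[OF that]]])
      (intro bounded_linear_Pair bounded_linear_ident bounded_linear_zero)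
  have D: "blinfun_apply (D x s) v = FD F (x, s) (v, 0)" if "x \<in> U" "s \<in> {0..1}" for x s v
    unfolding D_def by (simp only: bounded_linear_Blinfun_apply[OF bl[OF that]])
  have cD: "continuous_on (U \<times> {0..1}) (\<lambda>p. FD F (fst p, snd p) (v, 0))" for v
    by (intro continuous_on_FD[OF F] continuous_intros) (use UW in auto)
  have cD': "continuous_on (U \<times> cbox 0 1) (\<lambda>(x, s). D x s)"
  proof (rule continuous_on_blinfun_componentwise)
    fix i :: 'a
    show "continuous_on (U \<times> cbox 0 1) (\<lambda>p. blinfun_apply (case p of (x, s) \<Rightarrow> D x s) i)"
      unfolding cbox_interval using cD[of i] by (rule continuous_on_eq) (auto simp: D)
  qed
  have c1: "continuous_on {0..1} (\<lambda>s. F (x, s))" if "x \<in> U" for x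
    by (intro continuous_on_compose2[OF C1_on_continuous_on[OF F]] continuous_intros) (use UW that in auto)
  have c2: "continuous_on {0..1} (\<lambda>s. D x s)" if "x \<in> U" for x
  proof -
    have "continuous_on {0..1} (\<lambda>s. case (x, s) of (x, s) \<Rightarrow> D x s)"
      by (rule continuous_on_compose2[OF cD']) (use that in \<open>auto intro!: continuous_intros\<close>)
    then show ?thesis by simp
  qed
  have app: "blinfun_apply (integral {0..1} (D x)) v = integral {0..1} (\<lambda>s. FD F (x, s) (v, 0))" if "x \<in> U" for x v
  proof -
    have "blinfun_apply (integral {0..1} (D x)) v = integral {0..1} (\<lambda>s. blinfun_apply (D x s) v)"
      by (rule blinfun_apply_integral) (rule integrable_continuous_real[OF c2[OF that]])
    also have "\<dots> = integral {0..1} (\<lambda>s. FD F (x, s) (v, 0))"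
      by (rule Henstock_Kurzweil_Integration.integral_cong) (simp add: D that)
    finally show ?thesis .
  qed
  have d: "((\<lambda>x. integral {0..1} (\<lambda>s. F (x, s))) has_derivative (\<lambda>v. integral {0..1} (\<lambda>s. FD F (x, s) (v, 0)))) (at x)" if x: "x \<in> U" for x
  proof -
    have "((\<lambda>x. integral (cbox 0 1) (\<lambda>s. F (x, s))) has_derivative blinfun_apply (integral (cbox 0 1) (D x))) (at x within U)"
    proof (rule leibniz_rule[OF _ _ cD' x U(2)])
      fix x s assume xs: "x \<in> U" "s \<in> cbox (0::real) 1"
      have "((\<lambda>x. (x, s)) has_derivative (\<lambda>v. (v, 0))) (at x within U)"
        by (intro has_derivative_Pair has_derivative_ident has_derivative_const)
      from has_derivative_compose[OF this C1_on_has_derivative[OF F]] UW xs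
      have "((\<lambda>x. F (x, s)) has_derivative (\<lambda>v. FD F (x, s) (v, 0))) (at x within U)" by simp
      moreover have "blinfun_apply (D x s) = (\<lambda>v. FD F (x, s) (v, 0))" using D xs by (auto simp: fun_eq_iff)
      ultimately show "((\<lambda>x. F (x, s)) has_derivative blinfun_apply (D x s)) (at x within U)" by (simp only:)
    next
      show "(\<lambda>s. F (x, s)) integrable_on cbox 0 1" if "x \<in> U" for x
        using integrable_continuous_real[OF c1[OF that]] by simp
    qed
    then have "((\<lambda>x. integral {0..1} (\<lambda>s. F (x, s))) has_derivative blinfun_apply (integral {0..1} (D x))) (at x)"
      using at_within_open[OF x U(1)] by (simp only: cbox_interval)
    moreover have "blinfun_apply (integral {0..1} (D x)) = (\<lambda>v. integral {0..1} (\<lambda>s. FD F (x, s) (v, 0)))"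
      by (rule ext) (rule app[OF x])
    ultimately show ?thesis by (simp only:)
  qed
  show "FD (\<lambda>x. integral {0..1} (\<lambda>s. F (x, s))) x v = integral {0..1} (\<lambda>s. FD F (x, s) (v, 0))" if "x \<in> U" for x v
    by (simp only: FD_eq[OF d[OF that]])
  show "C1_on (\<lambda>x. integral {0..1} (\<lambda>s. F (x, s))) U"
  proof (rule C1_onI[OF U(1) d])
    fix v
    have "continuous_on (U \<times> cbox 0 1) (\<lambda>(x, s). FD F (x, s) (v, 0))" using cD[of v] by (simp add: case_prod_unfold)
    from integral_continuous_on_param[OF this]
    show "continuous_on U (\<lambda>x. integral {0..1} (\<lambda>s. FD F (x, s) (v, 0)))" by simp
  qed
qed

section \<open>Barycentric subdivision and integrals over triangles\<close>

text \<open>The inverse of \<open>barycentric\<close> on the standard simplex.\<close>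

definition plane :: "(nat \<Rightarrow> real) \<Rightarrow> real \<times> real" where
  "plane x = (x 1, x 2)"

text \<open>The integral of G dx \<and> dy over the oriented affine triangle with the vertices of
  \<open>f\<close>. The determinant carries the orientation, which matters because the triangles of
  a subdivision occur with signs.\<close>

definition affine_integral :: "(real \<times> real \<Rightarrow> complex) \<Rightarrow> ((nat \<Rightarrow> real) \<Rightarrow> (nat \<Rightarrow> real)) \<Rightarrow> complex" where
  "affine_integral G f =
    (let a = plane (simplicial_vertex 0 f); u = plane (simplicial_vertex 1 f) - a; v = plane (simplicial_vertex 2 f) - a
     in of_real (fst u * snd v - snd u * fst v) * integral triangle (\<lambda>p. G (a + fst p *\<^sub>R u + snd p *\<^sub>R v)))"

lemma C1_on_polynomial_function:
  fixes g :: "'a::real_normed_vector \<Rightarrow> complex"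
  assumes "polynomial_function g"
  shows "C1_on g UNIV"
proof -
  have r: "C1_on f UNIV" if "real_polynomial_function f" for f :: "'a \<Rightarrow> real"
    using that by induction (auto intro: C1_on_bounded_linear C1_on_add C1_on_mult)
  have "C1_on (\<lambda>x. Re (g x)) UNIV" "C1_on (\<lambda>x. Im (g x)) UNIV"
    using assms r bounded_linear_Re bounded_linear_Im unfolding polynomial_function_def comp_def by blast+
  then have "C1_on (\<lambda>x. of_real (Re (g x)) + \<i> * of_real (Im (g x))) UNIV"
    by (intro C1_intros open_UNIV)
  moreover have "(\<lambda>x. of_real (Re (g x)) + \<i> * of_real (Im (g x))) = g"
    by (auto simp: complex_eq_iff)
  ultimately show ?thesis by (simp only:)
qed

text \<open>\<open>H\<close> at (x, y) is x times the integral of g (s x, y) over s in [0, 1]: the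
  limits are fixed, so that \<open>C1_on_integral_param\<close> applies.\<close>

lemma primitive_fst:
  fixes g :: "real \<times> real \<Rightarrow> complex"
  assumes g: "C1_on g UNIV"
  obtains H where "C1_on H UNIV" "\<And>p. FD H p (1, 0) = g p"
proof -
  define A where "A = (\<lambda>q :: (real \<times> real) \<times> real. (snd q * fst (fst q), snd (fst q)))"
  have A: "C1_on A UNIV" unfolding A_def by (intro C1_intros open_UNIV)
  define F where "F = (\<lambda>q. fst (fst q) *\<^sub>R g (A q))"
  have F: "C1_on F UNIV" unfolding F_def by (intro C1_intros open_UNIV C1_on_compose[OF A g]) auto
  define H where "H = (\<lambda>p. integral {0..1} (\<lambda>s. F (p, s)))"
  have "C1_on H UNIV" and FDH: "\<And>p v. FD H p v = integral {0..1} (\<lambda>s. FD F (p, s) (v, 0))"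
    unfolding H_def using C1_on_integral_param[OF F, of UNIV] by auto
  moreover have "FD H (x, y) (1, 0) = g (x, y)" for x y
  proof -
    have dF: "FD F ((x, y), s) ((1, 0), 0) = g (s * x, y) + x *\<^sub>R FD g (s * x, y) (s, 0)" for s
    proof -
      have dA: "(A has_derivative (\<lambda>w. (s * fst (fst w) + snd w * x, snd (fst w)))) (at ((x, y), s))"
        unfolding A_def by (auto intro!: derivative_eq_intros)
      have "((\<lambda>q. g (A q)) has_derivative (\<lambda>w. FD g (A ((x, y), s)) (s * fst (fst w) + snd w * x, snd (fst w)))) (at ((x, y), s))"
        by (rule has_derivative_compose[OF dA C1_on_has_derivative[OF g]]) simp
      moreover have "((\<lambda>q :: (real \<times> real) \<times> real. fst (fst q)) has_derivative (\<lambda>w. fst (fst w))) (at ((x, y), s))"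
        by (auto intro!: derivative_eq_intros)
      ultimately have "(F has_derivative (\<lambda>w. x *\<^sub>R FD g (A ((x, y), s)) (s * fst (fst w) + snd w * x, snd (fst w)) + fst (fst w) *\<^sub>R g (A ((x, y), s)))) (at ((x, y), s))"
        unfolding F_def using has_derivative_scaleR by fastforce
      from FD_eq[OF this] show ?thesis by (simp add: A_def)
    qed
    \<comment> \<open>The integrand of the derivative of \<open>H\<close> in direction (1, 0) is the
      derivative of s g (s x, y) in s.\<close>
    have "((\<lambda>s. s *\<^sub>R g (s * x, y)) has_vector_derivative FD F ((x, y), s) ((1, 0), 0)) (at s within {0..1})" for s
    proof -
      have "((\<lambda>s. (s * x, y)) has_derivative (\<lambda>c. (c * x, 0))) (at s within {0..1})"
        by (auto intro!: derivative_eq_intros)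
      from has_derivative_compose[OF this C1_on_has_derivative[OF g]]
      have "((\<lambda>s. g (s * x, y)) has_derivative (\<lambda>c. FD g (s * x, y) (c * x, 0))) (at s within {0..1})" by simp
      from has_derivative_scaleR[OF has_derivative_ident this]
      have "((\<lambda>s. s *\<^sub>R g (s * x, y)) has_derivative (\<lambda>c. s *\<^sub>R FD g (s * x, y) (c * x, 0) + c *\<^sub>R g (s * x, y))) (at s within {0..1})" .
      moreover have "s *\<^sub>R FD g (s * x, y) (c * x, 0) + c *\<^sub>R g (s * x, y) = c *\<^sub>R FD F ((x, y), s) ((1, 0), 0)" for c
      proof -
        interpret bounded_linear "FD g (s * x, y)" using C1_on_linear[OF g] by simp
        have "FD g (s * x, y) (c * x, 0) = (c * x) *\<^sub>R FD g (s * x, y) (1, 0)" "FD g (s * x, y) (s, 0) = s *\<^sub>R FD g (s * x, y) (1, 0)"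
          by (simp_all flip: scaleR)
        then show ?thesis by (simp add: dF algebra_simps)
      qed
      ultimately show ?thesis by (simp only: has_vector_derivative_def)
    qed
    then have "((\<lambda>s. FD F ((x, y), s) ((1, 0), 0)) has_integral (1 *\<^sub>R g (1 * x, y) - 0 *\<^sub>R g (0 * x, y))) {0..1}"
      by (intro fundamental_theorem_of_calculus) simp_all
    then show ?thesis by (simp add: FDH integral_unique)
  qed
  ultimately show thesis using that[of H] by auto
qed

text \<open>Stokes on degenerate triangles: dH \<and> dB vanishes on parallel vectors.\<close>

lemma lint_collinear:
  fixes H B :: "real \<times> real \<Rightarrow> complex"
  assumes H: "C1_on H UNIV" and B: "C1_on B UNIV"
  shows "lint H B b b = 0" "lint H B a b + lint H B b a = 0"
    "m - a = c *\<^sub>R (b - a) \<Longrightarrow> lint H B m b - lint H B m a = lint H B a b"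
proof -
  have z: "FD B x 0 = 0" "FD H x 0 = 0" for x
    using C1_on_linear[OF B, of x] C1_on_linear[OF H, of x] by (simp_all add: linear_simps(3))
  show b: "lint H B b b = 0" for b by (simp add: lint_def z)
  have "lint H B a (a + (b - a)) + lint H B (a + (b - a)) (a + 0) - lint H B a (a + 0) = integral triangle (\<lambda>p. wedge H B (a + fst p *\<^sub>R (b - a) + snd p *\<^sub>R 0) (b - a) 0)" for a b
    by (rule Stokes_affine[symmetric, OF H B]) simp
  then show r: "lint H B a b + lint H B b a = 0" for a b by (simp add: wedge_def z b)
  assume m: "m - a = c *\<^sub>R (b - a)"
  have "lint H B a (a + (m - a)) + lint H B (a + (m - a)) (a + (b - a)) - lint H B a (a + (b - a)) = integral triangle (\<lambda>p. wedge H B (a + fst p *\<^sub>R (m - a) + snd p *\<^sub>R (b - a)) (m - a) (b - a))"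
    by (rule Stokes_affine[symmetric, OF H B]) simp
  moreover have "wedge H B x (m - a) (b - a) = 0" for x
  proof -
    have "linear (FD H x)" "linear (FD B x)"
      using C1_on_linear[OF B, of x] C1_on_linear[OF H, of x] by (simp_all add: bounded_linear.linear)
    then show ?thesis by (simp add: wedge_def m linear_scale)
  qed
  ultimately show "lint H B m b - lint H B m a = lint H B a b"
    using r[of a m] by (simp add: algebra_simps add_eq_0_iff)
qed

text \<open>g dx \<and> dy is the exterior derivative of H dy, so the integral becomes one over the
  three edges.\<close>

lemma affine_integral_Stokes:
  assumes H: "C1_on H UNIV" and g: "\<And>p. FD H p (1, 0) = g p" and f: "simplicial_simplex 2 S f"
  shows "affine_integral g f =
    (\<Sum>k\<le>2. (-1) ^ k * lint H (\<lambda>p. of_real (snd p)) (plane (simplicial_vertex 0 (singular_face 2 k f))) (plane (simplicial_vertex 1 (singular_face 2 k f))))"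
proof -
  obtain l where l: "f = oriented_simplex 2 l" using f by (auto simp: simplicial_simplex)
  let ?B = "\<lambda>p :: real \<times> real. complex_of_real (snd p)"
  have B: "C1_on ?B UNIV" by (intro C1_intros open_UNIV)
  have FDB: "FD ?B p v = of_real (snd v)" for p v
  proof -
    have "(?B has_derivative (\<lambda>v. of_real (snd v))) (at p)"
      by (intro has_derivative_of_real has_derivative_snd has_derivative_ident)
    then show ?thesis by (simp add: FD_eq)
  qed
  define a u v where "a = plane (l 0)" and "u = plane (l 1) - a" and "v = plane (l 2) - a"
  have w: "wedge H ?B p u v = of_real (fst u * snd v - snd u * fst v) * g p" for p
  proof -
    interpret bounded_linear "FD H p" using C1_on_linear[OF H] by simp
    have "FD H p w = fst w *\<^sub>R FD H p (1, 0) + snd w *\<^sub>R FD H p (0, 1)" for w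
      by (cases w) (simp flip: scaleR add)
    from this[of u] this[of v] show ?thesis by (simp add: wedge_def FDB g scaleR_conv_of_real algebra_simps)
  qed
  have "affine_integral g f = of_real (fst u * snd v - snd u * fst v) * integral triangle (\<lambda>p. g (a + fst p *\<^sub>R u + snd p *\<^sub>R v))"
    by (simp add: affine_integral_def Let_def l simplicial_vertex_oriented_simplex a_def u_def v_def)
  also have "\<dots> = integral triangle (\<lambda>p. wedge H ?B (a + fst p *\<^sub>R u + snd p *\<^sub>R v) u v)"
    by (simp only: w integral_mult_right)
  also have "\<dots> = lint H ?B a (a + u) + lint H ?B (a + u) (a + v) - lint H ?B a (a + v)"
    by (rule Stokes_affine[OF H B]) simp
  also have "\<dots> = (\<Sum>k\<le>2. (-1) ^ k * lint H ?B (plane (simplicial_vertex 0 (singular_face 2 k f))) (plane (simplicial_vertex 1 (singular_face 2 k f))))"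
    by (simp add: l singular_face_oriented_simplex simplicial_vertex_oriented_simplex a_def u_def v_def numeral_2_eq_2)
  finally show ?thesis .
qed

text \<open>Subdivision replaces an edge by the difference of the two edges leading from its
  midpoint to its ends, and line integrals are additive along collinear points.\<close>

lemma lint_subdivision:
  assumes H: "C1_on H UNIV" and B: "C1_on B UNIV" and d: "simplicial_chain 1 S d"
  defines "\<phi> \<equiv> \<lambda>f :: (nat \<Rightarrow> real) \<Rightarrow> (nat \<Rightarrow> real). lint H B (plane (simplicial_vertex 0 f)) (plane (simplicial_vertex 1 f))"
  shows "frag_ext \<phi> (simplicial_subdivision 1 d) = frag_ext \<phi> d"
  using d unfolding simplicial_chain_def
proof (induction rule: frag_induction)
  case (one f)
  then obtain l where l: "f = oriented_simplex 1 l" by (auto simp: simplicial_simplex)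
  define m where "m = (\<lambda>i. (l 0 i + l 1 i) / 2)"
  have "chain_boundary 1 (frag_of f) = frag_of (oriented_simplex 0 (\<lambda>j. l 1)) - frag_of (oriented_simplex 0 (\<lambda>j. l 0))"
  proof -
    have "oriented_simplex 0 (\<lambda>j. if j < 0 then l j else l (Suc j)) = oriented_simplex 0 (\<lambda>j. l 1)"
      "oriented_simplex 0 (\<lambda>j. if j < 1 then l j else l (Suc j)) = oriented_simplex 0 (\<lambda>j. l 0)"
      unfolding oriented_simplex_eq by simp_all
    then show ?thesis by (simp add: chain_boundary_of l singular_face_oriented_simplex)
  qed
  then have "simplicial_subdivision 1 (frag_of f) =
    frag_of (simplex_cone 0 m (oriented_simplex 0 (\<lambda>j. l 1))) - frag_of (simplex_cone 0 m (oriented_simplex 0 (\<lambda>j. l 0)))"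
    using simplicial_subdivision_of[of 1 f]
    by (simp add: simplicial_cone_def frag_extend_diff l simplicial_vertex_oriented_simplex m_def)
  then have "frag_ext \<phi> (simplicial_subdivision 1 (frag_of f)) = lint H B (plane m) (plane (l 1)) - lint H B (plane m) (plane (l 0))"
    by (simp add: frag_ext_diff \<phi>_def simplex_cone simplicial_vertex_oriented_simplex)
  also have "\<dots> = lint H B (plane (l 0)) (plane (l 1))"
    by (rule lint_collinear(3)[OF H B, where c = "1/2"]) (simp add: plane_def m_def field_simps)
  finally show ?case by (simp add: \<phi>_def l simplicial_vertex_oriented_simplex)
next
  case (diff a b)
  then show ?case by (simp only: simplicial_subdivision_diff frag_ext_diff)
qed simp

lemma plane_standard_simplex: "x \<in> standard_simplex 2 \<Longrightarrow> plane x \<in> triangle"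
proof -
  assume x: "x \<in> standard_simplex 2"
  then have x0: "x 0 \<ge> 0" by (simp add: standard_simplex_def)
  have "x 0 + x 1 + x 2 = 1" "x 1 \<ge> 0" "x 2 \<ge> 0" using x by (simp_all add: standard_simplex_def numeral_2_eq_2)
  then show ?thesis using x0 by (simp add: plane_def triangle_def)
qed

lemma convex_triangle: "convex triangle"
proof -
  have "triangle = {p. 0 \<le> fst p} \<inter> {p. 0 \<le> snd p} \<inter> {p. fst p + snd p \<le> 1}"
    by (auto simp: triangle_def)
  also have "convex \<dots>"
  proof (intro convex_Int)
    show "convex {p :: real \<times> real. 0 \<le> fst p}" "convex {p :: real \<times> real. 0 \<le> snd p}" "convex {p :: real \<times> real. fst p + snd p \<le> 1}"
    using convex_halfspace_ge[of 0 "(1 :: real, 0 :: real)"] convex_halfspace_ge[of 0 "(0 :: real, 1 :: real)"] convex_halfspace_le[of "(1 :: real, 1 :: real)" 1]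
    by (simp_all add: inner_prod_def)
  qed
  finally show ?thesis .
qed

text \<open>\<open>singular_subdivision\<close> of a 2-chain maps this one affine chain into each of
  its simplices, so a single computation in the plane serves them all.\<close>

definition unit_subdivision :: "((nat \<Rightarrow> real) \<Rightarrow> (nat \<Rightarrow> real)) \<Rightarrow>\<^sub>0 int" where
  "unit_subdivision = simplicial_subdivision 2 (frag_of (restrict id (standard_simplex 2)))"

lemma simplicial_chain_unit: "simplicial_chain 2 (standard_simplex 2) (frag_of (restrict id (standard_simplex 2)))"
  using simplicial_simplex_id[of 2 "standard_simplex 2"] by simp

lemma simplicial_chain_unit_subdivision: "simplicial_chain 2 (standard_simplex 2) unit_subdivision"
  unfolding unit_subdivision_def by (intro simplicial_chain_simplicial_subdivision simplicial_chain_unit)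

lemma affine_integral_unit: "affine_integral G (restrict id (standard_simplex 2)) = integral triangle G"
proof -
  have "(\<lambda>j. if j = i then 1 else 0) \<in> standard_simplex 2" if "i \<le> 2" for i
    using that by simp
  then have "simplicial_vertex i (restrict id (standard_simplex 2)) = (\<lambda>j. if j = i then 1 else 0)" if "i \<le> 2" for i
    using that by (simp add: simplicial_vertex_def)
  then show ?thesis by (simp add: affine_integral_def plane_def)
qed

text \<open>Additivity of the plane integral without listing the small triangles: for a polynomial
  integrand the integral is a cochain of edges evaluated on the boundary, the boundary commutes with
  subdivision, and on edges subdivision changes nothing. Continuous integrands follow by uniform
  approximation.\<close>

lemma affine_integral_unit_subdivision:
  fixes G :: "real \<times> real \<Rightarrow> complex"
  assumes G: "continuous_on triangle G"
  shows "frag_ext (affine_integral G) unit_subdivision = integral triangle G"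
proof -
  let ?id = "restrict id (standard_simplex 2) :: (nat \<Rightarrow> real) \<Rightarrow> (nat \<Rightarrow> real)"
  have poly: "frag_ext (affine_integral g) unit_subdivision = integral triangle g" if "polynomial_function g" for g
  proof -
    have pg: "polynomial_function g" using that .
    obtain H where H: "C1_on H UNIV" and g: "\<And>p. FD H p (1, 0) = g p"
      by (rule primitive_fst[OF C1_on_polynomial_function[OF pg]]) blast
    let ?B = "\<lambda>p :: real \<times> real. complex_of_real (snd p)"
    have B: "C1_on ?B UNIV" by (intro C1_intros open_UNIV)
    define \<phi> where "\<phi> = (\<lambda>f :: (nat \<Rightarrow> real) \<Rightarrow> (nat \<Rightarrow> real). lint H ?B (plane (simplicial_vertex 0 f)) (plane (simplicial_vertex 1 f)))"
    have ai: "frag_ext (affine_integral g) c = frag_ext \<phi> (chain_boundary 2 c)" if "simplicial_chain 2 (standard_simplex 2) c" for c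
      unfolding frag_ext_boundary[OF zero_less_numeral] \<phi>_def
      using that by (intro frag_ext_cong affine_integral_Stokes[OF H g]) (auto simp: simplicial_chain_def)
    have "frag_ext (affine_integral g) unit_subdivision = frag_ext \<phi> (chain_boundary 2 unit_subdivision)"
      by (rule ai[OF simplicial_chain_unit_subdivision])
    also have "chain_boundary 2 unit_subdivision = simplicial_subdivision 1 (chain_boundary 2 (frag_of ?id))"
      unfolding unit_subdivision_def using chain_boundary_simplicial_subdivision[OF simplicial_chain_unit] by simp
    also have "frag_ext \<phi> \<dots> = frag_ext \<phi> (chain_boundary 2 (frag_of ?id))"
      unfolding \<phi>_def using simplicial_chain_boundary[OF simplicial_chain_unit]
      by (intro lint_subdivision[OF H B]) simp
    also have "\<dots> = frag_ext (affine_integral g) (frag_of ?id)"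
      by (rule ai[OF simplicial_chain_unit, symmetric])
    finally show ?thesis by (simp add: affine_integral_unit)
  qed
  \<comment> \<open>Each affine integral is Lipschitz in its integrand for the supremum norm,
    because the affine triangle stays inside \<open>triangle\<close>.\<close>
  have diff: "\<exists>C\<ge>0. \<forall>g \<epsilon>. continuous_on triangle g \<longrightarrow> (\<forall>p\<in>triangle. norm (G p - g p) \<le> \<epsilon>) \<longrightarrow> \<epsilon> \<ge> 0 \<longrightarrow> norm (affine_integral G f - affine_integral g f) \<le> C * \<epsilon>"
    if "simplicial_simplex 2 (standard_simplex 2) f" for f
  proof -
    from that have "\<exists>l. f = oriented_simplex 2 l" and fS: "f \<in> standard_simplex 2 \<rightarrow> standard_simplex 2"
      by (auto simp: simplicial_simplex)
    then obtain l where l: "f = oriented_simplex 2 l" by blast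
    define a u v where "a = plane (l 0)" and "u = plane (l 1) - a" and "v = plane (l 2) - a"
    have lT: "plane (l i) \<in> triangle" if "i \<le> 2" for i
    proof -
      have "simplicial_vertex i f \<in> standard_simplex 2" using fS that by (auto simp: simplicial_vertex_def)
      then show ?thesis using that by (simp add: l simplicial_vertex_oriented_simplex plane_standard_simplex)
    qed
    have T: "a + fst p *\<^sub>R u + snd p *\<^sub>R v \<in> triangle" if "p \<in> triangle" for p
      using affine_in_convex[OF convex_triangle _ _ _ that, of a u v] lT by (simp add: a_def u_def v_def)
    have ai: "affine_integral g f = of_real (fst u * snd v - snd u * fst v) * integral triangle (\<lambda>p. g (a + fst p *\<^sub>R u + snd p *\<^sub>R v))" for g
      by (simp add: affine_integral_def Let_def l simplicial_vertex_oriented_simplex a_def u_def v_def)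
    define A where "A = integral triangle (\<lambda>_. 1 :: real)"
    have A1: "(\<lambda>_. c :: real) integrable_on triangle" for c
    proof -
      have "triangle \<in> lmeasurable" by (simp add: compact_triangle lmeasurable_compact)
      then show ?thesis by (rule integrable_on_const)
    qed
    have A0: "A \<ge> 0" unfolding A_def by (rule Henstock_Kurzweil_Integration.integral_nonneg[OF A1]) simp
    show ?thesis
    proof (intro exI[of _ "\<bar>fst u * snd v - snd u * fst v\<bar> * A"] conjI allI impI)
      show "0 \<le> \<bar>fst u * snd v - snd u * fst v\<bar> * A" using A0 by simp
      fix g \<epsilon> assume g: "continuous_on triangle g" and e: "\<forall>p\<in>triangle. norm (G p - g p) \<le> \<epsilon>" and e0: "(\<epsilon> :: real) \<ge> 0"
      have i: "(\<lambda>p. h (a + fst p *\<^sub>R u + snd p *\<^sub>R v)) integrable_on triangle" if "continuous_on triangle h" for h :: "real \<times> real \<Rightarrow> complex"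
        using T by (intro integrable_triangle continuous_on_compose2[OF that] continuous_intros) auto
      have "norm (integral triangle (\<lambda>p. G (a + fst p *\<^sub>R u + snd p *\<^sub>R v) - g (a + fst p *\<^sub>R u + snd p *\<^sub>R v))) \<le> integral triangle (\<lambda>p. \<epsilon>)"
        using e T by (intro integral_norm_bound_integral integrable_diff i[OF G] i[OF g] A1) auto
      also have "integral triangle (\<lambda>p. \<epsilon>) = \<epsilon> * A"
        unfolding A_def using integral_mult_right[of triangle \<epsilon> "\<lambda>_. 1"] by simp
      also have "integral triangle (\<lambda>p. G (a + fst p *\<^sub>R u + snd p *\<^sub>R v) - g (a + fst p *\<^sub>R u + snd p *\<^sub>R v)) =
         integral triangle (\<lambda>p. G (a + fst p *\<^sub>R u + snd p *\<^sub>R v)) - integral triangle (\<lambda>p. g (a + fst p *\<^sub>R u + snd p *\<^sub>R v))"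
        by (rule Henstock_Kurzweil_Integration.integral_diff[OF i[OF G] i[OF g]])
      finally have *: "norm (integral triangle (\<lambda>p. G (a + fst p *\<^sub>R u + snd p *\<^sub>R v)) - integral triangle (\<lambda>p. g (a + fst p *\<^sub>R u + snd p *\<^sub>R v))) \<le> \<epsilon> * A" .
      show "norm (affine_integral G f - affine_integral g f) \<le> \<bar>fst u * snd v - snd u * fst v\<bar> * A * \<epsilon>"
        unfolding ai right_diff_distrib[symmetric] norm_mult norm_of_real
        using mult_left_mono[OF *, of "\<bar>fst u * snd v - snd u * fst v\<bar>"] by (simp add: mult_ac)
    qed
  qed
  let ?U = "unit_subdivision" and ?K = "Poly_Mapping.keys unit_subdivision"
  have sK: "simplicial_simplex 2 (standard_simplex 2) f" if "f \<in> ?K" for f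
    using simplicial_chain_unit_subdivision that by (auto simp: simplicial_chain_def)
  obtain C where C: "\<And>f. f \<in> insert ?id ?K \<Longrightarrow> C f \<ge> 0 \<and> (\<forall>g \<epsilon>. continuous_on triangle g \<longrightarrow> (\<forall>p\<in>triangle. norm (G p - g p) \<le> \<epsilon>) \<longrightarrow> \<epsilon> \<ge> 0 \<longrightarrow> norm (affine_integral G f - affine_integral g f) \<le> C f * \<epsilon>)"
    using diff sK simplicial_simplex_id[of 2 "standard_simplex 2"] by (metis insert_iff order_refl)
  \<comment> \<open>A Lipschitz constant for the difference of the two sides of the claim.\<close>
  define M where "M = C ?id + (\<Sum>f\<in>?K. \<bar>real_of_int (Poly_Mapping.lookup ?U f)\<bar> * C f)"
  have M: "M \<ge> 0" unfolding M_def using C by (intro add_nonneg_nonneg sum_nonneg mult_nonneg_nonneg) auto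
  have "norm (frag_ext (affine_integral G) ?U - integral triangle G) \<le> e" if "e > 0" for e
  proof -
    define \<epsilon> where "\<epsilon> = e / (M + 1)"
    have \<epsilon>: "\<epsilon> > 0" using that M by (simp add: \<epsilon>_def)
    obtain g where g: "polynomial_function g" "\<And>p. p \<in> triangle \<Longrightarrow> norm (G p - g p) < \<epsilon>"
      using Stone_Weierstrass_polynomial_function[OF compact_triangle G \<epsilon>] by blast
    have cg: "continuous_on triangle g" using C1_on_continuous_on[OF C1_on_polynomial_function[OF g(1)]] continuous_on_subset by blast
    have b: "norm (affine_integral G f - affine_integral g f) \<le> C f * \<epsilon>" if "f \<in> insert ?id ?K" for f
      using C[OF that] cg g(2) \<epsilon> less_imp_le by metis
    have 1: "frag_ext (affine_integral G) ?U - integral triangle G =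
      (\<Sum>f\<in>?K. of_int (Poly_Mapping.lookup ?U f) * (affine_integral G f - affine_integral g f)) - (affine_integral G ?id - affine_integral g ?id)"
      using poly[OF g(1)] by (simp add: frag_ext_def affine_integral_unit sum_subtractf right_diff_distrib)
    also have "norm \<dots> \<le> norm (\<Sum>f\<in>?K. of_int (Poly_Mapping.lookup ?U f) * (affine_integral G f - affine_integral g f)) + norm (affine_integral G ?id - affine_integral g ?id)"
      by (rule norm_triangle_ineq4)
    also have "\<dots> \<le> (\<Sum>f\<in>?K. \<bar>real_of_int (Poly_Mapping.lookup ?U f)\<bar> * (C f * \<epsilon>)) + C ?id * \<epsilon>"
      by (intro add_mono b sum_norm_le) (auto simp: norm_mult intro!: mult_left_mono b)
    also have "\<dots> = M * \<epsilon>" by (simp only: M_def distrib_right sum_distrib_right mult.assoc add.commute)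
    also have "\<dots> \<le> e" using M that by (simp add: \<epsilon>_def field_simps)
    finally show ?thesis .
  qed
  note le = this
  have "norm (frag_ext (affine_integral G) ?U - integral triangle G) \<le> 0"
  proof (rule field_le_epsilon)
    fix e :: real assume "e > 0"
    then show "norm (frag_ext (affine_integral G) ?U - integral triangle G) \<le> 0 + e" using le[of e] by simp
  qed
  then show ?thesis by simp
qed

section \<open>The octic polynomials\<close>

lemma distinct_4 [simp]: "(0 :: 4) \<noteq> 1" "(0 :: 4) \<noteq> 2" "(0 :: 4) \<noteq> 3" "(1 :: 4) \<noteq> 2" "(1 :: 4) \<noteq> 3" "(2 :: 4) \<noteq> 3"
  "(1 :: 4) \<noteq> 0" "(2 :: 4) \<noteq> 0" "(3 :: 4) \<noteq> 0" "(2 :: 4) \<noteq> 1" "(3 :: 4) \<noteq> 1" "(3 :: 4) \<noteq> 2"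
  by simp_all

lemma sum_UNIV_4: "(\<Sum>i\<in>UNIV. h i) = h 0 + h 1 + h 2 + h (3 :: 4)"
  by (subst univ_4) (simp add: add.assoc)

lemma prod_UNIV_4: "(\<Prod>i\<in>UNIV. h i) = h 0 * h 1 * h 2 * h (3 :: 4)"
  by (subst univ_4) (simp add: mult.assoc)

lemma all_4: "(\<forall>i. P i) \<longleftrightarrow> P 0 \<and> P 1 \<and> P 2 \<and> P (3 :: 4)"
proof -
  have "(\<forall>i\<in>UNIV. P i) \<longleftrightarrow> P 0 \<and> P 1 \<and> P 2 \<and> P (3 :: 4)" unfolding univ_4 by simp
  then show ?thesis by simp
qed

lemma expo_sum: "expo \<alpha> 0 + expo \<alpha> 1 = 4" "expo \<alpha> 2 + expo \<alpha> 3 = 4"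
  using expo[of \<alpha>] by simp_all

lemma scaleR_eq_scale: "r *\<^sub>R (x :: complex^'n) = of_real r *s x"
  by (simp only: vec_eq_iff vector_scaleR_component vector_smult_component scaleR_conv_of_real[of _ "_ :: complex"] simp_thms)

definition monomial_deriv :: "(4 \<Rightarrow> nat) \<Rightarrow> complex^4 \<Rightarrow> complex^4 \<Rightarrow> complex" where
  "monomial_deriv \<beta> x v = (\<Sum>i\<in>UNIV. of_nat (\<beta> i) * x $ i ^ (\<beta> i - 1) * v $ i * (\<Prod>j\<in>UNIV - {i}. x $ j ^ \<beta> j))"

definition octic_deriv :: "param \<Rightarrow> complex^4 \<Rightarrow> complex^4 \<Rightarrow> complex" where
  "octic_deriv t x v = (\<Sum>i\<in>UNIV. 8 * x $ i ^ 7 * v $ i) - (\<Sum>\<alpha>\<in>UNIV. t $ \<alpha> * monomial_deriv (expo \<alpha>) x v)"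

lemma has_derivative_monomial: "(monomial \<beta> has_derivative monomial_deriv \<beta> x) (at x)"
proof -
  have "((\<lambda>x. \<Prod>i\<in>UNIV. x $ i ^ \<beta> i) has_derivative
      (\<lambda>v. \<Sum>i\<in>UNIV. (of_nat (\<beta> i) * v $ i * x $ i ^ (\<beta> i - 1)) * (\<Prod>j\<in>UNIV - {i}. x $ j ^ \<beta> j))) (at x)"
    by (intro has_derivative_prod has_derivative_power bounded_linear_imp_has_derivative bounded_linear_vec_nth)
  then show ?thesis by (simp add: monomial_def[abs_def] monomial_deriv_def[abs_def] mult_ac)
qed

lemma has_derivative_octic: "(octic t has_derivative octic_deriv t x) (at x)"
proof -
  have "((\<lambda>x. (\<Sum>i\<in>UNIV. x $ i ^ 8) - (\<Sum>\<alpha>\<in>UNIV. t $ \<alpha> * monomial (expo \<alpha>) x)) has_derivative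
    (\<lambda>v. (\<Sum>i\<in>UNIV. of_nat 8 * v $ i * x $ i ^ (8 - 1)) - (\<Sum>\<alpha>\<in>UNIV. t $ \<alpha> * monomial_deriv (expo \<alpha>) x v))) (at x)"
    by (intro has_derivative_diff has_derivative_sum has_derivative_power has_derivative_mult_right has_derivative_monomial
      bounded_linear_imp_has_derivative bounded_linear_vec_nth)
  then show ?thesis by (simp add: octic_def[abs_def] octic_deriv_def[abs_def] mult_ac)
qed

lemma FD_octic: "FD (octic t) x = octic_deriv t x"
  by (rule FD_eq[OF has_derivative_octic])

lemma linear_octic_deriv: "linear (octic_deriv t x)"
  using has_derivative_octic has_derivative_bounded_linear bounded_linear.linear by blast

lemma octic_deriv_scale [simp]: "octic_deriv t x (c *s v) = c * octic_deriv t x v"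
  unfolding octic_deriv_def monomial_deriv_def
  by (simp add: sum_distrib_left right_diff_distrib mult_ac)

lemma octic_deriv_add [simp]: "octic_deriv t x (u + v) = octic_deriv t x u + octic_deriv t x v"
  and octic_deriv_diff [simp]: "octic_deriv t x (u - v) = octic_deriv t x u - octic_deriv t x v"
  and octic_deriv_0 [simp]: "octic_deriv t x 0 = 0"
  using linear_octic_deriv by (auto simp: linear_add linear_diff linear_0)

lemma monomial_scale: "monomial \<beta> (c *s x) = c ^ (\<Sum>i\<in>UNIV. \<beta> i) * monomial \<beta> x"
  by (simp add: monomial_def power_mult_distrib prod.distrib power_sum)

lemma octic_scale: "octic t (c *s x) = c ^ 8 * octic t x"
proof -
  have "(\<Sum>i\<in>UNIV. expo \<alpha> i) = 8" for \<alpha> using expo_sum[of \<alpha>] by (simp add: sum_UNIV_4)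
  then show ?thesis
    by (simp add: octic_def monomial_scale power_mult_distrib sum_distrib_left right_diff_distrib mult_ac)
qed

lemma octic_deriv_base_scale:
  assumes "c \<noteq> 0"
  shows "octic_deriv t (c *s x) v = c ^ 7 * octic_deriv t x v"
proof -
  have "((\<lambda>y. c *s y) has_derivative (\<lambda>v. c *s v)) (at x)"
    unfolding vector_scalar_mult_def
    by (intro has_derivative_vec_lambda has_derivative_mult_right bounded_linear_imp_has_derivative bounded_linear_vec_nth)
  from has_derivative_compose[OF this has_derivative_octic]
  have "((\<lambda>y. octic t (c *s y)) has_derivative (\<lambda>v. octic_deriv t (c *s x) (c *s v))) (at x)" .
  moreover have "((\<lambda>y. octic t (c *s y)) has_derivative (\<lambda>v. c ^ 8 * octic_deriv t x v)) (at x)"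
    unfolding octic_scale by (intro has_derivative_mult_right has_derivative_octic)
  ultimately have "octic_deriv t (c *s x) (c *s v) = c ^ 8 * octic_deriv t x v"
    using fun_cong[OF has_derivative_unique] by blast
  also have "c ^ 8 = c * c ^ 7" by (simp flip: power_Suc)
  finally show ?thesis using assms by simp
qed

lemma octic_Euler: "octic_deriv t x x = 8 * octic t x"
proof -
  have "((\<lambda>r :: real. r *\<^sub>R x) has_derivative (\<lambda>h. h *\<^sub>R x)) (at 1)"
    by (intro bounded_linear_imp_has_derivative bounded_linear_scaleR_left)
  from has_derivative_compose[OF this, of "octic t" "octic_deriv t x"] has_derivative_octic
  have "((\<lambda>r. octic t (r *\<^sub>R x)) has_derivative (\<lambda>h. octic_deriv t x (h *\<^sub>R x))) (at 1)" by simp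
  moreover have "((\<lambda>r :: real. octic t (r *\<^sub>R x)) has_derivative (\<lambda>h. of_real (8 * h) * octic t x)) (at 1)"
    unfolding scaleR_eq_scale octic_scale of_real_power[symmetric]
    by (auto intro!: derivative_eq_intros)
  ultimately have "octic_deriv t x (1 *\<^sub>R x) = of_real (8 * 1) * octic t x"
    using fun_cong[OF has_derivative_unique] by blast
  then show ?thesis by simp
qed

lemma C1_on_monomial: "open S \<Longrightarrow> C1_on h S \<Longrightarrow> C1_on (\<lambda>z. monomial \<beta> (h z)) S"
  unfolding monomial_def by (intro C1_intros)

lemma C1_on_octic: "open S \<Longrightarrow> C1_on h S \<Longrightarrow> C1_on k S \<Longrightarrow> C1_on (\<lambda>z. octic (k z) (h z)) S"
  unfolding octic_def by (intro C1_intros C1_on_monomial)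

lemma C1_on_octic_deriv:
  "open S \<Longrightarrow> C1_on h S \<Longrightarrow> C1_on k S \<Longrightarrow> C1_on l S \<Longrightarrow> C1_on (\<lambda>z. octic_deriv (k z) (h z) (l z)) S"
  unfolding octic_deriv_def monomial_deriv_def by (intro C1_intros)

lemma continuous_on_monomial:
  "continuous_on S h \<Longrightarrow> continuous_on S (\<lambda>z. monomial \<beta> (h z))"
  unfolding monomial_def by (intro continuous_intros)

lemma continuous_on_octic:
  "continuous_on S h \<Longrightarrow> continuous_on S k \<Longrightarrow> continuous_on S (\<lambda>z. octic (k z) (h z))"
  unfolding octic_def by (intro continuous_intros continuous_on_monomial)

lemma continuous_on_octic_deriv:
  "continuous_on S h \<Longrightarrow> continuous_on S k \<Longrightarrow> continuous_on S l \<Longrightarrow> continuous_on S (\<lambda>z. octic_deriv (k z) (h z) (l z))"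
  unfolding octic_deriv_def monomial_deriv_def by (intro continuous_intros)

section \<open>The residue forms\<close>

definition rows :: "complex^4 \<Rightarrow> complex^4 \<Rightarrow> complex^4 \<Rightarrow> complex^4 \<Rightarrow> complex^4^4" where
  "rows x w u v = (\<chi> i. if i = 0 then x else if i = 1 then w else if i = 2 then u else v)"

abbreviation det4 :: "complex^4 \<Rightarrow> complex^4 \<Rightarrow> complex^4 \<Rightarrow> complex^4 \<Rightarrow> complex" where
  "det4 x w u v \<equiv> det (rows x w u v)"

text \<open>The rules for linearity in one row expect that row in the first branch; these forms
  bring each row there.\<close>

lemma rows_alt:
  "rows x w u v = (\<chi> i. if i = 1 then w else if i = 0 then x else if i = 2 then u else v)"
  "rows x w u v = (\<chi> i. if i = 2 then u else if i = 0 then x else if i = 1 then w else v)"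
  "rows x w u v = (\<chi> i. if i = 3 then v else if i = 0 then x else if i = 1 then w else u)"
  by (simp_all add: rows_def vec_eq_iff all_4)

lemma det4_add:
  "det4 (x + y) w u v = det4 x w u v + det4 y w u v"
  "det4 x (w + y) u v = det4 x w u v + det4 x y u v"
  "det4 x w (u + y) v = det4 x w u v + det4 x w y v"
  "det4 x w u (v + y) = det4 x w u v + det4 x w u y"
  using det_row_add[of 0 "\<lambda>_. x" "\<lambda>_. y" "\<lambda>i. if i = 1 then w else if i = 2 then u else v"]
    det_row_add[of 1 "\<lambda>_. w" "\<lambda>_. y" "\<lambda>i. if i = 0 then x else if i = 2 then u else v"]
    det_row_add[of 2 "\<lambda>_. u" "\<lambda>_. y" "\<lambda>i. if i = 0 then x else if i = 1 then w else v"]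
    det_row_add[of 3 "\<lambda>_. v" "\<lambda>_. y" "\<lambda>i. if i = 0 then x else if i = 1 then w else u"]
  by (simp_all only: rows_def[symmetric] rows_alt[symmetric])

lemma det4_scale:
  "det4 (c *s x) w u v = c * det4 x w u v"
  "det4 x (c *s w) u v = c * det4 x w u v"
  "det4 x w (c *s u) v = c * det4 x w u v"
  "det4 x w u (c *s v) = c * det4 x w u v"
  using det_row_mul[of 0 c "\<lambda>_. x" "\<lambda>i. if i = 1 then w else if i = 2 then u else v"]
    det_row_mul[of 1 c "\<lambda>_. w" "\<lambda>i. if i = 0 then x else if i = 2 then u else v"]
    det_row_mul[of 2 c "\<lambda>_. u" "\<lambda>i. if i = 0 then x else if i = 1 then w else v"]
    det_row_mul[of 3 c "\<lambda>_. v" "\<lambda>i. if i = 0 then x else if i = 1 then w else u"]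
  by (simp_all only: rows_def[symmetric] rows_alt[symmetric])

lemma det4_same:
  "det4 x x u v = 0" "det4 x w x v = 0" "det4 x w u x = 0" "det4 x w w v = 0" "det4 x w u w = 0" "det4 x w u u = 0"
  by (rule det_identical_rows[of 0 1] det_identical_rows[of 0 2] det_identical_rows[of 0 3] det_identical_rows[of 1 2]
    det_identical_rows[of 1 3] det_identical_rows[of 2 3]; simp add: rows_def row_def)+

lemma det4_swap: "det4 x w v u = - det4 x w u v"
proof -
  have "det4 x w u v + det4 x w v u = 0"
    using det4_same(6)[of x w "u + v"] det4_add(3)[of x w u v "u + v"] det4_add(4)[of x w u u v] det4_add(4)[of x w v u v]
      det4_same(6)[of x w u] det4_same(6)[of x w v] by simp
  then show ?thesis by (metis minus_unique)
qed

lemma octic_deriv_axis: "octic_deriv t x v = (\<Sum>i\<in>UNIV. octic_deriv t x (axis i 1) * v $ i)"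
proof -
  have "v = (\<Sum>i\<in>UNIV. v $ i *s axis i 1)" by (simp add: basis_expansion)
  then have "octic_deriv t x v = octic_deriv t x (\<Sum>i\<in>UNIV. v $ i *s axis i 1)" by simp
  also have "\<dots> = (\<Sum>i\<in>UNIV. octic_deriv t x (v $ i *s axis i 1))"
    by (rule linear_sum[OF linear_octic_deriv])
  finally show ?thesis by (simp add: mult.commute)
qed

text \<open>Four vectors in the kernel of a nonzero linear form on a four-dimensional space are
  dependent: an invertible matrix with such rows would force the form to vanish.\<close>

lemma det4_kernel:
  assumes "octic_deriv t y w' \<noteq> 0" "octic_deriv t y x = 0" "octic_deriv t y w = 0" "octic_deriv t y u = 0" "octic_deriv t y v = 0"
  shows "det4 x w u v = 0"
proof (rule ccontr)
  assume "det4 x w u v \<noteq> 0"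
  then obtain B where B: "B ** rows x w u v = mat 1" unfolding invertible_det_nz[symmetric] invertible_def by blast
  let ?a = "\<chi> i. octic_deriv t y (axis i 1)"
  have "(rows x w u v *v ?a) $ i = octic_deriv t y (rows x w u v $ i)" for i
    by (subst octic_deriv_axis) (simp add: matrix_vector_mult_def mult.commute)
  then have "rows x w u v *v ?a = 0"
    using assms by (simp add: vec_eq_iff rows_def)
  then have "?a = 0" using B matrix_vector_mul_assoc[of B "rows x w u v" ?a] by simp
  then have "octic_deriv t y w' = 0" using octic_deriv_axis[of t y w'] by (simp add: vec_eq_iff)
  with assms(1) show False by simp
qed

text \<open>The vector chosen by \<open>SOME\<close> may be replaced by any \<open>w\<close>
  transversal to the cone: a combination of the two is tangent to the cone, as is \<open>x\<close>
  by Euler's relation, and the determinant of four tangent vectors is 0.\<close>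

lemma residue_form_eq:
  assumes x: "octic t x = 0" and w: "octic_deriv t x w \<noteq> 0" and u: "octic_deriv t x u = 0" and v: "octic_deriv t x v = 0"
  shows "residue_form t \<beta> x u v = monomial \<beta> x * det4 x w u v / octic_deriv t x w"
proof -
  define w' where "w' = (SOME w. octic_deriv t x w \<noteq> 0)"
  have w': "octic_deriv t x w' \<noteq> 0" unfolding w'_def using w by (rule someI)
  have "det4 x (octic_deriv t x w *s w' + (- octic_deriv t x w') *s w) u v = 0"
    by (rule det4_kernel[OF w]) (use u v x in \<open>simp_all add: octic_Euler\<close>)
  then have "octic_deriv t x w * det4 x w' u v = octic_deriv t x w' * det4 x w u v"
    by (simp only: det4_add det4_scale) simp
  then show ?thesis
    using w w' by (simp add: residue_form_def FD_octic Let_def w'_def[symmetric] rows_def[symmetric] field_simps)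
qed

text \<open>Serves two changes at once: reparametrisation of a simplex, through the determinant of
  the coefficients, and change of the lift, through the multiples of the Euler vector
  \<open>x\<close>, which the row \<open>x\<close> kills.\<close>

lemma residue_form_bilinear:
  "residue_form t \<beta> x (a *s u + b *s v + e *s x) (c *s u + d *s v + e' *s x) = (a * d - b * c) * residue_form t \<beta> x u v"
proof -
  define w where "w = (SOME w. octic_deriv t x w \<noteq> 0)"
  have r: "residue_form t \<beta> x u v = monomial \<beta> x * det4 x w u v / octic_deriv t x w" for u v
    by (simp add: residue_form_def FD_octic Let_def w_def rows_def)
  have "det4 x w (a *s u + b *s v + e *s x) (c *s u + d *s v + e' *s x) = (a * d - b * c) * det4 x w u v"
    by (simp add: det4_add det4_scale det4_same det4_swap[of x w u v] algebra_simps)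
  then show ?thesis by (simp add: r)
qed

text \<open>The weights cancel: 4 from the monomial, 1 from the row \<open>x\<close> and 2 from the
  rows \<open>u\<close>, \<open>v\<close>, against 7 from the derivative of the octic.\<close>

lemma residue_form_rescale:
  assumes \<beta>: "\<beta> \<in> quartic_exps" and k: "k \<noteq> 0" and x: "octic t x = 0" and w: "octic_deriv t x w \<noteq> 0"
    and u: "octic_deriv t x u = 0" and v: "octic_deriv t x v = 0"
  shows "residue_form t \<beta> (k *s x) (k *s u + e *s x) (k *s v + e' *s x) = residue_form t \<beta> x u v"
proof -
  have "(e / k) *s (k *s x) = e *s x" "(e' / k) *s (k *s x) = e' *s x" "0 *s v = 0" "0 *s u = 0" using k by (simp_all add: vec_eq_iff)
  then have "residue_form t \<beta> (k *s x) (k *s u + e *s x) (k *s v + e' *s x) =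
    residue_form t \<beta> (k *s x) (k *s u + 0 *s v + (e / k) *s (k *s x)) (0 *s u + k *s v + (e' / k) *s (k *s x))"
    by (simp only: add_0_left add_0_right)
  also have "\<dots> = k ^ 2 * residue_form t \<beta> (k *s x) u v"
    by (simp only: residue_form_bilinear power2_eq_square mult_zero_left diff_zero)
  also have "residue_form t \<beta> (k *s x) u v = monomial \<beta> (k *s x) * det4 (k *s x) w u v / octic_deriv t (k *s x) w"
    by (rule residue_form_eq) (use k x w u v in \<open>simp_all add: octic_scale octic_deriv_base_scale\<close>)
  also have "\<dots> = (k ^ 4 * k) * (monomial \<beta> x * det4 x w u v) / (k ^ 7 * octic_deriv t x w)"
    using \<beta> k by (simp add: monomial_scale quartic_exps_def det4_scale octic_deriv_base_scale)
  also have "k ^ 2 * \<dots> = monomial \<beta> x * det4 x w u v / octic_deriv t x w"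
  proof -
    have "k ^ 2 * (k ^ 4 * k * a / (k ^ 7 * b)) = a / b" for a b
    proof -
      have "k ^ 7 = k ^ 2 * (k ^ 4 * k)" by (simp flip: power_add power_Suc2)
      then show ?thesis using k by simp
    qed
    then show ?thesis .
  qed
  also have "\<dots> = residue_form t \<beta> x u v"
    by (rule residue_form_eq[OF x w u v, symmetric])
  finally show ?thesis .
qed

section \<open>Integrals over differentiable simplices\<close>

definition smooth_octic :: "param \<Rightarrow> bool" where
  "smooth_octic t \<longleftrightarrow> (\<forall>x. x \<noteq> 0 \<longrightarrow> octic t x = 0 \<longrightarrow> (\<exists>w. octic_deriv t x w \<noteq> 0))"

lemma proj_eq_iff: "proj x = proj y \<longleftrightarrow> (\<exists>c. c \<noteq> 0 \<and> y = c *s x)"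
proof
  assume "proj x = proj y"
  moreover have "y \<in> proj y" unfolding proj_def by (auto intro!: exI[of _ 1])
  ultimately show "\<exists>c. c \<noteq> 0 \<and> y = c *s x" by (auto simp: proj_def)
next
  assume "\<exists>c. c \<noteq> 0 \<and> y = c *s x"
  then obtain c where c: "c \<noteq> 0" "y = c *s x" by blast
  have "\<exists>d. d \<noteq> 0 \<and> a *s x = d *s y" if "a \<noteq> 0" for a
    using c that by (intro exI[of _ "a / c"]) (simp add: vector_smult_assoc)
  moreover have "\<exists>d. d \<noteq> 0 \<and> a *s y = d *s x" if "a \<noteq> 0" for a
    using c that by (intro exI[of _ "a * c"]) (simp add: vector_smult_assoc)
  ultimately show "proj x = proj y" by (auto simp: proj_def)
qed

lemma proj_scale [simp]: "c \<noteq> 0 \<Longrightarrow> proj (c *s x) = proj x"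
  by (metis proj_eq_iff)

lemma proj_in_octic_points: "x \<noteq> 0 \<Longrightarrow> proj x \<in> octic_points t \<longleftrightarrow> octic t x = 0"
  by (auto simp: octic_points_def proj_eq_iff octic_scale)

lemma barycentric_simplex: "p \<in> triangle \<Longrightarrow> barycentric p \<in> standard_simplex 2"
  by (auto simp: barycentric_def standard_simplex_def triangle_def numeral_2_eq_2)

lemma barycentric_plane: "x \<in> standard_simplex 2 \<Longrightarrow> barycentric (plane x) = x"
proof (rule ext)
  fix i assume x: "x \<in> standard_simplex 2"
  then have "x 0 + x 1 + x 2 = 1" "i > 2 \<Longrightarrow> x i = 0" by (auto simp: standard_simplex_def numeral_2_eq_2)
  then show "barycentric (plane x) i = x i"
    by (cases "i = 0"; cases "i = 1"; cases "i = 2") (auto simp: barycentric_def plane_def)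
qed

type_synonym sing_simplex = "(nat \<Rightarrow> real) \<Rightarrow> (complex^4) set"

text \<open>\<open>C1_lift\<close> in terms of \<open>FD\<close>, with the neighbourhood of the
  triangle made explicit, so that the calculus of \<open>C1_on\<close> applies.\<close>

definition lift :: "sing_simplex \<Rightarrow> (real \<times> real \<Rightarrow> complex^4) \<Rightarrow> (real \<times> real) set \<Rightarrow> bool" where
  "lift \<sigma> g S \<longleftrightarrow> C1_on g S \<and> triangle \<subseteq> S \<and> (\<forall>p\<in>triangle. g p \<noteq> 0 \<and> \<sigma> (barycentric p) = proj (g p))"

lemma FD_partials:
  assumes "C1_on g S" "p \<in> S"
  shows "FD g p h = fst h *\<^sub>R FD g p (1, 0) + snd h *\<^sub>R FD g p (0, 1)"
proof -
  interpret bounded_linear "FD g p" using C1_on_linear[OF assms] .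
  have "FD g p h = FD g p (fst h *\<^sub>R (1, 0) + snd h *\<^sub>R (0, 1))" by (simp add: prod_eq_iff)
  then show ?thesis by (simp only: add scaleR)
qed

lemma lift_imp_C1_lift:
  assumes "lift \<sigma> g S"
  shows "C1_lift \<sigma> g (\<lambda>p. FD g p (1, 0)) (\<lambda>p. FD g p (0, 1))"
proof -
  have g: "C1_on g S" and S: "triangle \<subseteq> S" using assms by (auto simp: lift_def)
  have "(g has_derivative (\<lambda>h. fst h *\<^sub>R FD g p (1, 0) + snd h *\<^sub>R FD g p (0, 1))) (at p)" if "p \<in> S" for p
    using C1_on_has_derivative[OF g that] FD_partials[OF g that] by (metis (no_types, lifting) ext)
  then show ?thesis
    using assms C1_on_open[OF g] C1_on_FD_continuous[OF g] unfolding C1_lift_def lift_def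
    by (intro conjI exI[of _ S]) auto
qed

lemma C1_lift_imp_lift:
  assumes "C1_lift \<sigma> g g1 g2"
  obtains S where "lift \<sigma> g S" "\<And>p. p \<in> S \<Longrightarrow> g1 p = FD g p (1, 0)" "\<And>p. p \<in> S \<Longrightarrow> g2 p = FD g p (0, 1)"
proof -
  obtain S where S: "open S" "triangle \<subseteq> S" "continuous_on S g1" "continuous_on S g2"
    and d: "\<And>p. p \<in> S \<Longrightarrow> (g has_derivative (\<lambda>h. fst h *\<^sub>R g1 p + snd h *\<^sub>R g2 p)) (at p)"
    using assms by (auto simp: C1_lift_def)
  have "C1_on g S" by (rule C1_onI[OF S(1) d]) (auto intro!: continuous_intros S)
  then have "lift \<sigma> g S" using assms S by (auto simp: lift_def C1_lift_def)
  moreover have "g1 p = FD g p (1, 0)" "g2 p = FD g p (0, 1)" if "p \<in> S" for p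
    using FD_eq[OF d[OF that]] by simp_all
  ultimately show thesis using that by blast
qed

lemma C1_simplex_iff: "C1_simplex \<sigma> \<longleftrightarrow> (\<exists>g S. lift \<sigma> g S)"
  unfolding C1_simplex_def using lift_imp_C1_lift C1_lift_imp_lift by metis

definition rform :: "param \<Rightarrow> (4 \<Rightarrow> nat) \<Rightarrow> (real \<times> real \<Rightarrow> complex^4) \<Rightarrow> real \<times> real \<Rightarrow> complex" where
  "rform t \<beta> g p = residue_form t \<beta> (g p) (FD g p (1, 0)) (FD g p (0, 1))"

lemma interior_triangle: "interior triangle \<noteq> {}"
proof -
  have "{1/10<..<2/10 :: real} \<times> {1/10<..<2/10 :: real} \<subseteq> triangle" by (auto simp: triangle_def)
  moreover have "open ({1/10<..<2/10 :: real} \<times> {1/10<..<2/10 :: real})" by (intro open_Times open_greaterThanLessThan)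
  moreover have "(3/20, 3/20) \<in> {1/10<..<2/10 :: real} \<times> {1/10<..<2/10 :: real}" by simp
  ultimately show ?thesis using interior_maximal by blast
qed

lemma negligible_triangle_boundary: "negligible (triangle - interior triangle)"
proof -
  have "triangle - interior triangle \<subseteq> frontier triangle"
    using compact_imp_closed[OF compact_triangle] by (simp add: frontier_def)
  then show ?thesis using negligible_convex_frontier[OF convex_triangle] negligible_subset by blast
qed

text \<open>The octic is known to vanish along \<open>g\<close> on the triangle only, so the
  derivative vanishes in the interior at first; the boundary points are reached by
  continuity.\<close>

lemma lift_tangent:
  assumes l: "lift \<sigma> g S" and z: "\<And>p. p \<in> triangle \<Longrightarrow> octic t (g p) = 0" and p: "p \<in> triangle"
  shows "octic_deriv t (g p) (FD g p h) = 0"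
proof -
  have g: "C1_on g S" and S: "triangle \<subseteq> S" using l by (auto simp: lift_def)
  have int: "octic_deriv t (g p) (FD g p h) = 0" if p: "p \<in> interior triangle" for p
  proof -
    have pS: "p \<in> S" using p S interior_subset by blast
    have 1: "((\<lambda>p. octic t (g p)) has_derivative (\<lambda>h. octic_deriv t (g p) (FD g p h))) (at p)"
      by (rule has_derivative_compose[OF C1_on_has_derivative[OF g pS] has_derivative_octic])
    have 2: "((\<lambda>p. octic t (g p)) has_derivative (\<lambda>h. 0)) (at p)"
      by (rule has_derivative_transform_within_open[OF has_derivative_const open_interior p])
        (simp add: z interior_subset[THEN subsetD])
    from has_derivative_unique[OF 1 2] show ?thesis by (simp only: fun_eq_iff)
  qed
  have "continuous_on S (\<lambda>p. octic_deriv t (g p) (FD g p h))"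
    by (intro continuous_on_octic_deriv continuous_intros C1_on_continuous_on[OF g] C1_on_FD_continuous[OF g])
  then have c: "continuous_on triangle (\<lambda>p. octic_deriv t (g p) (FD g p h))"
    by (rule continuous_on_subset[OF _ S])
  have cl: "closure (interior triangle) = triangle"
    using convex_closure_interior[OF convex_triangle interior_triangle] closure_closed[OF compact_imp_closed[OF compact_triangle]] by simp
  show ?thesis
    by (rule continuous_constant_on_closure[of "interior triangle"]) (use c p int in \<open>simp_all only: cl\<close>)
qed

lemma lift_tangent':
  assumes "smooth_octic t" "lift \<sigma> g S" "\<And>p. p \<in> triangle \<Longrightarrow> octic t (g p) = 0" "p \<in> triangle"
  obtains w where "octic_deriv t (g p) w \<noteq> 0"
proof -
  have "g p \<noteq> 0" using assms(2,4) by (auto simp: lift_def)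
  then show thesis using assms(1) assms(3)[OF assms(4)] that unfolding smooth_octic_def by blast
qed

lemma rform_local:
  assumes l: "lift \<sigma> g S" and z: "\<And>p. p \<in> triangle \<Longrightarrow> octic t (g p) = 0" and p: "p \<in> triangle"
    and w: "octic_deriv t (g p) w \<noteq> 0"
  shows "rform t \<beta> g p = monomial \<beta> (g p) * det4 (g p) w (FD g p (1, 0)) (FD g p (0, 1)) / octic_deriv t (g p) w"
  using residue_form_eq[OF z[OF p] w lift_tangent[OF l z p] lift_tangent[OF l z p]] by (simp only: rform_def)

lemma continuous_on_det4:
  assumes "continuous_on S x" "continuous_on S w" "continuous_on S u" "continuous_on S v"
  shows "continuous_on S (\<lambda>z. det4 (x z) (w z) (u z) (v z))"
  unfolding det_def rows_def
proof (intro continuous_on_sum continuous_on_mult continuous_on_const continuous_on_prod)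
  fix p :: "4 \<Rightarrow> 4" and i :: 4
  show "continuous_on S (\<lambda>z. (\<chi> i. if i = 0 then x z else if i = 1 then w z else if i = 2 then u z else v z) $ i $ p i)"
    by (cases "i = 0"; cases "i = 1"; cases "i = 2"; simp; intro continuous_on_component assms)
qed

lemma C1_on_det4:
  assumes "C1_on x S" "C1_on w S" "C1_on u S" "C1_on v S"
  shows "C1_on (\<lambda>z. det4 (x z) (w z) (u z) (v z)) S"
  unfolding det_def rows_def
proof (intro C1_on_sum C1_on_mult C1_on_const C1_on_prod C1_on_open[OF assms(1)])
  fix p :: "4 \<Rightarrow> 4" and i :: 4
  show "C1_on (\<lambda>z. (\<chi> i. if i = 0 then x z else if i = 1 then w z else if i = 2 then u z else v z) $ i $ p i) S"
    by (cases "i = 0"; cases "i = 1"; cases "i = 2"; simp; intro C1_on_vec_nth assms)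
qed

text \<open>The transversal vector hidden in \<open>residue_form\<close> may jump from point to
  point; near each point it is replaced by a constant one.\<close>

lemma continuous_on_rform:
  assumes sm: "smooth_octic t" and l: "lift \<sigma> g S" and z: "\<And>p. p \<in> triangle \<Longrightarrow> octic t (g p) = 0"
  shows "continuous_on triangle (rform t \<beta> g)"
  unfolding continuous_on_eq_continuous_within
proof
  have g: "C1_on g S" and S: "triangle \<subseteq> S" using l by (auto simp: lift_def)
  fix q assume q: "q \<in> triangle"
  obtain w where w: "octic_deriv t (g q) w \<noteq> 0" using lift_tangent'[OF sm l z q] .
  have gT: "continuous_on triangle g" using C1_on_continuous_on[OF g] S continuous_on_subset by blast
  have cd: "continuous_on triangle (\<lambda>p. octic_deriv t (g p) w)"
    by (intro continuous_on_octic_deriv continuous_intros gT)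
  then obtain d where d: "d > 0" "\<And>p. p \<in> triangle \<Longrightarrow> dist p q < d \<Longrightarrow> octic_deriv t (g p) w \<noteq> 0"
    using w q unfolding continuous_on_iff
    by (metis dist_0_norm dist_commute dist_norm dist_pos_lt less_irrefl)
  let ?f = "\<lambda>p. monomial \<beta> (g p) * det4 (g p) w (FD g p (1, 0)) (FD g p (0, 1)) / octic_deriv t (g p) w"
  have cFD: "continuous_on triangle (\<lambda>p. FD g p v)" for v using C1_on_FD_continuous[OF g] S continuous_on_subset by blast
  have "continuous_on (triangle \<inter> ball q d) ?f"
    using d(2)
    by (intro continuous_intros continuous_on_monomial continuous_on_det4 continuous_on_subset[OF cd] continuous_on_subset[OF gT]
      continuous_on_subset[OF cFD]) (auto simp: dist_commute)
  then have "continuous (at q within triangle \<inter> ball q d) ?f"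
    using q d(1) by (simp add: continuous_on_eq_continuous_within)
  then have "continuous (at q within triangle) ?f"
    using at_within_nhd[of q "ball q d" "triangle \<inter> ball q d" triangle] d(1) by (simp add: Int_assoc)
  then show "continuous (at q within triangle) (rform t \<beta> g)"
    by (rule continuous_transform_within[OF _ d(1) q]) (simp add: rform_local[OF l z _ d(2)] dist_commute)
qed

text \<open>Two lifts of one simplex differ by a scalar function \<open>k\<close>, which is C1 as a
  quotient of coordinates, and whose derivative contributes only multiples of the Euler vector.
  Comparing derivatives takes an open neighbourhood inside the triangle, hence the interior
  point.\<close>

lemma rform_unique:
  assumes \<beta>: "\<beta> \<in> quartic_exps" and sm: "smooth_octic t" and l: "lift \<sigma> g S" and l': "lift \<sigma> g' S'"
    and z: "\<And>p. p \<in> triangle \<Longrightarrow> octic t (g p) = 0" and p: "p \<in> interior triangle"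
  shows "rform t \<beta> g' p = rform t \<beta> g p"
proof -
  have g: "C1_on g S" and S: "triangle \<subseteq> S" using l by (auto simp: lift_def)
  have g': "C1_on g' S'" and S': "triangle \<subseteq> S'" using l' by (auto simp: lift_def)
  have pT: "p \<in> triangle" using p interior_subset by blast
  obtain w where w: "octic_deriv t (g p) w \<noteq> 0" using lift_tangent'[OF sm l z pT] .
  obtain i where i: "g p $ i \<noteq> 0" using l pT by (auto simp: lift_def vec_eq_iff)
  have oS: "open S" "open S'" using C1_on_open g g' by auto
  define N where "N = interior triangle \<inter> ((\<lambda>q. g q $ i) -` (- {0}) \<inter> S)"
  have "open ((\<lambda>q. g q $ i) -` (- {0}) \<inter> S)"
    by (rule continuous_on_open_vimage[OF oS(1), THEN iffD1, rule_format, OF _ open_Compl[OF closed_singleton]])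
      (intro continuous_on_component C1_on_continuous_on[OF g])
  then have oN: "open N" unfolding N_def by (rule open_Int[OF open_interior])
  have NT: "q \<in> triangle" if "q \<in> N" for q using that interior_subset by (auto simp: N_def)
  have Ng: "C1_on g N" "C1_on g' N" using C1_on_subset[OF g oN] C1_on_subset[OF g' oN] NT S S' by (meson subset_iff)+
  have pN: "p \<in> N" using p i S pT by (auto simp: N_def)
  define k where "k = (\<lambda>q. g' q $ i / g q $ i)"
  have k: "C1_on k N" unfolding k_def by (intro C1_on_divide C1_on_vec_nth Ng) (auto simp: N_def)
  have kg: "g' q = k q *s g q" if "q \<in> N" for q
  proof -
    have "proj (g q) = proj (g' q)" using l l' NT[OF that] by (auto simp: lift_def)
    then obtain c where "g' q = c *s g q" unfolding proj_eq_iff by blast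
    then show ?thesis using that by (simp add: k_def N_def)
  qed
  have kp: "k p \<noteq> 0" using kg[OF pN] l' pT by (auto simp: lift_def)
  have "FD g' p h = k p *s FD g p h + FD k p h *s g p" for h
  proof -
    have dk: "(k has_derivative FD k p) (at p)" by (rule C1_on_has_derivative[OF k pN])
    have dg: "(g has_derivative FD g p) (at p)" by (rule C1_on_has_derivative[OF Ng(1) pN])
    have "((\<lambda>q. k q *s g q) has_derivative (\<lambda>h. \<chi> j. k p * FD g p h $ j + FD k p h * g p $ j)) (at p)"
      unfolding vector_scalar_mult_def
      by (intro has_derivative_vec_lambda has_derivative_mult dk bounded_linear.has_derivative[OF bounded_linear_vec_nth] dg)
    then have "(g' has_derivative (\<lambda>h. \<chi> j. k p * FD g p h $ j + FD k p h * g p $ j)) (at p)"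
      by (rule has_derivative_transform_within_open[OF _ oN pN]) (simp add: kg)
    from FD_eq[OF this] show ?thesis by (simp add: vec_eq_iff)
  qed
  then show ?thesis
    unfolding rform_def kg[OF pN]
    by (simp add: residue_form_rescale[OF \<beta> kp z[OF pT] w lift_tangent[OF l z pT] lift_tangent[OF l z pT]])
qed

text \<open>Two lifts have the same integrand off the boundary of the triangle, which is negligible;
  so the definite description in \<open>simplex_integral\<close> is met by any lift.\<close>

lemma simplex_integral_lift:
  assumes \<beta>: "\<beta> \<in> quartic_exps" and sm: "smooth_octic t" and l: "lift \<sigma> g S"
    and z: "\<And>p. p \<in> triangle \<Longrightarrow> octic t (g p) = 0"
  shows "simplex_integral t \<beta> \<sigma> = integral triangle (rform t \<beta> g)"
  unfolding simplex_integral_def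
proof (rule the_equality)
  show "\<exists>h g1 g2. C1_lift \<sigma> h g1 g2 \<and> integral triangle (rform t \<beta> g) = integral triangle (\<lambda>p. residue_form t \<beta> (h p) (g1 p) (g2 p))"
    using lift_imp_C1_lift[OF l] by (intro exI[of _ g] exI[of _ "\<lambda>p. FD g p (1, 0)"] exI[of _ "\<lambda>p. FD g p (0, 1)"]) (simp add: rform_def[abs_def])
  fix I assume "\<exists>h g1 g2. C1_lift \<sigma> h g1 g2 \<and> I = integral triangle (\<lambda>p. residue_form t \<beta> (h p) (g1 p) (g2 p))"
  then obtain h g1 g2 where h: "C1_lift \<sigma> h g1 g2" and I: "I = integral triangle (\<lambda>p. residue_form t \<beta> (h p) (g1 p) (g2 p))" by blast
  obtain S' where l': "lift \<sigma> h S'" and g12: "\<And>p. p \<in> S' \<Longrightarrow> g1 p = FD h p (1, 0)" "\<And>p. p \<in> S' \<Longrightarrow> g2 p = FD h p (0, 1)"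
    by (rule C1_lift_imp_lift[OF h]) blast
  have "I = integral triangle (rform t \<beta> h)"
    unfolding I by (rule Henstock_Kurzweil_Integration.integral_cong) (use l' g12 in \<open>auto simp: rform_def lift_def\<close>)
  also have "\<dots> = integral triangle (rform t \<beta> g)"
    by (rule integral_spike[OF negligible_triangle_boundary]) (use rform_unique[OF \<beta> sm l l' z] in auto)
  finally show "I = integral triangle (rform t \<beta> g)" .
qed

lemma singular_simplex_octic:
  assumes "singular_simplex 2 (octic_surface t) \<sigma>" "lift \<sigma> g S" "p \<in> triangle"
  shows "octic t (g p) = 0"
proof -
  have "\<sigma> (barycentric p) \<in> octic_points t"
    using assms(1) barycentric_simplex[OF assms(3)]
    by (auto simp: singular_simplex_subtopology octic_surface_def)
  then show ?thesis using assms(2,3) by (simp add: lift_def proj_in_octic_points)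
qed

text \<open>Precomposition with an affine simplex multiplies the pulled back form by the same
  determinant that occurs in \<open>affine_integral\<close>.\<close>

lemma lift_simplex_map:
  assumes f: "simplicial_simplex 2 (standard_simplex 2) f" and l: "lift \<sigma> g S"
  defines "a \<equiv> plane (simplicial_vertex 0 f)" and "u \<equiv> plane (simplicial_vertex 1 f) - plane (simplicial_vertex 0 f)"
    and "v \<equiv> plane (simplicial_vertex 2 f) - plane (simplicial_vertex 0 f)"
  defines "A \<equiv> \<lambda>p. a + fst p *\<^sub>R u + snd p *\<^sub>R v"
  shows "lift (simplex_map 2 \<sigma> f) (\<lambda>p. g (A p)) (A -` S)" "\<And>p. p \<in> triangle \<Longrightarrow> A p \<in> triangle"
    "\<And>p. p \<in> triangle \<Longrightarrow> rform t \<beta> (\<lambda>p. g (A p)) p = of_real (fst u * snd v - snd u * fst v) * rform t \<beta> g (A p)"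
proof -
  have g: "C1_on g S" and S: "triangle \<subseteq> S" using l by (auto simp: lift_def)
  have "\<exists>l. f = oriented_simplex 2 l" and fS: "f \<in> standard_simplex 2 \<rightarrow> standard_simplex 2"
    using f by (auto simp: simplicial_simplex)
  then obtain l where l': "f = oriented_simplex 2 l" by blast
  have V: "simplicial_vertex i f = l i" if "i \<le> 2" for i
    using that by (simp add: l' simplicial_vertex_oriented_simplex)
  have fb: "f (barycentric p) i = l 0 i * (1 - fst p - snd p) + l 1 i * fst p + l 2 i * snd p" if "p \<in> triangle" for p i
    using barycentric_simplex[OF that]
    by (simp add: l' oriented_simplex_def barycentric_def numeral_2_eq_2)
  have fA: "plane (f (barycentric p)) = A p" if "p \<in> triangle" for p
    by (simp add: plane_def fb[OF that] A_def a_def u_def v_def V algebra_simps)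
  show AT: "A p \<in> triangle" if "p \<in> triangle" for p
    using plane_standard_simplex fA[OF that] fS barycentric_simplex[OF that] by (metis PiE)
  have cA: "continuous_on UNIV A" unfolding A_def by (intro continuous_intros)
  have oS: "open (A -` S)" using continuous_on_open_vimage[of UNIV A] cA C1_on_open[OF g] by auto
  have A: "C1_on A (A -` S)" unfolding A_def[symmetric] by (subst A_def) (intro C1_intros oS)
  have FDA: "FD A p w = fst w *\<^sub>R u + snd w *\<^sub>R v" for p w
  proof -
    have "(A has_derivative (\<lambda>w. fst w *\<^sub>R u + snd w *\<^sub>R v)) (at p)"
      unfolding A_def by (auto intro!: derivative_eq_intros)
    then show ?thesis by (simp add: FD_eq)
  qed
  have gA: "C1_on (\<lambda>p. g (A p)) (A -` S)" by (rule C1_on_compose[OF A g]) simp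
  have "simplex_map 2 \<sigma> f (barycentric p) = proj (g (A p))" if "p \<in> triangle" for p
  proof -
    have "f (barycentric p) \<in> standard_simplex 2" using fS barycentric_simplex[OF that] by blast
    then have "f (barycentric p) = barycentric (A p)" using barycentric_plane fA[OF that] by metis
    then show ?thesis
      using l AT[OF that] barycentric_simplex[OF that] by (simp add: simplex_map_def lift_def)
  qed
  then show "lift (simplex_map 2 \<sigma> f) (\<lambda>p. g (A p)) (A -` S)"
    using gA l AT S unfolding lift_def by (intro conjI subsetI ballI vimageI2) (auto simp del: split_paired_All)
  show "rform t \<beta> (\<lambda>p. g (A p)) p = of_real (fst u * snd v - snd u * fst v) * rform t \<beta> g (A p)" if "p \<in> triangle" for p
  proof -
    have AS: "A p \<in> S" using AT[OF that] S by blast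
    have "FD (\<lambda>p. g (A p)) p w = FD g (A p) (fst w *\<^sub>R u + snd w *\<^sub>R v)" for w
      using FD_compose[OF A g _ AS, of w] AS by (simp add: FDA)
    then have "FD (\<lambda>p. g (A p)) p (1, 0) = of_real (fst u) *s FD g (A p) (1, 0) + of_real (snd u) *s FD g (A p) (0, 1) + 0 *s g (A p)"
      "FD (\<lambda>p. g (A p)) p (0, 1) = of_real (fst v) *s FD g (A p) (1, 0) + of_real (snd v) *s FD g (A p) (0, 1) + 0 *s g (A p)"
      using FD_partials[OF g AS, of u] FD_partials[OF g AS, of v] by (simp_all add: scaleR_eq_scale)
    then show ?thesis unfolding rform_def by (simp only: residue_form_bilinear) simp
  qed
qed

lemma frag_ext_chain_map: "frag_ext \<phi> (chain_map p g c) = frag_ext (\<lambda>f. \<phi> (simplex_map p g f)) c"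
  by (simp add: chain_map_def frag_ext_frag_extend)

lemma keys_chain_map: "Poly_Mapping.keys (chain_map p g c) \<subseteq> simplex_map p g ` Poly_Mapping.keys c"
  using keys_frag_extend[of "frag_of \<circ> simplex_map p g" c] by (auto simp: chain_map_def)

lemma simplex_integral_subdivision:
  assumes \<beta>: "\<beta> \<in> quartic_exps" and sm: "smooth_octic t"
    and \<sigma>: "singular_simplex 2 (octic_surface t) \<sigma>" "C1_simplex \<sigma>"
  shows "chain_integral t \<beta> (chain_map 2 \<sigma> unit_subdivision) = simplex_integral t \<beta> \<sigma>"
    "\<And>\<tau>. \<tau> \<in> Poly_Mapping.keys (chain_map 2 \<sigma> unit_subdivision) \<Longrightarrow> C1_simplex \<tau>"
proof -
  obtain g S where l: "lift \<sigma> g S" using \<sigma>(2) C1_simplex_iff by blast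
  note z = singular_simplex_octic[OF \<sigma>(1) l]
  have K: "simplicial_simplex 2 (standard_simplex 2) f" if "f \<in> Poly_Mapping.keys unit_subdivision" for f
    using simplicial_chain_unit_subdivision that by (auto simp: simplicial_chain_def)
  have "simplex_integral t \<beta> (simplex_map 2 \<sigma> f) = affine_integral (rform t \<beta> g) f" if "f \<in> Poly_Mapping.keys unit_subdivision" for f
  proof -
    note L = lift_simplex_map[OF K[OF that] l]
    have "simplex_integral t \<beta> (simplex_map 2 \<sigma> f) = integral triangle (rform t \<beta> (\<lambda>p. g (plane (simplicial_vertex 0 f) + fst p *\<^sub>R (plane (simplicial_vertex 1 f) - plane (simplicial_vertex 0 f)) + snd p *\<^sub>R (plane (simplicial_vertex 2 f) - plane (simplicial_vertex 0 f)))))"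
      by (rule simplex_integral_lift[OF \<beta> sm L(1)]) (rule z[OF L(2)])
    also have "\<dots> = affine_integral (rform t \<beta> g) f"
      unfolding affine_integral_def Let_def integral_mult_right[symmetric]
      by (rule Henstock_Kurzweil_Integration.integral_cong) (rule L(3))
    finally show ?thesis .
  qed
  then have "chain_integral t \<beta> (chain_map 2 \<sigma> unit_subdivision) = frag_ext (affine_integral (rform t \<beta> g)) unit_subdivision"
    unfolding chain_integral_eq frag_ext_chain_map by (intro frag_ext_cong)
  also have "\<dots> = integral triangle (rform t \<beta> g)"
    by (rule affine_integral_unit_subdivision[OF continuous_on_rform[OF sm l z]])
  also have "\<dots> = simplex_integral t \<beta> \<sigma>"
    by (rule simplex_integral_lift[OF \<beta> sm l z, symmetric])
  finally show "chain_integral t \<beta> (chain_map 2 \<sigma> unit_subdivision) = simplex_integral t \<beta> \<sigma>" .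
  show "C1_simplex \<tau>" if "\<tau> \<in> Poly_Mapping.keys (chain_map 2 \<sigma> unit_subdivision)" for \<tau>
    using keys_chain_map[of 2 \<sigma> unit_subdivision] that lift_simplex_map(1)[OF K l] C1_simplex_iff by blast
qed

text \<open>Allows a chain to be replaced by one with arbitrarily small simplices without losing
  differentiability.\<close>

lemma chain_integral_subdivision:
  assumes \<beta>: "\<beta> \<in> quartic_exps" and sm: "smooth_octic t"
    and z: "singular_chain 2 (octic_surface t) z" "\<And>\<sigma>. \<sigma> \<in> Poly_Mapping.keys z \<Longrightarrow> C1_simplex \<sigma>"
  shows "chain_integral t \<beta> ((singular_subdivision 2 ^^ n) z) = chain_integral t \<beta> z \<and>
    singular_chain 2 (octic_surface t) ((singular_subdivision 2 ^^ n) z) \<and>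
    (\<forall>\<sigma>\<in>Poly_Mapping.keys ((singular_subdivision 2 ^^ n) z). C1_simplex \<sigma>)"
proof (induction n)
  case (Suc n)
  let ?z = "(singular_subdivision 2 ^^ n) z"
  have K: "singular_simplex 2 (octic_surface t) \<sigma>" "C1_simplex \<sigma>" if "\<sigma> \<in> Poly_Mapping.keys ?z" for \<sigma>
    using Suc that by (auto simp: singular_chain_def)
  have e: "singular_subdivision 2 ?z = frag_extend (\<lambda>f. chain_map 2 f unit_subdivision) ?z"
    by (simp add: singular_subdivision_def unit_subdivision_def)
  have "chain_integral t \<beta> (singular_subdivision 2 ?z) = chain_integral t \<beta> ?z"
    unfolding e chain_integral_eq frag_ext_frag_extend
    using simplex_integral_subdivision(1)[OF \<beta> sm K] by (intro frag_ext_cong) (simp add: chain_integral_eq)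
  moreover have "singular_chain 2 (octic_surface t) (singular_subdivision 2 ?z)"
    using Suc by (intro singular_chain_singular_subdivision) simp
  moreover have "C1_simplex \<sigma>" if "\<sigma> \<in> Poly_Mapping.keys (singular_subdivision 2 ?z)" for \<sigma>
    using that keys_frag_extend[of "\<lambda>f. chain_map 2 f unit_subdivision" ?z] simplex_integral_subdivision(2)[OF \<beta> sm K]
    unfolding e by blast
  ultimately show ?case using Suc by simp
qed (use z in auto)

section \<open>Holomorphic functions\<close>

text \<open>Complex differentiability of class C1. The scalar action is a parameter because the
  notion is used both on vectors and on pairs, where the action is
  \<open>pair_scale\<close>.\<close>

definition hol_on :: "(complex \<Rightarrow> 'a \<Rightarrow> 'a) \<Rightarrow> ('a::real_normed_vector \<Rightarrow> complex) \<Rightarrow> 'a set \<Rightarrow> bool" where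
  "hol_on sc f S \<longleftrightarrow> C1_on f S \<and> (\<forall>x\<in>S. \<forall>c v. FD f x (sc c v) = c * FD f x v)"

lemma hol_onI:
  assumes "C1_on f S" "\<And>x. x \<in> S \<Longrightarrow> (f has_derivative D x) (at x)" "\<And>x c v. x \<in> S \<Longrightarrow> D x (sc c v) = c * D x v"
  shows "hol_on sc f S"
  using assms FD_eq unfolding hol_on_def by metis

lemma hol_on_C1: "hol_on sc f S \<Longrightarrow> C1_on f S"
  by (simp add: hol_on_def)

lemma hol_on_scale: "hol_on sc f S \<Longrightarrow> x \<in> S \<Longrightarrow> FD f x (sc c v) = c * FD f x v"
  by (simp add: hol_on_def)

lemma hol_on_has_derivative: "hol_on sc f S \<Longrightarrow> x \<in> S \<Longrightarrow> (f has_derivative FD f x) (at x)"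
  by (rule C1_on_has_derivative[OF hol_on_C1])

lemma hol_on_subset: "hol_on sc f S \<Longrightarrow> open T \<Longrightarrow> T \<subseteq> S \<Longrightarrow> hol_on sc f T"
  unfolding hol_on_def using C1_on_subset by blast

lemma hol_on_const: "open S \<Longrightarrow> hol_on sc (\<lambda>_. k) S"
  by (rule hol_onI[where D = "\<lambda>_ _. 0"]) auto

lemma hol_on_add: "hol_on sc f S \<Longrightarrow> hol_on sc g S \<Longrightarrow> hol_on sc (\<lambda>x. f x + g x) S"
  by (rule hol_onI[where D = "\<lambda>x v. FD f x v + FD g x v"])
    (auto intro!: C1_on_add has_derivative_add hol_on_has_derivative intro: hol_on_C1 simp: hol_on_scale distrib_left)

lemma hol_on_diff: "hol_on sc f S \<Longrightarrow> hol_on sc g S \<Longrightarrow> hol_on sc (\<lambda>x. f x - g x) S"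
  by (rule hol_onI[where D = "\<lambda>x v. FD f x v - FD g x v"])
    (auto intro!: C1_on_diff has_derivative_diff hol_on_has_derivative intro: hol_on_C1 simp: hol_on_scale right_diff_distrib)

lemma hol_on_mult:
  assumes f: "hol_on sc f S" and g: "hol_on sc g S"
  shows "hol_on sc (\<lambda>x. f x * g x) S"
proof (rule hol_onI[where D = "\<lambda>x v. f x * FD g x v + FD f x v * g x"])
  show "C1_on (\<lambda>x. f x * g x) S" using f g by (intro C1_on_mult hol_on_C1)
  show "((\<lambda>x. f x * g x) has_derivative (\<lambda>v. f x * FD g x v + FD f x v * g x)) (at x)" if "x \<in> S" for x
    using has_derivative_mult[OF hol_on_has_derivative[OF f that] hol_on_has_derivative[OF g that]] .
qed (simp add: hol_on_scale[OF f] hol_on_scale[OF g] algebra_simps)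

lemma hol_on_divide:
  assumes f: "hol_on sc f S" and g: "hol_on sc g S" and nz: "\<And>x. x \<in> S \<Longrightarrow> g x \<noteq> 0"
  shows "hol_on sc (\<lambda>x. f x / g x) S"
proof (rule hol_onI[where D = "\<lambda>x v. - f x * (inverse (g x) * FD g x v * inverse (g x)) + FD f x v / g x"])
  show "C1_on (\<lambda>x. f x / g x) S" using f g nz by (intro C1_on_divide) (auto intro: hol_on_C1)
  show "((\<lambda>x. f x / g x) has_derivative (\<lambda>v. - f x * (inverse (g x) * FD g x v * inverse (g x)) + FD f x v / g x)) (at x)"
    if "x \<in> S" for x
    using has_derivative_divide[OF hol_on_has_derivative[OF f that] hol_on_has_derivative[OF g that] nz[OF that]] .
  show "- f x * (inverse (g x) * FD g x (sc c v) * inverse (g x)) + FD f x (sc c v) / g x =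
    c * (- f x * (inverse (g x) * FD g x v * inverse (g x)) + FD f x v / g x)" if "x \<in> S" for x c v
    using hol_on_scale[OF f that] hol_on_scale[OF g that] by (simp add: algebra_simps)
qed

lemma hol_on_sum: "open S \<Longrightarrow> (\<And>i. i \<in> I \<Longrightarrow> hol_on sc (f i) S) \<Longrightarrow> hol_on sc (\<lambda>x. \<Sum>i\<in>I. f i x) S"
  by (induction I rule: infinite_finite_induct) (auto intro: hol_on_add hol_on_const)

lemma hol_on_prod: "open S \<Longrightarrow> (\<And>i. i \<in> I \<Longrightarrow> hol_on sc (f i) S) \<Longrightarrow> hol_on sc (\<lambda>x. \<Prod>i\<in>I. f i x) S"
  by (induction I rule: infinite_finite_induct) (auto intro: hol_on_mult hol_on_const)

lemma hol_on_power: "open S \<Longrightarrow> hol_on sc f S \<Longrightarrow> hol_on sc (\<lambda>x. f x ^ n) S"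
  by (induction n) (auto intro: hol_on_mult hol_on_const)

lemmas hol_intros = hol_on_const hol_on_add hol_on_diff hol_on_mult hol_on_sum hol_on_prod hol_on_power

definition pair_scale :: "complex \<Rightarrow> complex \<times> complex \<Rightarrow> complex \<times> complex" where
  "pair_scale c v = (c * fst v, c * snd v)"

lemma hol_on_fst: "open S \<Longrightarrow> hol_on pair_scale fst S" and hol_on_snd: "open S \<Longrightarrow> hol_on pair_scale snd S"
  by (rule hol_onI[where D = "\<lambda>_. fst"] hol_onI[where D = "\<lambda>_. snd"];
    auto intro!: C1_on_bounded_linear bounded_linear_fst bounded_linear_snd bounded_linear_imp_has_derivative simp: pair_scale_def)+

lemma FD_pair:
  assumes "hol_on pair_scale f S" "y \<in> S"
  shows "FD f y v = fst v * FD f y (1, 0) + snd v * FD f y (0, 1)"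
proof -
  interpret bounded_linear "FD f y" using C1_on_linear[OF hol_on_C1[OF assms(1)] assms(2)] .
  have "FD f y v = FD f y (pair_scale (fst v) (1, 0) + pair_scale (snd v) (0, 1))" by (simp add: pair_scale_def prod_eq_iff)
  then show ?thesis by (simp only: add hol_on_scale[OF assms])
qed

text \<open>\<open>\<Psi>\<close> integrates \<open>\<phi>\<close> in the first variable, along
  segments starting from the first coordinate of the centre. The conclusion says that d\<Psi> \<and>
  dy2 = \<phi> dy1 \<and> dy2; it holds because \<Psi> is again complex differentiable, so that no
  conjugate differentials occur.\<close>

lemma holomorphic_primitive:
  fixes \<phi> :: "complex \<times> complex \<Rightarrow> complex"
  assumes \<phi>: "hol_on pair_scale \<phi> (ball y0 \<rho>)"
  obtains \<Psi> where "C1_on \<Psi> (ball y0 \<rho>)"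
    "\<And>y v. y \<in> ball y0 \<rho> \<Longrightarrow> FD \<Psi> y v = \<phi> y * fst v + FD \<Psi> y (0, 1) * snd v"
proof -
  let ?K = "ball y0 \<rho>"
  define c where "c = fst y0"
  define A where "A = (\<lambda>q :: (complex \<times> complex) \<times> real. (c + of_real (snd q) * (fst (fst q) - c), snd (fst q)))"
  have A: "C1_on A S" if "open S" for S unfolding A_def by (intro C1_intros that)
  have oW: "open (A -` ?K)"
    using continuous_on_open_vimage[of UNIV A] C1_on_continuous_on[OF A[OF open_UNIV]] by auto
  \<comment> \<open>The segment stays in the ball because it only shrinks the distance in the first
    coordinate.\<close>
  have AK: "A (y, s) \<in> ?K" if y: "y \<in> ?K" and s: "s \<in> {0..1}" for y s
  proof -
    have "dist y0 (A (y, s)) \<le> dist y0 y"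
    proof -
      have "cmod (of_real s * (fst y - c)) \<le> cmod (fst y - c)"
        using s by (simp add: norm_mult mult_left_le_one_le)
      then have "dist (fst y0) (fst (A (y, s))) \<le> dist (fst y0) (fst y)"
        by (simp add: A_def c_def dist_norm norm_minus_commute)
      then show ?thesis
        unfolding dist_prod_def by (intro real_sqrt_le_mono add_mono power_mono) (simp_all add: A_def)
    qed
    then show ?thesis using y by simp
  qed
  define F where "F = (\<lambda>q. (fst (fst q) - c) * \<phi> (A q))"
  have F: "C1_on F (A -` ?K)" unfolding F_def
    by (intro C1_intros oW C1_on_compose[OF A[OF oW] hol_on_C1[OF \<phi>]]) simp
  define \<Psi> where "\<Psi> = (\<lambda>y. integral {0..1} (\<lambda>s. F (y, s)))"
  have C: "C1_on \<Psi> ?K" and FD\<Psi>: "\<And>y v. y \<in> ?K \<Longrightarrow> FD \<Psi> y v = integral {0..1} (\<lambda>s. FD F (y, s) (v, 0))"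
    unfolding \<Psi>_def using C1_on_integral_param[OF F, of ?K] AK by (auto simp: convex_ball)
  have FDF: "FD F (y, s) (v, 0) = (fst y - c) * FD \<phi> (A (y, s)) (of_real s * fst v, snd v) + fst v * \<phi> (A (y, s))"
    if y: "y \<in> ?K" and s: "s \<in> {0..1}" for y s v
  proof -
    have dA: "(A has_derivative (\<lambda>w. (of_real s * fst (fst w) + of_real (snd w) * (fst y - c), snd (fst w)))) (at (y, s))"
      unfolding A_def by (auto intro!: derivative_eq_intros)
    have d1: "((\<lambda>q. \<phi> (A q)) has_derivative (\<lambda>w. FD \<phi> (A (y, s)) (of_real s * fst (fst w) + of_real (snd w) * (fst y - c), snd (fst w)))) (at (y, s))"
      by (rule has_derivative_compose[OF dA hol_on_has_derivative[OF \<phi> AK[OF y s]]])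
    have d2: "((\<lambda>q :: (complex \<times> complex) \<times> real. fst (fst q) - c) has_derivative (\<lambda>w. fst (fst w))) (at (y, s))"
      by (auto intro!: derivative_eq_intros)
    from FD_eq[OF has_derivative_mult[OF d2 d1]] show ?thesis by (simp add: F_def)
  qed
  have "FD \<Psi> y (1, 0) = \<phi> y" if y: "y \<in> ?K" for y
  proof -
    have "((\<lambda>s. of_real s * \<phi> (A (y, s))) has_vector_derivative FD F (y, s) ((1, 0), 0)) (at s within {0..1})" if s: "s \<in> {0..1}" for s
    proof -
      have "((\<lambda>s. A (y, s)) has_derivative (\<lambda>h. (of_real h * (fst y - c), 0))) (at s within {0..1})"
        unfolding A_def by (auto intro!: derivative_eq_intros)
      from has_derivative_compose[OF this hol_on_has_derivative[OF \<phi> AK[OF y s]]]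
      have d: "((\<lambda>s. \<phi> (A (y, s))) has_derivative (\<lambda>h. FD \<phi> (A (y, s)) (of_real h * (fst y - c), 0))) (at s within {0..1})" .
      have "((\<lambda>s. complex_of_real s) has_derivative (\<lambda>h. of_real h)) (at s within {0..1})"
        by (intro has_derivative_of_real has_derivative_ident)
      from has_derivative_mult[OF this d]
      have "((\<lambda>s. of_real s * \<phi> (A (y, s))) has_derivative (\<lambda>h. of_real s * FD \<phi> (A (y, s)) (of_real h * (fst y - c), 0) + of_real h * \<phi> (A (y, s)))) (at s within {0..1})" .
      moreover have "of_real s * FD \<phi> (A (y, s)) (of_real h * (fst y - c), 0) + of_real h * \<phi> (A (y, s)) = h *\<^sub>R FD F (y, s) ((1, 0), 0)" for h
      proof -
        have "FD \<phi> (A (y, s)) (z, 0) = z * FD \<phi> (A (y, s)) (1, 0)" for z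
          using FD_pair[OF \<phi> AK[OF y s], of "(z, 0)"] by simp
        from this[of "of_real h * (fst y - c)"] this[of "of_real s"] show ?thesis
          by (simp only: FDF[OF y s] scaleR_conv_of_real fst_conv snd_conv mult_1_right mult_1_left distrib_left) (simp add: mult_ac)
      qed
      ultimately show ?thesis by (simp only: has_vector_derivative_def)
    qed
    then have "((\<lambda>s. FD F (y, s) ((1, 0), 0)) has_integral (of_real 1 * \<phi> (A (y, 1)) - of_real 0 * \<phi> (A (y, 0)))) {0..1}"
      by (intro fundamental_theorem_of_calculus) simp_all
    then show ?thesis using FD\<Psi>[OF y] by (simp add: integral_unique A_def)
  qed
  moreover have "FD \<Psi> y (pair_scale k v) = k * FD \<Psi> y v" if y: "y \<in> ?K" for y k v
  proof -
    have "FD F (y, s) (pair_scale k v, 0) = k * FD F (y, s) (v, 0)" if "s \<in> {0..1}" for s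
      using hol_on_scale[OF \<phi> AK[OF y that], of k "(of_real s * fst v, snd v)"]
      by (simp add: FDF[OF y that] pair_scale_def algebra_simps)
    then show ?thesis
      unfolding FD\<Psi>[OF y] integral_mult_right[symmetric] by (intro Henstock_Kurzweil_Integration.integral_cong)
  qed
  then have "hol_on pair_scale \<Psi> ?K" using C by (simp add: hol_on_def)
  ultimately have "FD \<Psi> y v = \<phi> y * fst v + FD \<Psi> y (0, 1) * snd v" if "y \<in> ?K" for y v
    using FD_pair[of \<Psi> ?K y v] that by simp
  with C show thesis using that by blast
qed

section \<open>Charts and local primitives of the residue forms\<close>

text \<open>An open subset of projective space, represented by the cone over it.\<close>

definition cone_open :: "(complex^4) set \<Rightarrow> bool" where
  "cone_open W \<longleftrightarrow> open W \<and> 0 \<notin> W \<and> (\<forall>x\<in>W. \<forall>c. c \<noteq> 0 \<longrightarrow> c *s x \<in> W)"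

text \<open>\<open>y\<close> gives coordinates on a piece of projective space and
  \<open>\<Gamma>\<close> is a section over \<open>K\<close> with values in the surface. Convexity
  of \<open>K\<close> is asked for with the Poincare lemma in view.\<close>

definition chart :: "param \<Rightarrow> (complex^4) set \<Rightarrow> (complex \<times> complex) set \<Rightarrow> (complex \<times> complex \<Rightarrow> complex^4) \<Rightarrow> (complex^4 \<Rightarrow> complex \<times> complex) \<Rightarrow> bool" where
  "chart t N K \<Gamma> y \<longleftrightarrow> cone_open N \<and> convex K \<and> C1_on \<Gamma> K \<and> C1_on y N \<and>
     (\<forall>x\<in>N. \<forall>c. c \<noteq> 0 \<longrightarrow> y (c *s x) = y x) \<and>
     (\<forall>k\<in>K. \<Gamma> k \<in> N \<and> octic t (\<Gamma> k) = 0 \<and> y (\<Gamma> k) = k) \<and>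
     (\<forall>x\<in>N. octic t x = 0 \<longrightarrow> y x \<in> K \<and> (\<exists>c. c \<noteq> 0 \<and> x = c *s \<Gamma> (y x)))"

text \<open>A local potential \<open>H dB\<close> of the residue form. Both functions live on an
  ambient open cone, so that they can be evaluated along lifts without choosing coordinates of the
  surface.\<close>

definition primitive :: "param \<Rightarrow> (4 \<Rightarrow> nat) \<Rightarrow> (complex^4) set \<Rightarrow> (complex^4 \<Rightarrow> complex) \<Rightarrow> (complex^4 \<Rightarrow> complex) \<Rightarrow> bool" where
  "primitive t \<beta> W H B \<longleftrightarrow> cone_open W \<and> C1_on H W \<and> C1_on B W \<and>
     (\<forall>x\<in>W. \<forall>c. c \<noteq> 0 \<longrightarrow> H (c *s x) = H x \<and> B (c *s x) = B x) \<and>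
     (\<forall>x\<in>W. octic t x = 0 \<longrightarrow> (\<forall>u v. octic_deriv t x u = 0 \<longrightarrow> octic_deriv t x v = 0 \<longrightarrow>
        wedge H B x u v = residue_form t \<beta> x u v))"

lemma remaining_indices:
  assumes "j \<noteq> (k :: 4)"
  obtains l m where "UNIV = {j, k, l, m}" "l \<noteq> j" "l \<noteq> k" "m \<noteq> j" "m \<noteq> k" "l \<noteq> m"
proof -
  have "card (UNIV - {j, k}) = 2" using assms by (simp add: card_Diff_subset)
  then obtain l m where "UNIV - {j, k} = {l, m}" "l \<noteq> m" unfolding card_2_iff by blast
  then show thesis using that[of l m] by blast
qed

text \<open>In the affine chart where coordinate \<open>j\<close> is 1 the equation is solved for
  coordinate \<open>k\<close>; the other two, \<open>l\<close> and \<open>m\<close>, are coordinates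
  of the surface. There the residue form is \<phi> dy1 \<and> dy2 with \<phi> holomorphic, and a
  primitive \<Psi> of \<phi> in the first coordinate yields the potential \<Psi> dy2.\<close>

lemma chart_primitive_exist:
  assumes sm: "smooth_octic t" and \<beta>: "\<beta> \<in> quartic_exps" and x0: "x0 \<noteq> 0" "octic t x0 = 0" and O: "cone_open O'" "x0 \<in> O'"
  obtains N K \<Gamma> y H B where "chart t N K \<Gamma> y" "x0 \<in> N" "\<Gamma> ` K \<subseteq> O'" "primitive t \<beta> N H B"
proof -
  obtain w where "octic_deriv t x0 w \<noteq> 0" using sm x0 unfolding smooth_octic_def by blast
  then obtain k where k: "octic_deriv t x0 (axis k 1) \<noteq> 0" using octic_deriv_axis[of t x0 w] by fastforce
  \<comment> \<open>Euler's relation: if \<open>x0\<close> were a multiple of the k-th axis, the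
    nonzero k-th partial derivative times \<open>x0 $ k\<close> would be 8 times the octic, that is
    0.\<close>
  have "\<exists>j. j \<noteq> k \<and> x0 $ j \<noteq> 0"
  proof (rule ccontr)
    assume n: "\<not> (\<exists>j. j \<noteq> k \<and> x0 $ j \<noteq> 0)"
    have "octic_deriv t x0 x0 = (\<Sum>i\<in>UNIV. if i = k then octic_deriv t x0 (axis k 1) * x0 $ k else 0)"
      by (subst octic_deriv_axis, rule sum.cong) (use n in auto)
    then have "octic_deriv t x0 (axis k 1) * x0 $ k = 0" using x0 by (simp add: octic_Euler)
    then have "x0 $ k = 0" using k by simp
    with n have "x0 = 0" by (metis vec_eq_iff zero_index)
    with x0 show False by simp
  qed
  then obtain j where j: "j \<noteq> k" "x0 $ j \<noteq> 0" by blast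
  obtain l m where lm: "UNIV = {j, k, l, m}" "l \<noteq> j" "l \<noteq> k" "m \<noteq> j" "m \<noteq> k" "l \<noteq> m"
    using remaining_indices[OF j(1)] .
  have all: "(\<forall>i. P i) \<longleftrightarrow> P j \<and> P k \<and> P l \<and> P m" for P
    using lm(1) by (metis UNIV_I empty_iff insert_iff)
  define P where "P = (\<lambda>p :: (complex \<times> complex) \<times> complex. axis j 1 + snd p *s axis k 1 + fst (fst p) *s axis l 1 + snd (fst p) *s axis m (1 :: complex))"
  have P: "P p $ j = 1" "P p $ k = snd p" "P p $ l = fst (fst p)" "P p $ m = snd (fst p)" for p
    using j(1) lm by (simp_all add: P_def axis_def)
  have dP: "(P has_derivative (\<lambda>v. snd v *s axis k 1 + fst (fst v) *s axis l 1 + snd (fst v) *s axis m 1)) (at p)" for p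
  proof -
    have b: "bounded_linear (\<lambda>p :: (complex \<times> complex) \<times> complex. c p *s (axis i 1 :: complex^4))" if "bounded_linear c" for c i
    proof -
      interpret c: bounded_linear c by fact
      show ?thesis
        unfolding linear_conv_bounded_linear[symmetric]
        by (rule linearI) (simp_all add: c.add c.scaleR vec_eq_iff algebra_simps)
    qed
    have "((\<lambda>p. axis j 1 + snd p *s axis k 1 + fst (fst p) *s axis l 1 + snd (fst p) *s axis m (1 :: complex)) has_derivative
      (\<lambda>v. 0 + snd v *s axis k 1 + fst (fst v) *s axis l 1 + snd (fst v) *s axis m 1)) (at p)"
      by (intro has_derivative_add has_derivative_const bounded_linear_imp_has_derivative b bounded_linear_snd
        bounded_linear_compose[OF bounded_linear_fst bounded_linear_fst] bounded_linear_compose[OF bounded_linear_snd bounded_linear_fst])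
    then show ?thesis by (simp add: P_def[abs_def])
  qed
  define F where "F = (\<lambda>p. octic t (P p))"
  have C1P: "C1_on P S" if "open S" for S unfolding P_def by (intro C1_intros that)
  have F: "C1_on F UNIV" unfolding F_def by (intro C1_on_octic open_UNIV C1P C1_on_const)
  have FDF: "FD F p v = octic_deriv t (P p) (snd v *s axis k 1 + fst (fst v) *s axis l 1 + snd (fst v) *s axis m 1)" for p v
    unfolding F_def by (subst FD_eq[OF has_derivative_compose[OF dP has_derivative_octic]]) simp
  define y where "y = (\<lambda>x :: complex^4. (x $ l / x $ j, x $ m / x $ j))"
  define s where "s = (\<lambda>x :: complex^4. x $ k / x $ j)"
  have xP: "x = x $ j *s P (y x, s x)" if "x $ j \<noteq> 0" for x
    using that by (simp add: vec_eq_iff all P y_def s_def)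
  have F0: "F (y x0, s x0) = 0"
  proof -
    have "octic t (x0 $ j *s P (y x0, s x0)) = 0" using xP[OF j(2)] x0(2) by simp
    then show ?thesis using j(2) by (simp add: octic_scale F_def)
  qed
  have FDk: "FD F (y x0, s x0) (0, 1) \<noteq> 0"
  proof -
    have "octic_deriv t (x0 $ j *s P (y x0, s x0)) (axis k 1) \<noteq> 0" using xP[OF j(2)] k by simp
    then show ?thesis using j(2) by (simp add: octic_deriv_base_scale FDF)
  qed
  have lin: "FD F p (0, z) = z * FD F p (0, 1)" for p z by (simp add: FDF)
  obtain Z r h where Z: "y x0 \<in> Z" "r > 0" "C1_on h Z" "h (y x0) = s x0"
    "\<And>z. z \<in> Z \<Longrightarrow> h z \<in> ball (s x0) r"
    "\<And>z. z \<in> Z \<Longrightarrow> (z, h z) \<in> UNIV" "\<And>z. z \<in> Z \<Longrightarrow> F (z, h z) = 0" "\<And>z. z \<in> Z \<Longrightarrow> FD F (z, h z) (0, 1) \<noteq> 0"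
    "\<And>z w. z \<in> Z \<Longrightarrow> w \<in> ball (s x0) r \<Longrightarrow> F (z, w) = 0 \<Longrightarrow> w = h z"
    and FDh: "\<And>z u. z \<in> Z \<Longrightarrow> FD h z u = - FD F (z, h z) (u, 0) / FD F (z, h z) (0, 1)"
    by (rule implicit_function[OF F UNIV_I F0 lin FDk]) blast
  have oZ: "open Z" using C1_on_open[OF Z(3)] .
  define \<Gamma> where "\<Gamma> = (\<lambda>z. P (z, h z))"
  have C\<Gamma>: "C1_on \<Gamma> Z" unfolding \<Gamma>_def
    by (rule C1_on_compose[OF C1_on_Pair[OF C1_on_id[OF oZ] Z(3)] C1P[OF open_UNIV]]) simp
  have oO: "open O'" using O by (simp add: cone_open_def)
  have "open (\<Gamma> -` O' \<inter> Z)"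
    by (rule continuous_on_open_vimage[OF oZ, THEN iffD1, rule_format, OF C1_on_continuous_on[OF C\<Gamma>] oO])
  moreover have "y x0 \<in> \<Gamma> -` O' \<inter> Z"
  proof -
    have "inverse (x0 $ j) *s x0 = P (y x0, s x0)" using xP[OF j(2)] j(2)
      by (metis left_inverse vector_smult_assoc vector_smult_lid)
    then have "\<Gamma> (y x0) = inverse (x0 $ j) *s x0" by (simp add: \<Gamma>_def Z(4))
    then show ?thesis using O j(2) Z(1) by (simp add: cone_open_def)
  qed
  ultimately obtain \<rho> where \<rho>: "\<rho> > 0" "ball (y x0) \<rho> \<subseteq> \<Gamma> -` O' \<inter> Z" using open_contains_ball by blast
  define K where "K = ball (y x0) \<rho>"
  have KZ: "K \<subseteq> Z" and KO: "\<Gamma> ` K \<subseteq> O'" using \<rho> by (auto simp: K_def)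
  have oK: "open K" by (simp add: K_def)
  define U where "U = {x :: complex^4. x $ j \<noteq> 0}"
  have oU: "open U" unfolding U_def by (intro open_Collect_neq continuous_intros)
  have Cy: "C1_on y U" and Cs: "C1_on s U" unfolding y_def s_def
    by (intro C1_on_Pair C1_on_divide C1_on_vec_nth C1_on_id oU; simp add: U_def)+
  define N where "N = (\<lambda>x. (y x, s x)) -` (K \<times> ball (s x0) r) \<inter> U"
  have oN: "open N" unfolding N_def
    by (rule continuous_on_open_vimage[OF oU, THEN iffD1, rule_format, OF C1_on_continuous_on[OF C1_on_Pair[OF Cy Cs]]])
      (intro open_Times oK open_ball)
  have ysc: "y (c *s x) = y x" "s (c *s x) = s x" if "c \<noteq> 0" for c x using that by (simp_all add: y_def s_def)
  have cN: "cone_open N" unfolding cone_open_def using oN ysc by (auto simp: N_def U_def)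
  have y\<Gamma>: "y (\<Gamma> z) = z" "s (\<Gamma> z) = h z" "\<Gamma> z $ j = 1" for z by (simp_all add: y_def s_def \<Gamma>_def P)
  have \<Gamma>0: "octic t (\<Gamma> z) = 0" if "z \<in> K" for z using Z(7)[OF subsetD[OF KZ that]] by (simp add: F_def \<Gamma>_def)
  have \<Gamma>N: "\<Gamma> z \<in> N" if "z \<in> K" for z
    using that Z(5)[of z] KZ by (auto simp: N_def U_def y\<Gamma>)
  have xN: "y x \<in> K" "x = x $ j *s \<Gamma> (y x)" "x $ j \<noteq> 0" if x: "x \<in> N" "octic t x = 0" for x
  proof -
    show yK: "y x \<in> K" and xj: "x $ j \<noteq> 0" using x by (auto simp: N_def U_def)
    have "octic t (x $ j *s P (y x, s x)) = 0" using xP[OF xj] x(2) by simp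
    then have "F (y x, s x) = 0" using xj by (simp add: octic_scale F_def)
    then have "s x = h (y x)" using Z(9)[of "y x" "s x"] x(1) KZ yK by (auto simp: N_def)
    then show "x = x $ j *s \<Gamma> (y x)" using xP[OF xj] by (simp add: \<Gamma>_def)
  qed
  have NU: "N \<subseteq> U" by (auto simp: N_def)
  have "chart t N K \<Gamma> y"
    unfolding chart_def
  proof (intro conjI ballI allI impI)
    show "cone_open N" "convex K" "C1_on \<Gamma> K" "C1_on y N"
      using cN C1_on_subset[OF C\<Gamma> oK KZ] C1_on_subset[OF Cy oN NU] by (simp_all add: K_def convex_ball)
    show "y (c *s x) = y x" if "c \<noteq> 0" for x c using ysc(1)[OF that] .
    show "\<Gamma> z \<in> N" "octic t (\<Gamma> z) = 0" "y (\<Gamma> z) = z" if "z \<in> K" for z using \<Gamma>N[OF that] \<Gamma>0[OF that] y\<Gamma>(1) .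
    show "y x \<in> K" "\<exists>c. c \<noteq> 0 \<and> x = c *s \<Gamma> (y x)" if "x \<in> N" "octic t x = 0" for x using xN[OF that] by blast+
  qed
  moreover have x0N: "x0 \<in> N" using j(2) Z(2) \<rho>(1) by (simp add: N_def U_def K_def)
  moreover have "\<exists>H B. primitive t \<beta> N H B"
  proof -
    \<comment> \<open>The derivative of the implicit function is a complex linear expression divided
      by a scalar.\<close>
    have hol_h: "hol_on pair_scale h Z"
      unfolding hol_on_def
    proof (intro conjI ballI allI Z(3))
      fix x c v assume x: "x \<in> Z"
      have "FD F (x, h x) (pair_scale c v, 0) = c * FD F (x, h x) (v, 0)"
        by (simp add: FDF pair_scale_def distrib_left mult.assoc)
      then show "FD h x (pair_scale c v) = c * FD h x v" by (simp add: FDh[OF x])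
    qed
    have hol\<Gamma>: "hol_on pair_scale (\<lambda>z. \<Gamma> z $ i) Z" for i
    proof -
      have "\<forall>i. hol_on pair_scale (\<lambda>z. \<Gamma> z $ i) Z"
        unfolding all \<Gamma>_def P fst_conv snd_conv by (intro conjI hol_h hol_on_const hol_on_fst hol_on_snd oZ)
      then show ?thesis by blast
    qed
    \<comment> \<open>The sign of the permutation (j, k, l, m).\<close>
    define D where "D = det4 (axis j 1) (axis k 1) (axis l 1) (axis m 1)"
    define \<phi> where "\<phi> = (\<lambda>z. monomial \<beta> (\<Gamma> z) * D / octic_deriv t (\<Gamma> z) (axis k 1))"
    have dk: "octic_deriv t (\<Gamma> z) (axis k 1) \<noteq> 0" if "z \<in> Z" for z using Z(8)[OF that] by (simp add: FDF \<Gamma>_def)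
    have "hol_on pair_scale \<phi> Z" unfolding \<phi>_def
    proof (intro hol_on_divide hol_on_mult hol_on_const oZ dk)
      show "hol_on pair_scale (\<lambda>z. monomial \<beta> (\<Gamma> z)) Z" unfolding monomial_def by (intro hol_intros hol\<Gamma> oZ)
      show "hol_on pair_scale (\<lambda>z. octic_deriv t (\<Gamma> z) (axis k 1)) Z"
        unfolding octic_deriv_def monomial_deriv_def by (intro hol_intros hol\<Gamma> oZ)
    qed
    then have "hol_on pair_scale \<phi> (ball (y x0) \<rho>)" using hol_on_subset[OF _ oK KZ] by (simp add: K_def)
    then obtain \<Psi> where \<Psi>: "C1_on \<Psi> K" and FD\<Psi>: "\<And>z v. z \<in> K \<Longrightarrow> FD \<Psi> z v = \<phi> z * fst v + FD \<Psi> z (0, 1) * snd v"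
      unfolding K_def by (rule holomorphic_primitive) blast
    define H B where "H = (\<lambda>x. \<Psi> (y x))" and "B = (\<lambda>x :: complex^4. snd (y x))"
    have CyN: "C1_on y N" using C1_on_subset[OF Cy oN NU] .
    have yK: "y x \<in> K" if "x \<in> N" for x using that by (simp add: N_def)
    have H: "C1_on H N" unfolding H_def by (rule C1_on_compose[OF CyN \<Psi> yK])
    have B: "C1_on B N" unfolding B_def by (rule C1_on_snd[OF CyN])
    have w: "wedge H B x u v = residue_form t \<beta> x u v"
      if x: "x \<in> N" "octic t x = 0" and u: "octic_deriv t x u = 0" and v: "octic_deriv t x v = 0" for x u v
    proof -
      have xj: "x $ j \<noteq> 0" and xG: "x = x $ j *s \<Gamma> (y x)" using xN[OF x] by auto
      have dy: "FD y x v = ((v $ l * x $ j - x $ l * v $ j) / (x $ j)^2, (v $ m * x $ j - x $ m * v $ j) / (x $ j)^2)" for v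
      proof -
        have 1: "((\<lambda>x. x $ i / x $ j) has_derivative (\<lambda>v. (v $ i * x $ j - x $ i * v $ j) / (x $ j * x $ j))) (at x)" for i
          by (intro has_derivative_divide' bounded_linear_imp_has_derivative bounded_linear_vec_nth xj)
        from FD_eq[OF has_derivative_Pair[OF 1 1]] show ?thesis by (simp add: y_def power2_eq_square)
      qed
      have FDH: "FD H x v = \<phi> (y x) * fst (FD y x v) + FD \<Psi> (y x) (0, 1) * snd (FD y x v)" for v
        unfolding H_def FD_compose[OF CyN \<Psi> x(1) yK[OF x(1)]] using FD\<Psi>[OF yK[OF x(1)]] .
      have FDB: "FD B x v = snd (FD y x v)" for v
        unfolding B_def using FD_eq[OF has_derivative_snd[OF C1_on_has_derivative[OF CyN x(1)]]] by simp
      have W: "wedge H B x u v = \<phi> (y x) * (fst (FD y x u) * snd (FD y x v) - fst (FD y x v) * snd (FD y x u))"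
        unfolding wedge_def FDH FDB by (simp add: algebra_simps)
      define a where "a = (\<lambda>u :: complex^4. u $ j / x $ j)"
      \<comment> \<open>Every vector splits into an Euler part, a part along the k-th axis and the
        two chart directions; only the last two survive in a determinant with rows \<open>x\<close>
        and \<open>axis k 1\<close>.\<close>
      have dec: "u = a u *s x + (u $ k - a u * x $ k) *s axis k 1 + (x $ j * fst (FD y x u)) *s axis l 1 + (x $ j * snd (FD y x u)) *s axis m 1" for u
        unfolding vec_eq_iff all using xj j(1) lm
        by (simp add: a_def dy axis_def field_simps power2_eq_square)
      have xdec: "x = x $ j *s axis j 1 + x $ k *s axis k 1 + x $ l *s axis l 1 + x $ m *s axis m 1"
        unfolding vec_eq_iff all using j(1) lm by (simp add: axis_def)
      have D1: "det4 x (axis k 1) (axis l 1) (axis m 1) = x $ j * D"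
        by (subst (1) xdec) (simp add: det4_add det4_scale det4_same D_def)
      have "det4 x (axis k 1) u v = (x $ j)^2 * (fst (FD y x u) * snd (FD y x v) - fst (FD y x v) * snd (FD y x u)) * det4 x (axis k 1) (axis l 1) (axis m 1)"
        apply (subst (1) dec[of u])
        apply (subst (1) dec[of v])
        apply (simp only: det4_add det4_scale det4_same det4_swap[of x "axis k 1" "axis l 1" "axis m 1"])
        apply (simp add: algebra_simps power2_eq_square)
        done
      then have det: "det4 x (axis k 1) u v = (x $ j)^3 * D * (fst (FD y x u) * snd (FD y x v) - fst (FD y x v) * snd (FD y x u))"
        unfolding D1 by (simp add: power2_eq_square power3_eq_cube)
      have dx: "octic_deriv t x (axis k 1) = (x $ j)^7 * octic_deriv t (\<Gamma> (y x)) (axis k 1)"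
        by (subst (1) xG) (rule octic_deriv_base_scale[OF xj])
      have mx: "monomial \<beta> x = (x $ j)^4 * monomial \<beta> (\<Gamma> (y x))"
        by (subst (1) xG) (use \<beta> in \<open>simp add: monomial_scale quartic_exps_def\<close>)
      have dk': "octic_deriv t (\<Gamma> (y x)) (axis k 1) \<noteq> 0" using dk yK[OF x(1)] KZ by blast
      then have "octic_deriv t x (axis k 1) \<noteq> 0" using dx xj by simp
      from residue_form_eq[OF x(2) this u v]
      have "residue_form t \<beta> x u v = ((x $ j)^4 * monomial \<beta> (\<Gamma> (y x))) * ((x $ j)^3 * D * (fst (FD y x u) * snd (FD y x v) - fst (FD y x v) * snd (FD y x u))) / ((x $ j)^7 * octic_deriv t (\<Gamma> (y x)) (axis k 1))"
        by (simp only: det dx mx)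
      also have "\<dots> = \<phi> (y x) * (fst (FD y x u) * snd (FD y x v) - fst (FD y x v) * snd (FD y x u))"
      proof -
        have e: "(x $ j)^7 = (x $ j)^4 * (x $ j)^3" by (simp flip: power_add)
        have g: "b \<noteq> 0 \<Longrightarrow> c \<noteq> 0 \<Longrightarrow> c * M * (b * D * E) / (c * b * d) = M * D / d * E" for b c d M D E :: complex
          by simp
        show ?thesis unfolding e \<phi>_def by (rule g) (use xj in simp_all)
      qed
      finally show ?thesis using W by simp
    qed
    have "primitive t \<beta> N H B"
      unfolding primitive_def using cN H B ysc w by (auto simp: H_def B_def)
    then show ?thesis by blast
  qed
  ultimately show thesis using that KO by blast
qed

section \<open>Nearby points of projective space\<close>

text \<open>Closeness of the points of projective space given by \<open>x\<close> and
  \<open>y\<close>, measured on unit representatives; it forces both vectors to be nonzero and is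
  insensitive to their scaling.\<close>

definition near :: "real \<Rightarrow> complex^4 \<Rightarrow> complex^4 \<Rightarrow> bool" where
  "near \<epsilon> x y \<longleftrightarrow> (\<exists>c d. norm (c *s x) = 1 \<and> norm (d *s y) = 1 \<and> norm (c *s x - d *s y) < \<epsilon>)"

lemma norm_scale: "norm (c *s (x :: complex^'n)) = cmod c * norm x"
  by (simp add: norm_vec_def norm_mult L2_set_right_distrib)

lemma norm_unit_scale: "cmod u = 1 \<Longrightarrow> norm (u *s (x :: complex^'n)) = norm x"
  by (simp only: norm_scale mult_1_left)

lemma near_sym: "near \<epsilon> x y \<Longrightarrow> near \<epsilon> y x"
  unfolding near_def using norm_minus_commute by metis

lemma near_refl: "x \<noteq> 0 \<Longrightarrow> \<epsilon> > 0 \<Longrightarrow> near \<epsilon> x x"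
  unfolding near_def by (intro exI[of _ "of_real (1 / norm x)"]) (simp add: norm_scale norm_divide)

lemma near_mono: "near \<epsilon> x y \<Longrightarrow> \<epsilon> \<le> \<delta> \<Longrightarrow> near \<delta> x y"
  unfolding near_def using order_less_le_trans by blast

lemma near_nonzero: "near \<epsilon> x y \<Longrightarrow> x \<noteq> 0 \<and> y \<noteq> 0"
  unfolding near_def by (auto simp: norm_scale)

lemma near_scale: "near \<epsilon> x y \<Longrightarrow> a \<noteq> 0 \<Longrightarrow> near \<epsilon> x (a *s y)"
  unfolding near_def
proof (elim exE conjE)
  fix c d assume h: "norm (c *s x) = 1" "norm (d *s y) = 1" "norm (c *s x - d *s y) < \<epsilon>" "a \<noteq> 0"
  then have "(d / a) *s (a *s y) = d *s y" by (simp add: vector_smult_assoc)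
  with h show "\<exists>c d. norm (c *s x) = 1 \<and> norm (d *s (a *s y)) = 1 \<and> norm (c *s x - d *s (a *s y)) < \<epsilon>" by metis
qed

text \<open>The two unit representatives of \<open>y\<close> differ by a phase \<open>u\<close>;
  rotating the second pair by \<open>u\<close> makes them agree.\<close>

lemma near_trans: assumes "near \<epsilon> x y" "near \<delta> y z" shows "near (\<epsilon> + \<delta>) x z"
proof -
  obtain c c' where c: "norm (c *s x) = 1" "norm (c' *s y) = 1" "norm (c *s x - c' *s y) < \<epsilon>" using assms(1) unfolding near_def by blast
  obtain d d' where d: "norm (d *s y) = 1" "norm (d' *s z) = 1" "norm (d *s y - d' *s z) < \<delta>" using assms(2) unfolding near_def by blast
  define u where "u = c' / d"
  have "d \<noteq> 0" using d by (auto simp: norm_scale)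
  then have ud: "u *s (d *s y) = c' *s y" by (simp add: u_def vector_smult_assoc)
  then have u: "cmod u = 1" using c(2) d(1) norm_scale[of u "d *s y"] by (simp only: mult_1_right)
  have "c *s x - u *s (d' *s z) = (c *s x - c' *s y) + u *s (d *s y - d' *s z)"
    by (simp only: vector_ssub_ldistrib ud) simp
  also have "norm \<dots> \<le> norm (c *s x - c' *s y) + norm (d *s y - d' *s z)"
    using norm_triangle_ineq[of "c *s x - c' *s y" "u *s (d *s y - d' *s z)"] by (simp only: norm_unit_scale[OF u])
  finally have "norm (c *s x - u *s (d' *s z)) < \<epsilon> + \<delta>" using c(3) d(3) by linarith
  moreover have "norm (u *s (d' *s z)) = 1" using d(2) by (simp only: norm_unit_scale[OF u])
  ultimately show ?thesis unfolding near_def vector_smult_assoc using c(1) by blast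
qed

text \<open>Written as a union over all phases: for a fixed phase the condition on the vector is an
  open one.\<close>

lemma cone_open_near:
  assumes "x \<noteq> 0"
  shows "cone_open {y. near \<epsilon> x y}"
proof -
  define V where "V = (\<Union>c\<in>{c. norm (c *s x) = 1}. \<Union>u\<in>{u :: complex. cmod u = 1}. {y. y \<noteq> 0 \<and> norm (c *s x - (u / of_real (norm y)) *s y) < \<epsilon>})"
  have "near \<epsilon> x y \<longleftrightarrow> y \<in> V" for y
  proof
    assume "near \<epsilon> x y"
    then obtain c d where c: "norm (c *s x) = 1" "norm (d *s y) = 1" "norm (c *s x - d *s y) < \<epsilon>" unfolding near_def by blast
    then have y: "y \<noteq> 0" by (auto simp: norm_scale)
    have "cmod (d * of_real (norm y)) = 1" using c(2) by (simp add: norm_scale norm_mult)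
    moreover have "(d * of_real (norm y)) / of_real (norm y) = d" using y by simp
    ultimately show "y \<in> V" unfolding V_def using c y by (intro UN_I[of c] UN_I[of "d * of_real (norm y)"]) simp_all
  next
    assume "y \<in> V"
    then obtain c u where "norm (c *s x) = 1" "cmod u = 1" "y \<noteq> 0" "norm (c *s x - (u / of_real (norm y)) *s y) < \<epsilon>" unfolding V_def by blast
    then show "near \<epsilon> x y" unfolding near_def
      by (intro exI[of _ c] exI[of _ "u / of_real (norm y)"]) (simp add: norm_scale norm_divide)
  qed
  then have e: "{y. near \<epsilon> x y} = V" by blast
  have "open {y :: complex^4. y \<noteq> 0 \<and> norm (c *s x - (u / of_real (norm y)) *s y) < \<epsilon>}" for c u
  proof -
    have "open ((\<lambda>y :: complex^4. norm (c *s x - (u / of_real (norm y)) *s y)) -` {..<\<epsilon>} \<inter> (- {0}))"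
      unfolding vector_scalar_mult_def
      by (rule continuous_on_open_vimage[OF open_Compl[OF closed_singleton], THEN iffD1, rule_format, OF _ open_lessThan])
        (intro continuous_intros continuous_on_vec_lambda; simp)
    moreover have "{y :: complex^4. y \<noteq> 0 \<and> norm (c *s x - (u / of_real (norm y)) *s y) < \<epsilon>} = (\<lambda>y :: complex^4. norm (c *s x - (u / of_real (norm y)) *s y)) -` {..<\<epsilon>} \<inter> (- {0})"
      by auto
    ultimately show ?thesis by (simp only:)
  qed
  then have "open V" unfolding V_def by (intro open_UN ballI)
  then show ?thesis unfolding cone_open_def e[symmetric] using near_scale near_nonzero by blast
qed

definition cone_points :: "param \<Rightarrow> (complex^4) set" where
  "cone_points t = {x. x \<noteq> 0 \<and> octic t x = 0}"

lemma compact_cone_sphere: "compact {x :: complex^4. norm x = 1 \<and> octic t x = 0}"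
proof -
  have "closed {x :: complex^4. norm x = 1 \<and> octic t x = 0}"
    by (intro closed_Collect_conj closed_Collect_eq continuous_intros continuous_on_octic)
  moreover have "bounded {x :: complex^4. norm x = 1 \<and> octic t x = 0}"
    by (rule bounded_subset[OF bounded_cball[of 0 1]]) auto
  ultimately show ?thesis using compact_eq_bounded_closed by blast
qed

text \<open>A Lebesgue number on the compact set of unit vectors; since the sets are cones it works
  for all representatives.\<close>

lemma Lebesgue_near:
  assumes O: "\<And>x. x \<in> cone_points t \<Longrightarrow> cone_open (V x) \<and> x \<in> V x"
  obtains \<epsilon> where "\<epsilon> > 0" "\<And>x. x \<in> cone_points t \<Longrightarrow> \<exists>y\<in>cone_points t. {z. near \<epsilon> x z} \<subseteq> V y"
proof -
  let ?S = "{x :: complex^4. norm x = 1 \<and> octic t x = 0}"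
  have S: "x \<in> cone_points t" if "x \<in> ?S" for x using that by (auto simp: cone_points_def)
  obtain \<epsilon> where e: "\<epsilon> > 0" "\<And>x. x \<in> ?S \<Longrightarrow> \<exists>G\<in>V ` ?S. ball x \<epsilon> \<subseteq> G"
    using Heine_Borel_lemma[OF compact_cone_sphere, of t "V ` ?S"] O S unfolding cone_open_def by blast
  have "\<exists>y\<in>cone_points t. {z. near \<epsilon> x z} \<subseteq> V y" if x: "x \<in> cone_points t" for x
  proof -
    define x1 where "x1 = of_real (1 / norm x) *s x"
    have nx: "norm x \<noteq> 0" using x by (simp add: cone_points_def)
    have "x1 \<in> ?S" using x nx by (simp add: x1_def norm_scale norm_divide octic_scale cone_points_def)
    then obtain y where y: "y \<in> ?S" "ball x1 \<epsilon> \<subseteq> V y" using e(2) by blast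
    have "z \<in> V y" if nz: "near \<epsilon> x z" for z
    proof -
      obtain c d where c: "norm (c *s x) = 1" "norm (d *s z) = 1" "norm (c *s x - d *s z) < \<epsilon>" using nz unfolding near_def by blast
      define u where "u = of_real (1 / norm x) / c"
      have c0: "c \<noteq> 0" using c by (auto simp: norm_scale)
      have u1: "u *s (c *s x) = x1" using c0 by (simp add: u_def x1_def vector_smult_assoc)
      have "norm x1 = 1" using nx by (simp add: x1_def norm_scale norm_divide)
      then have u: "cmod u = 1" using c(1) u1 norm_scale[of u "c *s x"] by (simp only: mult_1_right)
      have "norm (x1 - u *s (d *s z)) = norm (u *s (c *s x - d *s z))" by (simp only: vector_ssub_ldistrib u1)
      then have "u *s (d *s z) \<in> ball x1 \<epsilon>" using c(3) by (simp only: norm_unit_scale[OF u] mem_ball dist_norm)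
      then have "(u * d) *s z \<in> V y" using y(2) by (auto simp: vector_smult_assoc)
      moreover have "u * d \<noteq> 0" using u c(2) by (auto simp: norm_scale)
      ultimately have "inverse (u * d) *s ((u * d) *s z) \<in> V y"
        using O[OF S[OF y(1)]] unfolding cone_open_def by (metis inverse_nonzero_iff_nonzero)
      then show ?thesis by (simp only: vector_smult_assoc left_inverse[OF \<open>u * d \<noteq> 0\<close>] vector_smult_lid)
    qed
    then show ?thesis using S[OF y(1)] by blast
  qed
  with e(1) show thesis using that by blast
qed

text \<open>Two-sided control of size: the chart contains a whole neighbourhood of \<open>x\<close>,
  yet the points of its section are within \<epsilon> of \<open>x\<close>. It is applied at two
  successive scales.\<close>

lemma small_charts:
  assumes sm: "smooth_octic t" and \<epsilon>: "\<epsilon> > 0"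
  obtains \<delta> where "\<delta> > 0" "\<delta> \<le> \<epsilon>"
    "\<And>x. x \<in> cone_points t \<Longrightarrow> \<exists>N K \<Gamma> y. chart t N K \<Gamma> y \<and> {z. near \<delta> x z} \<subseteq> N \<and> (\<forall>k\<in>K. near \<epsilon> x (\<Gamma> k))"
proof -
  \<comment> \<open>A placeholder of degree four: the existence lemma asks for an exponent, and only
    its chart is kept here.\<close>
  have \<beta>: "(\<lambda>i :: 4. 1) \<in> quartic_exps" by (simp add: quartic_exps_def)
  have "\<exists>N. \<exists>K \<Gamma> y. chart t N K \<Gamma> y \<and> x \<in> N \<and> (\<forall>k\<in>K. near (\<epsilon> / 2) x (\<Gamma> k))" if "x \<in> cone_points t" for x
  proof -
    have x: "x \<noteq> 0" "octic t x = 0" using that by (simp_all add: cone_points_def)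
    have "cone_open {y. near (\<epsilon> / 2) x y}" "x \<in> {y. near (\<epsilon> / 2) x y}"
      using cone_open_near[OF x(1)] near_refl[OF x(1)] \<epsilon> by simp_all
    from chart_primitive_exist[OF sm \<beta> x this] show ?thesis by (smt (verit) image_subset_iff mem_Collect_eq)
  qed
  then obtain N where N: "\<And>x. x \<in> cone_points t \<Longrightarrow> \<exists>K \<Gamma> y. chart t (N x) K \<Gamma> y \<and> x \<in> N x \<and> (\<forall>k\<in>K. near (\<epsilon> / 2) x (\<Gamma> k))" by metis
  have "\<And>x. x \<in> cone_points t \<Longrightarrow> cone_open (N x) \<and> x \<in> N x" using N unfolding chart_def by blast
  from Lebesgue_near[OF this] obtain \<delta> where \<delta>: "\<delta> > 0" "\<And>x. x \<in> cone_points t \<Longrightarrow> \<exists>y\<in>cone_points t. {z. near \<delta> x z} \<subseteq> N y" by blast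
  show thesis
  proof (rule that[of "min \<delta> \<epsilon>"])
    fix x assume x: "x \<in> cone_points t"
    then have x0: "x \<noteq> 0" "octic t x = 0" by (simp_all add: cone_points_def)
    obtain y0 where y0: "y0 \<in> cone_points t" "{z. near \<delta> x z} \<subseteq> N y0" using \<delta>(2)[OF x] by blast
    obtain K \<Gamma> y where c: "chart t (N y0) K \<Gamma> y" "\<And>k. k \<in> K \<Longrightarrow> near (\<epsilon> / 2) y0 (\<Gamma> k)" using N[OF y0(1)] by blast
    have "x \<in> N y0" using y0(2) near_refl[OF x0(1) \<delta>(1)] by blast
    then obtain e where e: "y x \<in> K" "e \<noteq> 0" "x = e *s \<Gamma> (y x)" using c(1) x0(2) unfolding chart_def by blast
    have "near (\<epsilon> / 2) y0 x" using near_scale[OF c(2)[OF e(1)] e(2)] e(3) by simp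
    then have "near \<epsilon> x (\<Gamma> k)" if "k \<in> K" for k
      using near_trans[OF near_sym c(2)[OF that]] by fastforce
    moreover have "{z. near (min \<delta> \<epsilon>) x z} \<subseteq> N y0" using y0(2) near_mono[of "min \<delta> \<epsilon>" x _ \<delta>] by auto
    ultimately show "\<exists>N K \<Gamma> y. chart t N K \<Gamma> y \<and> {z. near (min \<delta> \<epsilon>) x z} \<subseteq> N \<and> (\<forall>k\<in>K. near \<epsilon> x (\<Gamma> k))"
      using c(1) by blast
  qed (use \<delta>(1) \<epsilon> in auto)
qed

section \<open>Line integrals\<close>

definition smooth_path :: "(real \<Rightarrow> complex^4) \<Rightarrow> (real \<Rightarrow> complex^4) \<Rightarrow> bool" where
  "smooth_path \<gamma> \<gamma>' \<longleftrightarrow> (\<forall>s\<in>{0..1}. (\<gamma> has_vector_derivative \<gamma>' s) (at s)) \<and> continuous_on {0..1} \<gamma>'"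

definition path_int :: "(complex^4 \<Rightarrow> complex) \<Rightarrow> (complex^4 \<Rightarrow> complex) \<Rightarrow> (real \<Rightarrow> complex^4) \<Rightarrow> (real \<Rightarrow> complex^4) \<Rightarrow> complex" where
  "path_int H B \<gamma> \<gamma>' = integral {0..1} (\<lambda>s. H (\<gamma> s) * FD B (\<gamma> s) (\<gamma>' s))"

lemma smooth_path_continuous: "smooth_path \<gamma> \<gamma>' \<Longrightarrow> continuous_on {0..1} \<gamma>"
  unfolding smooth_path_def
  by (intro continuous_at_imp_continuous_on ballI) (blast intro: has_vector_derivative_continuous)

lemma has_vector_derivative_compose_C1:
  fixes f :: "'a::euclidean_space \<Rightarrow> 'b::real_normed_vector"
  assumes "C1_on f N" "(\<gamma> has_vector_derivative d) (at s)" "\<gamma> s \<in> N"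
  shows "((\<lambda>s. f (\<gamma> s)) has_vector_derivative FD f (\<gamma> s) d) (at s)"
proof -
  interpret bounded_linear "FD f (\<gamma> s)" using C1_on_linear[OF assms(1,3)] .
  from has_derivative_compose[OF assms(2)[unfolded has_vector_derivative_def] C1_on_has_derivative[OF assms(1,3)]]
  show ?thesis by (simp add: has_vector_derivative_def scaleR)
qed

text \<open>Pulled back to the convex set \<open>K\<close>, the two potentials have the same
  exterior derivative, so they differ by df, and \<open>F\<close> is \<open>f\<close> composed with
  \<open>y\<close>. A path on the cone is pointwise a multiple of a path in the image of \<Gamma>,
  and functions invariant under scalars do not see the factor.\<close>

lemma primitive_difference:
  assumes ch: "chart t N K \<Gamma> y"
    and P: "primitive t \<beta> W H B" "\<Gamma> ` K \<subseteq> W" and P': "primitive t \<beta> W' H' B'" "\<Gamma> ` K \<subseteq> W'"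
  obtains F where "\<And>x c. x \<in> N \<Longrightarrow> c \<noteq> 0 \<Longrightarrow> F (c *s x) = F x"
    "\<And>\<gamma> \<gamma>'. smooth_path \<gamma> \<gamma>' \<Longrightarrow> (\<And>s. s \<in> {0..1} \<Longrightarrow> \<gamma> s \<in> N \<and> octic t (\<gamma> s) = 0) \<Longrightarrow>
       path_int H B \<gamma> \<gamma>' - path_int H' B' \<gamma> \<gamma>' = F (\<gamma> 1) - F (\<gamma> 0)"
proof -
  have K: "convex K" "C1_on \<Gamma> K" and y: "C1_on y N" using ch by (auto simp: chart_def)
  have oK: "open K" using C1_on_open[OF K(2)] .
  have \<Gamma>W: "\<Gamma> k \<in> W" "\<Gamma> k \<in> W'" if "k \<in> K" for k using P(2) P'(2) that by auto
  have C: "C1_on H W" "C1_on B W" "C1_on H' W'" "C1_on B' W'" using P P' by (auto simp: primitive_def)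
  have Cc: "C1_on (\<lambda>k. H (\<Gamma> k)) K" "C1_on (\<lambda>k. B (\<Gamma> k)) K" "C1_on (\<lambda>k. H' (\<Gamma> k)) K" "C1_on (\<lambda>k. B' (\<Gamma> k)) K"
    using C1_on_compose[OF K(2) C(1) \<Gamma>W(1)] C1_on_compose[OF K(2) C(2) \<Gamma>W(1)] C1_on_compose[OF K(2) C(3) \<Gamma>W(2)] C1_on_compose[OF K(2) C(4) \<Gamma>W(2)] by auto
  have \<Gamma>0: "octic t (\<Gamma> k) = 0" if "k \<in> K" for k using ch that by (auto simp: chart_def)
  have tan: "octic_deriv t (\<Gamma> k) (FD \<Gamma> k u) = 0" if k: "k \<in> K" for k u
  proof -
    have 1: "((\<lambda>k. octic t (\<Gamma> k)) has_derivative (\<lambda>u. octic_deriv t (\<Gamma> k) (FD \<Gamma> k u))) (at k)"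
      by (rule has_derivative_compose[OF C1_on_has_derivative[OF K(2) k] has_derivative_octic])
    have 2: "((\<lambda>k. octic t (\<Gamma> k)) has_derivative (\<lambda>u. 0)) (at k)"
      by (rule has_derivative_transform_within_open[OF has_derivative_const oK k]) (simp add: \<Gamma>0)
    from has_derivative_unique[OF 1 2] show ?thesis by (simp only: fun_eq_iff)
  qed
  have FDc: "FD (\<lambda>k. f (\<Gamma> k)) k v = FD f (\<Gamma> k) (FD \<Gamma> k v)" if "C1_on f V" "k \<in> K" "\<Gamma> k \<in> V" for f :: "complex^4 \<Rightarrow> complex" and V k v
    using FD_compose[OF K(2) that(1,2,3)] .
  have w: "wedge (\<lambda>k. H (\<Gamma> k)) (\<lambda>k. B (\<Gamma> k)) k u v = wedge (\<lambda>k. H' (\<Gamma> k)) (\<lambda>k. B' (\<Gamma> k)) k u v" if k: "k \<in> K" for k u v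
  proof -
    have "wedge (\<lambda>k. H (\<Gamma> k)) (\<lambda>k. B (\<Gamma> k)) k u v = wedge H B (\<Gamma> k) (FD \<Gamma> k u) (FD \<Gamma> k v)"
      unfolding wedge_def FDc[OF C(1) k \<Gamma>W(1)[OF k]] FDc[OF C(2) k \<Gamma>W(1)[OF k]] ..
    also have "\<dots> = residue_form t \<beta> (\<Gamma> k) (FD \<Gamma> k u) (FD \<Gamma> k v)"
      using P(1) \<Gamma>W(1)[OF k] \<Gamma>0[OF k] tan[OF k] unfolding primitive_def by blast
    also have "\<dots> = wedge H' B' (\<Gamma> k) (FD \<Gamma> k u) (FD \<Gamma> k v)"
      using P'(1) \<Gamma>W(2)[OF k] \<Gamma>0[OF k] tan[OF k] unfolding primitive_def by metis
    also have "\<dots> = wedge (\<lambda>k. H' (\<Gamma> k)) (\<lambda>k. B' (\<Gamma> k)) k u v"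
      unfolding wedge_def FDc[OF C(3) k \<Gamma>W(2)[OF k]] FDc[OF C(4) k \<Gamma>W(2)[OF k]] ..
    finally show ?thesis .
  qed
  obtain f where f: "\<And>k. k \<in> K \<Longrightarrow> (f has_derivative (\<lambda>v. H (\<Gamma> k) * FD (\<lambda>k. B (\<Gamma> k)) k v - H' (\<Gamma> k) * FD (\<lambda>k. B' (\<Gamma> k)) k v)) (at k)"
    by (rule Poincare_convex[OF K(1) Cc w]) blast+
  have cf: "continuous_on K f" using f has_derivative_continuous by (blast intro: continuous_at_imp_continuous_on)
  show thesis
  proof (rule that[of "\<lambda>x. f (y x)"])
    show "f (y (c *s x)) = f (y x)" if "x \<in> N" "c \<noteq> 0" for x c using ch that by (simp add: chart_def)
    fix \<gamma> \<gamma>' assume g: "smooth_path \<gamma> \<gamma>'" and gN: "\<And>s. s \<in> {0..1} \<Longrightarrow> \<gamma> s \<in> N \<and> octic t (\<gamma> s) = 0"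
    define k where "k = (\<lambda>s. y (\<gamma> s))"
    have kK: "k s \<in> K" "\<exists>c. c \<noteq> 0 \<and> \<gamma> s = c *s \<Gamma> (k s)" if "s \<in> {0..1}" for s
      using ch gN[OF that] by (auto simp: chart_def k_def)
    have inv: "h (\<gamma> s) = h (\<Gamma> (k s))" if a: "primitive t \<beta> V h' h''" "h = h' \<or> h = h''" "\<Gamma> ` K \<subseteq> V" "s \<in> {0..1}" for h h' h'' V s
    proof -
      obtain c where c: "c \<noteq> 0" "\<gamma> s = c *s \<Gamma> (k s)" using kK(2)[OF a(4)] by blast
      have "\<Gamma> (k s) \<in> V" using kK(1)[OF a(4)] a(3) by blast
      then have "h' (c *s \<Gamma> (k s)) = h' (\<Gamma> (k s))" "h'' (c *s \<Gamma> (k s)) = h'' (\<Gamma> (k s))"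
        using a(1) c(1) unfolding primitive_def by blast+
      then show ?thesis using a(2) c(2) by metis
    qed
    have gW: "\<gamma> s \<in> V" if "cone_open V" "\<Gamma> ` K \<subseteq> V" "s \<in> {0..1}" for V s
      using kK[OF that(3)] that(1,2) unfolding cone_open_def by (metis image_subset_iff)
    have co: "cone_open W" "cone_open W'" using P P' by (auto simp: primitive_def)
    have dg: "(\<gamma> has_vector_derivative \<gamma>' s) (at s)" if "s \<in> {0..1}" for s using g that by (simp add: smooth_path_def)
    have dk: "(k has_vector_derivative FD y (\<gamma> s) (\<gamma>' s)) (at s)" if "s \<in> {0..1}" for s
      unfolding k_def using has_vector_derivative_compose_C1[OF y dg[OF that]] gN[OF that] by blast
    have FDB: "FD b (\<gamma> s) (\<gamma>' s) = FD (\<lambda>k. b (\<Gamma> k)) (k s) (FD y (\<gamma> s) (\<gamma>' s))"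
      if b: "C1_on b V" "primitive t \<beta> V h b" "\<Gamma> ` K \<subseteq> V" and s: "s \<in> {0<..<1}" for b V h s
    proof -
      have s': "s \<in> {0..1}" using s by auto
      have "C1_on (\<lambda>k. b (\<Gamma> k)) K" by (rule C1_on_compose[OF K(2) b(1)]) (use b(3) in blast)
      from has_vector_derivative_compose_C1[OF this dk[OF s'] kK(1)[OF s']]
      have "((\<lambda>s. b (\<Gamma> (k s))) has_vector_derivative FD (\<lambda>k. b (\<Gamma> k)) (k s) (FD y (\<gamma> s) (\<gamma>' s))) (at s)" .
      then have "((\<lambda>s. b (\<gamma> s)) has_vector_derivative FD (\<lambda>k. b (\<Gamma> k)) (k s) (FD y (\<gamma> s) (\<gamma>' s))) (at s)"
        by (rule has_vector_derivative_transform_within_open[OF _ open_greaterThanLessThan s]) (use inv[OF b(2) disjI2[OF refl] b(3)] in auto)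
      moreover have "((\<lambda>s. b (\<gamma> s)) has_vector_derivative FD b (\<gamma> s) (\<gamma>' s)) (at s)"
        by (rule has_vector_derivative_compose_C1[OF b(1) dg[OF s']]) (use gW[of V] b s' in \<open>auto simp: primitive_def\<close>)
      ultimately show ?thesis by (metis vector_derivative_unique_at)
    qed
    have df: "((\<lambda>s. f (k s)) has_vector_derivative (H (\<gamma> s) * FD B (\<gamma> s) (\<gamma>' s) - H' (\<gamma> s) * FD B' (\<gamma> s) (\<gamma>' s))) (at s)" if s: "s \<in> {0<..<1}" for s
    proof -
      have s': "s \<in> {0..1}" using s by auto
      let ?e = "\<lambda>v. H (\<Gamma> (k s)) * FD (\<lambda>k. B (\<Gamma> k)) (k s) v - H' (\<Gamma> (k s)) * FD (\<lambda>k. B' (\<Gamma> k)) (k s) v"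
      have fd: "(f has_derivative ?e) (at (k s))" by (rule f[OF kK(1)[OF s']])
      have "((\<lambda>s. f (k s)) has_derivative (\<lambda>h. ?e (h *\<^sub>R FD y (\<gamma> s) (\<gamma>' s)))) (at s)"
        by (rule has_derivative_compose[OF dk[OF s', unfolded has_vector_derivative_def] fd])
      moreover have "?e (h *\<^sub>R v) = h *\<^sub>R ?e v" for h v
        using linear_scale[OF has_derivative_linear[OF fd]] by blast
      ultimately have "((\<lambda>s. f (k s)) has_vector_derivative ?e (FD y (\<gamma> s) (\<gamma>' s))) (at s)"
        by (simp only: has_vector_derivative_def)
      then show ?thesis
        using inv[OF P(1) _ P(2) s', of H] inv[OF P'(1) _ P'(2) s', of H'] FDB[OF C(2) P s] FDB[OF C(4) P' s] by simp
    qed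
    have ck: "continuous_on {0..1} k"
      using dk by (blast intro: continuous_at_imp_continuous_on has_vector_derivative_continuous)
    have "continuous_on {0..1} (\<lambda>s. f (k s))"
      by (rule continuous_on_compose2[OF cf ck]) (use kK(1) in auto)
    from fundamental_theorem_of_calculus_interior[OF _ this df]
    have F: "((\<lambda>s. H (\<gamma> s) * FD B (\<gamma> s) (\<gamma>' s) - H' (\<gamma> s) * FD B' (\<gamma> s) (\<gamma>' s)) has_integral (f (k 1) - f (k 0))) {0..1}" by simp
    have cg: "continuous_on {0..1} \<gamma>" "continuous_on {0..1} \<gamma>'" using smooth_path_continuous[OF g] g by (auto simp: smooth_path_def)
    have i: "(\<lambda>s. h (\<gamma> s) * FD b (\<gamma> s) (\<gamma>' s)) integrable_on {0..1}" if "C1_on h V" "C1_on b V" "cone_open V" "\<Gamma> ` K \<subseteq> V" for h b :: "complex^4 \<Rightarrow> complex" and V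
    proof (rule integrable_continuous_real, rule continuous_on_mult)
      have V: "\<gamma> s \<in> V" if s: "s \<in> {0..1}" for s using gW[OF \<open>cone_open V\<close> \<open>\<Gamma> ` K \<subseteq> V\<close> s] .
      show "continuous_on {0..1} (\<lambda>s. h (\<gamma> s))"
        by (rule continuous_on_compose2[OF C1_on_continuous_on[OF that(1)] cg(1)]) (use V in auto)
      show "continuous_on {0..1} (\<lambda>s. FD b (\<gamma> s) (\<gamma>' s))"
        by (rule continuous_on_FD[OF that(2) cg(1) _ cg(2)]) (use V in auto)
    qed
    show "path_int H B \<gamma> \<gamma>' - path_int H' B' \<gamma> \<gamma>' = f (y (\<gamma> 1)) - f (y (\<gamma> 0))"
      using integral_unique[OF F] Henstock_Kurzweil_Integration.integral_diff[OF i[OF C(1,2) co(1) P(2)] i[OF C(3,4) co(2) P'(2)]]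
      by (simp add: path_int_def k_def)
  qed
qed

section \<open>Integrals over boundaries vanish\<close>

definition rep :: "(complex^4) set \<Rightarrow> complex^4" where
  "rep q = (SOME x. x \<in> q)"

lemma rep_proj: obtains c where "c \<noteq> 0" "rep (proj x) = c *s x"
proof -
  have "x \<in> proj x" unfolding proj_def by (auto intro!: exI[of _ 1])
  then have "rep (proj x) \<in> proj x" unfolding rep_def by (rule someI)
  then show thesis using that by (auto simp: proj_def)
qed

lemma rep_octic_points:
  assumes "q \<in> octic_points t"
  shows "rep q \<in> cone_points t" "proj (rep q) = q"
proof -
  obtain x where x: "q = proj x" "x \<noteq> 0" "octic t x = 0" using assms by (auto simp: octic_points_def)
  obtain c where "c \<noteq> 0" "rep (proj x) = c *s x" by (rule rep_proj)
  with x show "rep q \<in> cone_points t" "proj (rep q) = q" by (auto simp: cone_points_def octic_scale)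
qed

lemma near_rep: "near \<epsilon> a (rep (proj x)) \<longleftrightarrow> near \<epsilon> a x"
proof -
  obtain c where c: "c \<noteq> 0" "rep (proj x) = c *s x" by (rule rep_proj)
  have "x = inverse c *s (c *s x)" using c by simp
  then show ?thesis using near_scale c by (metis inverse_nonzero_iff_nonzero)
qed

definition bary1 :: "real \<Rightarrow> nat \<Rightarrow> real" where
  "bary1 s = (\<lambda>i. if i = 0 then 1 - s else if i = 1 then s else 0)"

text \<open>The integral of \<open>H dB\<close> along a singular 1-simplex, through arbitrary
  representatives of its points instead of a lift. As it depends on the 1-simplex alone,
  neighbouring triangles have equal edge terms.\<close>

definition edge_int :: "(complex^4 \<Rightarrow> complex) \<Rightarrow> (complex^4 \<Rightarrow> complex) \<Rightarrow> sing_simplex \<Rightarrow> complex" where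
  "edge_int H B e = integral {0..1} (\<lambda>s. H (rep (e (bary1 s))) * vector_derivative (\<lambda>s. B (rep (e (bary1 s)))) (at s))"

lemma edge_int_lift:
  assumes P: "primitive t \<beta> W H B" and g: "smooth_path \<gamma> \<gamma>'"
    and e: "\<And>s. s \<in> {0..1} \<Longrightarrow> \<gamma> s \<in> W \<and> e (bary1 s) = proj (\<gamma> s)"
  shows "edge_int H B e = path_int H B \<gamma> \<gamma>'"
  unfolding edge_int_def path_int_def
proof (rule integral_spike[of "{0, 1}"])
  show "negligible {0 :: real, 1}" by (simp add: negligible_finite)
  have inv: "H (rep (e (bary1 s))) = H (\<gamma> s)" "B (rep (e (bary1 s))) = B (\<gamma> s)" if "s \<in> {0..1}" for s
  proof -
    obtain c where "c \<noteq> 0" "rep (proj (\<gamma> s)) = c *s \<gamma> s" by (rule rep_proj)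
    then show "H (rep (e (bary1 s))) = H (\<gamma> s)" "B (rep (e (bary1 s))) = B (\<gamma> s)"
      using P e[OF that] unfolding primitive_def by auto
  qed
  fix s :: real assume "s \<in> {0..1} - {0, 1}"
  then have s: "s \<in> {0<..<1}" "s \<in> {0..1}" by auto
  have B: "C1_on B W" using P by (simp add: primitive_def)
  have "((\<lambda>s. B (\<gamma> s)) has_vector_derivative FD B (\<gamma> s) (\<gamma>' s)) (at s)"
    by (rule has_vector_derivative_compose_C1[OF B]) (use g e[OF s(2)] s(2) in \<open>auto simp: smooth_path_def\<close>)
  then have "((\<lambda>s. B (rep (e (bary1 s)))) has_vector_derivative FD B (\<gamma> s) (\<gamma>' s)) (at s)"
    by (rule has_vector_derivative_transform_within_open[OF _ open_greaterThanLessThan s(1)]) (simp add: inv)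
  then show "H (\<gamma> s) * FD B (\<gamma> s) (\<gamma>' s) = H (rep (e (bary1 s))) * vector_derivative (\<lambda>s. B (rep (e (bary1 s)))) (at s)"
    using inv(1)[OF s(2)] by (simp add: vector_derivative_at)
qed

lemma simplicial_vertex_face:
  assumes "1 \<le> p" "k \<le> p" "i < p"
  shows "simplicial_vertex i (singular_face p k f) = simplicial_vertex (if i < k then i else Suc i) f"
proof -
  have "(\<lambda>j :: nat. if j = i then 1 else 0 :: real) \<in> standard_simplex (p - Suc 0)" using assms by simp
  moreover have "simplical_face k (\<lambda>j :: nat. if j = i then 1 else 0 :: real) = (\<lambda>j. if j = (if i < k then i else Suc i) then 1 else 0)"
    using assms by (auto simp: simplical_face_def fun_eq_iff)
  ultimately show ?thesis by (simp add: simplicial_vertex_def singular_face_def)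
qed

lemma singular_face_bary1:
  assumes "s \<in> {0..1}"
  shows "singular_face 2 0 \<sigma> (bary1 s) = \<sigma> (barycentric ((1, 0) + s *\<^sub>R ((0, 1) - (1, 0))))"
    "singular_face 2 1 \<sigma> (bary1 s) = \<sigma> (barycentric ((0, 0) + s *\<^sub>R ((0, 1) - (0, 0))))"
    "singular_face 2 2 \<sigma> (bary1 s) = \<sigma> (barycentric ((0, 0) + s *\<^sub>R ((1, 0) - (0, 0))))"
proof -
  have "bary1 s \<in> standard_simplex (Suc 0)" using assms by (auto simp: standard_simplex_def bary1_def)
  moreover have "simplical_face 0 (bary1 s) = barycentric ((1, 0) + s *\<^sub>R ((0, 1) - (1, 0)))"
    "simplical_face 1 (bary1 s) = barycentric ((0, 0) + s *\<^sub>R ((0, 1) - (0, 0)))"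
    "simplical_face 2 (bary1 s) = barycentric ((0, 0) + s *\<^sub>R ((1, 0) - (0, 0)))"
    by (auto simp: simplical_face_def bary1_def barycentric_def fun_eq_iff)
  ultimately show "singular_face 2 0 \<sigma> (bary1 s) = \<sigma> (barycentric ((1, 0) + s *\<^sub>R ((0, 1) - (1, 0))))"
    "singular_face 2 1 \<sigma> (bary1 s) = \<sigma> (barycentric ((0, 0) + s *\<^sub>R ((0, 1) - (0, 0))))"
    "singular_face 2 2 \<sigma> (bary1 s) = \<sigma> (barycentric ((0, 0) + s *\<^sub>R ((1, 0) - (0, 0))))"
    by (simp_all add: singular_face_def)
qed

lemma triangle_segment:
  assumes "x \<in> triangle" "y \<in> triangle" "s \<in> {0..1}"
  shows "x + s *\<^sub>R (y - x) \<in> triangle"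
  using convexD_alt[OF convex_triangle assms(1,2), of s] assms(3) by (simp add: algebra_simps)

lemma lift_edge_path:
  assumes l: "lift \<sigma> g S" and xy: "x \<in> triangle" "y \<in> triangle"
  shows "smooth_path (\<lambda>s. g (x + s *\<^sub>R (y - x))) (\<lambda>s. FD g (x + s *\<^sub>R (y - x)) (y - x))"
proof -
  have g: "C1_on g S" and S: "triangle \<subseteq> S" using l by (auto simp: lift_def)
  have inS: "x + s *\<^sub>R (y - x) \<in> S" if "s \<in> {0..1}" for s using triangle_segment[OF xy that] S by blast
  show ?thesis unfolding smooth_path_def
  proof (intro conjI ballI)
    show "((\<lambda>s. g (x + s *\<^sub>R (y - x))) has_vector_derivative FD g (x + s *\<^sub>R (y - x)) (y - x)) (at s)" if "s \<in> {0..1}" for s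
      by (rule has_vector_derivative_compose_C1[where \<gamma> = "\<lambda>s. x + s *\<^sub>R (y - x)", OF g _ inS[OF that]]) (auto intro!: derivative_eq_intros)
    show "continuous_on {0..1} (\<lambda>s. FD g (x + s *\<^sub>R (y - x)) (y - x))"
      by (rule continuous_on_FD[OF g]) (use inS in \<open>auto intro!: continuous_intros\<close>)
  qed
qed

lemma simplex_integral_primitive:
  assumes \<beta>: "\<beta> \<in> quartic_exps" and sm: "smooth_octic t" and \<sigma>: "singular_simplex 2 (octic_surface t) \<sigma>"
    and l: "lift \<sigma> g S" and P: "primitive t \<beta> W H B" and W: "\<And>p. p \<in> triangle \<Longrightarrow> g p \<in> W"
  shows "simplex_integral t \<beta> \<sigma> = edge_int H B (singular_face 2 0 \<sigma>) - edge_int H B (singular_face 2 1 \<sigma>) + edge_int H B (singular_face 2 2 \<sigma>)"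
proof -
  have g: "C1_on g S" and S: "triangle \<subseteq> S" using l by (auto simp: lift_def)
  note z = singular_simplex_octic[OF \<sigma> l]
  have C: "C1_on H W" "C1_on B W" "open W" using P by (auto simp: primitive_def cone_open_def)
  define S' where "S' = g -` W \<inter> S"
  have oS': "open S'" unfolding S'_def
    by (rule continuous_on_open_vimage[OF C1_on_open[OF g], THEN iffD1, rule_format, OF C1_on_continuous_on[OF g] C(3)])
  have g': "C1_on g S'" using C1_on_subset[OF g oS'] by (auto simp: S'_def)
  have S': "triangle \<subseteq> S'" using S W by (auto simp: S'_def simp del: split_paired_All)
  have gW: "g p \<in> W" if "p \<in> S'" for p using that by (simp add: S'_def)
  have Hg: "C1_on (\<lambda>p. H (g p)) S'" "C1_on (\<lambda>p. B (g p)) S'"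
    using C1_on_compose[OF g' C(1) gW] C1_on_compose[OF g' C(2) gW] by auto
  have FDc: "FD (\<lambda>p. H (g p)) p v = FD H (g p) (FD g p v)" "FD (\<lambda>p. B (g p)) p v = FD B (g p) (FD g p v)" if "p \<in> S'" for p v
    using FD_compose[OF g' C(1) that gW[OF that]] FD_compose[OF g' C(2) that gW[OF that]] by auto
  have "simplex_integral t \<beta> \<sigma> = integral triangle (rform t \<beta> g)" by (rule simplex_integral_lift[OF \<beta> sm l z])
  also have "\<dots> = integral triangle (\<lambda>p. wedge (\<lambda>p. H (g p)) (\<lambda>p. B (g p)) p (1, 0) (0, 1))"
  proof (rule Henstock_Kurzweil_Integration.integral_cong)
    fix p assume p: "p \<in> triangle"
    then have pS: "p \<in> S'" using S' by blast
    show "rform t \<beta> g p = wedge (\<lambda>p. H (g p)) (\<lambda>p. B (g p)) p (1, 0) (0, 1)"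
      using P W[OF p] z[OF p] lift_tangent[OF l z p]
      unfolding rform_def wedge_def FDc[OF pS] primitive_def by (metis wedge_def)
  qed
  also have "\<dots> = lint (\<lambda>p. H (g p)) (\<lambda>p. B (g p)) (0, 0) (1, 0) + lint (\<lambda>p. H (g p)) (\<lambda>p. B (g p)) (1, 0) (0, 1) - lint (\<lambda>p. H (g p)) (\<lambda>p. B (g p)) (0, 0) (0, 1)"
    by (rule Stokes_triangle[OF Hg S'])
  finally have *: "simplex_integral t \<beta> \<sigma> = \<dots>" .
  have e: "edge_int H B f = lint (\<lambda>p. H (g p)) (\<lambda>p. B (g p)) x y"
    if xy: "x \<in> triangle" "y \<in> triangle" and f: "\<And>s. s \<in> {0..1} \<Longrightarrow> f (bary1 s) = \<sigma> (barycentric (x + s *\<^sub>R (y - x)))" for f x y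
  proof -
    have "edge_int H B f = path_int H B (\<lambda>s. g (x + s *\<^sub>R (y - x))) (\<lambda>s. FD g (x + s *\<^sub>R (y - x)) (y - x))"
    proof (rule edge_int_lift[OF P lift_edge_path[OF l xy]])
      fix s :: real assume s: "s \<in> {0..1}"
      show "g (x + s *\<^sub>R (y - x)) \<in> W \<and> f (bary1 s) = proj (g (x + s *\<^sub>R (y - x)))"
        using W[OF triangle_segment[OF xy s]] f[OF s] l triangle_segment[OF xy s] by (simp add: lift_def)
    qed
    also have "\<dots> = lint (\<lambda>p. H (g p)) (\<lambda>p. B (g p)) x y"
      unfolding path_int_def lint_def
    proof (rule Henstock_Kurzweil_Integration.integral_cong)
      fix s :: real assume s: "s \<in> {0..1}"
      have "x + s *\<^sub>R (y - x) \<in> S'" using triangle_segment[OF xy s] S' by blast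
      then show "H (g (x + s *\<^sub>R (y - x))) * FD B (g (x + s *\<^sub>R (y - x))) (FD g (x + s *\<^sub>R (y - x)) (y - x)) =
        H (g (x + s *\<^sub>R (y - x))) * FD (\<lambda>p. B (g p)) (x + s *\<^sub>R (y - x)) (y - x)" by (simp only: FDc)
    qed
    finally show ?thesis .
  qed
  have v: "(0, 0) \<in> triangle" "(1, 0) \<in> triangle" "(0, 1) \<in> triangle" by (auto simp: triangle_def)
  have "edge_int H B (singular_face 2 0 \<sigma>) = lint (\<lambda>p. H (g p)) (\<lambda>p. B (g p)) (1, 0) (0, 1)"
    by (rule e[OF v(2,3)], rule singular_face_bary1(1))
  moreover have "edge_int H B (singular_face 2 1 \<sigma>) = lint (\<lambda>p. H (g p)) (\<lambda>p. B (g p)) (0, 0) (0, 1)"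
    by (rule e[OF v(1,3)], rule singular_face_bary1(2))
  moreover have "edge_int H B (singular_face 2 2 \<sigma>) = lint (\<lambda>p. H (g p)) (\<lambda>p. B (g p)) (0, 0) (1, 0)"
    by (rule e[OF v(1,2)], rule singular_face_bary1(3))
  ultimately show ?thesis unfolding * by simp
qed

text \<open>With local primitives \<open>form = dH\<^sub>a \<and> dB\<^sub>a\<close>, two of the edge integrals
  \<open>\<integral> H\<^sub>a dB\<^sub>a\<close> and \<open>\<integral> H\<^sub>b dB\<^sub>b\<close> differ by \<open>F\<close>, evaluated at the end points. Up to edge terms, which
  cancel on cycles, the integral over a small simplex therefore equals a cochain \<open>\<Phi>\<close> that depends on the
  vertices only. It is defined for continuous simplices too, and it vanishes on boundaries.\<close>

lemma chain_integral_boundary: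
  assumes \<beta>: "\<beta> \<in> quartic_exps" and sm: "smooth_octic t" and w: "singular_chain 3 (octic_surface t) w"
    and C1: "\<And>\<sigma>. \<sigma> \<in> Poly_Mapping.keys (chain_boundary 3 w) \<Longrightarrow> C1_simplex \<sigma>"
  shows "chain_integral t \<beta> (chain_boundary 3 w) = 0"
proof -
  let ?X = "octic_surface t"
  have "\<exists>W H B. primitive t \<beta> W H B \<and> x \<in> W" if "x \<in> cone_points t" for x
  proof -
    have x: "x \<noteq> 0" "octic t x = 0" using that by (simp_all add: cone_points_def)
    show ?thesis
      by (rule chart_primitive_exist[OF sm \<beta> x cone_open_near[OF x(1), of 1]]) (use near_refl[OF x(1), of 1] in auto)
  qed
  then obtain W0 H0 B0 where 0: "\<And>x. x \<in> cone_points t \<Longrightarrow> primitive t \<beta> (W0 x) (H0 x) (B0 x) \<and> x \<in> W0 x" by metis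
  have "cone_open (W0 x) \<and> x \<in> W0 x" if "x \<in> cone_points t" for x using 0[OF that] by (simp add: primitive_def)
  from Lebesgue_near[OF this] obtain \<epsilon>0 where e0: "\<epsilon>0 > 0" "\<And>x. x \<in> cone_points t \<Longrightarrow> \<exists>y\<in>cone_points t. {z. near \<epsilon>0 x z} \<subseteq> W0 y" by blast
  then obtain ix where ix: "\<And>x. x \<in> cone_points t \<Longrightarrow> ix x \<in> cone_points t \<and> {z. near \<epsilon>0 x z} \<subseteq> W0 (ix x)" by metis
  define W H B where "W = (\<lambda>x. W0 (ix x))" and "H = (\<lambda>x. H0 (ix x))" and "B = (\<lambda>x. B0 (ix x))"
  have P: "primitive t \<beta> (W x) (H x) (B x)" if "x \<in> cone_points t" for x
    using 0 ix[OF that] by (simp add: W_def H_def B_def)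
  have WN: "z \<in> W x" if "x \<in> cone_points t" "near \<epsilon>0 x z" for x z using ix[OF that(1)] that(2) by (auto simp: W_def)
  \<comment> \<open>Three scales. Points within \<epsilon>0 of \<open>x\<close> lie in the domain of
    the potential attached to \<open>x\<close>; charts of size \<epsilon>0 / 2 compare two
    potentials on an \<epsilon>1-neighbourhood; charts of size \<epsilon>1 / 2 join two vertices by
    a differentiable path that stays in such a neighbourhood.\<close>
  obtain \<epsilon>1 where e1: "\<epsilon>1 > 0" "\<epsilon>1 \<le> \<epsilon>0 / 2" and ch1: "\<And>x. x \<in> cone_points t \<Longrightarrow> \<exists>N K \<Gamma> y. chart t N K \<Gamma> y \<and> {z. near \<epsilon>1 x z} \<subseteq> N \<and> (\<forall>k\<in>K. near (\<epsilon>0 / 2) x (\<Gamma> k))"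
    using small_charts[OF sm, of "\<epsilon>0 / 2"] e0(1) by (metis half_gt_zero)
  obtain \<epsilon>2 where e2: "\<epsilon>2 > 0" "\<epsilon>2 \<le> \<epsilon>1 / 2" and ch2: "\<And>x. x \<in> cone_points t \<Longrightarrow> \<exists>N K \<Gamma> y. chart t N K \<Gamma> y \<and> {z. near \<epsilon>2 x z} \<subseteq> N \<and> (\<forall>k\<in>K. near (\<epsilon>1 / 2) x (\<Gamma> k))"
    using small_charts[OF sm, of "\<epsilon>1 / 2"] e1(1) by (metis half_gt_zero)
  have "\<exists>F. (\<forall>z c. near \<epsilon>1 x z \<longrightarrow> c \<noteq> 0 \<longrightarrow> F (c *s z) = F z) \<and>
      (\<forall>\<gamma> \<gamma>'. smooth_path \<gamma> \<gamma>' \<longrightarrow> (\<forall>s\<in>{0..1}. near \<epsilon>1 x (\<gamma> s) \<and> octic t (\<gamma> s) = 0) \<longrightarrow>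
         path_int (H x) (B x) \<gamma> \<gamma>' - path_int (H x') (B x') \<gamma> \<gamma>' = F (\<gamma> 1) - F (\<gamma> 0))"
    if x: "x \<in> cone_points t" "x' \<in> cone_points t" "near (\<epsilon>0 / 2) x x'" for x x'
  proof -
    obtain N K \<Gamma> y where c: "chart t N K \<Gamma> y" "{z. near \<epsilon>1 x z} \<subseteq> N" "\<And>k. k \<in> K \<Longrightarrow> near (\<epsilon>0 / 2) x (\<Gamma> k)"
      using ch1[OF x(1)] by blast
    have "near \<epsilon>0 x (\<Gamma> k)" "near \<epsilon>0 x' (\<Gamma> k)" if "k \<in> K" for k
      using near_mono[OF c(3)[OF that], of \<epsilon>0] near_trans[OF near_sym[OF x(3)] c(3)[OF that]] e0(1) by auto
    then have "\<Gamma> ` K \<subseteq> W x" "\<Gamma> ` K \<subseteq> W x'" using WN x by blast+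
    then obtain F where "\<And>z c. z \<in> N \<Longrightarrow> c \<noteq> 0 \<Longrightarrow> F (c *s z) = F z"
      "\<And>\<gamma> \<gamma>'. smooth_path \<gamma> \<gamma>' \<Longrightarrow> (\<And>s. s \<in> {0..1} \<Longrightarrow> \<gamma> s \<in> N \<and> octic t (\<gamma> s) = 0) \<Longrightarrow>
       path_int (H x) (B x) \<gamma> \<gamma>' - path_int (H x') (B x') \<gamma> \<gamma>' = F (\<gamma> 1) - F (\<gamma> 0)"
      using primitive_difference[OF c(1) P[OF x(1)] _ P[OF x(2)]] by blast
    with c(2) show ?thesis by (intro exI[of _ F]) blast
  qed
  then obtain F where F: "\<And>x x'. x \<in> cone_points t \<Longrightarrow> x' \<in> cone_points t \<Longrightarrow> near (\<epsilon>0 / 2) x x' \<Longrightarrow>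
      (\<forall>z c. near \<epsilon>1 x z \<longrightarrow> c \<noteq> 0 \<longrightarrow> F x x' (c *s z) = F x x' z) \<and>
      (\<forall>\<gamma> \<gamma>'. smooth_path \<gamma> \<gamma>' \<longrightarrow> (\<forall>s\<in>{0..1}. near \<epsilon>1 x (\<gamma> s) \<and> octic t (\<gamma> s) = 0) \<longrightarrow>
         path_int (H x) (B x) \<gamma> \<gamma>' - path_int (H x') (B x') \<gamma> \<gamma>' = F x x' (\<gamma> 1) - F x x' (\<gamma> 0))"
    by metis
  \<comment> \<open>\<open>F\<close> is invariant under scalars, so the ends of the path may be
    replaced by other representatives of the same points.\<close>
  have Fpath: "path_int (H x) (B x) \<gamma> \<gamma>' - path_int (H x') (B x') \<gamma> \<gamma>' = F x x' z1 - F x x' z0"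
    if "x \<in> cone_points t" "x' \<in> cone_points t" "near (\<epsilon>0 / 2) x x'" "smooth_path \<gamma> \<gamma>'"
      "\<And>s. s \<in> {0..1} \<Longrightarrow> near \<epsilon>1 x (\<gamma> s) \<and> octic t (\<gamma> s) = 0"
      "proj (\<gamma> 0) = proj z0" "proj (\<gamma> 1) = proj z1" for x x' \<gamma> \<gamma>' z0 z1
  proof -
    have "F x x' z0 = F x x' (\<gamma> 0)" "F x x' z1 = F x x' (\<gamma> 1)"
      using F[OF that(1,2,3)] that(5)[of 0] that(5)[of 1] that(6,7) unfolding proj_eq_iff by auto
    then show ?thesis using F[OF that(1,2,3)] that(4,5) by metis
  qed
  define v where "v = (\<lambda>i (\<sigma> :: (nat \<Rightarrow> real) \<Rightarrow> (complex^4) set). rep (simplicial_vertex i \<sigma>))"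
  \<comment> \<open>The change, from the second to the third vertex, of the function comparing the
    potentials at the first two vertices.\<close>
  define \<Phi> where "\<Phi> = (\<lambda>\<sigma>. F (v 0 \<sigma>) (v 1 \<sigma>) (v 2 \<sigma>) - F (v 0 \<sigma>) (v 1 \<sigma>) (v 1 \<sigma>))"
  \<comment> \<open>Each edge uses the potential at its own first vertex, a choice that does not
    refer to the triangle.\<close>
  define E where "E = (\<lambda>e. edge_int (H (v 0 e)) (B (v 0 e)) e)"
  define small where "small = (\<lambda>p (\<sigma> :: (nat \<Rightarrow> real) \<Rightarrow> (complex^4) set). \<forall>s\<in>standard_simplex p. \<forall>s'\<in>standard_simplex p. near \<epsilon>2 (rep (\<sigma> s)) (rep (\<sigma> s')))"
  have vert: "v i \<sigma> \<in> cone_points t" "proj (v i \<sigma>) = simplicial_vertex i \<sigma>" if "singular_simplex p ?X \<sigma>" "i \<le> p" for p i \<sigma>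
  proof -
    have "simplicial_vertex i \<sigma> \<in> octic_points t"
      using that by (auto simp: singular_simplex_subtopology octic_surface_def simplicial_vertex_def)
    then show "v i \<sigma> \<in> cone_points t" "proj (v i \<sigma>) = simplicial_vertex i \<sigma>" using rep_octic_points by (auto simp: v_def)
  qed
  have vnear: "near \<epsilon>2 (v i \<sigma>) (v j \<sigma>)" if "small p \<sigma>" "i \<le> p" "j \<le> p" for p i j \<sigma>
    using that by (simp add: small_def v_def simplicial_vertex_def)
  have mono: "near \<epsilon>1 x y" "near (\<epsilon>0 / 2) x y" "near \<epsilon>0 x y" if "near \<epsilon>2 x y" for x y
    using near_mono[OF that] e0(1) e1 e2 by auto
  \<comment> \<open>Stokes with the potential of the first vertex. On the opposite edge this
    potential is exchanged for that of the second vertex at the cost of \<open>\<Phi>\<close>; the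
    other two edges already start at the first vertex.\<close>
  have claim1: "simplex_integral t \<beta> \<sigma> = (\<Sum>k\<le>2. (-1) ^ k * E (singular_face 2 k \<sigma>)) + \<Phi> \<sigma>"
    if \<sigma>: "singular_simplex 2 ?X \<sigma>" "C1_simplex \<sigma>" "small 2 \<sigma>" for \<sigma>
  proof -
    obtain g S where l: "lift \<sigma> g S" using \<sigma>(2) C1_simplex_iff by blast
    note z = singular_simplex_octic[OF \<sigma>(1) l]
    define a b c where "a = v 0 \<sigma>" and "b = v 1 \<sigma>" and "c = v 2 \<sigma>"
    have abc: "a \<in> cone_points t" "b \<in> cone_points t" using vert[OF \<sigma>(1)] by (auto simp: a_def b_def)
    have ng: "near \<epsilon>2 (v i \<sigma>) (g p)" if "p \<in> triangle" "i \<le> 2" for p i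
    proof -
      have "near \<epsilon>2 (v i \<sigma>) (rep (\<sigma> (barycentric p)))"
        using \<sigma>(3) barycentric_simplex[OF that(1)] that(2) by (simp add: small_def v_def simplicial_vertex_def)
      then show ?thesis using l that(1) near_rep by (simp add: lift_def)
    qed
    have gW: "g p \<in> W a" "g p \<in> W b" if "p \<in> triangle" for p
      using WN[OF abc(1) mono(3)] WN[OF abc(2) mono(3)] ng[OF that, of 0] ng[OF that, of 1] by (auto simp: a_def b_def)
    have 1: "simplex_integral t \<beta> \<sigma> = edge_int (H a) (B a) (singular_face 2 0 \<sigma>) - edge_int (H a) (B a) (singular_face 2 1 \<sigma>) + edge_int (H a) (B a) (singular_face 2 2 \<sigma>)"
      by (rule simplex_integral_primitive[OF \<beta> sm \<sigma>(1) l P[OF abc(1)] gW(1)])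
    have vf: "v 0 (singular_face 2 0 \<sigma>) = b" "v 0 (singular_face 2 1 \<sigma>) = a" "v 0 (singular_face 2 2 \<sigma>) = a"
      by (simp_all add: v_def a_def b_def simplicial_vertex_face)
    let ?g = "\<lambda>s. g ((1, 0) + s *\<^sub>R ((0, 1) - (1, 0)))" and ?g' = "\<lambda>s. FD g ((1, 0) + s *\<^sub>R ((0, 1) - (1, 0))) ((0, 1) - (1, 0))"
    have T: "(1, 0) \<in> triangle" "(0, 1) \<in> triangle" by (auto simp: triangle_def)
    have sp: "smooth_path ?g ?g'" by (rule lift_edge_path[OF l T])
    have e: "edge_int (H x) (B x) (singular_face 2 0 \<sigma>) = path_int (H x) (B x) ?g ?g'" if "x \<in> cone_points t" "\<And>p. p \<in> triangle \<Longrightarrow> g p \<in> W x" for x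
    proof (rule edge_int_lift[OF P[OF that(1)] sp])
      fix s :: real assume s: "s \<in> {0..1}"
      have "\<forall>p\<in>triangle. \<sigma> (barycentric p) = proj (g p)" using l by (simp add: lift_def)
      then show "?g s \<in> W x \<and> singular_face 2 0 \<sigma> (bary1 s) = proj (?g s)"
        unfolding singular_face_bary1(1)[OF s] using that(2) triangle_segment[OF T s] by blast
    qed
    have pv: "proj (?g 0) = proj b" "proj (?g 1) = proj c"
    proof -
      have e: "barycentric (1, 0) = (\<lambda>j. if j = 1 then 1 else 0)" "barycentric (0, 1) = (\<lambda>j. if j = 2 then 1 else 0)"
        by (auto simp: barycentric_def)
      have "proj (g (1, 0)) = simplicial_vertex 1 \<sigma>" "proj (g (0, 1)) = simplicial_vertex 2 \<sigma>"
        using l T unfolding lift_def simplicial_vertex_def e[symmetric] by auto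
      then show "proj (?g 0) = proj b" "proj (?g 1) = proj c" using vert(2)[OF \<sigma>(1)] by (simp_all add: b_def c_def)
    qed
    have "path_int (H a) (B a) ?g ?g' - path_int (H b) (B b) ?g ?g' = F a b c - F a b b"
    proof (rule Fpath[OF abc _ sp _ pv])
      show "near (\<epsilon>0 / 2) a b" using mono(2)[OF vnear[OF \<sigma>(3)]] by (simp add: a_def b_def)
      fix s :: real assume s: "s \<in> {0..1}"
      show "near \<epsilon>1 a (?g s) \<and> octic t (?g s) = 0"
        using mono(1)[OF ng[OF triangle_segment[OF T s], of 0]] z[OF triangle_segment[OF T s]] by (simp add: a_def)
    qed
    then have "edge_int (H a) (B a) (singular_face 2 0 \<sigma>) = edge_int (H b) (B b) (singular_face 2 0 \<sigma>) + F a b c - F a b b"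
      using e[OF abc(1) gW(1)] e[OF abc(2) gW(2)] by (simp add: algebra_simps)
    then show ?thesis
      unfolding 1 by (simp add: numeral_2_eq_2 E_def vf[unfolded numeral_2_eq_2 One_nat_def] \<Phi>_def a_def b_def c_def)
  qed
  \<comment> \<open>The edge of \<open>\<tau>\<close> from \<open>c\<close> to \<open>d\<close> is
    only continuous, so a differentiable path between these points is drawn in a chart. The faces
    then contribute differences of its integrals for the potentials at \<open>a\<close>,
    \<open>b\<close> and \<open>c\<close>, which cancel in pairs.\<close>
  have claim2: "(\<Sum>k\<le>3. (-1) ^ k * \<Phi> (singular_face 3 k \<tau>)) = 0"
    if \<tau>: "singular_simplex 3 ?X \<tau>" "small 3 \<tau>" for \<tau>
  proof -
    define a b c d where "a = v 0 \<tau>" and "b = v 1 \<tau>" and "c = v 2 \<tau>" and "d = v 3 \<tau>"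
    have cp: "a \<in> cone_points t" "b \<in> cone_points t" "c \<in> cone_points t" "d \<in> cone_points t"
      using vert(1)[OF \<tau>(1)] by (simp_all add: a_def b_def c_def d_def)
    have nr: "near \<epsilon>2 a b" "near \<epsilon>2 a c" "near \<epsilon>2 b c" "near \<epsilon>2 c d" 
      using vnear[OF \<tau>(2)] by (simp_all add: a_def b_def c_def d_def)
    obtain N K \<Gamma> y where ch: "chart t N K \<Gamma> y" "{z. near \<epsilon>2 c z} \<subseteq> N" "\<And>k. k \<in> K \<Longrightarrow> near (\<epsilon>1 / 2) c (\<Gamma> k)"
      using ch2[OF cp(3)] by blast
    have K: "convex K" "C1_on \<Gamma> K" using ch(1) by (auto simp: chart_def)
    have "c \<in> N" "d \<in> N" using ch(2) nr(4) near_refl[of c \<epsilon>2] e2(1) cp(3) by (auto simp: cone_points_def)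
    then have yK: "y c \<in> K" "y d \<in> K" and pr: "\<exists>k. k \<noteq> 0 \<and> c = k *s \<Gamma> (y c)" "\<exists>k. k \<noteq> 0 \<and> d = k *s \<Gamma> (y d)"
      using ch(1) cp(3,4) unfolding chart_def cone_points_def by blast+
    define \<gamma> where "\<gamma> = (\<lambda>s. \<Gamma> (y c + s *\<^sub>R (y d - y c)))"
    define \<gamma>' where "\<gamma>' = (\<lambda>s. FD \<Gamma> (y c + s *\<^sub>R (y d - y c)) (y d - y c))"
    have inK: "y c + s *\<^sub>R (y d - y c) \<in> K" if "s \<in> {0..1}" for s
      using convexD_alt[OF K(1) yK, of s] that by (simp add: algebra_simps)
    have sp: "smooth_path \<gamma> \<gamma>'" unfolding smooth_path_def
    proof (intro conjI ballI)
      show "(\<gamma> has_vector_derivative \<gamma>' s) (at s)" if "s \<in> {0..1}" for s unfolding \<gamma>_def \<gamma>'_def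
        by (rule has_vector_derivative_compose_C1[where \<gamma> = "\<lambda>s. y c + s *\<^sub>R (y d - y c)", OF K(2) _ inK[OF that]]) (auto intro!: derivative_eq_intros)
      show "continuous_on {0..1} \<gamma>'" unfolding \<gamma>'_def
        by (rule continuous_on_FD[OF K(2)]) (use inK in \<open>auto intro!: continuous_intros\<close>)
    qed
    have oct: "octic t (\<gamma> s) = 0" and nc: "near (\<epsilon>1 / 2) c (\<gamma> s)" if "s \<in> {0..1}" for s
      using inK[OF that] ch unfolding chart_def \<gamma>_def by blast+
    have na: "near \<epsilon>1 x (\<gamma> s)" if "near \<epsilon>2 x c" "s \<in> {0..1}" for x s
      using near_mono[OF near_trans[OF that(1) nc[OF that(2)]], of \<epsilon>1] e2(2) by simp
    have pe: "proj (\<gamma> 0) = proj c" "proj (\<gamma> 1) = proj d" using pr by (simp_all add: \<gamma>_def proj_eq_iff)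
    have p1: "path_int (H a) (B a) \<gamma> \<gamma>' - path_int (H b) (B b) \<gamma> \<gamma>' = F a b d - F a b c"
      by (rule Fpath[OF cp(1,2) mono(2)[OF nr(1)] sp _ pe]) (use na nr(2) oct in blast)
    have p2: "path_int (H a) (B a) \<gamma> \<gamma>' - path_int (H c) (B c) \<gamma> \<gamma>' = F a c d - F a c c"
      by (rule Fpath[OF cp(1,3) mono(2)[OF nr(2)] sp _ pe]) (use na nr(2) oct in blast)
    have p3: "path_int (H b) (B b) \<gamma> \<gamma>' - path_int (H c) (B c) \<gamma> \<gamma>' = F b c d - F b c c"
      by (rule Fpath[OF cp(2,3) mono(2)[OF nr(3)] sp _ pe]) (use na nr(3) oct in blast)
    have f: "\<Phi> (singular_face 3 0 \<tau>) = F b c d - F b c c" "\<Phi> (singular_face 3 1 \<tau>) = F a c d - F a c c"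
      "\<Phi> (singular_face 3 2 \<tau>) = F a b d - F a b b" "\<Phi> (singular_face 3 3 \<tau>) = F a b c - F a b b"
      by (simp_all add: \<Phi>_def v_def simplicial_vertex_face a_def b_def c_def d_def eval_nat_numeral)
    have "(\<Sum>k\<le>3. (-1) ^ k * \<Phi> (singular_face 3 k \<tau>)) = \<Phi> (singular_face 3 0 \<tau>) - \<Phi> (singular_face 3 1 \<tau>) + \<Phi> (singular_face 3 2 \<tau>) - \<Phi> (singular_face 3 3 \<tau>)"
    proof -
      have "{..3 :: nat} = {0, 1, 2, 3}" by auto
      then show ?thesis by simp
    qed
    also have "\<dots> = (F b c d - F b c c) - (F a c d - F a c c) + (F a b d - F a b c)" unfolding f by simp
    also have "\<dots> = 0" unfolding p1[symmetric] p2[symmetric] p3[symmetric] by simp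
    finally show ?thesis .
  qed
  define U where "U = (\<lambda>x. {q \<in> octic_points t. near (\<epsilon>2 / 2) x (rep q)})"
  have opn: "openin ?X (U x)" if x: "x \<in> cone_points t" for x
  proof -
    have "x \<noteq> 0" using x by (simp add: cone_points_def)
    define T where "T = proj ` {z. near (\<epsilon>2 / 2) x z}"
    have e: "{z. z \<noteq> 0 \<and> proj z \<in> T} = {z. near (\<epsilon>2 / 2) x z}"
    proof (intro equalityI subsetI CollectI)
      fix z assume "z \<in> {z. z \<noteq> 0 \<and> proj z \<in> T}"
      then obtain z' where z': "near (\<epsilon>2 / 2) x z'" "proj z' = proj z" by (auto simp: T_def)
      then obtain c where "c \<noteq> 0" "z = c *s z'" unfolding proj_eq_iff by blast
      then show "near (\<epsilon>2 / 2) x z" using near_scale[OF z'(1)] by simp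
    qed (use near_nonzero in \<open>auto simp: T_def\<close>)
    have "openin P3 T" unfolding openin_P3 e using cone_open_near[OF \<open>x \<noteq> 0\<close>, of "\<epsilon>2 / 2"] near_nonzero by (auto simp: T_def cone_open_def)
    moreover have "U x = T \<inter> octic_points t"
    proof -
      have "near (\<epsilon>2 / 2) x (rep q) \<longleftrightarrow> q \<in> T" if "q \<in> octic_points t" for q
        using rep_octic_points[OF that] e unfolding cone_points_def by (metis (mono_tags, lifting) mem_Collect_eq)
      then show ?thesis by (auto simp: U_def)
    qed
    ultimately show ?thesis unfolding octic_surface_def openin_subtopology by blast
  qed
  have cover: "topspace ?X \<subseteq> \<Union>(U ` cone_points t)"
  proof
    fix q assume "q \<in> topspace ?X"
    then have q: "q \<in> octic_points t" by (simp add: octic_surface_def)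
    then have "q \<in> U (rep q)" using near_refl[of "rep q" "\<epsilon>2 / 2"] e2(1) rep_octic_points(1)[OF q] by (simp add: U_def cone_points_def)
    then show "q \<in> \<Union>(U ` cone_points t)" using rep_octic_points(1)[OF q] by blast
  qed
  have smallU: "small p f" if "f \<in> standard_simplex p \<rightarrow> U x" for p f x
    unfolding small_def
  proof (intro ballI)
    fix s s' assume "s \<in> standard_simplex p" "s' \<in> standard_simplex p"
    then have "near (\<epsilon>2 / 2) x (rep (f s))" "near (\<epsilon>2 / 2) x (rep (f s'))" using that by (auto simp: U_def)
    then show "near \<epsilon>2 (rep (f s)) (rep (f s'))" using near_trans[OF near_sym] by fastforce
  qed
  define z where "z = chain_boundary 3 w"
  have z: "singular_chain 2 ?X z" unfolding z_def using singular_chain_boundary[OF w] by simp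
  obtain n1 where n1: "\<And>m f. n1 \<le> m \<Longrightarrow> f \<in> Poly_Mapping.keys ((singular_subdivision 2 ^^ m) z) \<Longrightarrow> \<exists>V\<in>U ` cone_points t. f \<in> standard_simplex 2 \<rightarrow> V"
    using sufficient_iterated_singular_subdivision_exists[OF _ cover z] opn by blast
  obtain n2 where n2: "\<And>m f. n2 \<le> m \<Longrightarrow> f \<in> Poly_Mapping.keys ((singular_subdivision 3 ^^ m) w) \<Longrightarrow> \<exists>V\<in>U ` cone_points t. f \<in> standard_simplex 3 \<rightarrow> V"
    using sufficient_iterated_singular_subdivision_exists[OF _ cover w] opn by blast
  \<comment> \<open>The same number of subdivisions for both chains, so that the first remains the
    boundary of the second.\<close>
  define n where "n = max n1 n2"
  let ?z = "(singular_subdivision 2 ^^ n) z" and ?w = "(singular_subdivision 3 ^^ n) w"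
  have zw: "singular_chain 3 ?X ((singular_subdivision 3 ^^ m) w) \<and> (singular_subdivision 2 ^^ m) z = chain_boundary 3 ((singular_subdivision 3 ^^ m) w)" for m
  proof (induction m)
    case (Suc m)
    then show ?case
      using singular_chain_singular_subdivision[of 3 ?X "(singular_subdivision 3 ^^ m) w"]
        chain_boundary_singular_subdivision[of 3 ?X "(singular_subdivision 3 ^^ m) w"] by simp
  qed (simp add: w z_def)
  note S = chain_integral_subdivision[OF \<beta> sm z C1[folded z_def], of n]
  have "chain_integral t \<beta> z = frag_ext (\<lambda>\<sigma>. simplex_integral t \<beta> \<sigma>) ?z" using S by (simp add: chain_integral_eq)
  also have "\<dots> = frag_ext (\<lambda>\<sigma>. (\<Sum>k\<le>2. (-1) ^ k * E (singular_face 2 k \<sigma>)) + \<Phi> \<sigma>) ?z"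
  proof (rule frag_ext_cong)
    fix \<sigma> assume \<sigma>: "\<sigma> \<in> Poly_Mapping.keys ?z"
    have "small 2 \<sigma>" using n1[OF _ \<sigma>] smallU by (auto simp: n_def)
    then show "simplex_integral t \<beta> \<sigma> = (\<Sum>k\<le>2. (-1) ^ k * E (singular_face 2 k \<sigma>)) + \<Phi> \<sigma>"
      using S \<sigma> by (intro claim1) (auto simp: singular_chain_def)
  qed
  also have "\<dots> = frag_ext (\<lambda>\<sigma>. \<Sum>k\<le>2. (-1) ^ k * E (singular_face 2 k \<sigma>)) ?z + frag_ext \<Phi> ?z"
    unfolding frag_ext_def by (simp add: distrib_left sum.distrib)
  also have "frag_ext (\<lambda>\<sigma>. \<Sum>k\<le>2. (-1) ^ k * E (singular_face 2 k \<sigma>)) ?z = frag_ext E (chain_boundary 2 ?z)"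
    by (rule frag_ext_boundary[symmetric]) simp
  also have "chain_boundary 2 ?z = 0" using zw[of n] chain_boundary_boundary_alt[of 2 ?X ?w] by (simp add: eval_nat_numeral)
  also have "frag_ext \<Phi> ?z = frag_ext (\<lambda>\<tau>. \<Sum>k\<le>3. (-1) ^ k * \<Phi> (singular_face 3 k \<tau>)) ?w"
    using zw[of n] by (simp add: frag_ext_boundary)
  also have "\<dots> = frag_ext (\<lambda>_. 0) ?w"
  proof (rule frag_ext_cong)
    fix \<tau> assume \<tau>: "\<tau> \<in> Poly_Mapping.keys ?w"
    have "small 3 \<tau>" using n2[OF _ \<tau>] smallU by (auto simp: n_def)
    then show "(\<Sum>k\<le>3. (-1) ^ k * \<Phi> (singular_face 3 k \<tau>)) = 0"
      using zw[of n] \<tau> by (intro claim2) (auto simp: singular_chain_def)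
  qed
  also have "\<dots> = 0" by (simp add: frag_ext_def)
  finally show ?thesis by (simp add: z_def)
qed

text \<open>Two differentiable cycles in one class differ by the boundary of a continuous chain, on
  which the integral vanishes; so the definite description in \<open>period\<close> is met by any
  such cycle.\<close>

lemma period_eq:
  assumes \<beta>: "\<beta> \<in> quartic_exps" and sm: "smooth_octic t"
    and z: "singular_relcycle 2 (octic_surface t) {} z" and C1: "\<And>\<sigma>. \<sigma> \<in> Poly_Mapping.keys z \<Longrightarrow> C1_simplex \<sigma>"
  shows "period t \<beta> (homologous_rel_set 2 (octic_surface t) {} z) = chain_integral t \<beta> z"
  unfolding period_def
proof (rule the_equality)
  let ?X = "octic_surface t"
  show "\<exists>z'. singular_relcycle 2 ?X {} z' \<and> (\<forall>\<sigma>\<in>Poly_Mapping.keys z'. C1_simplex \<sigma>) \<and>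
     homologous_rel_set 2 ?X {} z = homologous_rel_set 2 ?X {} z' \<and> chain_integral t \<beta> z = chain_integral t \<beta> z'"
    using z C1 by blast
  fix I assume "\<exists>z'. singular_relcycle 2 ?X {} z' \<and> (\<forall>\<sigma>\<in>Poly_Mapping.keys z'. C1_simplex \<sigma>) \<and>
     homologous_rel_set 2 ?X {} z = homologous_rel_set 2 ?X {} z' \<and> I = chain_integral t \<beta> z'"
  then obtain z' where z': "singular_relcycle 2 ?X {} z'" "\<And>\<sigma>. \<sigma> \<in> Poly_Mapping.keys z' \<Longrightarrow> C1_simplex \<sigma>"
    "homologous_rel_set 2 ?X {} z = homologous_rel_set 2 ?X {} z'" "I = chain_integral t \<beta> z'" by blast
  have "singular_relboundary 2 ?X {} (z - z')"
    using z'(3) unfolding homologous_rel_set_eq by (simp add: homologous_rel_def)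
  moreover have e: "Suc 2 = 3" by simp
  ultimately obtain w where w: "singular_chain 3 ?X w" "chain_boundary 3 w = z - z'"
    unfolding singular_boundary e by blast
  have "chain_integral t \<beta> (chain_boundary 3 w) = 0"
  proof (rule chain_integral_boundary[OF \<beta> sm w(1)])
    fix \<sigma> assume "\<sigma> \<in> Poly_Mapping.keys (chain_boundary 3 w)"
    then have "\<sigma> \<in> Poly_Mapping.keys z \<union> Poly_Mapping.keys z'" unfolding w(2) by (rule subsetD[OF keys_diff])
    then show "C1_simplex \<sigma>" using C1 z'(2) by blast
  qed
  then show "I = chain_integral t \<beta> z" by (simp add: w(2) z'(4) chain_integral_eq frag_ext_diff)
qed

section \<open>A retraction onto nearby octic surfaces\<close>

text \<open>The conjugate gradient of the Fermat octic is transversal to its cone, and scales so that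
  moving along it defines a map of projective space.\<close>

definition normal_field :: "complex^4 \<Rightarrow> complex^4" where
  "normal_field x = (\<chi> i. cnj (x $ i) ^ 7)"

lemma normal_field_scale: "normal_field (c *s x) = cnj c ^ 7 *s normal_field x"
  by (simp add: normal_field_def vec_eq_iff power_mult_distrib)

lemma C1_on_normal_field: "C1_on h S \<Longrightarrow> C1_on (\<lambda>z. normal_field (h z)) S"
  unfolding normal_field_def by (intro C1_on_vec_lambda C1_intros C1_on_open[of h])

lemma continuous_on_scale [continuous_intros]:
  fixes c :: "'a::topological_space \<Rightarrow> complex" and f :: "'a \<Rightarrow> complex^'n"
  assumes "continuous_on S c" "continuous_on S f"
  shows "continuous_on S (\<lambda>x. c x *s f x)"
  unfolding vector_scalar_mult_def by (intro continuous_on_vec_lambda continuous_intros assms)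

lemma continuous_on_normal_field: "continuous_on S h \<Longrightarrow> continuous_on S (\<lambda>z. normal_field (h z))"
  unfolding normal_field_def by (intro continuous_on_vec_lambda continuous_intros)

text \<open>The value is positive for nonzero \<open>x\<close>, which is the transversality to the
  cone; it reappears as the denominator in \<open>line_density\<close>.\<close>

lemma octic_deriv_normal_field: "octic_deriv 0 x (normal_field x) = of_real (8 * (\<Sum>i\<in>UNIV. cmod (x $ i) ^ 14))"
proof -
  have "z ^ 7 * cnj z ^ 7 = of_real (cmod z ^ 14)" for z
  proof -
    have "z ^ 7 * cnj z ^ 7 = (z * cnj z) ^ 7" by (simp add: power_mult_distrib)
    also have "\<dots> = of_real ((cmod z)\<^sup>2 ^ 7)" by (simp only: complex_norm_square[symmetric] of_real_power)
    finally show ?thesis by (simp flip: power_mult)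
  qed
  then show ?thesis by (simp add: octic_deriv_def normal_field_def mult.assoc sum_distrib_left)
qed

lemma sum_power_pos: assumes "(x :: complex^4) \<noteq> 0" shows "0 < (\<Sum>i\<in>UNIV. cmod (x $ i) ^ 14)"
proof -
  obtain i where "x $ i \<noteq> 0" using assms by (auto simp: vec_eq_iff)
  then show ?thesis by (intro sum_pos2[of _ i]) auto
qed

lemma C1_on_local:
  assumes "\<And>x. x \<in> S \<Longrightarrow> \<exists>Z. x \<in> Z \<and> C1_on f Z"
    and "open S"
  shows "C1_on f S"
  unfolding C1_on_def
proof (intro conjI ballI allI)
  show "f differentiable (at x)" if "x \<in> S" for x using assms(1)[OF that] by (auto simp: C1_on_def)
  show "continuous_on S (\<lambda>x. FD f x v)" for v
  proof (rule continuous_at_imp_continuous_on, intro ballI)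
    fix x assume "x \<in> S"
    then obtain Z where Z: "x \<in> Z" "C1_on f Z" using assms(1) by blast
    then show "continuous (at x) (\<lambda>x. FD f x v)"
      using C1_on_FD_continuous[OF Z(2)] C1_on_open[OF Z(2)] by (simp add: continuous_on_eq_continuous_at)
  qed
qed fact

section \<open>Small roots of nearby octics along the normal field\<close>

lemma compact_unit_sphere: "compact {x :: complex^4. norm x = 1}"
  using compact_sphere[of "0 :: complex^4" 1] by (simp add: sphere_def dist_norm)

text \<open>Compactness of the sphere makes continuity in the first argument uniform in the
  second.\<close>

lemma uniform_on_sphere:
  fixes h :: "'a::real_normed_vector \<times> (complex^4) \<Rightarrow> 'b::metric_space"
  assumes "continuous_on UNIV h" "e > 0"
  obtains r where "r > 0" "\<And>z x. norm z < r \<Longrightarrow> norm x = 1 \<Longrightarrow> dist (h (z, x)) (h (0, x)) \<le> e"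
proof -
  have "continuous_on (UNIV \<times> {x :: complex^4. norm x = 1}) h" using assms(1) by (rule continuous_on_subset) simp
  from continuous_on_prod_compactE[OF this compact_unit_sphere UNIV_I assms(2)]
  obtain X0 where X0: "0 \<in> X0" "open X0" "\<forall>z\<in>X0 \<inter> UNIV. \<forall>x\<in>{x. norm x = 1}. dist (h (z, x)) (h (0, x)) \<le> e" by blast
  obtain r where "r > 0" "ball 0 r \<subseteq> X0" using X0 open_contains_ball by blast
  with X0(3) show thesis by (intro that[of r]) (auto simp: dist_norm subset_iff)
qed

text \<open>A simplified Newton iteration: \<open>G\<close> subtracts the value of the octic divided
  by \<open>c x\<close>, the fixed derivative at l = 0 and t = 0. On the unit sphere
  \<open>c\<close> has a positive minimum \<open>c0\<close>, so for small parameters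
  \<open>G\<close> contracts by the factor 1/2 and has exactly one fixed point.\<close>

lemma nearby_roots:
  obtains \<rho> \<delta> \<epsilon> :: real where "\<rho> > 0" "\<delta> > 0" "\<epsilon> > 0"
    "\<And>t x. norm t < \<epsilon> \<Longrightarrow> norm x = 1 \<Longrightarrow> cmod (octic 0 x) < \<delta> \<Longrightarrow> \<exists>!l. cmod l < \<rho> \<and> octic t (x + l *s normal_field x) = 0"
    "\<And>t x l. norm t < \<epsilon> \<Longrightarrow> norm x = 1 \<Longrightarrow> cmod l < \<rho> \<Longrightarrow> octic_deriv t (x + l *s normal_field x) (normal_field x) \<noteq> 0 \<and> x + l *s normal_field x \<noteq> 0"
    "\<And>t x. norm t < \<epsilon> \<Longrightarrow> norm x = 1 \<Longrightarrow> octic t x = 0 \<Longrightarrow> cmod (octic 0 x) < \<delta>"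
proof -
  let ?S = "{x :: complex^4. norm x = 1}"
  define c where "c = (\<lambda>x. 8 * (\<Sum>i\<in>UNIV. cmod ((x :: complex^4) $ i) ^ 14))"
  have cd: "octic_deriv 0 x (normal_field x) = of_real (c x)" for x by (simp add: c_def octic_deriv_normal_field)
  have cpos: "c x > 0" if "norm x = 1" for x using sum_power_pos[of x] that by (fastforce simp: c_def)
  have cc: "continuous_on ?S c" unfolding c_def by (intro continuous_intros)
  have "axis 0 1 \<in> ?S" by (simp add: norm_axis_1)
  then obtain m where m: "norm m = 1" "\<And>x. norm x = 1 \<Longrightarrow> c m \<le> c x"
    using continuous_attains_inf[OF compact_unit_sphere _ cc] by blast
  define c0 where "c0 = c m"
  have c0: "c0 > 0" "\<And>x. norm x = 1 \<Longrightarrow> c0 \<le> c x" using m cpos by (auto simp: c0_def)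
  let ?y = "\<lambda>p :: (param \<times> complex) \<times> (complex^4). snd p + snd (fst p) *s normal_field (snd p)"
  have cy: "continuous_on UNIV ?y" by (intro continuous_intros continuous_on_normal_field)
  obtain r1 where r1: "r1 > 0" "\<And>(z :: param \<times> complex) x. norm z < r1 \<Longrightarrow> norm x = 1 \<Longrightarrow> dist (octic_deriv (fst z) (x + snd z *s normal_field x) (normal_field x)) (octic_deriv 0 x (normal_field x)) \<le> c0 / 2"
  proof (rule uniform_on_sphere[of "\<lambda>p. octic_deriv (fst (fst p)) (?y p) (normal_field (snd p))" "c0 / 2"])
    show "continuous_on UNIV (\<lambda>p. octic_deriv (fst (fst p)) (?y p) (normal_field (snd p)))"
      by (intro continuous_on_octic_deriv cy continuous_on_normal_field continuous_intros)
  qed (use c0 that in auto)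
  obtain r2 where r2: "r2 > 0" "\<And>(z :: param \<times> complex) x. norm z < r2 \<Longrightarrow> norm x = 1 \<Longrightarrow> dist (x + snd z *s normal_field x) x \<le> 1 / 2"
  proof (rule uniform_on_sphere[of ?y "1 / 2"])
    fix r :: real assume "r > 0" "\<And>(z :: param \<times> complex) x. norm z < r \<Longrightarrow> norm x = 1 \<Longrightarrow> dist (?y (z, x)) (?y (0, x)) \<le> 1 / 2"
    then show thesis using that[of r] by simp
  qed (use cy in auto)
  define \<rho> where "\<rho> = min r1 r2 / 2"
  have \<rho>: "\<rho> > 0" using r1 r2 by (simp add: \<rho>_def)
  \<comment> \<open>Makes the value of the octic divided by \<open>c x\<close> at most 2 \<delta> /
    c0 = \<rho> / 4 at the start of the iteration, so that the ball of radius \<rho> / 2 is mapped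
    into itself.\<close>
  define \<delta> where "\<delta> = \<rho> * c0 / 8"
  have \<delta>: "\<delta> > 0" using \<rho> c0 by (simp add: \<delta>_def)
  obtain r3 where r3: "r3 > 0" "\<And>z x. norm z < r3 \<Longrightarrow> norm x = 1 \<Longrightarrow> dist (octic z x) (octic 0 x) \<le> \<delta> / 2"
  proof (rule uniform_on_sphere[of "\<lambda>p. octic (fst p) (snd p)" "\<delta> / 2"])
    show "continuous_on UNIV (\<lambda>p. octic (fst p) (snd p))" by (intro continuous_on_octic continuous_intros)
  qed (use \<delta> that in auto)
  define \<epsilon> where "\<epsilon> = min (min r1 r2 / 2) r3"
  have \<epsilon>: "\<epsilon> > 0" using r1 r2 r3 by (simp add: \<epsilon>_def)
  have nz: "norm (t, l) < r1 \<and> norm (t, l) < r2" if "norm t < \<epsilon>" "cmod l < \<rho>" for t :: param and l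
    using norm_Pair_le[of t l] that by (simp add: \<epsilon>_def \<rho>_def)
  have A: "cmod (octic_deriv t (x + l *s normal_field x) (normal_field x) - of_real (c x)) \<le> c0 / 2"
    if "norm t < \<epsilon>" "norm x = 1" "cmod l < \<rho>" for t x l
    using r1(2)[of "(t, l)" x] nz[OF that(1,3)] that(2) cd by (simp add: dist_norm)
  show thesis
  proof (rule that[OF \<rho> \<delta> \<epsilon>])
    fix t :: param and x :: "complex^4" assume t: "norm t < \<epsilon>" and x: "norm x = 1"
    show "cmod (octic 0 x) < \<delta>" if "octic t x = 0"
      using r3(2)[of t x] t x that \<delta> by (simp add: \<epsilon>_def dist_norm)
    show "octic_deriv t (x + l *s normal_field x) (normal_field x) \<noteq> 0 \<and> x + l *s normal_field x \<noteq> 0" if l: "cmod l < \<rho>" for l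
    proof
      show "octic_deriv t (x + l *s normal_field x) (normal_field x) \<noteq> 0"
        using A[OF t x l] c0(2)[OF x] c0(1) by auto
      have "norm (l *s normal_field x) \<le> 1 / 2" using r2(2)[of "(t, l)" x] nz[OF t l] x by (simp add: dist_norm)
      moreover have "norm x \<le> norm (x + l *s normal_field x) + norm (l *s normal_field x)"
        using norm_triangle_ineq4[of "x + l *s normal_field x" "l *s normal_field x"] by simp
      ultimately show "x + l *s normal_field x \<noteq> 0" using x by auto
    qed
    assume small: "cmod (octic 0 x) < \<delta>"
    define G where "G = (\<lambda>l. l - octic t (x + l *s normal_field x) / of_real (c x))"
    have cx: "c x > 0" using cpos[OF x] .
    have dG: "(G has_field_derivative (1 - octic_deriv t (x + l *s normal_field x) (normal_field x) / of_real (c x))) (at l within S)" for l S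
    proof -
      have "((\<lambda>l. x + l *s normal_field x) has_derivative (\<lambda>h. h *s normal_field x)) (at l)"
      proof -
        have "((\<lambda>l. \<chi> i. x $ i + l * normal_field x $ i) has_derivative (\<lambda>h. \<chi> i. h * normal_field x $ i)) (at l)"
          by (intro has_derivative_vec_lambda) (auto intro!: derivative_eq_intros)
        then show ?thesis by (simp add: vector_scalar_mult_def plus_vec_def)
      qed
      from has_derivative_compose[OF this has_derivative_octic]
      have "((\<lambda>l. octic t (x + l *s normal_field x)) has_derivative (\<lambda>h. octic_deriv t (x + l *s normal_field x) (h *s normal_field x))) (at l)" .
      then have "((\<lambda>l. octic t (x + l *s normal_field x)) has_field_derivative octic_deriv t (x + l *s normal_field x) (normal_field x)) (at l)"
        unfolding has_field_derivative_def octic_deriv_scale mult_commute_abs .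
      then have "(G has_field_derivative (1 - octic_deriv t (x + l *s normal_field x) (normal_field x) / of_real (c x))) (at l)"
        unfolding G_def by (intro DERIV_diff DERIV_ident DERIV_cdivide)
      then show ?thesis by (rule has_field_derivative_at_within)
    qed
    have dG1: "cmod (1 - octic_deriv t (x + l *s normal_field x) (normal_field x) / of_real (c x)) \<le> 1 / 2" if "cmod l < \<rho>" for l
    proof -
      have "1 - octic_deriv t (x + l *s normal_field x) (normal_field x) / of_real (c x) = - ((octic_deriv t (x + l *s normal_field x) (normal_field x) - of_real (c x)) / of_real (c x))"
        using cx by (simp add: field_simps)
      also have "cmod \<dots> = cmod (octic_deriv t (x + l *s normal_field x) (normal_field x) - of_real (c x)) / c x"
        using cx by (simp only: norm_minus_cancel norm_divide norm_of_real abs_of_pos)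
      also have "\<dots> \<le> (c0 / 2) / c x" by (intro divide_right_mono A t x that) (use cx in simp)
      also have "\<dots> \<le> 1 / 2" using cx c0(2)[OF x] by (simp add: field_simps)
      finally show ?thesis .
    qed
    have lip: "cmod (G l - G l') \<le> 1 / 2 * cmod (l - l')" if "cmod l < \<rho>" "cmod l' < \<rho>" for l l'
      by (rule field_differentiable_bound[OF convex_ball[of 0 \<rho>] dG]) (use dG1 that in auto)
    have G0: "cmod (G 0) \<le> \<rho> / 4"
    proof -
      have "dist (octic t x) (octic 0 x) \<le> \<delta> / 2" using r3(2)[of t x] t x by (simp add: \<epsilon>_def)
      then have "cmod (octic t x) \<le> 2 * \<delta>"
        using small \<delta> norm_triangle_ineq2[of "octic t x" "octic 0 x"] unfolding dist_norm by linarith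
      then have "cmod (octic t x) / c x \<le> (2 * \<delta>) / c0"
        using c0(1) c0(2)[OF x] \<delta> by (intro frac_le) auto
      also have "\<dots> = \<rho> / 4" using c0(1) by (simp add: \<delta>_def)
      finally show ?thesis using cx by (simp add: G_def norm_divide)
    qed
    have root: "octic t (x + l *s normal_field x) = 0 \<longleftrightarrow> G l = l" for l using cx by (simp add: G_def)
    \<comment> \<open>The fixed point is found in the closed ball of radius \<rho> / 2; its
      uniqueness in the larger open ball follows from the same contraction bound.\<close>
    have "\<exists>!l\<in>cball 0 (\<rho> / 2). G l = l"
    proof (rule Banach_fix[where c = "1 / 2"])
      show "complete (cball 0 (\<rho> / 2) :: complex set)" by (intro compact_imp_complete compact_cball)
      show "G ` cball 0 (\<rho> / 2) \<subseteq> cball 0 (\<rho> / 2)"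
      proof clarify
        fix l :: complex assume "l \<in> cball 0 (\<rho> / 2)"
        then have l: "cmod l \<le> \<rho> / 2" by simp
        have "cmod (G l) \<le> cmod (G 0) + cmod (G l - G 0)" using norm_triangle_sub by blast
        also have "\<dots> \<le> \<rho> / 4 + 1 / 2 * cmod (l - 0)" by (intro add_mono G0 lip) (use l \<rho> in auto)
        finally show "G l \<in> cball 0 (\<rho> / 2)" using l by simp
      qed
      fix l l' :: complex assume "l \<in> cball 0 (\<rho> / 2)" "l' \<in> cball 0 (\<rho> / 2)"
      then have "cmod l < \<rho>" "cmod l' < \<rho>" using \<rho> by auto
      then show "dist (G l) (G l') \<le> 1 / 2 * dist l l'" unfolding dist_norm by (rule lip)
    qed (use \<rho> in auto)
    then obtain l where "l \<in> cball 0 (\<rho> / 2)" "G l = l" by blast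
    with \<rho> have l: "cmod l < \<rho>" "G l = l" by auto
    show "\<exists>!l. cmod l < \<rho> \<and> octic t (x + l *s normal_field x) = 0"
    proof (rule ex1I[of _ l])
      show "cmod l < \<rho> \<and> octic t (x + l *s normal_field x) = 0" using l root by simp
      fix l' assume l': "cmod l' < \<rho> \<and> octic t (x + l' *s normal_field x) = 0"
      then have "cmod (l' - l) \<le> 1 / 2 * cmod (l' - l)" using lip[of l' l] l root by simp
      then show "l' = l" by simp
    qed
  qed
qed

section \<open>The root and the retraction on arbitrary representatives\<close>

locale nearby_octics =
  fixes \<rho> \<delta> \<epsilon> :: real
  assumes pos: "\<rho> > 0" "\<delta> > 0" "\<epsilon> > 0"
    and unit_root: "\<And>t x. norm t < \<epsilon> \<Longrightarrow> norm x = 1 \<Longrightarrow> cmod (octic 0 x) < \<delta> \<Longrightarrow> \<exists>!l. cmod l < \<rho> \<and> octic t (x + l *s normal_field x) = 0"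
    and unit_deriv: "\<And>t x l. norm t < \<epsilon> \<Longrightarrow> norm x = 1 \<Longrightarrow> cmod l < \<rho> \<Longrightarrow> octic_deriv t (x + l *s normal_field x) (normal_field x) \<noteq> 0 \<and> x + l *s normal_field x \<noteq> 0"
    and unit_small: "\<And>t x. norm t < \<epsilon> \<Longrightarrow> norm x = 1 \<Longrightarrow> octic t x = 0 \<Longrightarrow> cmod (octic 0 x) < \<delta>"
begin

text \<open>The bound is homogeneous: replacing \<open>x\<close> by c x divides the absolute value
  of the root by the sixth power of that of c, since the normal field has degree 7 in the conjugate
  variables.\<close>

definition is_root :: "param \<Rightarrow> complex^4 \<Rightarrow> complex \<Rightarrow> bool" where
  "is_root t x l \<longleftrightarrow> cmod l * norm x ^ 6 < \<rho> \<and> octic t (x + l *s normal_field x) = 0"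

text \<open>A tube around the Fermat surface, cut out by a homogeneous inequality so that it is a
  cone in \<open>x\<close>.\<close>

definition dom :: "(param \<times> (complex^4)) set" where
  "dom = {(t, x). norm t < \<epsilon> \<and> x \<noteq> 0 \<and> cmod (octic 0 x) < \<delta> * norm x ^ 8}"

definition root :: "param \<Rightarrow> complex^4 \<Rightarrow> complex" where
  "root t x = (THE l. is_root t x l)"

definition retr :: "param \<Rightarrow> complex^4 \<Rightarrow> complex^4" where
  "retr t x = x + root t x *s normal_field x"

lemma dom_iff: "(t, x) \<in> dom \<longleftrightarrow> norm t < \<epsilon> \<and> x \<noteq> 0 \<and> cmod (octic 0 x) < \<delta> * norm x ^ 8"
  by (simp add: dom_def)

lemma line_scale:
  assumes "c \<noteq> 0"
  shows "c *s x + l *s normal_field (c *s x) = c *s (x + (l * cnj c ^ 7 / c) *s normal_field x)"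
  using assms by (simp add: normal_field_scale vec_eq_iff algebra_simps)

lemma bound_scale:
  assumes "c \<noteq> 0"
  shows "cmod (l * cnj c ^ 7 / c) * norm x ^ 6 = cmod l * norm (c *s x) ^ 6"
proof -
  have "cmod c ^ 7 = cmod c ^ 6 * cmod c" by (simp flip: power_Suc2)
  then show ?thesis using assms by (simp add: norm_mult norm_divide norm_power norm_scale power_mult_distrib)
qed

lemma is_root_scale:
  assumes "c \<noteq> 0"
  shows "is_root t (c *s x) l \<longleftrightarrow> is_root t x (l * cnj c ^ 7 / c)"
  unfolding is_root_def line_scale[OF assms] bound_scale[OF assms] octic_scale using assms by simp

lemma ex1_root:
  assumes "(t, x) \<in> dom"
  shows "\<exists>!l. is_root t x l"
proof -
  define c where "c = complex_of_real (1 / norm x)"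
  have x: "x \<noteq> 0" "norm t < \<epsilon>" "cmod (octic 0 x) < \<delta> * norm x ^ 8" using assms by (auto simp: dom_iff)
  have c0: "c \<noteq> 0" using x by (simp add: c_def)
  define \<kappa> where "\<kappa> = cnj c ^ 7 / c"
  have \<kappa>0: "\<kappa> \<noteq> 0" using c0 by (simp add: \<kappa>_def)
  have n1: "norm (c *s x) = 1" using x by (simp add: c_def norm_scale norm_divide)
  have "cmod (octic 0 (c *s x)) < \<delta>"
    using x(1,3) by (simp add: octic_scale c_def norm_mult norm_power norm_divide power_divide pos_divide_less_eq)
  from unit_root[OF x(2) n1 this] obtain l where l: "is_root t (c *s x) l" "\<And>l'. is_root t (c *s x) l' \<Longrightarrow> l' = l"
    by (auto simp: is_root_def n1)
  have R: "is_root t (c *s x) l \<longleftrightarrow> is_root t x (l * \<kappa>)" for l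
    using is_root_scale[OF c0] by (simp add: \<kappa>_def)
  show ?thesis
  proof (rule ex1I[of _ "l * \<kappa>"])
    show "is_root t x (l * \<kappa>)" using l(1) R by blast
    fix l' assume "is_root t x l'"
    then have "is_root t (c *s x) (l' / \<kappa>)" using R \<kappa>0 by simp
    from l(2)[OF this] show "l' = l * \<kappa>" using \<kappa>0 by (simp add: field_simps)
  qed
qed

lemma is_root_root: "(t, x) \<in> dom \<Longrightarrow> is_root t x (root t x)"
  unfolding root_def by (rule theI'[OF ex1_root])

lemma root_unique: "(t, x) \<in> dom \<Longrightarrow> is_root t x l \<Longrightarrow> root t x = l"
  using ex1_root is_root_root by blast

lemma octic_retr: "(t, x) \<in> dom \<Longrightarrow> octic t (retr t x) = 0"
  using is_root_root by (simp add: retr_def is_root_def)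

lemma root_deriv:
  assumes "norm t < \<epsilon>" "x \<noteq> 0" "cmod l * norm x ^ 6 < \<rho>"
  shows "octic_deriv t (x + l *s normal_field x) (normal_field x) \<noteq> 0" "x + l *s normal_field x \<noteq> 0"
proof -
  define c where "c = complex_of_real (1 / norm x)"
  have c0: "c \<noteq> 0" using assms by (simp add: c_def)
  define l1 where "l1 = l * c / cnj c ^ 7"
  have ll: "l1 * cnj c ^ 7 / c = l" using c0 by (simp add: l1_def)
  have n1: "norm (c *s x) = 1" using assms by (simp add: c_def norm_scale norm_divide)
  have "cmod l1 < \<rho>" using bound_scale[OF c0, of l1 x] assms(3) by (simp only: ll n1 power_one mult_1_right)
  from unit_deriv[OF assms(1) n1 this]
  have *: "octic_deriv t (c *s (x + l *s normal_field x)) (cnj c ^ 7 *s normal_field x) \<noteq> 0 \<and> c *s (x + l *s normal_field x) \<noteq> 0"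
    unfolding line_scale[OF c0] ll unfolding normal_field_scale .
  show "octic_deriv t (x + l *s normal_field x) (normal_field x) \<noteq> 0"
    using * unfolding octic_deriv_base_scale[OF c0] octic_deriv_scale by simp
  show "x + l *s normal_field x \<noteq> 0" using * by (metis vector_smult_rzero)
qed

lemma retr_nonzero: "(t, x) \<in> dom \<Longrightarrow> retr t x \<noteq> 0"
  and retr_deriv: "(t, x) \<in> dom \<Longrightarrow> octic_deriv t (retr t x) (normal_field x) \<noteq> 0"
  using root_deriv[of t x "root t x"] is_root_root[of t x] by (auto simp: retr_def is_root_def dom_iff)

lemma dom_scale: "c \<noteq> 0 \<Longrightarrow> (t, c *s x) \<in> dom \<longleftrightarrow> (t, x) \<in> dom"
  by (auto simp: dom_iff octic_scale norm_mult norm_power norm_scale power_mult_distrib)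

lemma retr_scale:
  assumes "(t, x) \<in> dom" "c \<noteq> 0"
  shows "retr t (c *s x) = c *s retr t x"
proof -
  have "is_root t x (root t (c *s x) * cnj c ^ 7 / c)"
    using is_root_scale[OF assms(2)] is_root_root[of t "c *s x"] dom_scale[OF assms(2)] assms(1) by blast
  from root_unique[OF assms(1) this] show ?thesis
    unfolding retr_def line_scale[OF assms(2)] by simp
qed

text \<open>Every nearby octic lies in the tube, for all nearby parameters at once; so all fibres
  over a segment can be retracted to one of them.\<close>

lemma dom_zero:
  assumes "norm t < \<epsilon>" "x \<noteq> 0" "octic t x = 0" "norm t' < \<epsilon>"
  shows "(t', x) \<in> dom"
proof -
  have "cmod (octic 0 (of_real (1 / norm x) *s x)) < \<delta>"
    by (rule unit_small[OF assms(1)]) (use assms in \<open>simp_all add: norm_scale norm_divide octic_scale\<close>)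
  then show ?thesis using assms(2,4)
    by (simp add: dom_iff octic_scale norm_mult norm_power norm_divide power_divide pos_divide_less_eq)
qed

lemma root_zero: "(t, x) \<in> dom \<Longrightarrow> octic t x = 0 \<Longrightarrow> root t x = 0"
  by (rule root_unique) (simp_all add: is_root_def pos)

lemma retr_zero: "(t, x) \<in> dom \<Longrightarrow> octic t x = 0 \<Longrightarrow> retr t x = x"
  by (simp add: retr_def root_zero)

lemma smooth_nearby: "norm t < \<epsilon> \<Longrightarrow> smooth_octic t"
  unfolding smooth_octic_def using root_deriv(1)[of t _ 0] pos by auto

lemma open_dom: "open dom"
proof -
  have "dom = {p. norm (fst p) < \<epsilon>} \<inter> {p. snd p \<noteq> 0} \<inter> {p. cmod (octic 0 (snd p)) < \<delta> * norm (snd p) ^ 8}"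
    by (auto simp: dom_def)
  moreover have "open ({p :: param \<times> (complex^4). norm (fst p) < \<epsilon>} \<inter> {p. snd p \<noteq> 0} \<inter> {p. cmod (octic 0 (snd p)) < \<delta> * norm (snd p) ^ 8})"
    by (intro open_Int open_Collect_less open_Collect_neq continuous_intros continuous_on_octic)
  ultimately show ?thesis by simp
qed

text \<open>A local solution of the implicit equation satisfies the size bound near the given point,
  so uniqueness identifies it with \<open>root\<close>. The derivative in the parameter has no sign
  because the parameters enter the octic with a minus sign.\<close>

lemma C1_root_and_derivative:
  shows "C1_on (\<lambda>p. root (fst p) (snd p)) dom"
    "\<And>t x s. (t, x) \<in> dom \<Longrightarrow> FD (\<lambda>p. root (fst p) (snd p)) (t, x) (s, 0) =
       (\<Sum>\<alpha>\<in>UNIV. s $ \<alpha> * monomial (expo \<alpha>) (retr t x)) / octic_deriv t (retr t x) (normal_field x)"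
proof -
  define F where "F = (\<lambda>p :: (param \<times> (complex^4)) \<times> complex. octic (fst (fst p)) (snd (fst p) + snd p *s normal_field (snd (fst p))))"
  have F: "C1_on F UNIV" unfolding F_def
    by (intro C1_on_octic C1_intros C1_on_normal_field open_UNIV)
  have Fl: "FD F ((t, x), l) (0, s) = s * octic_deriv t (x + l *s normal_field x) (normal_field x)" for t x l s
  proof -
    have "((\<lambda>s. ((t, x), s)) has_derivative (\<lambda>h. (0, h))) (at l)"
      by (intro has_derivative_Pair[where f' = "\<lambda>_. 0", simplified] has_derivative_const has_derivative_ident)
    from has_derivative_compose[OF this C1_on_has_derivative[OF F UNIV_I]]
    have 1: "((\<lambda>s. F ((t, x), s)) has_derivative (\<lambda>h. FD F ((t, x), l) (0, h))) (at l)" .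
    have "((\<lambda>l. \<chi> i. x $ i + l * normal_field x $ i) has_derivative (\<lambda>h. \<chi> i. h * normal_field x $ i)) (at l)"
      by (intro has_derivative_vec_lambda) (auto intro!: derivative_eq_intros)
    then have "((\<lambda>l. x + l *s normal_field x) has_derivative (\<lambda>h. h *s normal_field x)) (at l)"
      by (simp add: vector_scalar_mult_def plus_vec_def)
    from has_derivative_compose[OF this has_derivative_octic]
    have 2: "((\<lambda>s. F ((t, x), s)) has_derivative (\<lambda>h. octic_deriv t (x + l *s normal_field x) (h *s normal_field x))) (at l)"
      by (simp add: F_def)
    from fun_cong[OF has_derivative_unique[OF 1 2], of s] show ?thesis by simp
  qed
  have Ft: "FD F ((t, x), l) ((s, 0), 0) = - (\<Sum>\<alpha>\<in>UNIV. s $ \<alpha> * monomial (expo \<alpha>) (x + l *s normal_field x))" for t x l s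
  proof -
    have "((\<lambda>t. ((t, x), l)) has_derivative (\<lambda>h. ((h, 0), 0))) (at t)"
      by (intro has_derivative_Pair has_derivative_const has_derivative_ident)
    from has_derivative_compose[OF this C1_on_has_derivative[OF F UNIV_I]]
    have 1: "((\<lambda>t. F ((t, x), l)) has_derivative (\<lambda>h. FD F ((t, x), l) ((h, 0), 0))) (at t)" .
    have "((\<lambda>t. (\<Sum>i\<in>UNIV. (x + l *s normal_field x) $ i ^ 8) - (\<Sum>\<alpha>\<in>UNIV. t $ \<alpha> * monomial (expo \<alpha>) (x + l *s normal_field x)))
        has_derivative (\<lambda>s. 0 - (\<Sum>\<alpha>\<in>UNIV. s $ \<alpha> * monomial (expo \<alpha>) (x + l *s normal_field x)))) (at t)"
      by (intro has_derivative_diff has_derivative_const has_derivative_sum has_derivative_mult_left bounded_linear_imp_has_derivative bounded_linear_vec_nth)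
    then have 2: "((\<lambda>t. F ((t, x), l)) has_derivative (\<lambda>s. - (\<Sum>\<alpha>\<in>UNIV. s $ \<alpha> * monomial (expo \<alpha>) (x + l *s normal_field x)))) (at t)"
      by (simp add: F_def octic_def)
    from fun_cong[OF has_derivative_unique[OF 1 2], of s] show ?thesis by simp
  qed
  have lin: "FD F p (0, s) = s * FD F p (0, 1)" for p s
    by (cases p; cases "fst p") (simp add: Fl)
  have loc: "\<exists>Z. (t, x) \<in> Z \<and> C1_on (\<lambda>p. root (fst p) (snd p)) Z \<and> FD (\<lambda>p. root (fst p) (snd p)) (t, x) (s, 0) =
       (\<Sum>\<alpha>\<in>UNIV. s $ \<alpha> * monomial (expo \<alpha>) (retr t x)) / octic_deriv t (retr t x) (normal_field x)"
    if tx: "(t, x) \<in> dom" for t x s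
  proof -
    have nz: "FD F ((t, x), root t x) (0, 1) \<noteq> 0" using retr_deriv[OF tx] by (simp add: Fl retr_def)
    have z: "F ((t, x), root t x) = 0" using octic_retr[OF tx] by (simp add: F_def retr_def)
    obtain Z r h where Z: "(t, x) \<in> Z" "r > 0" "C1_on h Z" "h (t, x) = root t x"
      "\<And>z. z \<in> Z \<Longrightarrow> h z \<in> ball (root t x) r" "\<And>z. z \<in> Z \<Longrightarrow> (z, h z) \<in> UNIV" "\<And>z. z \<in> Z \<Longrightarrow> F (z, h z) = 0" "\<And>z. z \<in> Z \<Longrightarrow> FD F (z, h z) (0, 1) \<noteq> 0"
      "\<And>z w. z \<in> Z \<Longrightarrow> w \<in> ball (root t x) r \<Longrightarrow> F (z, w) = 0 \<Longrightarrow> w = h z"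
      "\<And>z u. z \<in> Z \<Longrightarrow> FD h z u = - FD F (z, h z) (u, 0) / FD F (z, h z) (0, 1)"
      by (rule implicit_function[OF F UNIV_I z lin nz]) blast
    have oZ: "open Z" using C1_on_open[OF Z(3)] .
    define Z' where "Z' = dom \<inter> ((\<lambda>p. cmod (h p) * norm (snd p) ^ 6) -` {..<\<rho>} \<inter> Z)"
    have "open ((\<lambda>p. cmod (h p) * norm (snd p) ^ 6) -` {..<\<rho>} \<inter> Z)"
      by (rule continuous_on_open_vimage[OF oZ, THEN iffD1, rule_format, OF _ open_lessThan])
        (intro continuous_intros C1_on_continuous_on[OF Z(3)])
    then have oZ': "open Z'" unfolding Z'_def by (rule open_Int[OF open_dom])
    have in_Z': "(t, x) \<in> Z'" using tx Z(1,4) is_root_root[OF tx] by (simp add: Z'_def is_root_def)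
    have h: "root (fst p) (snd p) = h p" if "p \<in> Z'" for p
      by (rule root_unique) (use that Z(7)[of p] in \<open>auto simp: Z'_def is_root_def F_def\<close>)
    have hC: "C1_on h Z'" using C1_on_subset[OF Z(3) oZ'] by (auto simp: Z'_def)
    have "FD (\<lambda>p. root (fst p) (snd p)) (t, x) = FD h (t, x)"
      by (rule FD_eq[OF has_derivative_transform_within_open[OF C1_on_has_derivative[OF hC in_Z'] oZ' in_Z']]) (simp add: h)
    then have "FD (\<lambda>p. root (fst p) (snd p)) (t, x) (s, 0) = (\<Sum>\<alpha>\<in>UNIV. s $ \<alpha> * monomial (expo \<alpha>) (retr t x)) / octic_deriv t (retr t x) (normal_field x)"
      by (simp add: Z(10)[OF Z(1)] Z(4) Fl Ft retr_def)
    then show ?thesis using C1_on_cong[OF hC h] in_Z' by blast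
  qed
  show "C1_on (\<lambda>p. root (fst p) (snd p)) dom"
  proof (rule C1_on_local[OF _ open_dom])
    fix p assume "p \<in> dom"
    then show "\<exists>Z. p \<in> Z \<and> C1_on (\<lambda>p. root (fst p) (snd p)) Z" using loc[of "fst p" "snd p" 0] by auto
  qed
  show "FD (\<lambda>p. root (fst p) (snd p)) (t, x) (s, 0) =
       (\<Sum>\<alpha>\<in>UNIV. s $ \<alpha> * monomial (expo \<alpha>) (retr t x)) / octic_deriv t (retr t x) (normal_field x)" if "(t, x) \<in> dom" for t x s
    using loc[OF that] by blast
qed

lemma C1_retr: "C1_on (\<lambda>p. retr (fst p) (snd p)) dom"
  unfolding retr_def by (intro C1_intros C1_root_and_derivative(1) C1_on_normal_field open_dom)

end

lemma nearby_octics_exist: obtains \<rho> \<delta> \<epsilon> where "nearby_octics \<rho> \<delta> \<epsilon>"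
  by (rule nearby_roots) (rule that, unfold_locales)

section \<open>Parallel transport by the retraction\<close>

text \<open>The cone over the image is the union of the dilates of \<open>B\<close>.\<close>

lemma openin_P3_proj_image:
  assumes "open B" "0 \<notin> B"
  shows "openin P3 (proj ` B)"
  unfolding openin_P3
proof
  show "proj ` B \<subseteq> proj ` (- {0})" using assms(2) by blast
  have "{x. x \<noteq> 0 \<and> proj x \<in> proj ` B} = (\<Union>c\<in>- {0}. {x. c *s x \<in> B})"
  proof (intro equalityI subsetI)
    fix x assume "x \<in> {x. x \<noteq> 0 \<and> proj x \<in> proj ` B}"
    then obtain b where "b \<in> B" "proj x = proj b" by blast
    then show "x \<in> (\<Union>c\<in>- {0}. {x. c *s x \<in> B})" unfolding proj_eq_iff by blast
  next
    fix x assume "x \<in> (\<Union>c\<in>- {0}. {x. c *s x \<in> B})"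
    then obtain c where c: "c \<noteq> 0" "c *s x \<in> B" by auto
    then have "x \<noteq> 0" using assms(2) by (metis vector_smult_rzero)
    moreover have "proj x \<in> proj ` B" using c proj_scale[OF c(1), of x] by (metis imageI)
    ultimately show "x \<in> {x. x \<noteq> 0 \<and> proj x \<in> proj ` B}" by blast
  qed
  moreover have "open {x. c *s x \<in> B}" for c
    using open_vimage[OF assms(1), of "\<lambda>x. c *s x"] by (simp add: vimage_def continuous_intros)
  ultimately show "open {x. x \<noteq> 0 \<and> proj x \<in> proj ` B}" by auto
qed

definition cone_over :: "('a \<times> (complex^4) set) set \<Rightarrow> ('a \<times> (complex^4)) set" where
  "cone_over Z = {(s, x). x \<noteq> 0 \<and> (s, proj x) \<in> Z}"

text \<open>The projection is open, and an open map stays open over any subset of its target.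
  Continuity of a map out of a family of surfaces can therefore be checked on vectors.\<close>

lemma quotient_map_cone:
  "quotient_map (top_of_set (cone_over Z)) (subtopology (prod_topology euclidean P3) Z) (\<lambda>(s, x). (s, proj x))"
proof (rule continuous_open_imp_quotient_map)
  let ?q = "\<lambda>(s :: 'a, x). (s, proj x)"
  let ?E = "top_of_set (UNIV \<times> - {0}) :: ('a \<times> (complex^4)) topology"
  have E: "?E = prod_topology euclidean (top_of_set (- {0}))"
    by (metis prod_topology_subtopology_eu subtopology_UNIV)
  have c: "continuous_map ?E (prod_topology euclidean P3) ?q"
    unfolding E split_def
    by (intro continuous_map_pairedI continuous_map_fst
        continuous_map_compose[OF continuous_map_snd quotient_imp_continuous_map[OF quotient_map_proj], unfolded o_def])
  have o: "open_map ?E (prod_topology euclidean P3) ?q"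
    unfolding open_map_def
  proof (intro allI impI)
    fix U assume "openin ?E U"
    then have U: "open U" "\<And>s. (s, 0) \<notin> U"
      using openin_open_eq[of "UNIV \<times> - {0}" U] open_Times[OF open_UNIV open_delete[OF open_UNIV], of 0]
      by (auto simp: Compl_eq_Diff_UNIV)
    show "openin (prod_topology euclidean P3) (?q ` U)"
      unfolding openin_prod_topology_alt
    proof (intro allI impI)
      fix s q assume "(s, q) \<in> ?q ` U"
      then obtain x where x: "(s, x) \<in> U" "q = proj x" by auto
      from open_prod_elim[OF U(1) x(1)] obtain A B where AB: "open A" "open B" "(s, x) \<in> A \<times> B" "A \<times> B \<subseteq> U" by blast
      have "0 \<notin> B" using AB(3,4) U(2) by blast
      then have "openin P3 (proj ` B)" by (rule openin_P3_proj_image[OF AB(2)])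
      moreover have "A \<times> proj ` B \<subseteq> ?q ` U" using AB(4) by force
      ultimately show "\<exists>A B. openin euclidean A \<and> openin P3 B \<and> s \<in> A \<and> q \<in> B \<and> A \<times> B \<subseteq> ?q ` U"
        using AB(1,3) x(2) by (intro exI[of _ A] exI[of _ "proj ` B"]) auto
    qed
  qed
  have eq: "{p \<in> topspace ?E. ?q p \<in> Z} = cone_over Z" by (auto simp: cone_over_def)
  have sub: "subtopology ?E (cone_over Z) = top_of_set (cone_over Z)"
    by (simp add: subtopology_subtopology) (auto simp: cone_over_def intro!: arg_cong[of _ _ "subtopology euclidean"])
  show "open_map (top_of_set (cone_over Z)) (subtopology (prod_topology euclidean P3) Z) ?q"
    using open_map_restriction[OF o eq] by (simp only: sub)
  have "continuous_map (subtopology ?E (cone_over Z)) (prod_topology euclidean P3) ?q"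
    using c by (rule continuous_map_from_subtopology)
  then show "continuous_map (top_of_set (cone_over Z)) (subtopology (prod_topology euclidean P3) Z) ?q"
    unfolding sub by (rule continuous_map_into_subtopology) (auto simp: cone_over_def)
  show "?q ` topspace (top_of_set (cone_over Z)) = topspace (subtopology (prod_topology euclidean P3) Z)"
    by (force simp: cone_over_def topspace_P3)
qed

lemma continuous_map_family:
  fixes G :: "'a::topological_space \<times> (complex^4) \<Rightarrow> complex^4"
  assumes G: "continuous_on (cone_over Z) G" and nz: "\<And>s x. (s, x) \<in> cone_over Z \<Longrightarrow> G (s, x) \<noteq> 0"
    and f: "\<And>s x. (s, x) \<in> cone_over Z \<Longrightarrow> f (s, proj x) = proj (G (s, x))"
  shows "continuous_map (subtopology (prod_topology euclidean P3) Z) P3 f"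
proof (rule continuous_compose_quotient_map[OF quotient_map_cone])
  have "continuous_map (top_of_set (cone_over Z)) (top_of_set (- {0})) G"
    using G nz by (auto simp: continuous_map_in_subtopology)
  then have "continuous_map (top_of_set (cone_over Z)) P3 (proj \<circ> G)"
    by (rule continuous_map_compose[OF _ quotient_imp_continuous_map[OF quotient_map_proj]])
  then show "continuous_map (top_of_set (cone_over Z)) P3 (f \<circ> (\<lambda>(s, x). (s, proj x)))"
    by (rule continuous_map_eq) (use f in force)
qed

lemma continuous_map_slice:
  "continuous_map (subtopology P3 A) (subtopology (prod_topology euclidean P3) Z) (Pair s)" if "A \<subseteq> {q. (s, q) \<in> Z}"
  by (rule continuous_map_into_subtopology, intro continuous_map_pairedI)
    (use that in \<open>auto simp: continuous_map_from_subtopology\<close>)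

context nearby_octics
begin

definition retr_proj :: "param \<Rightarrow> (complex^4) set \<Rightarrow> (complex^4) set" where
  "retr_proj t q = proj (retr t (rep q))"

lemma retr_proj: "(t, x) \<in> dom \<Longrightarrow> retr_proj t (proj x) = proj (retr t x)"
  by (rule rep_proj[of x]) (simp add: retr_proj_def retr_scale retr_nonzero)

lemma retr_proj_octic_points:
  "(t, x) \<in> dom \<Longrightarrow> retr_proj t (proj x) \<in> octic_points t"
  by (simp add: retr_proj proj_in_octic_points retr_nonzero octic_retr)

lemma norm_segment: "norm t < \<epsilon> \<Longrightarrow> 0 \<le> s \<Longrightarrow> s \<le> 1 \<Longrightarrow> norm (s *\<^sub>R t) < \<epsilon>"
  using mult_left_le_one_le[of "norm t" s] by simp

lemma cone_octic: "(s, x) \<in> cone_over {(s, q). P s \<and> q \<in> octic_points (T s)} \<longleftrightarrow> x \<noteq> 0 \<and> P s \<and> octic (T s) x = 0"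
  by (auto simp: cone_over_def proj_in_octic_points)

lemma continuous_retr:
  assumes "continuous_on S a" "continuous_on S b" "\<And>z. z \<in> S \<Longrightarrow> (a z, b z) \<in> dom"
  shows "continuous_on S (\<lambda>z. retr (a z) (b z))"
  using continuous_on_compose2[OF C1_on_continuous_on[OF C1_retr] continuous_on_Pair[OF assms(1,2)]] assms(3) by auto

text \<open>The parameter of the retraction stays \<open>t\<close> while the point ranges over all
  fibres: the whole family is retracted onto its end fibre.\<close>

lemma continuous_map_retraction:
  assumes t: "norm t < \<epsilon>"
  shows "continuous_map (segment_family t) (octic_surface t) (\<lambda>(s, q). retr_proj t q)"
proof -
  let ?Z = "{(s :: real, q). (0 \<le> s \<and> s \<le> 1) \<and> q \<in> octic_points (s *\<^sub>R t)}"
  have dom: "(t, x) \<in> dom" if "(s, x) \<in> cone_over ?Z" for s x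
    by (rule dom_zero[of "s *\<^sub>R t"]) (use that[unfolded cone_octic] t norm_segment[OF t, of s] in auto)
  have "continuous_map (segment_family t) P3 (\<lambda>(s, q). retr_proj t q)"
    unfolding segment_family_def conj_assoc[symmetric]
    by (rule continuous_map_family[where G = "\<lambda>p. retr t (snd p)"])
      (use dom in \<open>auto intro!: continuous_retr continuous_intros simp: retr_proj retr_nonzero\<close>)
  then show ?thesis unfolding octic_surface_def
  proof (rule continuous_map_into_subtopology[OF _ Pi_I])
    fix p assume "p \<in> topspace (segment_family t)"
    then obtain s x where "p = (s, proj x)" "(s, x) \<in> cone_over ?Z"
      by (auto simp: segment_family_def topspace_P3 cone_over_def)
    then show "(case p of (s, q) \<Rightarrow> retr_proj t q) \<in> octic_points t"
      using retr_proj_octic_points[OF dom] by simp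
  qed
qed

lemma continuous_map_retr_proj:
  assumes "norm t < \<epsilon>"
  shows "continuous_map (octic_surface 0) (octic_surface t) (retr_proj t)"
proof -
  have "continuous_map (octic_surface 0) (segment_family t) (Pair 0)"
    unfolding octic_surface_def segment_family_def by (rule continuous_map_slice) auto
  from continuous_map_compose[OF this continuous_map_retraction[OF assms]] show ?thesis by (simp add: o_def)
qed

text \<open>Here the parameter of the retraction moves along the segment: the central fibre is
  pushed through the family into the end fibre.\<close>

lemma homotopic_retr_proj:
  assumes t: "norm t < \<epsilon>"
  shows "homotopic_with (\<lambda>_. True) (octic_surface 0) (segment_family t) (Pair 0) (Pair 1 \<circ> retr_proj t)"
proof (subst homotopic_with, simp, intro exI conjI ballI TrueI)
  let ?h = "\<lambda>(s :: real, q). (s, retr_proj (s *\<^sub>R t) q)"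
  let ?Z = "{(s :: real, q). (0 \<le> s \<and> s \<le> 1) \<and> q \<in> octic_points 0}"
  have Z: "prod_topology (top_of_set {0..1}) (octic_surface 0) = subtopology (prod_topology euclideanreal P3) ?Z"
    unfolding octic_surface_def subtopology_Times[symmetric] by (rule arg_cong[of _ _ "subtopology _"]) auto
  have dom: "(s *\<^sub>R t, x) \<in> dom" if "(s, x) \<in> cone_over ?Z" for s x
    by (rule dom_zero[of 0]) (use that[unfolded cone_octic] pos norm_segment[OF t, of s] in auto)
  have "continuous_map (subtopology (prod_topology euclideanreal P3) ?Z) P3 (\<lambda>(s, q). retr_proj (s *\<^sub>R t) q)"
    by (rule continuous_map_family[where G = "\<lambda>p. retr (fst p *\<^sub>R t) (snd p)"])
      (use dom in \<open>auto intro!: continuous_retr continuous_intros simp: retr_proj retr_nonzero\<close>)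
  from continuous_map_pairedI[OF continuous_map_from_subtopology[OF continuous_map_fst] this]
  have "continuous_map (subtopology (prod_topology euclideanreal P3) ?Z) (prod_topology euclideanreal P3) ?h"
    by (simp add: split_def)
  then show "continuous_map (prod_topology (top_of_set {0..1}) (octic_surface 0)) (segment_family t) ?h"
    unfolding segment_family_def Z
  proof (rule continuous_map_into_subtopology[OF _ Pi_I])
    fix p assume "p \<in> topspace (subtopology (prod_topology euclideanreal P3) ?Z)"
    then obtain s x where *: "p = (s, proj x)" "(s, x) \<in> cone_over ?Z"
      by (auto simp: topspace_P3 cone_over_def)
    then have "0 \<le> s" "s \<le> 1" by (auto simp: cone_over_def)
    then show "?h p \<in> {(s, q). 0 \<le> s \<and> s \<le> 1 \<and> q \<in> octic_points (s *\<^sub>R t)}"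
      using retr_proj_octic_points[OF dom] * by simp
  qed
  fix q assume "q \<in> topspace (octic_surface 0)"
  then obtain x where x: "x \<noteq> 0" "q = proj x" "octic 0 x = 0"
    by (auto simp: octic_surface_def octic_points_def)
  have d: "(0, x) \<in> dom" using dom_zero[of 0 x 0] x pos by simp
  show "?h (0, q) = (0, q)" using x by (simp add: retr_proj[OF d] retr_zero[OF d])
  show "?h (1, q) = (Pair 1 \<circ> retr_proj t) q" by simp
qed

text \<open>The homotopy shows that the image under \<open>retr_proj t\<close> solves the equation
  defining \<open>transport\<close>. It is the only solution, because the retraction of the family
  is a left inverse of the inclusion of the end fibre.\<close>

lemma transport_eq:
  assumes t: "norm t < \<epsilon>" and c: "c \<in> carrier (homology_group 2 (octic_surface 0))"
  shows "transport t c = hom_induced 2 (octic_surface 0) {} (octic_surface t) {} (retr_proj t) c"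
  unfolding transport_def
proof (rule the_equality)
  let ?r = "hom_induced 2 (octic_surface 0) {} (octic_surface t) {} (retr_proj t) c"
  have P1: "continuous_map (octic_surface t) (segment_family t) (Pair 1)"
    unfolding octic_surface_def segment_family_def by (rule continuous_map_slice) auto
  have "hom_induced 2 (octic_surface t) {} (segment_family t) {} (Pair 1) ?r
      = hom_induced 2 (octic_surface 0) {} (segment_family t) {} (Pair 1 \<circ> retr_proj t) c"
    by (rule hom_induced_compose'[OF continuous_map_retr_proj[OF t] _ P1]) auto
  also have "\<dots> = hom_induced 2 (octic_surface 0) {} (segment_family t) {} (Pair 0) c"
    by (simp add: homology_homotopy_empty[OF homotopic_retr_proj[OF t]])
  finally show 1: "?r \<in> carrier (homology_group 2 (octic_surface t)) \<and>
      hom_induced 2 (octic_surface t) {} (segment_family t) {} (Pair 1) ?r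
      = hom_induced 2 (octic_surface 0) {} (segment_family t) {} (Pair 0) c"
    by (simp add: hom_induced_carrier)
  have inj: "hom_induced 2 (segment_family t) {} (octic_surface t) {} (\<lambda>(s, q). retr_proj t q)
      (hom_induced 2 (octic_surface t) {} (segment_family t) {} (Pair 1) c') = c'"
    if "c' \<in> carrier (homology_group 2 (octic_surface t))" for c'
  proof -
    have "hom_induced 2 (segment_family t) {} (octic_surface t) {} (\<lambda>(s, q). retr_proj t q)
      (hom_induced 2 (octic_surface t) {} (segment_family t) {} (Pair 1) c')
      = hom_induced 2 (octic_surface t) {} (octic_surface t) {} ((\<lambda>(s, q). retr_proj t q) \<circ> Pair (1 :: real)) c'"
      by (rule hom_induced_compose'[OF P1 _ continuous_map_retraction[OF t]]) auto
    also have "\<dots> = c'"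
    proof (rule hom_induced_id_gen[OF continuous_map_compose[OF P1 continuous_map_retraction[OF t]] _ that])
      fix q assume "q \<in> topspace (octic_surface t)"
      then obtain x where x: "x \<noteq> 0" "q = proj x" "octic t x = 0"
        by (auto simp: octic_surface_def octic_points_def)
      have d: "(t, x) \<in> dom" using dom_zero[of t x t] x t by simp
      show "((\<lambda>(s, q). retr_proj t q) \<circ> Pair (1 :: real)) q = q"
        using x by (simp add: retr_proj[OF d] retr_zero[OF d])
    qed
    finally show ?thesis .
  qed
  fix c' assume c': "c' \<in> carrier (homology_group 2 (octic_surface t)) \<and>
    hom_induced 2 (octic_surface t) {} (segment_family t) {} (Pair 1) c' =
    hom_induced 2 (octic_surface 0) {} (segment_family t) {} (Pair 0) c"
  then show "c' = ?r" using 1 inj by metis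
qed

lemma transport_class:
  assumes "norm t < \<epsilon>" "singular_relcycle 2 (octic_surface 0) {} z"
  shows "transport t (homologous_rel_set 2 (octic_surface 0) {} z)
    = homologous_rel_set 2 (octic_surface t) {} (chain_map 2 (retr_proj t) z)"
proof -
  have "homologous_rel_set 2 (octic_surface 0) {} z \<in> carrier (homology_group 2 (octic_surface 0))"
    using carrier_relative_homology_group[of 2 "octic_surface 0" "{}"] assms(2) by auto
  from transport_eq[OF assms(1) this]
    hom_induced_chain_map[OF continuous_map_retr_proj[OF assms(1)] _ assms(2), of "{}"]
  show ?thesis by simp
qed

end

section \<open>Cycles carried by lines\<close>

lemma lift_singular_simplex:
  assumes l: "lift \<sigma> g S" and e: "\<sigma> \<in> extensional (standard_simplex 2)" and A: "\<And>p. p \<in> triangle \<Longrightarrow> proj (g p) \<in> A"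
  shows "singular_simplex 2 (subtopology P3 A) \<sigma>"
  unfolding singular_simplex_def
proof (rule conjI[OF continuous_map_into_subtopology e])
  let ?\<Delta> = "subtopology (powertop_real UNIV) (standard_simplex 2)"
  have g: "continuous_on triangle g" "\<And>p. p \<in> triangle \<Longrightarrow> g p \<noteq> 0" "\<And>p. p \<in> triangle \<Longrightarrow> \<sigma> (barycentric p) = proj (g p)"
    using l C1_on_continuous_on continuous_on_subset unfolding lift_def by blast+
  have tri: "plane s \<in> triangle" if "s \<in> standard_simplex 2" for s
    using that by (simp add: plane_standard_simplex)
  have c: "continuous_map ?\<Delta> euclideanreal (\<lambda>s. s i)" for i
    by (rule continuous_map_from_subtopology, rule continuous_map_product_projection) simp
  have "continuous_map ?\<Delta> euclidean (\<lambda>s. (s 1, s 2))"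
    using continuous_map_pairedI[OF c[of 1] c[of 2]] by simp
  then have "continuous_map ?\<Delta> (top_of_set triangle) plane"
    using tri by (auto simp: continuous_map_in_subtopology plane_def[abs_def])
  moreover have "continuous_map (top_of_set triangle) (top_of_set (- {0})) g"
    using g by (auto simp: continuous_map_in_subtopology)
  ultimately have "continuous_map ?\<Delta> (top_of_set (- {0})) (g \<circ> plane)"
    by (rule continuous_map_compose)
  from continuous_map_compose[OF this quotient_imp_continuous_map[OF quotient_map_proj]]
  show "continuous_map ?\<Delta> P3 \<sigma>"
  proof (rule continuous_map_eq)
    fix s assume "s \<in> topspace ?\<Delta>"
    then have s: "s \<in> standard_simplex 2" by simp
    show "(proj \<circ> (g \<circ> plane)) s = \<sigma> s"
      using g(3)[OF tri[OF s]] by (simp add: barycentric_plane[OF s])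
  qed
  show "\<sigma> \<in> topspace ?\<Delta> \<rightarrow> A"
  proof
    fix s assume "s \<in> topspace ?\<Delta>"
    then have s: "s \<in> standard_simplex 2" by simp
    show "\<sigma> s \<in> A" using A[OF tri[OF s]] g(3)[OF tri[OF s]] by (simp add: barycentric_plane[OF s])
  qed
qed

text \<open>\<open>wt\<close> and \<open>sp\<close> are the coefficients of \<open>u\<close> and
  \<open>v\<close> in \<open>line_simplex\<close>, in the coordinates of
  \<open>triangle\<close>.\<close>

definition wt :: "real \<times> real \<Rightarrow> complex" where
  "wt p = 1 + of_real (fst p) * (cis (2 * pi / 3) - 1) + of_real (snd p) * (cis (4 * pi / 3) - 1)"

definition sp :: "real \<times> real \<Rightarrow> real" where
  "sp p = (1 - fst p - snd p) * fst p * snd p"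

definition line_lift :: "complex^4 \<Rightarrow> complex^4 \<Rightarrow> real \<times> real \<Rightarrow> complex^4" where
  "line_lift u v p = wt p *s u + of_real (sp p) *s v"

lemma cis_third: "cis (2 * pi / 3) = Complex (-1/2) (sqrt 3 / 2)" "cis (4 * pi / 3) = Complex (-1/2) (- sqrt 3 / 2)"
proof -
  show "cis (2 * pi / 3) = Complex (-1/2) (sqrt 3 / 2)" by (simp add: cis.ctr cos_120 sin_120)
  have "4 * pi / 3 = pi / 3 + pi" by simp
  then show "cis (4 * pi / 3) = Complex (-1/2) (- sqrt 3 / 2)"
    unfolding cis.ctr by (simp only: cos_periodic_pi sin_periodic_pi cos_60 sin_60) simp
qed

lemma wt_alt: "wt p = Complex (1 - 3/2 * fst p - 3/2 * snd p) (sqrt 3 / 2 * (fst p - snd p))"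
  unfolding wt_def cis_third by (simp add: complex_eq_iff field_simps)

lemma wt_eq_0: "wt p = 0 \<longleftrightarrow> p = (1/3, 1/3)"
  by (cases p) (auto simp: wt_alt complex_eq_iff)

text \<open>\<open>wt\<close> vanishes at the barycentre only, where \<open>sp\<close> is
  1/27.\<close>

lemma wt_sp_nonzero: "wt p \<noteq> 0 \<or> sp p \<noteq> 0"
  by (auto simp: wt_eq_0 sp_def)

lemma line_lift_nonzero: "indep2 u v \<Longrightarrow> line_lift u v p \<noteq> 0"
  using wt_sp_nonzero[of p] unfolding indep2_def line_lift_def by (metis of_real_eq_0_iff)

lemma line_lift_in_line: "indep2 u v \<Longrightarrow> proj (line_lift u v p) \<in> line u v"
  unfolding line_def line_lift_def using wt_sp_nonzero[of p]
  by (intro CollectI exI[of _ "wt p"] exI[of _ "complex_of_real (sp p)"]) auto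

lemma C1_line_lift: "C1_on h S \<Longrightarrow> C1_on (\<lambda>z. line_lift u v (h z)) S"
  unfolding line_lift_def wt_def sp_def
  by (intro C1_intros C1_on_open[of h S])

lemma lift_line_simplex:
  assumes "indep2 u v"
  shows "lift (line_simplex u v) (line_lift u v) UNIV"
proof -
  have "line_simplex u v (barycentric p) = proj (line_lift u v p)" if "p \<in> triangle" for p
    using barycentric_simplex[OF that]
    by (simp add: line_simplex_def line_lift_def wt_def sp_def barycentric_def algebra_simps)
  then show ?thesis
    using C1_line_lift[of "\<lambda>p. p"] line_lift_nonzero[OF assms] by (auto simp: lift_def)
qed

lemma lift_constant: "u \<noteq> 0 \<Longrightarrow> lift (\<lambda>s\<in>standard_simplex 2. proj u) (\<lambda>_. u) UNIV"
  by (auto simp: lift_def barycentric_simplex)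

lemma proj_in_line: "indep2 u v \<Longrightarrow> proj u \<in> line u v"
  unfolding line_def by (rule CollectI, rule exI[of _ 1], rule exI[of _ 0]) simp

lemma indep2_nonzero: "indep2 u v \<Longrightarrow> u \<noteq> 0"
  unfolding indep2_def by (metis add_0 vector_smult_lzero zero_neq_one vector_smult_rzero)

text \<open>On the boundary of the simplex the product \<open>sp\<close> is 0, so the whole boundary
  is mapped to the point of \<open>u\<close>. This is why subtracting the constant simplex makes
  \<open>line_cycle\<close> a cycle.\<close>

lemma face_line_simplex:
  assumes uv: "indep2 u v" and "k \<le> 2"
  shows "singular_face 2 k (line_simplex u v) = singular_face 2 k (\<lambda>s\<in>standard_simplex 2. proj u)"
proof -
  have "line_simplex u v (simplical_face k s) = proj u" if s: "s \<in> standard_simplex (2 - Suc 0)" for s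
  proof -
    let ?x = "simplical_face k s"
    have x: "?x \<in> standard_simplex 2" by (rule simplical_face_in_standard_simplex) (use assms s in auto)
    have b: "barycentric (plane ?x) = ?x" using x by (rule barycentric_plane)
    have "?x k = 0" by (simp add: simplical_face_def)
    moreover have "k = 0 \<or> k = 1 \<or> k = 2" using assms by auto
    ultimately have "?x 0 * ?x 1 * ?x 2 = 0" by auto
    then have s0: "sp (plane ?x) = 0" using b unfolding sp_def by (metis barycentric_def plane_def fst_conv snd_conv)
    then have "wt (plane ?x) \<noteq> 0" using wt_sp_nonzero by blast
    moreover have "plane ?x \<in> triangle" using x by (simp add: plane_standard_simplex)
    moreover have "line_simplex u v ?x = proj (line_lift u v (plane ?x))"
      using lift_line_simplex[OF uv] b calculation(2) unfolding lift_def by metis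
    ultimately show ?thesis by (simp add: line_lift_def s0)
  qed
  moreover have "simplical_face k s \<in> standard_simplex 2" if "s \<in> standard_simplex (2 - Suc 0)" for s
    by (rule simplical_face_in_standard_simplex) (use assms that in auto)
  ultimately show ?thesis
    unfolding singular_face_def by (intro restrict_ext) (simp only: o_def restrict_apply if_True)
qed

lemma line_cycle_relcycle:
  assumes "indep2 u v" "line u v \<subseteq> A"
  shows "singular_relcycle 2 (subtopology P3 A) {} (line_cycle u v)"
  unfolding singular_cycle
proof
  have "singular_simplex 2 (subtopology P3 A) (line_simplex u v)"
    by (rule lift_singular_simplex[OF lift_line_simplex[OF assms(1)]])
      (use line_lift_in_line[OF assms(1)] assms(2) in \<open>auto simp: line_simplex_def\<close>)
  moreover have "singular_simplex 2 (subtopology P3 A) (\<lambda>s\<in>standard_simplex 2. proj u)"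
    by (rule lift_singular_simplex[OF lift_constant[OF indep2_nonzero[OF assms(1)]]])
      (use proj_in_line[OF assms(1)] assms(2) in auto)
  ultimately show "singular_chain 2 (subtopology P3 A) (line_cycle u v)"
    unfolding line_cycle_def by (intro singular_chain_diff) (simp_all add: singular_chain_of)
  show "chain_boundary 2 (line_cycle u v) = 0"
    by (simp add: line_cycle_def chain_boundary_diff chain_boundary_of face_line_simplex[OF assms(1)])
qed

section \<open>Derivatives of the parametrised line and the pulled back residue form\<close>

definition normal_deriv :: "complex^4 \<Rightarrow> complex^4 \<Rightarrow> complex^4" where
  "normal_deriv x h = (\<chi> i. 7 * cnj (x $ i) ^ 6 * cnj (h $ i))"

lemma has_derivative_normal_field: "(normal_field has_derivative normal_deriv x) (at x)"
  unfolding normal_field_def normal_deriv_def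
proof (rule has_derivative_vec_lambda)
  fix i :: 4
  have "((\<lambda>x :: complex^4. cnj (x $ i)) has_derivative (\<lambda>h. cnj (h $ i))) (at x)"
    by (intro bounded_linear_imp_has_derivative bounded_linear_compose[OF bounded_linear_cnj] bounded_linear_vec_nth)
  from has_derivative_power[OF this, of 7]
  show "((\<lambda>x. cnj (x $ i) ^ 7) has_derivative (\<lambda>h. 7 * cnj (x $ i) ^ 6 * cnj (h $ i))) (at x)"
    by (simp add: mult_ac)
qed

definition line_du :: "complex^4 \<Rightarrow> complex^4 \<Rightarrow> real \<times> real \<Rightarrow> complex^4" where
  "line_du u v p = (cis (2 * pi / 3) - 1) *s u + of_real (snd p * (1 - 2 * fst p - snd p)) *s v"

definition line_dv :: "complex^4 \<Rightarrow> complex^4 \<Rightarrow> real \<times> real \<Rightarrow> complex^4" where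
  "line_dv u v p = (cis (4 * pi / 3) - 1) *s u + of_real (fst p * (1 - fst p - 2 * snd p)) *s v"

lemma FD_line_lift: "FD (line_lift u v) p h = fst h *\<^sub>R line_du u v p + snd h *\<^sub>R line_dv u v p"
proof -
  have "((\<lambda>p. \<chi> i. wt p * u $ i + of_real (sp p) * v $ i) has_derivative (\<lambda>h. \<chi> i.
     (of_real (fst h) * (cis (2 * pi / 3) - 1) + of_real (snd h) * (cis (4 * pi / 3) - 1)) * u $ i
     + of_real (fst h * (snd p * (1 - 2 * fst p - snd p)) + snd h * (fst p * (1 - fst p - 2 * snd p))) * v $ i)) (at p)"
    unfolding wt_def sp_def
    by (intro has_derivative_vec_lambda) (auto intro!: derivative_eq_intros simp: algebra_simps)
  then have "(line_lift u v has_derivative (\<lambda>h. fst h *\<^sub>R line_du u v p + snd h *\<^sub>R line_dv u v p)) (at p)"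
    by (rule has_derivative_eq_rhs[OF has_derivative_transform[of _ UNIV, simplified, rotated]])
      (auto simp: line_lift_def line_du_def line_dv_def vec_eq_iff fun_eq_iff scaleR_eq_scale algebra_simps)
  then show ?thesis by (simp add: FD_eq)
qed

lemma C1_line_du: "C1_on h S \<Longrightarrow> C1_on (\<lambda>z. line_du u v (h z)) S"
  and C1_line_dv: "C1_on h S \<Longrightarrow> C1_on (\<lambda>z. line_dv u v (h z)) S"
  unfolding line_du_def line_dv_def
  by (intro C1_intros C1_on_open[of h S]; assumption)+

lemma C1_normal_deriv: "C1_on h S \<Longrightarrow> C1_on k S \<Longrightarrow> C1_on (\<lambda>z. normal_deriv (h z) (k z)) S"
  unfolding normal_deriv_def by (intro C1_on_vec_lambda C1_intros C1_on_open[of h S])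

context nearby_octics
begin

lemma lift_retr:
  assumes l: "lift \<sigma> g UNIV" and nz: "\<And>p. g p \<noteq> 0" and z: "\<And>p. octic 0 (g p) = 0" and t: "norm t < \<epsilon>"
  shows "lift (simplex_map 2 (retr_proj t) \<sigma>) (\<lambda>p. retr t (g p)) UNIV" "(t, g p) \<in> dom"
proof -
  have d: "(t, g p) \<in> dom" for p
    using dom_zero[of 0 "g p" t] nz z t pos by simp
  have g: "C1_on g UNIV" using l by (simp add: lift_def)
  have "C1_on (\<lambda>p. retr t (g p)) UNIV"
    using C1_on_compose[OF C1_on_Pair[OF C1_on_const[of UNIV t] g] C1_retr] d by simp
  then show "lift (simplex_map 2 (retr_proj t) \<sigma>) (\<lambda>p. retr t (g p)) UNIV"
    using l d by (auto simp: lift_def simplex_map_def barycentric_simplex retr_proj retr_nonzero)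
  show "(t, g p) \<in> dom" by (rule d)
qed

text \<open>The pulled back residue form with the normal vector as transversal row. Multiples of
  that row are dropped from the other rows, which removes the derivatives of \<open>root\<close>
  along the line; so the expression is C1 in parameter and point although \<open>root\<close> itself
  is only known to be C1.\<close>

definition line_integrand :: "(4 \<Rightarrow> nat) \<Rightarrow> complex^4 \<Rightarrow> complex^4 \<Rightarrow> param \<Rightarrow> real \<times> real \<Rightarrow> complex" where
  "line_integrand \<beta> u v t p = (let g = line_lift u v p; g1 = line_du u v p; g2 = line_dv u v p; n = normal_field g; l = root t g
     in monomial \<beta> (retr t g) * det4 g n (g1 + l *s normal_deriv g g1) (g2 + l *s normal_deriv g g2) / octic_deriv t (retr t g) n)"

definition line_period :: "(4 \<Rightarrow> nat) \<Rightarrow> complex^4 \<Rightarrow> complex^4 \<Rightarrow> param \<Rightarrow> complex" where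
  "line_period \<beta> u v t = integral triangle (line_integrand \<beta> u v t)"

text \<open>The derivative of the retracted lift contains the derivative of \<open>root\<close> only
  as a multiple of the normal vector, and \<open>retr\<close> differs from the line by such a
  multiple as well; the determinant kills both.\<close>

lemma rform_line:
  assumes uv: "indep2 u v" "line u v \<subseteq> octic_points 0" and t: "norm t < \<epsilon>" and p: "p \<in> triangle"
  shows "rform t \<beta> (\<lambda>p. retr t (line_lift u v p)) p = line_integrand \<beta> u v t p"
proof -
  let ?g = "line_lift u v"
  have nz: "?g p \<noteq> 0" for p by (rule line_lift_nonzero[OF uv(1)])
  have z: "octic 0 (?g p) = 0" for p
    using line_lift_in_line[OF uv(1), of p] uv(2) proj_in_octic_points[OF nz] by blast
  have d: "(t, ?g p) \<in> dom" for p using lift_retr(2)[OF lift_line_simplex[OF uv(1)] nz z t] .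
  have l: "lift (simplex_map 2 (retr_proj t) (line_simplex u v)) (\<lambda>p. retr t (?g p)) UNIV"
    by (rule lift_retr(1)[OF lift_line_simplex[OF uv(1)] nz z t])
  let ?n = "normal_field (?g p)" and ?l = "root t (?g p)" and ?g1 = "line_du u v p" and ?g2 = "line_dv u v p"
  have C1l: "C1_on (\<lambda>p. root t (?g p)) UNIV"
    using C1_on_compose[OF C1_on_Pair[OF C1_on_const[of UNIV t] C1_line_lift[OF C1_on_id[OF open_UNIV]]] C1_root_and_derivative(1)] d by simp
  define dl where "dl = FD (\<lambda>p. root t (?g p)) p"
  have dg: "(?g has_derivative (\<lambda>h. fst h *\<^sub>R ?g1 + snd h *\<^sub>R ?g2)) (at p)"
    using C1_on_has_derivative[OF C1_line_lift[OF C1_on_id[OF open_UNIV]] UNIV_I, of u v p] by (simp add: FD_line_lift[abs_def])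
  have dn: "((\<lambda>p. normal_field (?g p)) has_derivative (\<lambda>h. normal_deriv (?g p) (fst h *\<^sub>R ?g1 + snd h *\<^sub>R ?g2))) (at p)"
    by (rule has_derivative_compose[OF dg has_derivative_normal_field])
  have "((\<lambda>p. \<chi> i. ?g p $ i + root t (?g p) * normal_field (?g p) $ i) has_derivative
      (\<lambda>h. \<chi> i. (fst h *\<^sub>R ?g1 + snd h *\<^sub>R ?g2) $ i + (?l * normal_deriv (?g p) (fst h *\<^sub>R ?g1 + snd h *\<^sub>R ?g2) $ i + dl h * ?n $ i))) (at p)"
    unfolding dl_def
    by (intro has_derivative_vec_lambda has_derivative_add has_derivative_mult has_derivative_compose[OF dg, of "\<lambda>x. x $ _"]
        has_derivative_compose[OF dn, of "\<lambda>x. x $ _"] C1_on_has_derivative[OF C1l UNIV_I] bounded_linear_imp_has_derivative bounded_linear_vec_nth)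
  then have "((\<lambda>p. retr t (?g p)) has_derivative (\<lambda>h. (fst h *\<^sub>R ?g1 + snd h *\<^sub>R ?g2) +
      ?l *s normal_deriv (?g p) (fst h *\<^sub>R ?g1 + snd h *\<^sub>R ?g2) + dl h *s ?n)) (at p)"
    by (rule has_derivative_eq_rhs[OF has_derivative_transform[of _ UNIV, simplified, rotated]])
      (auto simp: retr_def vec_eq_iff fun_eq_iff)
  from FD_eq[OF this]
  have F: "FD (\<lambda>p. retr t (?g p)) p (1, 0) = ?g1 + ?l *s normal_deriv (?g p) ?g1 + dl (1, 0) *s ?n"
    "FD (\<lambda>p. retr t (?g p)) p (0, 1) = ?g2 + ?l *s normal_deriv (?g p) ?g2 + dl (0, 1) *s ?n"
    by simp_all
  have "rform t \<beta> (\<lambda>p. retr t (?g p)) p = monomial \<beta> (retr t (?g p)) * det4 (retr t (?g p)) ?n (FD (\<lambda>p. retr t (?g p)) p (1, 0)) (FD (\<lambda>p. retr t (?g p)) p (0, 1))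
      / octic_deriv t (retr t (?g p)) ?n"
    by (rule rform_local[OF l octic_retr[OF d] p retr_deriv[OF d]])
  also have "det4 (retr t (?g p)) ?n (FD (\<lambda>p. retr t (?g p)) p (1, 0)) (FD (\<lambda>p. retr t (?g p)) p (0, 1))
    = det4 (?g p) ?n (?g1 + ?l *s normal_deriv (?g p) ?g1) (?g2 + ?l *s normal_deriv (?g p) ?g2)"
    unfolding F unfolding retr_def by (simp only: det4_add(1) det4_add(3)[of _ _ _ "_ *s ?n"] det4_add(4)[of _ _ _ _ "_ *s ?n"] det4_scale det4_same mult_zero_right add_0_right)
  finally show ?thesis by (simp add: line_integrand_def Let_def)
qed

lemma chain_integral_line:
  assumes \<beta>: "\<beta> \<in> quartic_exps" and uv: "indep2 u v" "line u v \<subseteq> octic_points 0" and t: "norm t < \<epsilon>"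
  shows "chain_integral t \<beta> (chain_map 2 (retr_proj t) (line_cycle u v)) = line_period \<beta> u v t"
    "\<sigma> \<in> Poly_Mapping.keys (chain_map 2 (retr_proj t) (line_cycle u v)) \<Longrightarrow> C1_simplex \<sigma>"
proof -
  have nz: "line_lift u v p \<noteq> 0" for p by (rule line_lift_nonzero[OF uv(1)])
  have z: "octic 0 (line_lift u v p) = 0" for p
    using line_lift_in_line[OF uv(1), of p] uv(2) proj_in_octic_points[OF nz] by blast
  have nz': "u \<noteq> 0" by (rule indep2_nonzero[OF uv(1)])
  have z': "octic 0 u = 0"
    using proj_in_line[OF uv(1)] uv(2) proj_in_octic_points[OF nz'] by blast
  have l: "lift (simplex_map 2 (retr_proj t) (line_simplex u v)) (\<lambda>p. retr t (line_lift u v p)) UNIV"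
    and d: "(t, line_lift u v p) \<in> dom" for p
    using lift_retr[OF lift_line_simplex[OF uv(1)] nz z t] by blast+
  have l': "lift (simplex_map 2 (retr_proj t) (\<lambda>s\<in>standard_simplex 2. proj u)) (\<lambda>p. retr t u) UNIV"
    and d': "(t, u) \<in> dom"
    using lift_retr[OF lift_constant[OF nz'] nz' z' t] by blast+
  have "simplex_integral t \<beta> (simplex_map 2 (retr_proj t) (line_simplex u v)) = line_period \<beta> u v t"
    unfolding line_period_def simplex_integral_lift[OF \<beta> smooth_nearby[OF t] l octic_retr[OF d]]
    by (rule Henstock_Kurzweil_Integration.integral_cong) (rule rform_line[OF uv t])
  \<comment> \<open>The second simplex of the cycle has a constant lift, on which the form
    vanishes.\<close>
  moreover have "rform t \<beta> (\<lambda>p. retr t u) = (\<lambda>_. 0)"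
    by (simp add: fun_eq_iff rform_def residue_form_bilinear[of t \<beta> "retr t u" 0 0 0 0 0 0 0 0, simplified])
  then have "simplex_integral t \<beta> (simplex_map 2 (retr_proj t) (\<lambda>s\<in>standard_simplex 2. proj u)) = 0"
    unfolding simplex_integral_lift[OF \<beta> smooth_nearby[OF t] l' octic_retr[OF d']] by simp
  ultimately show "chain_integral t \<beta> (chain_map 2 (retr_proj t) (line_cycle u v)) = line_period \<beta> u v t"
    unfolding chain_integral_eq frag_ext_chain_map line_cycle_def by (simp add: frag_ext_diff)
  assume "\<sigma> \<in> Poly_Mapping.keys (chain_map 2 (retr_proj t) (line_cycle u v))"
  then have "\<sigma> \<in> simplex_map 2 (retr_proj t) ` Poly_Mapping.keys (line_cycle u v)"
    using keys_chain_map by blast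
  moreover have "Poly_Mapping.keys (line_cycle u v) \<subseteq> {line_simplex u v, \<lambda>s\<in>standard_simplex 2. proj u}"
    unfolding line_cycle_def using keys_diff[of "frag_of (line_simplex u v)"] by fastforce
  ultimately show "C1_simplex \<sigma>" using l l' unfolding C1_simplex_iff by blast
qed

end

section \<open>The periods as holomorphic functions of the parameters\<close>

abbreviation vec_hol_on :: "(complex^'n \<Rightarrow> complex) \<Rightarrow> (complex^'n) set \<Rightarrow> bool" where
  "vec_hol_on \<equiv> hol_on (\<lambda>c v. c *s v)"

lemma has_derivative_slice:
  fixes F :: "'a::euclidean_space \<times> 'b::euclidean_space \<Rightarrow> 'c::real_normed_vector"
  assumes "C1_on F W" "(t, x) \<in> W"
  shows "((\<lambda>t. F (t, x)) has_derivative (\<lambda>v. FD F (t, x) (v, 0))) (at t)"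
proof -
  have "((\<lambda>t. (t, x)) has_derivative (\<lambda>v. (v, 0))) (at t)"
    by (intro has_derivative_Pair has_derivative_const has_derivative_ident)
  from has_derivative_compose[OF this C1_on_has_derivative[OF assms]] show ?thesis .
qed

lemma hol_on_det4:
  assumes "open S" "\<And>i. hol_on sc (\<lambda>t. x t $ i) S" "\<And>i. hol_on sc (\<lambda>t. w t $ i) S" "\<And>i. hol_on sc (\<lambda>t. u t $ i) S" "\<And>i. hol_on sc (\<lambda>t. v t $ i) S"
  shows "hol_on sc (\<lambda>t. det4 (x t) (w t) (u t) (v t)) S"
  unfolding det_def rows_def
proof (intro hol_on_sum hol_on_mult hol_on_const hol_on_prod assms(1))
  fix p :: "4 \<Rightarrow> 4" and i :: 4
  show "hol_on sc (\<lambda>t. (\<chi> i. if i = 0 then x t else if i = 1 then w t else if i = 2 then u t else v t) $ i $ p i) S"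
    by (cases "i = 0"; cases "i = 1"; cases "i = 2"; simp add: assms)
qed

text \<open>Over the square of \<open>integral_triangle\<close> the limits are constant, so
  differentiation under the integral sign is applied in each of the two variables.\<close>

lemma C1_on_triangle_integral:
  fixes F :: "'a::euclidean_space \<times> (real \<times> real) \<Rightarrow> complex"
  assumes U: "open U" "convex U" and F: "C1_on F (U \<times> UNIV)"
  shows "C1_on (\<lambda>t. integral triangle (\<lambda>p. F (t, p))) U"
    "\<And>t v. t \<in> U \<Longrightarrow> FD (\<lambda>t. integral triangle (\<lambda>p. F (t, p))) t v = integral triangle (\<lambda>p. FD F (t, p) (v, 0))"
proof -
  define F2 where "F2 = (\<lambda>z :: ('a \<times> real) \<times> real. (1 - snd (fst z)) *\<^sub>R F (fst (fst z), (snd (fst z), (1 - snd (fst z)) * snd z)))"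
  define H where "H = (\<lambda>z :: 'a \<times> real. integral {0..1} (\<lambda>y. F2 (z, y)))"
  let ?W = "U \<times> (UNIV :: real set)"
  have W: "open ?W" "convex ?W" using U by (auto intro: open_Times convex_Times)
  have oW2: "open (?W \<times> (UNIV :: real set))" using U(1) by (intro open_Times open_UNIV)
  have F2: "C1_on F2 (?W \<times> UNIV)"
    unfolding F2_def
    by (intro C1_on_scaleR C1_on_compose[OF _ F] C1_intros oW2) auto
  have H: "C1_on H ?W" "\<And>z v. z \<in> ?W \<Longrightarrow> FD H z v = integral {0..1} (\<lambda>y. FD F2 (z, y) (v, 0))"
    unfolding H_def using C1_on_integral_param[OF F2 W] by auto
  have P: "C1_on (\<lambda>t. integral {0..1} (\<lambda>x. H (t, x))) U" "\<And>t v. t \<in> U \<Longrightarrow> FD (\<lambda>t. integral {0..1} (\<lambda>x. H (t, x))) t v = integral {0..1} (\<lambda>x. FD H (t, x) (v, 0))"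
    using C1_on_integral_param[OF H(1) U] by auto
  have cF: "continuous_on triangle (\<lambda>p. F (t, p))" if "t \<in> U" for t
    by (rule continuous_on_compose2[OF C1_on_continuous_on[OF F]]) (use that in \<open>auto intro!: continuous_intros\<close>)
  have eq: "integral triangle (\<lambda>p. F (t, p)) = integral {0..1} (\<lambda>x. H (t, x))" if "t \<in> U" for t
    unfolding integral_triangle[OF cF[OF that]] by (simp add: H_def F2_def)
  show C: "C1_on (\<lambda>t. integral triangle (\<lambda>p. F (t, p))) U"
    by (rule C1_on_cong[OF P(1) eq])
  fix t v assume t: "t \<in> U"
  have "FD (\<lambda>t. integral triangle (\<lambda>p. F (t, p))) t = FD (\<lambda>t. integral {0..1} (\<lambda>x. H (t, x))) t"
    by (rule FD_eq[OF has_derivative_transform_within_open[OF C1_on_has_derivative[OF P(1) t] U(1) t]]) (simp add: eq)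
  then have "FD (\<lambda>t. integral triangle (\<lambda>p. F (t, p))) t v = integral {0..1} (\<lambda>x. integral {0..1} (\<lambda>y. FD F2 ((t, x), y) ((v, 0), 0)))"
    using t by (simp add: P(2) H(2))
  moreover have "FD F2 ((t, x), y) ((v, 0), 0) = (1 - x) *\<^sub>R FD F (t, (x, (1 - x) * y)) (v, 0)" for x y
  proof -
    have "((\<lambda>t. ((t, x), y)) has_derivative (\<lambda>v. ((v, 0), 0))) (at t)"
      by (intro has_derivative_Pair has_derivative_const has_derivative_ident)
    from has_derivative_compose[OF this C1_on_has_derivative[OF F2, of "((t, x), y)"]]
    have 1: "((\<lambda>t. F2 ((t, x), y)) has_derivative (\<lambda>v. FD F2 ((t, x), y) ((v, 0), 0))) (at t)" using t by simp
    have 2: "((\<lambda>t. F2 ((t, x), y)) has_derivative (\<lambda>v. (1 - x) *\<^sub>R FD F (t, (x, (1 - x) * y)) (v, 0))) (at t)"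
      unfolding F2_def using has_derivative_scaleR_right[OF has_derivative_slice[OF F, of t "(x, (1 - x) * y)"], of "1 - x"] t by simp
    from has_derivative_unique[OF 1 2] show ?thesis by (simp only: fun_eq_iff)
  qed
  moreover have "continuous_on triangle (\<lambda>p. FD F (t, p) (v, 0))"
    by (rule continuous_on_compose2[OF C1_on_FD_continuous[OF F]]) (use t in \<open>auto intro!: continuous_intros\<close>)
  ultimately show "FD (\<lambda>t. integral triangle (\<lambda>p. F (t, p))) t v = integral triangle (\<lambda>p. FD F (t, p) (v, 0))"
    by (simp add: integral_triangle)
qed

context nearby_octics
begin

lemma line_dom:
  assumes "indep2 u v" "line u v \<subseteq> octic_points 0" "norm t < \<epsilon>"
  shows "(t, line_lift u v p) \<in> dom"
proof -
  have nz: "line_lift u v p \<noteq> 0" by (rule line_lift_nonzero[OF assms(1)])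
  moreover have "octic 0 (line_lift u v p) = 0"
    using line_lift_in_line[OF assms(1), of p] assms(2) proj_in_octic_points[OF nz] by blast
  ultimately show ?thesis using dom_zero[of 0] assms(3) pos by simp
qed

lemma root_t0: "x \<noteq> 0 \<Longrightarrow> octic 0 x = 0 \<Longrightarrow> root 0 x = 0"
  using root_zero[of 0 x] dom_zero[of 0 x 0] pos by simp

lemma line_integrand_C1:
  assumes uv: "indep2 u v" "line u v \<subseteq> octic_points 0"
  shows "C1_on (\<lambda>z. line_integrand \<beta> u v (fst z) (snd z)) (ball 0 \<epsilon> \<times> UNIV)"
proof -
  let ?W = "ball 0 \<epsilon> \<times> UNIV :: (param \<times> (real \<times> real)) set"
  have W: "open ?W" by (intro open_Times open_ball open_UNIV)
  have d: "(fst z, line_lift u v (snd z)) \<in> dom" if "z \<in> ?W" for z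
    using line_dom[OF uv] that by auto
  have s: "C1_on snd ?W" using C1_on_snd[OF C1_on_id[OF W]] .
  have f: "C1_on fst ?W" using C1_on_fst[OF C1_on_id[OF W]] .
  note g = C1_line_lift[OF s, of u v] and g1 = C1_line_du[OF s, of u v] and g2 = C1_line_dv[OF s, of u v]
  have r: "C1_on (\<lambda>z. root (fst z) (line_lift u v (snd z))) ?W"
    using C1_on_compose[OF C1_on_Pair[OF f g] C1_root_and_derivative(1) d] by simp
  have R: "C1_on (\<lambda>z. retr (fst z) (line_lift u v (snd z))) ?W"
    using C1_on_compose[OF C1_on_Pair[OF f g] C1_retr d] by simp
  show ?thesis unfolding line_integrand_def Let_def
    by (intro C1_on_divide C1_on_mult C1_on_monomial W R C1_on_det4 C1_on_add C1_on_vector_mult r g g1 g2 C1_normal_deriv C1_on_normal_field C1_on_octic_deriv f)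
      (use retr_deriv[OF d] in auto)
qed

text \<open>For fixed \<open>x\<close> the conjugates in the normal field are constants, so the
  formula for the derivative is complex linear in the parameter.\<close>

lemma root_hol:
  assumes x: "x \<noteq> 0" "octic 0 x = 0"
  shows "vec_hol_on (\<lambda>t. root t x) (ball 0 \<epsilon>)"
proof -
  have d: "(t, x) \<in> dom" if "t \<in> ball 0 \<epsilon>" for t using dom_zero[of 0 x t] x that pos by auto
  have C: "C1_on (\<lambda>t. root t x) (ball 0 \<epsilon>)"
    using C1_on_compose[OF C1_on_Pair[OF C1_on_id[OF open_ball] C1_on_const[OF open_ball]] C1_root_and_derivative(1), of 0 \<epsilon> x] d by simp
  have "FD (\<lambda>t. root t x) t (c *s s) = c * FD (\<lambda>t. root t x) t s" if t: "t \<in> ball 0 \<epsilon>" for t c s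
    using FD_eq[OF has_derivative_slice[OF C1_root_and_derivative(1) d[OF t]]]
    by (simp add: C1_root_and_derivative(2)[OF d[OF t]] sum_distrib_left mult.assoc)
  then show ?thesis using C by (simp add: hol_on_def)
qed

lemma line_integrand_hol:
  assumes uv: "indep2 u v" "line u v \<subseteq> octic_points 0"
  shows "vec_hol_on (\<lambda>t. line_integrand \<beta> u v t p) (ball 0 \<epsilon>)"
proof -
  let ?B = "ball 0 \<epsilon> :: param set"
  have d: "(t, line_lift u v p) \<in> dom" if "t \<in> ?B" for t
    using line_dom[OF uv] that by auto
  have nz: "line_lift u v p \<noteq> 0" by (rule line_lift_nonzero[OF uv(1)])
  have z: "octic 0 (line_lift u v p) = 0"
    using line_lift_in_line[OF uv(1), of p] uv(2) proj_in_octic_points[OF nz] by blast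
  note r = root_hol[OF nz z]
  have tt: "vec_hol_on (\<lambda>t. t $ \<alpha>) ?B" for \<alpha>
    by (rule hol_onI[where D = "\<lambda>_ v. v $ \<alpha>"])
      (auto intro: C1_on_bounded_linear bounded_linear_vec_nth bounded_linear_imp_has_derivative)
  have R: "vec_hol_on (\<lambda>t. retr t (line_lift u v p) $ i) ?B" for i
    unfolding retr_def by (simp, intro hol_intros r open_ball)
  have o: "vec_hol_on (\<lambda>t. octic_deriv t (retr t (line_lift u v p)) n) ?B" for n
    unfolding octic_deriv_def monomial_deriv_def by (intro hol_intros R tt open_ball)
  show ?thesis unfolding line_integrand_def Let_def
    by (rule hol_on_divide; (use retr_deriv[OF d] in blast)?)
      (intro hol_on_mult hol_on_det4 open_ball o; (simp add: monomial_def)?; intro hol_intros R r open_ball)+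
qed

lemma line_period_hol:
  assumes uv: "indep2 u v" "line u v \<subseteq> octic_points 0"
  shows "vec_hol_on (line_period \<beta> u v) (ball 0 \<epsilon>)"
    "\<And>t s. t \<in> ball 0 \<epsilon> \<Longrightarrow> FD (line_period \<beta> u v) t s = integral triangle (\<lambda>p. FD (\<lambda>t. line_integrand \<beta> u v t p) t s)"
proof -
  let ?B = "ball 0 \<epsilon> :: param set"
  note F = line_integrand_C1[OF uv, of \<beta>]
  note P = C1_on_triangle_integral[OF open_ball convex_ball F]
  have C: "C1_on (line_period \<beta> u v) ?B" using P(1) by (simp add: line_period_def[abs_def])
  have s: "FD (\<lambda>t. line_integrand \<beta> u v t p) t s = FD (\<lambda>z. line_integrand \<beta> u v (fst z) (snd z)) (t, p) (s, 0)" if "t \<in> ?B" for t p s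
    using FD_eq[OF has_derivative_slice[OF F, of t p]] that by simp
  show D: "FD (line_period \<beta> u v) t s = integral triangle (\<lambda>p. FD (\<lambda>t. line_integrand \<beta> u v t p) t s)" if "t \<in> ?B" for t s
    using P(2)[OF that, of s] by (simp add: line_period_def[abs_def] s[OF that])
  have "FD (line_period \<beta> u v) t (c *s s) = c * FD (line_period \<beta> u v) t s" if t: "t \<in> ?B" for t c s
    unfolding D[OF t] hol_on_scale[OF line_integrand_hol[OF uv] t] by simp
  then show "vec_hol_on (line_period \<beta> u v) ?B" using C by (simp add: hol_on_def)
qed

text \<open>The rows \<open>g\<close>, \<open>g1\<close>, \<open>g2\<close> lie in the plane spanned
  by \<open>u\<close> and \<open>v\<close>, so the determinant without normal derivatives is 0 and
  \<open>root\<close> splits off as a factor. As it vanishes at t = 0, only its own derivative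
  contributes there.\<close>

lemma line_integrand_0:
  assumes uv: "indep2 u v" "line u v \<subseteq> octic_points 0"
  defines "g \<equiv> line_lift u v" and "g1 \<equiv> line_du u v" and "g2 \<equiv> line_dv u v"
  shows "line_integrand \<beta> u v 0 p = 0"
    "FD (\<lambda>t. line_integrand \<beta> u v t p) 0 s = (\<Sum>\<alpha>\<in>UNIV. s $ \<alpha> * monomial (expo \<alpha>) (g p)) * monomial \<beta> (g p) *
      (det4 (g p) (normal_field (g p)) (normal_deriv (g p) (g1 p)) (g2 p) + det4 (g p) (normal_field (g p)) (g1 p) (normal_deriv (g p) (g2 p)))
      / (octic_deriv 0 (g p) (normal_field (g p)))\<^sup>2"
proof -
  let ?B = "ball 0 \<epsilon> :: param set" and ?n = "normal_field (g p)" and ?n1 = "normal_deriv (g p) (g1 p)" and ?n2 = "normal_deriv (g p) (g2 p)"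
  have d: "(t, g p) \<in> dom" if "t \<in> ?B" for t
    using line_dom[OF uv] that by (auto simp: g_def)
  have nz: "g p \<noteq> 0" unfolding g_def by (rule line_lift_nonzero[OF uv(1)])
  have z: "octic 0 (g p) = 0"
    using line_lift_in_line[OF uv(1), of p] uv(2) proj_in_octic_points nz unfolding g_def by blast
  have 0: "0 \<in> ?B" using pos by simp
  note r = root_hol[OF nz z]
  have r0: "root 0 (g p) = 0" by (rule root_t0[OF nz z])
  have "det4 (a *s u + b *s v) w (c *s u + e *s v) (c' *s u + e' *s v) = 0" for a b c e c' e' w
    by (simp only: det4_add det4_scale) (simp add: det4_same)
  then have D0: "det4 (g p) ?n (g1 p) (g2 p) = 0"
    unfolding g_def g1_def g2_def line_lift_def line_du_def line_dv_def by blast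
  define A where "A = (\<lambda>t. monomial \<beta> (retr t (g p)) * ((det4 (g p) ?n ?n1 (g2 p) + det4 (g p) ?n (g1 p) ?n2) + root t (g p) * det4 (g p) ?n ?n1 ?n2)
     / octic_deriv t (retr t (g p)) ?n)"
  have I: "line_integrand \<beta> u v t p = root t (g p) * A t" for t
    unfolding line_integrand_def Let_def A_def g_def[symmetric] g1_def[symmetric] g2_def[symmetric]
    by (simp only: det4_add det4_scale D0) (simp add: algebra_simps add_divide_distrib)
  show "line_integrand \<beta> u v 0 p = 0" unfolding I r0 by simp
  have C: "C1_on (\<lambda>t. retr t (g p)) ?B"
    using C1_on_compose[OF C1_on_Pair[OF C1_on_id[OF open_ball] C1_on_const[OF open_ball]] C1_retr, of 0 \<epsilon> "g p"] d by simp
  have "C1_on A ?B" unfolding A_def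
    by (intro C1_on_divide C1_on_mult C1_on_monomial C C1_on_add C1_on_const hol_on_C1[OF r] C1_on_octic_deriv C1_on_id open_ball)
      (use retr_deriv[OF d] in auto)
  from has_derivative_mult[OF has_derivative_slice[OF C1_root_and_derivative(1) d[OF 0]] C1_on_has_derivative[OF this 0]]
  have "((\<lambda>t. line_integrand \<beta> u v t p) has_derivative (\<lambda>s. FD (\<lambda>z. root (fst z) (snd z)) (0, g p) (s, 0) * A 0)) (at 0)"
    by (simp add: I r0)
  then show "FD (\<lambda>t. line_integrand \<beta> u v t p) 0 s = (\<Sum>\<alpha>\<in>UNIV. s $ \<alpha> * monomial (expo \<alpha>) (g p)) * monomial \<beta> (g p) *
      (det4 (g p) ?n ?n1 (g2 p) + det4 (g p) ?n (g1 p) ?n2) / (octic_deriv 0 (g p) ?n)\<^sup>2"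
    by (simp add: FD_eq C1_root_and_derivative(2)[OF d[OF 0]] A_def r0 retr_def power2_eq_square mult.assoc)
qed

lemma line_period_0: "indep2 u v \<Longrightarrow> line u v \<subseteq> octic_points 0 \<Longrightarrow> line_period \<beta> u v 0 = 0"
  unfolding line_period_def by (simp add: line_integrand_0(1) cong: Henstock_Kurzweil_Integration.integral_cong)

end

section \<open>The first derivatives of the periods\<close>

definition on_line :: "complex \<Rightarrow> complex \<Rightarrow> complex^4 \<Rightarrow> bool" where
  "on_line \<zeta> \<xi> x \<longleftrightarrow> x $ 0 = \<zeta> * x $ 1 \<and> x $ 2 = \<xi> * x $ 3"

definition vec4 :: "complex \<Rightarrow> complex \<Rightarrow> complex \<Rightarrow> complex \<Rightarrow> complex^4" where
  "vec4 a b c d = (\<chi> i. if i = 0 then a else if i = 1 then b else if i = 2 then c else d)"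

lemma vec4_nth [simp]: "vec4 a b c d $ 0 = a" "vec4 a b c d $ 1 = b" "vec4 a b c d $ 2 = c" "vec4 a b c d $ 3 = d"
  by (simp_all add: vec4_def)

text \<open>On the unit circle conjugation is inversion, so the conjugate to the seventh power is
  \<zeta> divided by \<zeta> ^ 8 = -1.\<close>

lemma root8:
  assumes "(\<zeta> :: complex) ^ 8 = -1"
  shows "cmod \<zeta> = 1" "cnj \<zeta> ^ 7 = - \<zeta>"
proof -
  have "cmod \<zeta> ^ 8 = 1" by (simp add: assms flip: norm_power)
  then show n: "cmod \<zeta> = 1" using power_eq_imp_eq_base[of "cmod \<zeta>" 8 1] by simp
  have "cnj \<zeta> ^ 7 * (\<zeta> ^ 8) = (cnj \<zeta> * \<zeta>) ^ 7 * \<zeta>" by (simp add: power_mult_distrib) (simp add: eval_nat_numeral)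
  moreover have "cnj \<zeta> * \<zeta> = 1" using n by (simp add: mult.commute complex_norm_square[symmetric])
  ultimately show "cnj \<zeta> ^ 7 = - \<zeta>" using assms by (simp add: minus_equation_iff)
qed

lemma line_det_nonzero:
  assumes "\<zeta> \<noteq> 0" "\<xi> \<noteq> 0"
  shows "det4 (vec4 \<zeta> 1 0 0) (vec4 (- \<zeta>) 1 0 0) (vec4 0 0 (- \<xi>) 1) (vec4 0 0 \<xi> 1) \<noteq> 0"
proof -
  let ?M = "rows (vec4 \<zeta> 1 0 0) (vec4 (- \<zeta>) 1 0 0) (vec4 0 0 (- \<xi>) 1) (vec4 0 0 \<xi> 1)"
  have "x = 0" if "?M *v x = 0" for x
  proof -
    have "(?M *v x) $ i = 0" for i using that by simp
    from this[of 0] this[of 1] this[of 2] this[of 3]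
    have "\<zeta> * x $ 0 + x $ 1 = 0" "- \<zeta> * x $ 0 + x $ 1 = 0" "- \<xi> * x $ 2 + x $ 3 = 0" "\<xi> * x $ 2 + x $ 3 = 0"
      by (simp_all add: matrix_vector_mult_def rows_def sum_UNIV_4)
    then show "x = 0" using assms by (simp add: vec_eq_iff all_4) algebra
  qed
  then have "\<exists>B. B ** ?M = mat 1" unfolding matrix_left_invertible_ker by blast
  then show ?thesis unfolding invertible_det_nz[symmetric] invertible_left_inverse .
qed

lemma det4_swap_middle: "det4 x u w v = - det4 x w u v"
proof -
  have "0 = det4 x (w + u) (w + u) v" by (simp add: det4_same)
  also have "\<dots> = det4 x w u v + det4 x u w v"
    by (simp only: det4_add) (simp add: det4_same)
  finally show ?thesis by (simp add: eq_neg_iff_add_eq_0 add.commute)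
qed

lemma det4_swap_outer: "det4 v w u x = - det4 x w u v"
proof -
  have "0 = det4 (x + v) w u (x + v)" by (simp add: det4_same)
  also have "\<dots> = det4 x w u v + det4 v w u x"
    by (simp only: det4_add) (simp add: det4_same)
  finally show ?thesis by (simp add: eq_neg_iff_add_eq_0 add.commute)
qed

lemma det4_two_planes:
  "det4 (a *s e + b *s f) (A *s e' + B *s f') (A1 *s e' + B1 *s f') (a2 *s e + b2 *s f)
   = (a * b2 - b * a2) * (A * B1 - B * A1) * det4 e e' f' f"
  by (simp only: det4_add det4_scale) (simp add: det4_same det4_swap_middle[of e f' e' f] det4_swap_outer[of f e' f' e] det4_swap_outer[of f f' e' e]
    det4_swap_middle[of _ f' e'] algebra_simps)

text \<open>Coordinates 1 and 3 are linear coordinates on the plane of vectors satisfying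
  \<open>on_line \<zeta> \<xi>\<close>; the minor is the area form in them.\<close>

definition plane_minor :: "complex^4 \<Rightarrow> complex^4 \<Rightarrow> complex" where
  "plane_minor x y = x $ 1 * y $ 3 - x $ 3 * y $ 1"

lemma plane_minor_nonzero:
  assumes "indep2 u v" "on_line \<zeta> \<xi> u" "on_line \<zeta> \<xi> v"
  shows "plane_minor u v \<noteq> 0"
proof
  assume "plane_minor u v = 0"
  then have "v $ 1 *s u + (- u $ 1) *s v = 0" "v $ 3 *s u + (- u $ 3) *s v = 0"
    using assms(2,3) by (auto simp: plane_minor_def on_line_def vec_eq_iff all_4 algebra_simps)
  then have "v $ 1 = 0" "u $ 1 = 0" "v $ 3 = 0" "u $ 3 = 0" using assms(1) unfolding indep2_def by (metis neg_equal_0_iff_equal)+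
  then have "u = 0" using assms(2) by (simp add: on_line_def vec_eq_iff all_4)
  then show False using indep2_nonzero[OF assms(1)] by blast
qed

text \<open>By \<open>root8\<close> the normal field and its derivative send the plane of the line
  into the plane where \<zeta>, \<xi> are replaced by -\<zeta>, -\<xi>. The determinants then factor
  into minors of the two planes, and those of the second plane are built from conjugates.\<close>

lemma line_numerator:
  assumes \<zeta>: "\<zeta> ^ 8 = -1" and \<xi>: "\<xi> ^ 8 = -1" and x: "on_line \<zeta> \<xi> x" and h: "on_line \<zeta> \<xi> h" and k: "on_line \<zeta> \<xi> k"
  shows "det4 x (normal_field x) (normal_deriv x h) k + det4 x (normal_field x) h (normal_deriv x k) =
    7 * det4 (vec4 \<zeta> 1 0 0) (vec4 (- \<zeta>) 1 0 0) (vec4 0 0 (- \<xi>) 1) (vec4 0 0 \<xi> 1) * (cnj (x $ 1) * cnj (x $ 3)) ^ 6 *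
    (plane_minor x k * cnj (plane_minor x h) - plane_minor x h * cnj (plane_minor x k))"
proof -
  let ?e = "vec4 \<zeta> 1 0 0" and ?e' = "vec4 (- \<zeta>) 1 0 0" and ?f' = "vec4 0 0 (- \<xi>) 1" and ?f = "vec4 0 0 \<xi> 1"
  have E: "y = y $ 1 *s ?e + y $ 3 *s ?f" if "on_line \<zeta> \<xi> y" for y
    using that by (simp add: vec_eq_iff all_4 on_line_def)
  have N: "normal_field x = cnj (x $ 1) ^ 7 *s ?e' + cnj (x $ 3) ^ 7 *s ?f'"
    using x root8(2)[OF \<zeta>] root8(2)[OF \<xi>] by (simp add: vec_eq_iff all_4 on_line_def normal_field_def power_mult_distrib)
  have 67: "cnj \<zeta> ^ 6 * cnj \<zeta> = - \<zeta>" "cnj \<xi> ^ 6 * cnj \<xi> = - \<xi>"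
    using root8(2)[OF \<zeta>] root8(2)[OF \<xi>] by (simp_all flip: power_Suc2)
  have D: "normal_deriv x y = (7 * cnj (x $ 1) ^ 6 * cnj (y $ 1)) *s ?e' + (7 * cnj (x $ 3) ^ 6 * cnj (y $ 3)) *s ?f'" if "on_line \<zeta> \<xi> y" for y
  proof -
    have *: "7 * cnj (z * a) ^ 6 * cnj (z * b) = - z * (7 * cnj a ^ 6 * cnj b)" if "cnj z ^ 6 * cnj z = - z" for z a b
      unfolding that[symmetric] by (simp add: power_mult_distrib)
    have xy: "x $ 0 = \<zeta> * x $ 1" "x $ 2 = \<xi> * x $ 3" "y $ 0 = \<zeta> * y $ 1" "y $ 2 = \<xi> * y $ 3"
      using x that by (simp_all add: on_line_def)
    have "normal_deriv x y $ 0 = - \<zeta> * (7 * cnj (x $ 1) ^ 6 * cnj (y $ 1))" "normal_deriv x y $ 2 = - \<xi> * (7 * cnj (x $ 3) ^ 6 * cnj (y $ 3))"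
      "normal_deriv x y $ 1 = 7 * cnj (x $ 1) ^ 6 * cnj (y $ 1)" "normal_deriv x y $ 3 = 7 * cnj (x $ 3) ^ 6 * cnj (y $ 3)"
      by (simp_all only: normal_deriv_def vec_lambda_beta xy *[OF 67(1)] *[OF 67(2)])
    then show ?thesis by (simp add: vec_eq_iff all_4)
  qed
  have "det4 x (normal_field x) (normal_deriv x h) k = plane_minor x k * (7 * (cnj (x $ 1) * cnj (x $ 3)) ^ 6 * cnj (plane_minor x h)) * det4 ?e ?e' ?f' ?f"
    if "on_line \<zeta> \<xi> h" "on_line \<zeta> \<xi> k" for h k
    apply (subst (1) E[OF x], subst N, subst D[OF that(1)], subst E[OF that(2)], subst det4_two_planes)
    apply (simp add: plane_minor_def power_mult_distrib)
    apply (simp add: eval_nat_numeral algebra_simps)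
    done
  note this[OF h k] this[OF k h]
  moreover have "det4 x (normal_field x) h (normal_deriv x k) = - det4 x (normal_field x) (normal_deriv x k) h"
    by (rule det4_swap)
  ultimately show ?thesis by (simp add: algebra_simps)
qed

text \<open>Up to the factor \<open>3\<close>, the excess of \<open>sp\<close> over its derivative in the direction away from the
  centre of the triangle.\<close>

definition rho :: "real \<times> real \<Rightarrow> real" where
  "rho p = fst p * snd p + (1 - fst p - snd p) * (fst p + snd p) - 6 * sp p"

text \<open>\<open>W1\<close> and \<open>W2\<close> are the numerators of the partial derivatives of
  sp / wt, so the expression is essentially the Jacobian of the parametrisation of the line; this is
  why its phase is constant.\<close>

lemma line_minors:
  fixes u v :: "complex^4"
  defines "\<kappa> \<equiv> plane_minor u v"
  shows "plane_minor (line_lift u v p) (line_dv u v p) * cnj (plane_minor (line_lift u v p) (line_du u v p))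
     - plane_minor (line_lift u v p) (line_du u v p) * cnj (plane_minor (line_lift u v p) (line_dv u v p))
     = \<i> * of_real ((cmod \<kappa>)\<^sup>2 * sqrt 3 * (sp p * rho p))"
proof -
  obtain a b where p: "p = (a, b)" by (cases p)
  define W1 where "W1 = wt p * of_real (b * (1 - 2 * a - b)) - of_real (sp p) * (cis (2 * pi / 3) - 1)"
  define W2 where "W2 = wt p * of_real (a * (1 - a - 2 * b)) - of_real (sp p) * (cis (4 * pi / 3) - 1)"
  have 1: "plane_minor (line_lift u v p) (line_du u v p) = \<kappa> * W1" "plane_minor (line_lift u v p) (line_dv u v p) = \<kappa> * W2"
    by (simp_all add: \<kappa>_def plane_minor_def line_lift_def line_du_def line_dv_def W1_def W2_def p algebra_simps)
  have 2: "W2 * cnj W1 - W1 * cnj W2 = \<i> * of_real (sqrt 3 * (sp p * rho p))"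
    unfolding W1_def W2_def wt_alt cis_third
    by (simp add: complex_eq_iff p sp_def rho_def) (simp add: field_simps)
  have "\<kappa> * W2 * cnj (\<kappa> * W1) - \<kappa> * W1 * cnj (\<kappa> * W2) = (\<kappa> * cnj \<kappa>) * (W2 * cnj W1 - W1 * cnj W2)"
    by (simp add: algebra_simps)
  then show ?thesis unfolding 1 2 complex_norm_square[symmetric] by (simp add: algebra_simps)
qed

lemma sp_nonneg: "p \<in> triangle \<Longrightarrow> 0 \<le> sp p"
  by (auto simp: triangle_def sp_def)

text \<open>Homogenised by a + b + c = 1 in the barycentric coordinates, \<open>rho\<close> becomes
  a sum of nonnegative terms.\<close>

lemma rho_nonneg: "p \<in> triangle \<Longrightarrow> 0 \<le> rho p"
proof -
  assume "p \<in> triangle"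
  then obtain a b c where p: "p = (a, b)" "0 \<le> a" "0 \<le> b" "0 \<le> c" and c: "c = 1 - a - b" by (auto simp: triangle_def)
  have "rho p = a * (b - c)\<^sup>2 + b * (c - a)\<^sup>2 + c * (a - b)\<^sup>2 + 3 * a * b * c"
    unfolding p(1) c rho_def sp_def by (simp add: power2_eq_square algebra_simps)
  then show ?thesis using p by simp
qed

lemma rho_pos: "p \<in> triangle \<Longrightarrow> 0 < sp p \<Longrightarrow> 0 < rho p"
proof -
  assume "p \<in> triangle" and s: "0 < sp p"
  then obtain a b c where p: "p = (a, b)" "0 \<le> a" "0 \<le> b" "0 \<le> c" and c: "c = 1 - a - b" by (auto simp: triangle_def)
  have "rho p = a * (b - c)\<^sup>2 + b * (c - a)\<^sup>2 + c * (a - b)\<^sup>2 + 3 * sp p"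
    unfolding p(1) c rho_def sp_def by (simp add: power2_eq_square algebra_simps)
  then show ?thesis using p s by (simp add: add_nonneg_pos)
qed

text \<open>Up to a constant factor the integrand of the derivative of a period is this nonnegative
  function, so that the integral cannot vanish.\<close>

definition line_density :: "complex^4 \<Rightarrow> complex^4 \<Rightarrow> real \<times> real \<Rightarrow> real" where
  "line_density u v p = (cmod (line_lift u v p $ 1) * cmod (line_lift u v p $ 3)) ^ 12 * (sp p * rho p)
     / (8 * (\<Sum>i\<in>UNIV. cmod (line_lift u v p $ i) ^ 14))\<^sup>2"

lemma continuous_line_density:
  assumes "indep2 u v"
  shows "continuous_on S (line_density u v)"
  unfolding line_density_def[abs_def]
  by (intro continuous_intros continuous_on_subset[OF C1_on_continuous_on[OF C1_line_lift[OF C1_on_id[OF open_UNIV]]] subset_UNIV])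
    (use sum_power_pos[OF line_lift_nonzero[OF assms]] in \<open>auto simp: sp_def[abs_def] rho_def[abs_def] less_le intro!: continuous_intros\<close>)

text \<open>If the integral vanished, the density would vanish on a box, so coordinate 1 or 3 would
  be 0 at each point there. As the minor is nonzero, each of these two linear forms has at most one
  zero on the line, and three distinct points give a contradiction.\<close>

lemma line_density_integral:
  assumes uv: "indep2 u v" and m: "plane_minor u v \<noteq> 0"
  shows "integral triangle (line_density u v) \<noteq> 0"
proof
  let ?g = "line_lift u v"
  assume 0: "integral triangle (line_density u v) = 0"
  have pos: "0 < (\<Sum>i\<in>UNIV. cmod (?g p $ i) ^ 14)" for p
    by (rule sum_power_pos[OF line_lift_nonzero[OF uv]])
  note c = continuous_line_density[OF uv]
  have nn: "0 \<le> line_density u v p" if "p \<in> triangle" for p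
    unfolding line_density_def using sp_nonneg[OF that] rho_nonneg[OF that] by simp
  \<comment> \<open>A box around the barycentre inside the open triangle.\<close>
  let ?B = "cbox (1/5, 3/10) (9/20, 7/20) :: (real \<times> real) set"
  have BT: "p \<in> triangle" "0 < sp p" if pB: "p \<in> ?B" for p
  proof -
    obtain a b where p: "p = (a, b)" "1/5 \<le> a" "a \<le> 9/20" "3/10 \<le> b" "b \<le> 7/20" using pB by (cases p) auto
    then show "p \<in> triangle" "0 < sp p" by (auto simp: triangle_def sp_def)
  qed
  have "integral ?B (line_density u v) \<le> integral triangle (line_density u v)"
    by (rule integral_subset_le) (use BT nn integrable_continuous[OF c] integrable_triangle[OF c] in auto)
  moreover have "0 \<le> integral ?B (line_density u v)"
    by (rule Henstock_Kurzweil_Integration.integral_nonneg) (use BT nn integrable_continuous[OF c] in auto)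
  ultimately have "integral ?B (line_density u v) = 0" using 0 by simp
  moreover have "box (1/5, 3/10) (9/20, 7/20) \<noteq> ({} :: (real \<times> real) set)" by (simp add: box_ne_empty Basis_prod_def)
  ultimately have z: "line_density u v p = 0" if "p \<in> ?B" for p
    using integral_cbox_eq_0_iff[OF c] nn BT that by blast
  have zz: "?g p $ 1 = 0 \<or> ?g p $ 3 = 0" if "p \<in> ?B" for p
    using z[OF that] BT(2)[OF that] rho_pos[OF BT[OF that]] pos[of p] by (simp add: line_density_def)
  \<comment> \<open>A linear form on the span of \<open>u\<close> and \<open>v\<close> with two
    zeros that are not proportional is 0, and then the minor vanishes.\<close>
  have two: False if "p \<in> ?B" "p' \<in> ?B" "wt p * of_real (sp p') \<noteq> wt p' * of_real (sp p)" "i = 1 \<or> i = 3" "?g p $ i = 0" "?g p' $ i = 0" for p p' i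
  proof -
    have "wt p * u $ i + of_real (sp p) * v $ i = 0" "wt p' * u $ i + of_real (sp p') * v $ i = 0"
      using that(5,6) by (simp_all add: line_lift_def)
    moreover have "(wt p * of_real (sp p') - wt p' * of_real (sp p)) * u $ i = of_real (sp p') * (wt p * u $ i + of_real (sp p) * v $ i) - of_real (sp p) * (wt p' * u $ i + of_real (sp p') * v $ i)"
      "(wt p * of_real (sp p') - wt p' * of_real (sp p)) * v $ i = wt p * (wt p' * u $ i + of_real (sp p') * v $ i) - wt p' * (wt p * u $ i + of_real (sp p) * v $ i)"
      by (simp_all add: algebra_simps)
    ultimately have "(wt p * of_real (sp p') - wt p' * of_real (sp p)) * u $ i = 0" "(wt p * of_real (sp p') - wt p' * of_real (sp p)) * v $ i = 0"
      by (simp_all only: mult_zero_right diff_0_right)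
    then have "u $ i = 0 \<and> v $ i = 0" using that(3) by simp
    then show False using m that(4) by (auto simp: plane_minor_def)
  qed
  \<comment> \<open>The barycentre and two neighbours on a horizontal line in the box; the three
    images on the projective line are distinct.\<close>
  let ?p = "(1/3, 1/3) :: real \<times> real" and ?q = "(13/30, 1/3) :: real \<times> real" and ?r = "(7/30, 1/3) :: real \<times> real"
  have B: "?p \<in> ?B" "?q \<in> ?B" "?r \<in> ?B" by simp_all
  have "wt ?p * of_real (sp ?q) \<noteq> wt ?q * of_real (sp ?p)" "wt ?p * of_real (sp ?r) \<noteq> wt ?r * of_real (sp ?p)" "wt ?q * of_real (sp ?r) \<noteq> wt ?r * of_real (sp ?q)"
    by (simp_all add: wt_alt sp_def complex_eq_iff)
  with two zz[OF B(1)] zz[OF B(2)] zz[OF B(3)] B show False by metis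
qed

text \<open>The value at (\<zeta>, 1, \<xi>, 1) of the monomial \<beta> times the perturbation with
  coefficients \<open>s\<close>, where \<open>p\<close> is the pair of \<zeta> and \<xi>.\<close>

definition slope_sum :: "param \<Rightarrow> (4 \<Rightarrow> nat) \<Rightarrow> complex \<times> complex \<Rightarrow> complex" where
  "slope_sum s \<beta> p = (\<Sum>\<alpha>\<in>UNIV. s $ \<alpha> * fst p ^ (expo \<alpha> 0 + \<beta> 0) * snd p ^ (expo \<alpha> 2 + \<beta> 2))"

context nearby_octics
begin

text \<open>On the line the product of the monomials \<alpha> and \<beta> has degree 6 in each pair
  of variables, so it is a product of powers of the slopes times one fixed function of the point.
  All dependence on the point thus goes into a constant \<open>J\<close> common to all \<alpha> and
  \<beta>.\<close>

lemma line_period_derivative: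
  assumes \<zeta>: "\<zeta> ^ 8 = -1" and \<xi>: "\<xi> ^ 8 = -1" and uv: "indep2 u v" "line u v \<subseteq> octic_points 0"
    and u: "on_line \<zeta> \<xi> u" and v: "on_line \<zeta> \<xi> v"
  obtains J where "J \<noteq> 0" "\<And>\<beta> s. \<beta> 0 + \<beta> 1 = 2 \<Longrightarrow> \<beta> 2 + \<beta> 3 = 2 \<Longrightarrow>
    FD (line_period \<beta> u v) 0 s = J * slope_sum s \<beta> (\<zeta>, \<xi>)"
proof -
  let ?C = "det4 (vec4 \<zeta> 1 0 0) (vec4 (- \<zeta>) 1 0 0) (vec4 0 0 (- \<xi>) 1) (vec4 0 0 \<xi> 1)"
  define K where "K = 7 * ?C * (\<i> * of_real ((cmod (plane_minor u v))\<^sup>2 * sqrt 3))"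
  define J where "J = K * of_real (integral triangle (line_density u v))"
  have m: "plane_minor u v \<noteq> 0" by (rule plane_minor_nonzero[OF uv(1) u v])
  have "\<zeta> \<noteq> 0" "\<xi> \<noteq> 0" using \<zeta> \<xi> by auto
  then have "J \<noteq> 0" unfolding J_def K_def using line_det_nonzero m line_density_integral[OF uv(1) m] by simp
  moreover have "FD (line_period \<beta> u v) 0 s = J * slope_sum s \<beta> (\<zeta>, \<xi>)"
    if \<beta>: "\<beta> 0 + \<beta> 1 = 2" "\<beta> 2 + \<beta> 3 = 2" for \<beta> s
  proof -
    let ?w = "\<Sum>\<alpha>\<in>UNIV. s $ \<alpha> * \<zeta> ^ (expo \<alpha> 0 + \<beta> 0) * \<xi> ^ (expo \<alpha> 2 + \<beta> 2)"
    have pt: "FD (\<lambda>t. line_integrand \<beta> u v t p) 0 s = (?w * K) * of_real (line_density u v p)" for p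
    proof -
      let ?g = "line_lift u v p"
      have on: "on_line \<zeta> \<xi> ?g" "on_line \<zeta> \<xi> (line_du u v p)" "on_line \<zeta> \<xi> (line_dv u v p)"
        using u v by (simp_all add: on_line_def line_lift_def line_du_def line_dv_def algebra_simps)
      have mon: "monomial (expo \<alpha>) ?g * monomial \<beta> ?g = \<zeta> ^ (expo \<alpha> 0 + \<beta> 0) * \<xi> ^ (expo \<alpha> 2 + \<beta> 2) * (?g $ 1 * ?g $ 3) ^ 6" for \<alpha>
      proof -
        have "expo \<alpha> 0 + \<beta> 0 + (expo \<alpha> 1 + \<beta> 1) = 6" "expo \<alpha> 2 + \<beta> 2 + (expo \<alpha> 3 + \<beta> 3) = 6"
          using expo_sum[of \<alpha>] \<beta> by linarith+
        then have 6: "x ^ (expo \<alpha> 0 + \<beta> 0) * x ^ (expo \<alpha> 1 + \<beta> 1) = x ^ 6" "x ^ (expo \<alpha> 2 + \<beta> 2) * x ^ (expo \<alpha> 3 + \<beta> 3) = x ^ 6" for x :: complex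
          by (simp_all flip: power_add)
        have "monomial (expo \<alpha>) ?g * monomial \<beta> ?g = ?g $ 0 ^ (expo \<alpha> 0 + \<beta> 0) * ?g $ 1 ^ (expo \<alpha> 1 + \<beta> 1) * (?g $ 2 ^ (expo \<alpha> 2 + \<beta> 2) * ?g $ 3 ^ (expo \<alpha> 3 + \<beta> 3))"
          by (simp add: monomial_def prod_UNIV_4 power_add)
        also have "\<dots> = \<zeta> ^ (expo \<alpha> 0 + \<beta> 0) * \<xi> ^ (expo \<alpha> 2 + \<beta> 2) * ((?g $ 1 ^ (expo \<alpha> 0 + \<beta> 0) * ?g $ 1 ^ (expo \<alpha> 1 + \<beta> 1)) * (?g $ 3 ^ (expo \<alpha> 2 + \<beta> 2) * ?g $ 3 ^ (expo \<alpha> 3 + \<beta> 3)))"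
          using on(1) by (simp add: on_line_def power_mult_distrib)
        finally show ?thesis by (simp only: 6 power_mult_distrib)
      qed
      have "(\<Sum>\<alpha>\<in>UNIV. s $ \<alpha> * monomial (expo \<alpha>) ?g) * monomial \<beta> ?g = ?w * (?g $ 1 * ?g $ 3) ^ 6"
        unfolding sum_distrib_right by (rule sum.cong) (simp_all add: mult.assoc mon)
      moreover have "(?g $ 1 * ?g $ 3) ^ 6 * (cnj (?g $ 1) * cnj (?g $ 3)) ^ 6 = of_real ((cmod (?g $ 1) * cmod (?g $ 3)) ^ 12)"
      proof -
        have "(?g $ 1 * ?g $ 3) ^ 6 * (cnj (?g $ 1) * cnj (?g $ 3)) ^ 6 = ((?g $ 1 * cnj (?g $ 1)) * (?g $ 3 * cnj (?g $ 3))) ^ 6"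
          by (simp add: power_mult_distrib)
        also have "\<dots> = of_real ((cmod (?g $ 1) * cmod (?g $ 3)) ^ 12)"
          unfolding complex_norm_square[symmetric] by (simp add: power_mult_distrib flip: power_mult)
        finally show ?thesis .
      qed
      ultimately show ?thesis
        unfolding line_integrand_0(2)[OF uv] line_numerator[OF \<zeta> \<xi> on] line_minors octic_deriv_normal_field
        by (simp add: K_def line_density_def mult_ac)
    qed
    have 0: "0 \<in> ball (0 :: param) \<epsilon>" using pos by simp
    show ?thesis
      unfolding line_period_hol(2)[OF uv 0] pt slope_sum_def fst_conv snd_conv
      using integral_linear[OF integrable_triangle[OF continuous_line_density[OF uv(1)]] bounded_linear_of_real[where 'a = complex]]
      by (simp add: J_def o_def)
  qed
  ultimately show thesis by (rule that)
qed

end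

section \<open>A symmetry of the family\<close>

definition rot :: "complex \<Rightarrow> complex^4 \<Rightarrow> complex^4" where
  "rot c x = vec4 (c * x $ 0) (c * x $ 1) (x $ 2) (x $ 3)"

lemma rot_nth [simp]: "rot c x $ 0 = c * x $ 0" "rot c x $ 1 = c * x $ 1" "rot c x $ 2 = x $ 2" "rot c x $ 3 = x $ 3"
  by (simp_all add: rot_def)

lemma rot_linear: "rot c (x + y) = rot c x + rot c y" "rot c (a *s x) = a *s rot c x"
  by (simp_all add: vec_eq_iff all_4 algebra_simps)

lemma rot_eq_0: "c \<noteq> 0 \<Longrightarrow> rot c x = 0 \<longleftrightarrow> x = 0"
  by (simp add: vec_eq_iff all_4)

lemma rot_1: "rot 1 x = x"
  by (simp add: vec_eq_iff all_4)

lemma monomial_rot: "monomial \<beta> (rot c x) = c ^ (\<beta> 0 + \<beta> 1) * monomial \<beta> x"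
  by (simp add: monomial_def prod_UNIV_4 power_mult_distrib power_add)

text \<open>The Fermat part is invariant since i ^ 8 = 1; the perturbing monomials have degree 4 in
  the first two variables, and i ^ 4 = 1.\<close>

lemma octic_rot: "octic t (rot \<i> x) = octic t x"
proof -
  have "(\<i> :: complex) ^ 8 = 1" "(\<i> :: complex) ^ 4 = 1" by (simp_all add: eval_nat_numeral)
  then show ?thesis by (simp add: octic_def sum_UNIV_4 monomial_rot expo_sum power_mult_distrib)
qed

lemma octic_deriv_rot: "octic_deriv t (rot \<i> x) (rot \<i> h) = octic_deriv t x h"
proof -
  have "rot \<i> = (\<lambda>x. \<chi> j. (if j = 0 \<or> j = 1 then \<i> else 1) * x $ j)"
    by (simp add: fun_eq_iff vec_eq_iff all_4)
  then have "(rot \<i> has_derivative rot \<i>) (at x)"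
    by (simp only:) (intro has_derivative_vec_lambda has_derivative_mult_right bounded_linear_imp_has_derivative bounded_linear_vec_nth)
  from has_derivative_compose[OF this has_derivative_octic, of t]
  have "(octic t has_derivative (\<lambda>h. octic_deriv t (rot \<i> x) (rot \<i> h))) (at x)" by (simp add: octic_rot)
  from has_derivative_unique[OF this has_derivative_octic] show ?thesis by (simp only: fun_eq_iff)
qed

lemma ii_power: "\<i> ^ 7 = - \<i>" "\<i> ^ 6 = -1"
  by (simp_all add: eval_nat_numeral)

lemma normal_field_rot: "normal_field (rot \<i> x) = rot \<i> (normal_field x)"
  by (simp add: vec_eq_iff all_4 normal_field_def power_minus_odd power_mult_distrib ii_power)

lemma normal_deriv_rot: "normal_deriv (rot \<i> x) (rot \<i> h) = rot \<i> (normal_deriv x h)"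
  by (simp add: vec_eq_iff all_4 normal_deriv_def power_mult_distrib ii_power)

lemma det4_rot: "det4 (rot c x) (rot c w) (rot c u) (rot c v) = c\<^sup>2 * det4 x w u v"
proof -
  let ?D = "\<chi> i j. if i = j then (if j = 0 \<or> j = 1 then c else 1) else 0 :: complex^4^4"
  have "rows (rot c x) (rot c w) (rot c u) (rot c v) = rows x w u v ** ?D"
    by (simp add: vec_eq_iff all_4 matrix_matrix_mult_def rows_def sum_UNIV_4)
  moreover have "det ?D = c\<^sup>2"
    by (subst det_diagonal) (simp_all add: prod_UNIV_4 power2_eq_square)
  ultimately show ?thesis by (simp add: det_mul)
qed

lemma norm_rot: "norm (rot \<i> x) = norm x"
  by (simp add: norm_vec_def L2_set_def sum_UNIV_4 norm_mult)

lemma rot_line_lift: "line_lift (rot c u) (rot c v) p = rot c (line_lift u v p)"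
  and rot_line_du: "line_du (rot c u) (rot c v) p = rot c (line_du u v p)"
  and rot_line_dv: "line_dv (rot c u) (rot c v) p = rot c (line_dv u v p)"
  by (simp_all only: line_lift_def line_du_def line_dv_def rot_linear)

lemma rot_indep2: "c \<noteq> 0 \<Longrightarrow> indep2 u v \<Longrightarrow> indep2 (rot c u) (rot c v)"
  unfolding indep2_def rot_linear[symmetric] by (simp add: rot_eq_0)

lemma continuous_on_rot: "continuous_on S a \<Longrightarrow> continuous_on S b \<Longrightarrow> continuous_on S (\<lambda>z. rot (a z) (b z))"
  unfolding rot_def vec4_def
proof (intro continuous_on_vec_lambda)
  fix i :: 4
  assume "continuous_on S a" "continuous_on S b"
  then show "continuous_on S (\<lambda>z. if i = 0 then a z * b z $ 0 else if i = 1 then a z * b z $ 1 else if i = 2 then b z $ 2 else b z $ 3)"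
    by (cases "i = 0"; cases "i = 1"; cases "i = 2") (auto intro!: continuous_intros)
qed

section \<open>The lines of the Fermat surface and the action of the rotations on them\<close>

definition line_set :: "complex \<Rightarrow> complex \<Rightarrow> (complex^4) set set" where
  "line_set \<zeta> \<xi> = {proj x | x. x \<noteq> 0 \<and> on_line \<zeta> \<xi> x}"

lemma on_line_scale: "c \<noteq> 0 \<Longrightarrow> on_line \<zeta> \<xi> (c *s x) \<longleftrightarrow> on_line \<zeta> \<xi> x"
  by (auto simp: on_line_def)

lemma proj_in_line_set: "x \<noteq> 0 \<Longrightarrow> proj x \<in> line_set \<zeta> \<xi> \<longleftrightarrow> on_line \<zeta> \<xi> x"
  by (auto simp: line_set_def proj_eq_iff on_line_scale)

lemma octic_0_on_line: "\<zeta> ^ 8 = -1 \<Longrightarrow> \<xi> ^ 8 = -1 \<Longrightarrow> on_line \<zeta> \<xi> x \<Longrightarrow> octic 0 x = 0"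
  by (simp add: octic_def sum_UNIV_4 on_line_def power_mult_distrib)

lemma on_line_rot: "on_line \<zeta> \<xi> x \<Longrightarrow> on_line \<zeta> \<xi> (rot c x)"
  by (simp add: on_line_def)

lemma line_subset_line_set:
  assumes "indep2 u v" "on_line \<zeta> \<xi> u" "on_line \<zeta> \<xi> v"
  shows "line u v \<subseteq> line_set \<zeta> \<xi>"
proof
  fix q assume "q \<in> line u v"
  then obtain a b where q: "q = proj (a *s u + b *s v)" "(a, b) \<noteq> (0, 0)" by (auto simp: line_def)
  then have "a *s u + b *s v \<noteq> 0" using assms(1) unfolding indep2_def by blast
  moreover have "on_line \<zeta> \<xi> (a *s u + b *s v)" using assms(2,3) by (simp add: on_line_def algebra_simps)
  ultimately show "q \<in> line_set \<zeta> \<xi>" using q by (simp add: proj_in_line_set)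
qed

lemma line_set_subset_octic: "\<zeta> ^ 8 = -1 \<Longrightarrow> \<xi> ^ 8 = -1 \<Longrightarrow> line_set \<zeta> \<xi> \<subseteq> octic_points 0"
  using octic_0_on_line by (auto simp: line_set_def octic_points_def)

definition rot_proj :: "complex \<Rightarrow> (complex^4) set \<Rightarrow> (complex^4) set" where
  "rot_proj c q = proj (rot c (rep q))"

lemma rot_proj: "rot_proj c (proj x) = proj (rot c x)"
  by (rule rep_proj[of x]) (simp add: rot_proj_def rot_linear)

lemma chain_map_rot_line_cycle: "chain_map 2 (rot_proj c) (line_cycle u v) = line_cycle (rot c u) (rot c v)"
  unfolding line_cycle_def chain_map_diff chain_map_of simplex_map_def line_simplex_def
  by (intro arg_cong2[of _ _ _ _ "(-)"] arg_cong[of _ _ frag_of] restrict_ext) (simp_all add: rot_proj rot_linear)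

text \<open>The circle of rotations connects \<open>rot \<i>\<close> to the identity, and it preserves each of the lines.\<close>

lemma line_class_rot:
  assumes \<zeta>: "\<zeta> ^ 8 = -1" "\<xi> ^ 8 = -1" and uv: "indep2 u v" "on_line \<zeta> \<xi> u" "on_line \<zeta> \<xi> v"
  shows "homologous_rel_set 2 (octic_surface 0) {} (line_cycle (rot \<i> u) (rot \<i> v))
    = homologous_rel_set 2 (octic_surface 0) {} (line_cycle u v)"
proof -
  let ?L = "subtopology P3 (line_set \<zeta> \<xi>)" and ?c = "\<lambda>s. cis (s * pi / 2)"
  let ?h = "\<lambda>(s :: real, q). rot_proj (?c s) q" and ?Z = "{0..1 :: real} \<times> line_set \<zeta> \<xi>"
  have "homotopic_with (\<lambda>_. True) ?L (octic_surface 0) id (rot_proj \<i>)"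
  proof (subst homotopic_with, simp, intro exI conjI ballI TrueI)
    have "continuous_map (subtopology (prod_topology euclideanreal P3) ?Z) P3 ?h"
      by (rule continuous_map_family[where G = "\<lambda>p. rot (?c (fst p)) (snd p)"])
        (auto intro!: continuous_on_rot continuous_intros simp: cone_over_def rot_eq_0 rot_proj)
    then show "continuous_map (prod_topology (top_of_set {0..1}) ?L) (octic_surface 0) ?h"
      unfolding octic_surface_def subtopology_Times[symmetric]
    proof (rule continuous_map_into_subtopology[OF _ Pi_I])
      fix p assume "p \<in> topspace (subtopology (prod_topology euclideanreal P3) ?Z)"
      then obtain s x where p: "p = (s, proj x)" "x \<noteq> 0" "on_line \<zeta> \<xi> x"
        by (auto simp: topspace_P3 line_set_def)
      then show "?h p \<in> octic_points 0"
        using octic_0_on_line[OF \<zeta> on_line_rot] by (simp add: rot_proj proj_in_octic_points rot_eq_0)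
    qed
    fix q assume "q \<in> topspace ?L"
    then obtain x where "q = proj x" by (auto simp: line_set_def)
    then show "?h (0, q) = id q" "?h (1, q) = rot_proj \<i> q" by (simp_all add: rot_proj rot_1)
  qed
  note h = homology_homotopy_empty[OF this, of 2] homotopic_with_imp_continuous_maps[OF this]
  have z: "singular_relcycle 2 ?L {} (line_cycle u v)"
    by (rule line_cycle_relcycle[OF uv(1) line_subset_line_set[OF uv]])
  then have "chain_map 2 id (line_cycle u v) = line_cycle u v"
    by (intro chain_map_ident[of 2 ?L]) (simp add: singular_cycle)
  then show ?thesis
    using hom_induced_chain_map[of ?L "octic_surface 0" id "{}" "{}" 2, OF _ _ z]
      hom_induced_chain_map[of ?L "octic_surface 0" "rot_proj \<i>" "{}" "{}" 2, OF _ _ z] h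
    by (simp add: chain_map_rot_line_cycle)
qed

context nearby_octics
begin

lemma root_rot:
  assumes "(t, x) \<in> dom"
  shows "root t (rot \<i> x) = root t x" "retr t (rot \<i> x) = rot \<i> (retr t x)"
proof -
  have d: "(t, rot \<i> x) \<in> dom" using assms by (simp add: dom_iff rot_eq_0 octic_rot norm_rot)
  have "is_root t (rot \<i> x) (root t x)"
    using is_root_root[OF assms] by (simp add: is_root_def norm_rot normal_field_rot octic_rot flip: rot_linear)
  then show "root t (rot \<i> x) = root t x" by (rule root_unique[OF d])
  then show "retr t (rot \<i> x) = rot \<i> (retr t x)" by (simp add: retr_def normal_field_rot rot_linear)
qed

lemma period_line:
  assumes "\<beta> \<in> quartic_exps" "indep2 u v" "line u v \<subseteq> octic_points 0" "norm t < \<epsilon>"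
  shows "period t \<beta> (transport t (homologous_rel_set 2 (octic_surface 0) {} (line_cycle u v))) = line_period \<beta> u v t"
proof -
  have z: "singular_relcycle 2 (octic_surface 0) {} (line_cycle u v)"
    unfolding octic_surface_def by (rule line_cycle_relcycle[OF assms(2,3)])
  show ?thesis
    unfolding transport_class[OF assms(4) z] chain_integral_line(1)[OF assms, symmetric]
    by (rule period_eq[OF assms(1) smooth_nearby[OF assms(4)]
          singular_relcycle_chain_map[OF z continuous_map_retr_proj[OF assms(4)]] chain_integral_line(2)[OF assms]]) auto
qed

text \<open>Rotating the basis keeps the class but multiplies the integrand by a power of i, with
  exponent \<open>\<beta> 0 + \<beta> 1\<close> from the monomial plus 2 from the determinant. For
  sums between 0 and 4 this power is 1 only if the sum is 2.\<close>

lemma line_period_vanishes: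
  assumes \<beta>: "\<beta> \<in> quartic_exps" "\<beta> 0 + \<beta> 1 \<noteq> 2"
    and \<zeta>: "\<zeta> ^ 8 = -1" "\<xi> ^ 8 = -1" and uv: "indep2 u v" "on_line \<zeta> \<xi> u" "on_line \<zeta> \<xi> v" and t: "norm t < \<epsilon>"
  shows "line_period \<beta> u v t = 0"
proof -
  have L: "line u v \<subseteq> octic_points 0"
    using line_subset_line_set[OF uv] line_set_subset_octic[OF \<zeta>] by blast
  have uv': "indep2 (rot \<i> u) (rot \<i> v)" by (rule rot_indep2[OF _ uv(1)]) simp
  have L': "line (rot \<i> u) (rot \<i> v) \<subseteq> octic_points 0"
    using line_subset_line_set[OF uv' on_line_rot[OF uv(2)] on_line_rot[OF uv(3)]] line_set_subset_octic[OF \<zeta>] by blast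
  have "line_integrand \<beta> (rot \<i> u) (rot \<i> v) t p = \<i> ^ (\<beta> 0 + \<beta> 1 + 2) * line_integrand \<beta> u v t p" for p
    unfolding line_integrand_def Let_def rot_line_lift rot_line_du rot_line_dv root_rot[OF line_dom[OF uv(1) L t]]
      normal_field_rot normal_deriv_rot octic_deriv_rot monomial_rot
    by (simp only: det4_rot octic_deriv_rot power_add flip: rot_linear) (simp add: mult_ac)
  then have "line_integrand \<beta> (rot \<i> u) (rot \<i> v) t = (\<lambda>p. \<i> ^ (\<beta> 0 + \<beta> 1 + 2) * line_integrand \<beta> u v t p)" by blast
  then have "line_period \<beta> (rot \<i> u) (rot \<i> v) t = \<i> ^ (\<beta> 0 + \<beta> 1 + 2) * line_period \<beta> u v t"
    unfolding line_period_def by (simp only: integral_mult_right)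
  \<comment> \<open>Both integrals compute the period of one transported class.\<close>
  moreover have "line_period \<beta> (rot \<i> u) (rot \<i> v) t = line_period \<beta> u v t"
    using period_line[OF \<beta>(1) uv' L' t] period_line[OF \<beta>(1) uv(1) L t] line_class_rot[OF \<zeta> uv] by simp
  moreover have "\<i> ^ (\<beta> 0 + \<beta> 1 + 2) \<noteq> (1 :: complex)"
  proof -
    have "\<beta> 0 + \<beta> 1 \<le> 4" using \<beta>(1) by (simp add: quartic_exps_def sum_UNIV_4)
    then have "\<beta> 0 + \<beta> 1 = 0 \<or> \<beta> 0 + \<beta> 1 = 1 \<or> \<beta> 0 + \<beta> 1 = 3 \<or> \<beta> 0 + \<beta> 1 = 4" using \<beta>(2) by arith
    then show ?thesis by (elim disjE) (simp_all add: eval_nat_numeral complex_eq_iff)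
  qed
  ultimately show ?thesis by (metis mult_cancel_right1)
qed

end

section \<open>The lines in the curves\<close>

text \<open>For a factor of x ^ 8 + y ^ 8 no zero is lost by setting y = 1, because (1, 0) is not a
  zero of the product.\<close>

definition slopes :: "(complex \<Rightarrow> complex \<Rightarrow> complex) \<Rightarrow> complex set" where
  "slopes f = {\<zeta>. f \<zeta> 1 = 0}"

lemma binary_form_scale: "binary_form n f \<Longrightarrow> f (c * x) (c * y) = c ^ n * f x y"
proof -
  assume "binary_form n f"
  then obtain a where a: "\<And>x y. f x y = (\<Sum>k\<le>n. a k * x ^ k * y ^ (n - k))" by (auto simp: binary_form_def)
  have "c ^ k * c ^ (n - k) = c ^ n" if "k \<le> n" for k using that by (simp flip: power_add)
  then have "a k * (c * x) ^ k * (c * y) ^ (n - k) = c ^ n * (a k * x ^ k * y ^ (n - k))" if "k \<le> n" for k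
    using that by (simp add: power_mult_distrib algebra_simps)
  then show ?thesis unfolding a sum_distrib_left by (intro sum.cong refl) (simp only: atMost_iff)
qed

lemma card_slopes:
  assumes "binary_form n f" "f x 1 \<noteq> 0"
  shows "finite (slopes f)" "card (slopes f) \<le> n"
proof -
  obtain a where a: "\<And>x y. f x y = (\<Sum>k\<le>n. a k * x ^ k * y ^ (n - k))" using assms(1) by (auto simp: binary_form_def)
  obtain k where k: "k \<le> n" "a k \<noteq> 0" using assms(2) unfolding a by (metis (no_types, lifting) atMost_iff mult_zero_left sum.neutral)
  from polyfun_rootbound[of n a] k show "finite (slopes f)" "card (slopes f) \<le> n"
    unfolding slopes_def a by auto
qed

locale three_forms =
  fixes f1 f3 f4 :: "complex \<Rightarrow> complex \<Rightarrow> complex"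
  assumes forms: "binary_form 1 f1" "binary_form 3 f3" "binary_form 4 f4"
    and factors: "\<And>x y. x ^ 8 + y ^ 8 = f1 x y * f3 x y * f4 x y"
begin

text \<open>The eight roots of z ^ 8 = -1 are covered by the zeros of three factors having at most
  1, 3 and 4 of them; so these bounds are attained and no root is counted twice.\<close>

lemma slopes: "card (slopes f1) = 1" "card (slopes f3) = 3" "slopes f1 \<inter> slopes f3 = {}"
  "\<zeta> \<in> slopes f1 \<union> slopes f3 \<Longrightarrow> \<zeta> ^ 8 = -1"
proof -
  have "f1 0 1 * f3 0 1 * f4 0 1 \<noteq> 0" unfolding factors[symmetric] by simp
  then have nz: "f1 0 1 \<noteq> 0" "f3 0 1 \<noteq> 0" "f4 0 1 \<noteq> 0" by auto
  note c1 = card_slopes[OF forms(1) nz(1)] and c3 = card_slopes[OF forms(2) nz(2)] and c4 = card_slopes[OF forms(3) nz(3)]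
  have un: "slopes f1 \<union> slopes f3 \<union> slopes f4 = {z. z ^ 8 = -1}"
  proof (intro equalityI subsetI)
    fix z assume "z \<in> slopes f1 \<union> slopes f3 \<union> slopes f4"
    then have "z ^ 8 + 1 ^ 8 = 0" unfolding factors slopes_def by auto
    then show "z \<in> {z. z ^ 8 = -1}" by (simp add: eq_neg_iff_add_eq_0)
  next
    fix z :: complex assume "z \<in> {z. z ^ 8 = -1}"
    then have "z ^ 8 + 1 ^ 8 = 0" by simp
    then show "z \<in> slopes f1 \<union> slopes f3 \<union> slopes f4" unfolding factors slopes_def by auto
  qed
  then have "card (slopes f1 \<union> slopes f3 \<union> slopes f4) = 8" using card_nth_roots[of "-1" 8] by simp
  moreover have "card (slopes f1 \<union> slopes f3 \<union> slopes f4) \<le> card (slopes f1 \<union> slopes f3) + card (slopes f4)" by (rule card_Un_le)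
  moreover have i: "card (slopes f1 \<union> slopes f3) + card (slopes f1 \<inter> slopes f3) = card (slopes f1) + card (slopes f3)"
    using card_Un_Int[OF c1(1) c3(1)] by simp
  ultimately have "card (slopes f1) = 1" "card (slopes f3) = 3" "card (slopes f1 \<inter> slopes f3) = 0" using c1(2) c3(2) c4(2) by linarith+
  then show "card (slopes f1) = 1" "card (slopes f3) = 3" "slopes f1 \<inter> slopes f3 = {}" using c1(1) by auto
  show "\<zeta> ^ 8 = -1" if "\<zeta> \<in> slopes f1 \<union> slopes f3" using un that by blast
qed

lemma zeros:
  assumes "f = f1 \<or> f = f3"
  shows "f x y = 0 \<longleftrightarrow> (\<exists>\<zeta>\<in>slopes f. x = \<zeta> * y)"
proof
  have "card (slopes f) \<noteq> 0" using assms slopes(1,2) by auto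
  then obtain \<zeta>0 where \<zeta>0: "\<zeta>0 \<in> slopes f" by (metis card.empty ex_in_conv)
  obtain n where n: "binary_form n f" using assms forms by blast
  { assume 0: "f x y = 0"
    show "\<exists>\<zeta>\<in>slopes f. x = \<zeta> * y"
    proof (cases "y = 0")
      \<comment> \<open>Here x ^ 8 = 0, so x = 0 and any slope serves.\<close>
      case True
      have "x ^ 8 + y ^ 8 = 0" unfolding factors using assms 0 by auto
      then show ?thesis using True \<zeta>0 by auto
    next
      case False
      have "f (y * (x / y)) (y * 1) = y ^ n * f (x / y) 1" by (rule binary_form_scale[OF n])
      then have "x / y \<in> slopes f" using False 0 by (simp add: slopes_def)
      then show ?thesis using False by (intro bexI[of _ "x / y"]) auto
    qed }
  assume "\<exists>\<zeta>\<in>slopes f. x = \<zeta> * y"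
  then obtain \<zeta> where "\<zeta> \<in> slopes f" "x = \<zeta> * y" by blast
  then show "f x y = 0" using binary_form_scale[OF n, of y \<zeta> 1] by (simp add: slopes_def mult.commute)
qed

end

text \<open>Cramer's rule in the coordinates 1 and 3.\<close>

lemma line_eq_line_set:
  assumes uv: "indep2 u v" "on_line \<zeta> \<xi> u" "on_line \<zeta> \<xi> v"
  shows "line u v = line_set \<zeta> \<xi>"
proof
  show "line_set \<zeta> \<xi> \<subseteq> line u v"
  proof
    fix q assume "q \<in> line_set \<zeta> \<xi>"
    then obtain x where x: "q = proj x" "x \<noteq> 0" "on_line \<zeta> \<xi> x" by (auto simp: line_set_def)
    let ?m = "plane_minor u v"
    have m: "?m \<noteq> 0" by (rule plane_minor_nonzero[OF uv])
    have "?m * (x $ i) = plane_minor x v * u $ i + plane_minor u x * v $ i" for i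
      using all_4[of "\<lambda>i. ?m * (x $ i) = plane_minor x v * u $ i + plane_minor u x * v $ i"] uv(2,3) x(3)
      by (auto simp: on_line_def plane_minor_def algebra_simps)
    then have e: "x = (plane_minor x v / ?m) *s u + (plane_minor u x / ?m) *s v"
      using m by (simp add: vec_eq_iff field_simps)
    then have "(plane_minor x v / ?m, plane_minor u x / ?m) \<noteq> (0, 0)" using x(2) by auto
    then show "q \<in> line u v" unfolding line_def x(1)
      by (intro CollectI exI[of _ "plane_minor x v / ?m"] exI[of _ "plane_minor u x / ?m"] conjI arg_cong[OF e])
  qed
qed (rule line_subset_line_set[OF uv])

lemma line_set_in_lines: "line_set \<zeta> \<xi> \<in> lines"
proof -
  have "indep2 (vec4 \<zeta> 1 0 0) (vec4 0 0 \<xi> 1)" by (simp add: indep2_def vec_eq_iff all_4)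
  moreover have "line_set \<zeta> \<xi> = line (vec4 \<zeta> 1 0 0) (vec4 0 0 \<xi> 1)"
    by (rule line_eq_line_set[symmetric]) (simp_all add: calculation on_line_def)
  ultimately show ?thesis by (auto simp: lines_def)
qed

lemma line_set_inj: "inj (\<lambda>(\<zeta>, \<xi>). line_set \<zeta> \<xi>)"
proof (rule injI, clarify)
  fix \<zeta> \<xi> \<zeta>' \<xi>' assume e: "line_set \<zeta> \<xi> = line_set \<zeta>' \<xi>'"
  have "vec4 \<zeta> 1 \<xi> 1 \<noteq> 0" by (simp add: vec_eq_iff all_4)
  moreover from this have "proj (vec4 \<zeta> 1 \<xi> 1) \<in> line_set \<zeta> \<xi>" by (simp add: proj_in_line_set on_line_def)
  ultimately have "on_line \<zeta>' \<xi>' (vec4 \<zeta> 1 \<xi> 1)" unfolding e by (simp add: proj_in_line_set)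
  then show "\<zeta> = \<zeta>' \<and> \<xi> = \<xi>'" by (simp add: on_line_def)
qed

text \<open>A line in a finite union of planes lies in one of them.\<close>

lemma lines_in_curve:
  assumes f: "\<And>x y. f x y = 0 \<longleftrightarrow> (\<exists>\<zeta>\<in>slopes f. x = \<zeta> * y)" and g: "\<And>x y. g x y = 0 \<longleftrightarrow> (\<exists>\<zeta>\<in>slopes g. x = \<zeta> * y)"
    and fin: "finite (slopes f)" "finite (slopes g)"
  shows "{L \<in> lines. L \<subseteq> curve f g} = (\<lambda>(\<zeta>, \<xi>). line_set \<zeta> \<xi>) ` (slopes f \<times> slopes g)"
proof (intro equalityI subsetI)
  fix L assume "L \<in> {L \<in> lines. L \<subseteq> curve f g}"
  then obtain u v where uv: "indep2 u v" "L = line u v" "line u v \<subseteq> curve f g" by (auto simp: lines_def)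
  have "\<exists>p\<in>slopes f \<times> slopes g. on_line (fst p) (snd p) (u + c *s v)" for c
  proof -
    have nz: "1 *s u + c *s v \<noteq> 0" using uv(1) unfolding indep2_def by (metis zero_neq_one)
    have "proj (1 *s u + c *s v) \<in> line u v" unfolding line_def by (rule CollectI, rule exI[of _ 1], rule exI[of _ c]) simp
    then have "proj (u + c *s v) \<in> curve f g" using uv(3) by auto
    then obtain x where x: "proj (u + c *s v) = proj x" "f (x $ 0) (x $ 1) = 0" "g (x $ 2) (x $ 3) = 0" by (auto simp: curve_def)
    then obtain \<zeta> \<xi> where z: "\<zeta> \<in> slopes f" "\<xi> \<in> slopes g" "on_line \<zeta> \<xi> x" unfolding f g on_line_def by blast
    obtain e where "e \<noteq> 0" "x = e *s (u + c *s v)" using x(1) unfolding proj_eq_iff by blast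
    then have "on_line \<zeta> \<xi> (u + c *s v)" using z(3) on_line_scale by metis
    then show ?thesis using z by (intro bexI[of _ "(\<zeta>, \<xi>)"]) auto
  qed
  then obtain P where P: "\<And>c. P c \<in> slopes f \<times> slopes g \<and> on_line (fst (P c)) (snd (P c)) (u + c *s v)" by metis
  \<comment> \<open>There are infinitely many points u + c v but only finitely many pairs of
    slopes.\<close>
  have "\<not> inj P"
    using P fin infinite_UNIV_char_0[where 'a = complex] finite_imageD[of P UNIV] finite_subset[of "range P" "slopes f \<times> slopes g"] by blast
  then obtain c c' where c: "c \<noteq> c'" "P c = P c'" by (auto simp: inj_def)
  obtain \<zeta> \<xi> where \<zeta>: "P c = (\<zeta>, \<xi>)" by (cases "P c")
  have "on_line \<zeta> \<xi> (u + c *s v)" "on_line \<zeta> \<xi> (u + c' *s v)" using P[of c] P[of c'] c(2) \<zeta> by auto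
  then have e: "u $ 0 + c * v $ 0 = \<zeta> * (u $ 1 + c * v $ 1)" "u $ 0 + c' * v $ 0 = \<zeta> * (u $ 1 + c' * v $ 1)"
    "u $ 2 + c * v $ 2 = \<xi> * (u $ 3 + c * v $ 3)" "u $ 2 + c' * v $ 2 = \<xi> * (u $ 3 + c' * v $ 3)" by (simp_all add: on_line_def)
  have "(c - c') * (v $ 0 - \<zeta> * v $ 1) = (u $ 0 + c * v $ 0 - \<zeta> * (u $ 1 + c * v $ 1)) - (u $ 0 + c' * v $ 0 - \<zeta> * (u $ 1 + c' * v $ 1))"
    "(c - c') * (v $ 2 - \<xi> * v $ 3) = (u $ 2 + c * v $ 2 - \<xi> * (u $ 3 + c * v $ 3)) - (u $ 2 + c' * v $ 2 - \<xi> * (u $ 3 + c' * v $ 3))"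
    by (simp_all add: algebra_simps)
  then have "(c - c') * (v $ 0 - \<zeta> * v $ 1) = 0" "(c - c') * (v $ 2 - \<xi> * v $ 3) = 0"
    unfolding e by simp_all
  then have v: "on_line \<zeta> \<xi> v" using c(1) by (simp add: on_line_def)
  then have "on_line \<zeta> \<xi> u" using e by (simp add: on_line_def algebra_simps)
  then show "L \<in> (\<lambda>(\<zeta>, \<xi>). line_set \<zeta> \<xi>) ` (slopes f \<times> slopes g)"
    using line_eq_line_set[OF uv(1) _ v] P[of c] \<zeta> uv(2) by force
next
  fix L assume "L \<in> (\<lambda>(\<zeta>, \<xi>). line_set \<zeta> \<xi>) ` (slopes f \<times> slopes g)"
  then obtain \<zeta> \<xi> where "\<zeta> \<in> slopes f" "\<xi> \<in> slopes g" "L = line_set \<zeta> \<xi>" by auto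
  moreover then have "L \<subseteq> curve f g" using f g unfolding line_set_def curve_def on_line_def by blast
  ultimately show "L \<in> {L \<in> lines. L \<subseteq> curve f g}" using line_set_in_lines by blast
qed

section \<open>Classes of lines and curves as sums of cycles\<close>

lemma line_class_basis:
  assumes "L \<in> lines"
  obtains u v where "indep2 u v" "L = line u v" "line_class X L = homologous_rel_set 2 X {} (line_cycle u v)"
proof -
  have "\<exists>c u v. indep2 u v \<and> L = line u v \<and> c = homologous_rel_set 2 X {} (line_cycle u v)"
    using assms by (auto simp: lines_def)
  from someI_ex[OF this] that show thesis unfolding line_class_def by blast
qed

text \<open>Passes from the multiplicatively written homology group to sums of cycles.\<close>

lemma finprod_classes:
  assumes "finite A" "\<And>i. i \<in> A \<Longrightarrow> singular_relcycle 2 X {} (z i)"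
  shows "finprod (homology_group 2 X) (\<lambda>i. homologous_rel_set 2 X {} (z i)) A = homologous_rel_set 2 X {} (\<Sum>i\<in>A. z i)"
  using assms
proof (induction A rule: finite_induct)
  case empty
  interpret comm_group "homology_group 2 X" by simp
  have "singular_relboundary_set 2 X {} = homologous_rel_set 2 X {} 0"
    using homologous_rel_set_eq_relboundary[of 2 X "{}" 0] by simp
  then show ?case using one_relative_homology_group[of 2 X "{}"] by simp
next
  case (insert i A)
  interpret comm_group "homology_group 2 X" by simp
  have car: "homologous_rel_set 2 X {} (z j) \<in> carrier (homology_group 2 X)" if "j \<in> insert i A" for j
    using insert.prems[OF that] carrier_relative_homology_group[of 2 X "{}"] by auto
  have "homologous_rel_set 2 X {} a \<otimes>\<^bsub>homology_group 2 X\<^esub> homologous_rel_set 2 X {} b = homologous_rel_set 2 X {} (a + b)" for a b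
  proof -
    have "\<exists>r s. homologous_rel 2 X {} a r \<and> homologous_rel 2 X {} b s \<and> x = r + s" if "homologous_rel 2 X {} (a + b) x" for x
      using that by (intro exI[of _ "x - b"] exI[of _ b]) (simp add: homologous_rel_def algebra_simps)
    then show ?thesis
      using mult_relative_homology_group[of 2 X "{}"] homologous_rel_add[of 2 X "{}" a _ b] by (auto simp: fun_eq_iff)
  qed
  then show ?case using insert car by (subst finprod_insert) (auto simp: Pi_iff)
qed

context nearby_octics
begin

text \<open>\<open>line_class\<close> picks some basis of each line; \<open>U\<close> and
  \<open>V\<close> collect these choices, so the class of the curve is that of the sum of the
  corresponding line cycles.\<close>

lemma curve_periods:
  assumes f: "\<And>x y. f x y = 0 \<longleftrightarrow> (\<exists>\<zeta>\<in>slopes f. x = \<zeta> * y)" and g: "\<And>x y. g x y = 0 \<longleftrightarrow> (\<exists>\<zeta>\<in>slopes g. x = \<zeta> * y)"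
    and fin: "finite (slopes f)" "finite (slopes g)"
    and s8: "\<And>\<zeta>. \<zeta> \<in> slopes f \<Longrightarrow> \<zeta> ^ 8 = -1" "\<And>\<zeta>. \<zeta> \<in> slopes g \<Longrightarrow> \<zeta> ^ 8 = -1"
  obtains U V where
    "\<And>\<zeta> \<xi>. \<zeta> \<in> slopes f \<Longrightarrow> \<xi> \<in> slopes g \<Longrightarrow> indep2 (U (\<zeta>, \<xi>)) (V (\<zeta>, \<xi>)) \<and> on_line \<zeta> \<xi> (U (\<zeta>, \<xi>)) \<and> on_line \<zeta> \<xi> (V (\<zeta>, \<xi>))"
    "\<And>t \<beta>. norm t < \<epsilon> \<Longrightarrow> \<beta> \<in> quartic_exps \<Longrightarrow> period t \<beta> (transport t (curve_class (octic_surface 0) (curve f g)))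
      = (\<Sum>p\<in>slopes f \<times> slopes g. line_period \<beta> (U p) (V p) t)"
proof -
  let ?X = "octic_surface 0" and ?A = "slopes f \<times> slopes g" and ?l = "\<lambda>(\<zeta>, \<xi>). line_set \<zeta> \<xi>"
  have "\<exists>u v. indep2 u v \<and> ?l p = line u v \<and> line_class ?X (?l p) = homologous_rel_set 2 ?X {} (line_cycle u v)" for p
    using line_class_basis[of "?l p" ?X] line_set_in_lines by (metis split_conv surj_pair)
  then obtain U V where UV: "\<And>p. indep2 (U p) (V p)" "\<And>p. ?l p = line (U p) (V p)"
    "\<And>p. line_class ?X (?l p) = homologous_rel_set 2 ?X {} (line_cycle (U p) (V p))" by metis
  have on: "on_line \<zeta> \<xi> (U (\<zeta>, \<xi>))" "on_line \<zeta> \<xi> (V (\<zeta>, \<xi>))" for \<zeta> \<xi>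
  proof -
    have i: "indep2 (U (\<zeta>, \<xi>)) (V (\<zeta>, \<xi>))" and l: "line_set \<zeta> \<xi> = line (U (\<zeta>, \<xi>)) (V (\<zeta>, \<xi>))" using UV(1,2)[of "(\<zeta>, \<xi>)"] by simp_all
    have i': "indep2 (V (\<zeta>, \<xi>)) (U (\<zeta>, \<xi>))" using i unfolding indep2_def by (metis add.commute)
    have l': "proj (V (\<zeta>, \<xi>)) \<in> line (U (\<zeta>, \<xi>)) (V (\<zeta>, \<xi>))" unfolding line_def by (rule CollectI, rule exI[of _ 0], rule exI[of _ 1]) simp
    show "on_line \<zeta> \<xi> (U (\<zeta>, \<xi>))" "on_line \<zeta> \<xi> (V (\<zeta>, \<xi>))"
      using proj_in_line[OF i] l' unfolding l[symmetric] by (simp_all add: proj_in_line_set indep2_nonzero[OF i] indep2_nonzero[OF i'])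
  qed
  have sub: "line (U p) (V p) \<subseteq> octic_points 0" if pA: "p \<in> ?A" for p
  proof -
    obtain \<zeta> \<xi> where "p = (\<zeta>, \<xi>)" "\<zeta> \<in> slopes f" "\<xi> \<in> slopes g" using pA by auto
    with line_set_subset_octic[OF s8(1) s8(2), of \<zeta> \<xi>] show ?thesis using UV(2)[of p] by simp
  qed
  have rc: "singular_relcycle 2 ?X {} (line_cycle (U p) (V p))" if "p \<in> ?A" for p
    unfolding octic_surface_def by (rule line_cycle_relcycle[OF UV(1) sub[OF that]])
  interpret comm_group "homology_group 2 ?X" by simp
  have car: "homologous_rel_set 2 ?X {} (line_cycle (U p) (V p)) \<in> carrier (homology_group 2 ?X)" if "p \<in> ?A" for p
    using rc[OF that] carrier_relative_homology_group[of 2 ?X "{}"] by auto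
  have finA: "finite ?A" using fin by simp
  have "curve_class ?X (curve f g) = finprod (homology_group 2 ?X) (\<lambda>p. line_class ?X (?l p)) ?A"
    unfolding curve_class_def lines_in_curve[OF f g fin]
    by (rule finprod_reindex) (use car UV(3) inj_on_subset[OF line_set_inj subset_UNIV] in \<open>auto simp: Pi_iff\<close>)
  also have "\<dots> = homologous_rel_set 2 ?X {} (\<Sum>p\<in>?A. line_cycle (U p) (V p))"
    unfolding UV(3) by (rule finprod_classes[OF finA rc])
  finally have cc: "curve_class ?X (curve f g) = homologous_rel_set 2 ?X {} (\<Sum>p\<in>?A. line_cycle (U p) (V p))" .
  have z: "singular_relcycle 2 ?X {} (\<Sum>p\<in>?A. line_cycle (U p) (V p))" by (rule singular_relcycle_sum[OF rc])
  show thesis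
  proof (rule that)
    show "indep2 (U (\<zeta>, \<xi>)) (V (\<zeta>, \<xi>)) \<and> on_line \<zeta> \<xi> (U (\<zeta>, \<xi>)) \<and> on_line \<zeta> \<xi> (V (\<zeta>, \<xi>))" for \<zeta> \<xi>
      using UV(1) on by blast
    fix t :: param and \<beta> assume t: "norm t < \<epsilon>" and \<beta>: "\<beta> \<in> quartic_exps"
    have e: "chain_map 2 (retr_proj t) (\<Sum>p\<in>?A. line_cycle (U p) (V p)) = (\<Sum>p\<in>?A. chain_map 2 (retr_proj t) (line_cycle (U p) (V p)))"
      using chain_map_sum[OF finA] by (simp add: o_def)
    have "period t \<beta> (transport t (curve_class ?X (curve f g))) = chain_integral t \<beta> (chain_map 2 (retr_proj t) (\<Sum>p\<in>?A. line_cycle (U p) (V p)))"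
      unfolding cc transport_class[OF t z]
    proof (rule period_eq[OF \<beta> smooth_nearby[OF t] singular_relcycle_chain_map[OF z continuous_map_retr_proj[OF t]]])
      fix \<sigma> assume "\<sigma> \<in> Poly_Mapping.keys (chain_map 2 (retr_proj t) (\<Sum>p\<in>?A. line_cycle (U p) (V p)))"
      then obtain p where "p \<in> ?A" "\<sigma> \<in> Poly_Mapping.keys (chain_map 2 (retr_proj t) (line_cycle (U p) (V p)))"
        unfolding e using keys_sum[of "\<lambda>p. chain_map 2 (retr_proj t) (line_cycle (U p) (V p))" ?A] by blast
      then show "C1_simplex \<sigma>" using chain_integral_line(2)[OF \<beta> UV(1) sub t] by blast
    qed simp
    also have "\<dots> = (\<Sum>p\<in>?A. line_period \<beta> (U p) (V p) t)"
      unfolding e chain_integral_eq frag_ext_sum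
      unfolding chain_integral_eq[symmetric] by (intro sum.cong refl chain_integral_line(1)[OF \<beta> UV(1) sub t])
    finally show "period t \<beta> (transport t (curve_class ?X (curve f g))) = (\<Sum>p\<in>?A. line_period \<beta> (U p) (V p) t)" .
  qed
qed

end

section \<open>Codimension\<close>

definition clinear :: "(complex^'n \<Rightarrow> complex) \<Rightarrow> bool" where
  "clinear l \<longleftrightarrow> (\<forall>v w. l (v + w) = l v + l w) \<and> (\<forall>c v. l (c *s v) = c * l v)"

lemma clinear_sum: "clinear l \<Longrightarrow> l (\<Sum>i\<in>I. f i) = (\<Sum>i\<in>I. l (f i))"
proof -
  assume l: "clinear l"
  have "l 0 = 0" using l unfolding clinear_def by (metis mult_zero_left vector_smult_lzero)
  then show ?thesis using l by (induction I rule: infinite_finite_induct) (auto simp: clinear_def)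
qed

text \<open>Induction on the number of forms. If some \<open>u\<close> is killed by the remaining
  forms but not by \<open>m\<close>, a multiple of the new form \<open>l x\<close> is subtracted
  from \<open>m\<close> so that the difference vanishes at \<open>u\<close>; the induction
  hypothesis then applies to it.\<close>

lemma clinear_in_span:
  assumes "finite I" "\<And>i. i \<in> I \<Longrightarrow> clinear (l i)" "clinear m" "\<And>v. (\<And>i. i \<in> I \<Longrightarrow> l i v = 0) \<Longrightarrow> m v = 0"
  shows "\<exists>a. \<forall>v. m v = (\<Sum>i\<in>I. a i * l i v)"
  using assms
proof (induction I arbitrary: m rule: finite_induct)
  case (insert x I)
  show ?case
  proof (cases "\<forall>v. (\<forall>i\<in>I. l i v = 0) \<longrightarrow> m v = 0")
    case True
    then obtain a where "\<forall>v. m v = (\<Sum>i\<in>I. a i * l i v)" using insert.IH[of m] insert.prems by blast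
    then have "m v = (\<Sum>i\<in>insert x I. (if i = x then 0 else a i) * l i v)" for v
      using insert.hyps by (auto intro!: sum.cong)
    then show ?thesis by (intro exI[of _ "\<lambda>i. if i = x then 0 else a i"] allI)
  next
    case False
    then obtain u where u: "\<And>i. i \<in> I \<Longrightarrow> l i u = 0" "m u \<noteq> 0" by blast
    have xu: "l x u \<noteq> 0" using insert.prems(3)[of u] u by auto
    have lin: "l i (v + c *s w) = l i v + c * l i w" if "i \<in> insert x I" for i v w c
      using insert.prems(1)[OF that] by (simp add: clinear_def)
    have m: "m (v + c *s w) = m v + c * m w" for v w c using insert.prems(2) by (simp add: clinear_def)
    let ?m = "\<lambda>v. m v - m u / l x u * l x v"
    have "\<exists>a. \<forall>v. ?m v = (\<Sum>i\<in>I. a i * l i v)"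
    proof (rule insert.IH)
      show "clinear ?m" using insert.prems(1)[of x] insert.prems(2) by (simp add: clinear_def algebra_simps add_divide_distrib)
      fix w assume w: "\<And>i. i \<in> I \<Longrightarrow> l i w = 0"
      define c where "c = - (l x w / l x u)"
      have "m (w + c *s u) = 0"
        by (rule insert.prems(3)) (use w u xu lin[of _ w c u] in \<open>auto simp: c_def\<close>)
      then show "?m w = 0" unfolding m by (simp add: c_def field_simps)
    qed (use insert.prems in auto)
    then obtain a where a: "\<And>v. ?m v = (\<Sum>i\<in>I. a i * l i v)" by blast
    have "m v = (\<Sum>i\<in>insert x I. (if i = x then m u / l x u else a i) * l i v)" for v
    proof -
      have "(\<Sum>i\<in>I. (if i = x then m u / l x u else a i) * l i v) = (\<Sum>i\<in>I. a i * l i v)"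
        using insert.hyps by (intro sum.cong) auto
      then show ?thesis using a[of v] insert.hyps by (simp add: algebra_simps)
    qed
    then show ?thesis by (intro exI[of _ "\<lambda>i. if i = x then m u / l x u else a i"] allI)
  qed
qed auto

text \<open>The condition imposed on the differentials in \<open>regular_point\<close>.\<close>

definition independent_forms :: "nat \<Rightarrow> (nat \<Rightarrow> complex^'n \<Rightarrow> complex) \<Rightarrow> bool" where
  "independent_forms k l \<longleftrightarrow> (\<forall>a. (\<forall>v. (\<Sum>i<k. a i * l i v) = 0) \<longrightarrow> (\<forall>i<k. a i = 0))"

lemma dual_vectors:
  assumes l: "\<And>i. i < k \<Longrightarrow> clinear (l i)" and ind: "independent_forms k l"
  shows "\<exists>e. \<forall>i<k. \<forall>j<k. l i (e j) = (if i = j then 1 else 0)"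
proof -
  have "\<exists>v. \<forall>i<k. l i v = (if i = j then 1 else 0)" if j: "j < k" for j
  proof -
    have "\<exists>u. (\<forall>i\<in>{..<k} - {j}. l i u = 0) \<and> l j u \<noteq> 0"
    proof (rule ccontr)
      assume "\<not> ?thesis"
      then have "\<exists>a. \<forall>v. l j v = (\<Sum>i\<in>{..<k} - {j}. a i * l i v)"
        by (intro clinear_in_span) (use l j in auto)
      then obtain a where a: "\<And>v. l j v = (\<Sum>i\<in>{..<k} - {j}. a i * l i v)" by blast
      have "(\<Sum>i<k. (if i = j then -1 else a i) * l i v) = 0" for v
        using j a[of v] by (subst sum.remove[of _ j]) (auto intro!: sum.cong)
      from ind[unfolded independent_forms_def, rule_format, OF this j] show False by simp
    qed
    then obtain u where u: "\<And>i. i < k \<Longrightarrow> i \<noteq> j \<Longrightarrow> l i u = 0" "l j u \<noteq> 0" by auto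
    have "l i ((1 / l j u) *s u) = (if i = j then 1 else 0)" if "i < k" for i
      using l[OF that] u that by (simp add: clinear_def)
    then show ?thesis by blast
  qed
  then obtain e where "\<forall>j<k. \<forall>i<k. l i (e j) = (if i = j then 1 else 0)" by metis
  then show ?thesis by (intro exI[of _ e]) blast
qed

text \<open>More unknowns than equations: each equation eliminates at most one unknown.\<close>

lemma homogeneous_system:
  fixes a :: "'i \<Rightarrow> nat \<Rightarrow> complex"
  assumes "finite S" "j < card S"
  shows "\<exists>c. (\<exists>i\<in>S. c i \<noteq> 0) \<and> (\<forall>m<j. (\<Sum>i\<in>S. c i * a i m) = 0)"
  using assms
proof (induction j arbitrary: S a)
  case 0
  then have "S \<noteq> {}" by auto
  then show ?case by (intro exI[of _ "\<lambda>_. 1"]) auto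
next
  case (Suc j)
  show ?case
  proof (cases "\<forall>i\<in>S. a i j = 0")
    case True
    from Suc.IH[OF Suc.prems(1), of a] Suc.prems(2) obtain c where "\<exists>i\<in>S. c i \<noteq> 0" "\<forall>m<j. (\<Sum>i\<in>S. c i * a i m) = 0" by auto
    then show ?thesis using True by (intro exI[of _ c]) (auto simp: less_Suc_eq)
  next
    case False
    then obtain s where s: "s \<in> S" "a s j \<noteq> 0" by blast
    let ?S = "S - {s}" and ?a = "\<lambda>i m. a i m - a i j / a s j * a s m"
    have "j < card ?S" using Suc.prems s(1) by simp
    from Suc.IH[OF _ this, of ?a] Suc.prems(1)
    obtain c where c: "\<exists>i\<in>?S. c i \<noteq> 0" "\<And>m. m < j \<Longrightarrow> (\<Sum>i\<in>?S. c i * ?a i m) = 0" by auto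
    let ?c = "\<lambda>i. if i = s then - (\<Sum>i\<in>?S. c i * a i j) / a s j else c i"
    have "(\<Sum>i\<in>S. ?c i * a i m) = (\<Sum>i\<in>?S. c i * ?a i m)" for m
    proof -
      define X where "X = (\<Sum>i\<in>?S. c i * a i j)"
      have "(\<Sum>i\<in>?S. ?c i * a i m) = (\<Sum>i\<in>?S. c i * a i m)" by (rule sum.cong) auto
      then have "(\<Sum>i\<in>S. ?c i * a i m) = - X / a s j * a s m + (\<Sum>i\<in>?S. c i * a i m)"
        unfolding sum.remove[OF Suc.prems(1) s(1), of "\<lambda>i. ?c i * a i m"] by (simp add: X_def)
      moreover have "(\<Sum>i\<in>?S. c i * ?a i m) = (\<Sum>i\<in>?S. c i * a i m) - X / a s j * a s m"
      proof -
        have "X / a s j * a s m = (\<Sum>i\<in>?S. c i * (a i j / a s j * a s m))"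
          unfolding X_def sum_divide_distrib sum_distrib_right by (rule sum.cong) simp_all
        then show ?thesis by (simp only: right_diff_distrib sum_subtractf)
      qed
      ultimately show ?thesis by simp
    qed
    moreover have "(\<Sum>i\<in>?S. c i * ?a i j) = 0" using s(2) by simp
    ultimately have "\<forall>m<Suc j. (\<Sum>i\<in>S. ?c i * a i m) = 0" using c(2) by (auto simp: less_Suc_eq)
    moreover have "\<exists>i\<in>S. ?c i \<noteq> 0" using c(1) by auto
    ultimately show ?thesis by (intro exI[of _ ?c] conjI)
  qed
qed

text \<open>Otherwise all the forms \<open>m\<close> would be combinations of the fewer forms
  \<open>l\<close>, and hence dependent.\<close>

lemma independent_forms_kernel:
  assumes "\<And>i. i < j \<Longrightarrow> clinear (l i)" "\<And>i. i < k \<Longrightarrow> clinear (m i)" "independent_forms k m" "j < k"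
  obtains v i where "i < k" "m i v \<noteq> 0" "\<And>i. i < j \<Longrightarrow> l i v = 0"
proof (rule ccontr)
  assume n: "\<not> thesis"
  note main = that
  have "m i v = 0" if "i < k" "\<And>n. n < j \<Longrightarrow> l n v = 0" for i v
    using main[OF that(1) _ that(2)] n by blast
  then have "\<exists>a. \<forall>v. m i v = (\<Sum>n\<in>{..<j}. a n * l n v)" if "i < k" for i
    by (intro clinear_in_span) (use assms(1,2) that in auto)
  then obtain a where a: "\<And>i v. i < k \<Longrightarrow> m i v = (\<Sum>n<j. a i n * l n v)" by metis
  obtain c where c: "\<exists>i\<in>{..<k}. c i \<noteq> 0" "\<forall>n<j. (\<Sum>i\<in>{..<k}. c i * a i n) = 0"
    using homogeneous_system[of "{..<k}" j a] assms(4) by auto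
  have "(\<Sum>i<k. c i * m i v) = 0" for v
  proof -
    have "(\<Sum>i<k. c i * m i v) = (\<Sum>i<k. \<Sum>n<j. c i * a i n * l n v)" by (simp add: a sum_distrib_left mult.assoc)
    also have "\<dots> = (\<Sum>n<j. (\<Sum>i<k. c i * a i n) * l n v)" by (subst sum.swap) (simp add: sum_distrib_right)
    finally show ?thesis using c(2) by simp
  qed
  then show False using assms(3) c(1) unfolding independent_forms_def by blast
qed

section \<open>Regular points and the codimension of a zero set\<close>

lemma holo_on_FD:
  assumes "holo_on f U" "p \<in> U"
  shows "(f has_derivative FD f p) (at p)" "clinear (FD f p)"
proof -
  obtain D where D: "(f has_derivative D) (at p)" "\<And>c v. D (c *s v) = c * D v"
    using assms by (auto simp: holo_on_def)
  have "FD f p = D" by (rule FD_eq[OF D(1)])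
  then show "(f has_derivative FD f p) (at p)" "clinear (FD f p)"
    using D linear_add[OF bounded_linear.linear[OF has_derivative_bounded_linear[OF D(1)]]] by (auto simp: clinear_def)
qed

text \<open>Brouwer's theorem is applied to the defect of the linear approximation of \<open>h\<close>.\<close>

lemma tangent_approximation:
  fixes h :: "nat \<Rightarrow> complex^'n \<Rightarrow> complex"
  assumes U: "open U" "p \<in> U" and h: "\<And>i. i < k \<Longrightarrow> holo_on (h i) U" and z: "\<And>i. i < k \<Longrightarrow> h i p = 0"
    and ind: "independent_forms k (\<lambda>i. FD (h i) p)" and v: "\<And>i. i < k \<Longrightarrow> FD (h i) p v = 0" and \<kappa>: "\<kappa> > 0"
  shows "\<exists>s w. 0 < s \<and> s < \<kappa> \<and> norm w \<le> \<kappa> * s \<and> p + (s *\<^sub>R v + w) \<in> U \<and> (\<forall>i<k. h i (p + (s *\<^sub>R v + w)) = 0)"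
proof -
  let ?D = "\<lambda>i. FD (h i) p"
  have D: "(h i has_derivative ?D i) (at p)" "clinear (?D i)" if "i < k" for i
    using holo_on_FD[OF h[OF that] U(2)] by auto
  obtain e where e: "\<forall>i<k. \<forall>j<k. ?D i (e j) = (if i = j then 1 else 0)"
    using dual_vectors[OF D(2) ind] by (rule exE)
  define P where "P = (\<lambda>w. \<Sum>i<k. ?D i w *s e i)"
  have DP: "?D i (\<Sum>j<k. a j *s e j) = a i" if "i < k" for i a
  proof -
    have "?D i (\<Sum>j<k. a j *s e j) = (\<Sum>j<k. a j * ?D i (e j))"
      using D(2)[OF that] by (simp add: clinear_sum) (simp add: clinear_def)
    also have "\<dots> = (\<Sum>j<k. if j = i then a i else 0)" using e that by (intro sum.cong) auto
    finally show ?thesis using that by simp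
  qed
  have bl: "bounded_linear (?D i)" if "i < k" for i using has_derivative_bounded_linear[OF D(1)[OF that]] .
  have bounded_linear_scale_vector: "bounded_linear (\<lambda>z. z *s x)" for x :: "complex^'n"
    unfolding linear_conv_bounded_linear[symmetric] by (rule linearI) (simp_all add: vec_eq_iff algebra_simps)
  have blP: "bounded_linear P" unfolding P_def
    by (intro bounded_linear_sum bounded_linear_compose[OF bounded_linear_scale_vector] bl) simp
  obtain N where N: "N > 0" "\<And>w. norm (P w) \<le> norm w * N" using bounded_linear.pos_bounded[OF blP] by blast
  define C where "C = (\<Sum>i<k. norm (e i))"
  have C: "C \<ge> 0" by (simp add: C_def sum_nonneg)
  define M where "M = norm v + N * \<kappa>"
  have M: "M > 0" using N(1) \<kappa> by (simp add: M_def add_nonneg_pos)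
  \<comment> \<open>The admissible relative error of the linear approximation: \<open>C\<close>
    measures the dual vectors and s M bounds \<open>X w\<close>, so the resulting correction stays
    below \<kappa> s.\<close>
  define \<eta> where "\<eta> = \<kappa> / ((C + 1) * M)"
  have \<eta>: "\<eta> > 0" "C * \<eta> * M \<le> \<kappa>" using C M \<kappa> by (simp_all add: \<eta>_def divide_simps)
  have "\<forall>\<^sub>F x in nhds 0. p + x \<in> U \<and> (\<forall>i\<in>{..<k}. cmod (h i (p + x) - ?D i x) \<le> \<eta> * norm x)"
  proof (intro eventually_conj eventually_ball_finite finite_lessThan ballI)
    have "((\<lambda>x. p + x) \<longlongrightarrow> p + 0) (nhds 0)" by (intro tendsto_intros filterlim_ident)
    then show "\<forall>\<^sub>F x in nhds 0. p + x \<in> U" using topological_tendstoD[OF _ U(1)] U(2) by force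
    fix i assume "i \<in> {..<k}"
    then have i: "i < k" by simp
    obtain d where d: "d > 0" "\<And>y. norm (y - p) < d \<Longrightarrow> norm (h i y - h i p - ?D i (y - p)) \<le> \<eta> * norm (y - p)"
      using D(1)[OF i] \<eta>(1) unfolding has_derivative_at_alt by blast
    show "\<forall>\<^sub>F x in nhds 0. cmod (h i (p + x) - ?D i x) \<le> \<eta> * norm x"
      unfolding eventually_nhds_metric using d(1) d(2)[of "p + _"] z[OF i] by (intro exI[of _ d]) (auto simp: dist_norm)
  qed
  then obtain d where d: "d > 0" "\<And>x. norm x < d \<Longrightarrow> p + x \<in> U" "\<And>x i. norm x < d \<Longrightarrow> i < k \<Longrightarrow> cmod (h i (p + x) - ?D i x) \<le> \<eta> * norm x"
    unfolding eventually_nhds_metric by (auto simp: dist_norm)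
  define s where "s = min (\<kappa> / 2) (d / (2 * M))"
  have s: "0 < s" "s < \<kappa>" "s * M < d"
  proof -
    show "0 < s" "s < \<kappa>" using \<kappa> d(1) M by (auto simp: s_def)
    have "s * M \<le> d / (2 * M) * M" using M by (intro mult_right_mono) (auto simp: s_def)
    then show "s * M < d" using M d(1) by simp
  qed
  define X where "X = (\<lambda>w. s *\<^sub>R v + P w)"
  have X: "norm (X w) \<le> s * M" if "norm w \<le> \<kappa> * s" for w
  proof -
    have "norm (X w) \<le> s * norm v + norm w * N" unfolding X_def using norm_triangle_ineq[of "s *\<^sub>R v" "P w"] N(2)[of w] s(1) by simp
    also have "\<dots> \<le> s * norm v + (\<kappa> * s) * N" using that N(1) by (intro add_left_mono mult_right_mono) auto
    finally show ?thesis by (simp add: M_def algebra_simps)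
  qed
  define \<Psi> where "\<Psi> = (\<lambda>w. P w - (\<Sum>i<k. h i (p + X w) *s e i))"
  have DX: "?D i (X w) = ?D i w" if i: "i < k" for i w
  proof -
    have "?D i (X w) = s *\<^sub>R ?D i v + ?D i (P w)" unfolding X_def
      using bounded_linear.linear[OF bl[OF i]] by (simp add: linear_add linear_scale)
    then show ?thesis using v[OF i] DP[OF i] by (simp add: P_def)
  qed
  have \<Psi>: "\<Psi> w = (\<Sum>i<k. (?D i w - h i (p + X w)) *s e i)" for w
    by (simp add: \<Psi>_def P_def vector_ssub_ldistrib vector_sub_rdistrib flip: sum_subtractf)
  \<comment> \<open>\<open>holo_on\<close> states differentiability alone, so a topological fixed
    point theorem takes the place of the inverse function theorem.\<close>
  have "\<exists>w\<in>cball 0 (\<kappa> * s). \<Psi> w = w"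
  proof (rule brouwer[of "cball 0 (\<kappa> * s)" \<Psi>])
    show "compact (cball 0 (\<kappa> * s) :: (complex^'n) set)" "convex (cball 0 (\<kappa> * s) :: (complex^'n) set)" by simp_all
    show "cball 0 (\<kappa> * s) \<noteq> ({} :: (complex^'n) set)" using mult_pos_pos[OF \<kappa> s(1)] by simp
    have cP: "continuous_on A P" for A by (rule linear_continuous_on[OF blP])
    have cX: "continuous_on A (\<lambda>w. p + X w)" for A unfolding X_def by (intro continuous_intros cP)
    have "continuous_on (cball 0 (\<kappa> * s)) (\<lambda>w. h i (p + X w))" if i: "i < k" for i
    proof (rule continuous_on_compose2[OF _ cX])
      show "continuous_on U (h i)"
        using holo_on_FD(1)[OF h[OF i]] by (meson continuous_at_imp_continuous_on has_derivative_continuous)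
      show "(\<lambda>w. p + X w) ` cball 0 (\<kappa> * s) \<subseteq> U" using X s(3) d(2) by force
    qed
    then show "continuous_on (cball 0 (\<kappa> * s)) \<Psi>" unfolding \<Psi>_def
      by (intro continuous_on_diff cP continuous_on_sum continuous_on_scale continuous_on_const) auto
    show "\<Psi> \<in> cball 0 (\<kappa> * s) \<rightarrow> cball 0 (\<kappa> * s)"
    proof
      fix w :: "complex^'n" assume "w \<in> cball 0 (\<kappa> * s)"
      then have w: "norm (X w) \<le> s * M" "norm (X w) < d" using X[of w] s(3) by auto
      have "norm (\<Psi> w) \<le> (\<Sum>i<k. cmod (?D i w - h i (p + X w)) * norm (e i))"
        unfolding \<Psi> by (rule sum_norm_le) (simp only: norm_scale order_refl)
      also have "\<dots> \<le> (\<Sum>i<k. \<eta> * (s * M) * norm (e i))"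
      proof (intro sum_mono mult_right_mono)
        fix i assume i: "i \<in> {..<k}"
        have "cmod (?D i w - h i (p + X w)) \<le> \<eta> * norm (X w)"
          using d(3)[OF w(2), of i] i DX[of i w] by (simp add: norm_minus_commute)
        also have "\<dots> \<le> \<eta> * (s * M)" using w(1) \<eta>(1) by simp
        finally show "cmod (?D i w - h i (p + X w)) \<le> \<eta> * (s * M)" .
      qed simp
      also have "\<dots> = (C * \<eta> * M) * s" by (simp add: C_def sum_distrib_left sum_distrib_right mult_ac)
      also have "\<dots> \<le> \<kappa> * s" using \<eta>(2) s(1) by (intro mult_right_mono) auto
      finally show "\<Psi> w \<in> cball 0 (\<kappa> * s)" by simp
    qed
    show "\<exists>w\<in>cball 0 (\<kappa> * s). \<Psi> w = w" if "x \<in> cball 0 (\<kappa> * s)" "\<Psi> x = x" for x using that by blast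
  qed
  then obtain w where w: "norm w \<le> \<kappa> * s" "\<Psi> w = w" by auto
  \<comment> \<open>The i-th form, evaluated on the fixed point equation, gives
    \<open>?D i w\<close> on one side and \<open>?D i w - h i (p + X w)\<close> on the
    other.\<close>
  have "?D i w = ?D i w - h i (p + X w)" if "i < k" for i
    using DP[OF that, of "\<lambda>i. ?D i w - h i (p + X w)"] w(2) unfolding \<Psi> by simp
  then have 0: "h i (p + X w) = 0" if "i < k" for i using that by simp
  then have "P w = w" using w(2) by (simp add: \<Psi>_def)
  then have "X w = s *\<^sub>R v + w" by (simp add: X_def)
  moreover have "p + X w \<in> U" using d(2) X[OF w(1)] s(3) by force
  ultimately show ?thesis using s(1,2) w(1) 0 by (intro exI[of _ s] exI[of _ w]) simp
qed

text \<open>If fewer than \<open>k\<close> equations defined \<open>Z\<close> regularly at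
  \<open>p\<close>, some vector \<open>v\<close> in the kernel of their differentials would not be
  killed by the differential of some \<open>h l\<close>. There are points of \<open>Z\<close>
  arbitrarily close to the ray in direction \<open>v\<close>, and on them \<open>h l\<close>
  vanishes, contrary to its derivative.\<close>

lemma regular_codimension:
  fixes h :: "nat \<Rightarrow> complex^'n \<Rightarrow> complex"
  assumes U: "open U" "p \<in> U" and h: "\<And>i. i < k \<Longrightarrow> holo_on (h i) U" and Z: "Z \<inter> U = {t \<in> U. \<forall>i<k. h i t = 0}"
    and ind: "independent_forms k (\<lambda>i. FD (h i) p)" and reg: "regular_point Z p j"
  shows "k \<le> j"
proof (rule ccontr)
  assume "\<not> k \<le> j"
  obtain U' h' where U': "open U'" "p \<in> U'" "\<And>i. i < j \<Longrightarrow> holo_on (h' i) U'" "Z \<inter> U' = {t \<in> U'. \<forall>i<j. h' i t = 0}"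
    and ind': "independent_forms j (\<lambda>i. FD (h' i) p)" and pZ: "p \<in> Z"
    using reg unfolding regular_point_def independent_forms_def by blast
  obtain v l where l: "l < k" "FD (h l) p v \<noteq> 0" and v: "\<And>i. i < j \<Longrightarrow> FD (h' i) p v = 0"
    by (rule independent_forms_kernel[of j "\<lambda>i. FD (h' i) p" k "\<lambda>i. FD (h i) p"])
      (use holo_on_FD(2)[OF U'(3) U'(2)] holo_on_FD(2)[OF h U(2)] ind \<open>\<not> k \<le> j\<close> in auto)
  let ?V = "U \<inter> U'" and ?D = "FD (h l) p"
  have V: "open ?V" "p \<in> ?V" using U U' by auto
  have hV: "holo_on (h' i) ?V" if "i < j" for i using U'(3)[OF that] by (auto simp: holo_on_def)
  have z: "h' i p = 0" if "i < j" for i using U'(2,4) pZ that by blast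
  have D: "(h l has_derivative ?D) (at p)" using holo_on_FD(1)[OF h[OF l(1)] U(2)] .
  have bl: "bounded_linear ?D" using has_derivative_bounded_linear[OF D] .
  obtain B where B: "B > 0" "\<And>w. norm (?D w) \<le> norm w * B" using bounded_linear.pos_bounded[OF bl] by blast
  let ?a = "cmod (?D v)"
  \<comment> \<open>Both errors, from the approximation of \<open>h l\<close> and from the deviation
    \<open>w\<close>, are kept below a quarter of the main term \<open>s * ?a\<close>.\<close>
  define \<eta> where "\<eta> = ?a / (4 * (norm v + 1))"
  have a: "?a > 0" using l(2) by simp
  have \<eta>: "\<eta> > 0" using a by (simp add: \<eta>_def add_nonneg_pos)
  obtain d where d: "d > 0" "\<And>y. norm (y - p) < d \<Longrightarrow> norm (h l y - h l p - ?D (y - p)) \<le> \<eta> * norm (y - p)"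
    using D \<eta> unfolding has_derivative_at_alt by blast
  define \<kappa> where "\<kappa> = min 1 (min (?a / (4 * B)) (d / (2 * (norm v + 1))))"
  have \<kappa>: "\<kappa> > 0" "\<kappa> \<le> 1" "\<kappa> * B \<le> ?a / 4" "\<kappa> * (norm v + 1) < d"
  proof -
    have n: "norm v + 1 > 0" by (simp add: add_nonneg_pos)
    have dx: "d / (2 * x) * x < d" if "x > 0" for x :: real using that d(1) by simp
    show "\<kappa> > 0" "\<kappa> \<le> 1" using a B(1) d(1) n by (auto simp: \<kappa>_def)
    have "\<kappa> * B \<le> ?a / (4 * B) * B" using B(1) by (intro mult_right_mono) (auto simp: \<kappa>_def)
    then show "\<kappa> * B \<le> ?a / 4" using B(1) by simp
    have "\<kappa> * (norm v + 1) \<le> d / (2 * (norm v + 1)) * (norm v + 1)" using n by (intro mult_right_mono) (auto simp: \<kappa>_def)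
    then show "\<kappa> * (norm v + 1) < d" using dx[OF n] by linarith
  qed
  obtain s w where s: "0 < s" "s < \<kappa>" "norm w \<le> \<kappa> * s" "p + (s *\<^sub>R v + w) \<in> ?V" "\<forall>i<j. h' i (p + (s *\<^sub>R v + w)) = 0"
    using tangent_approximation[OF V hV z ind' v \<kappa>(1)] by blast
  let ?x = "s *\<^sub>R v + w"
  have "p + ?x \<in> Z" using s(4,5) U'(4) by blast
  then have "h l (p + ?x) = 0" "h l p = 0" using s(4) Z l(1) pZ U(2) by blast+
  have nx: "norm ?x \<le> s * (norm v + 1)"
  proof -
    have "norm ?x \<le> s * norm v + \<kappa> * s" using norm_triangle_ineq[of "s *\<^sub>R v" w] s(1,3) by simp
    also have "\<dots> \<le> s * norm v + 1 * s" using \<kappa>(2) s(1) by (intro add_left_mono mult_right_mono) auto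
    finally show ?thesis by (simp add: algebra_simps)
  qed
  also have "\<dots> < d" using \<kappa>(4) s(2) by (meson add_nonneg_pos less_trans mult_strict_right_mono norm_ge_zero zero_less_one)
  finally have "norm (?D ?x) \<le> \<eta> * norm ?x"
    using d(2)[of "p + ?x"] \<open>h l (p + ?x) = 0\<close> \<open>h l p = 0\<close> by simp
  also have "\<dots> \<le> \<eta> * (s * (norm v + 1))" using nx \<eta> by simp
  also have "\<dots> = s * (?a / 4)"
  proof -
    have "y / (4 * x) * (s * x) = s * (y / 4)" if "x > 0" for x y :: real using that by simp
    then show ?thesis unfolding \<eta>_def by (simp only: add_nonneg_pos norm_ge_zero zero_less_one)
  qed
  finally have 1: "norm (?D ?x) \<le> s * (?a / 4)" .
  have "?D ?x = s *\<^sub>R ?D v + ?D w" using bounded_linear.linear[OF bl] by (simp add: linear_add linear_scale)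
  then have "s * ?a \<le> norm (?D ?x) + norm (?D w)" using s(1) norm_triangle_ineq4[of "?D ?x" "?D w"] by simp
  also have "norm (?D w) \<le> \<kappa> * s * B" using B(2)[of w] mult_right_mono[OF s(3), of B] B(1) by linarith
  also have "\<kappa> * s * B \<le> s * (?a / 4)" using mult_left_mono[OF \<kappa>(3), of s] s(1) by (simp add: mult_ac)
  finally have "s * ?a \<le> s * (?a / 2)" using 1 by simp
  then show False using s(1) a by simp
qed

text \<open>The origin is itself a regular point of codimension \<open>k\<close>. The differentials
  stay independent at all points close to it, so no regular point there has smaller
  codimension.\<close>

lemma codim0_independent:
  fixes h :: "nat \<Rightarrow> complex^'n \<Rightarrow> complex"
  assumes e: "e > 0" and h: "\<And>i. i < k \<Longrightarrow> vec_hol_on (h i) (ball 0 e)" and z: "\<And>i. i < k \<Longrightarrow> h i 0 = 0"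
    and Z: "Z \<inter> ball 0 e = {t \<in> ball 0 e. \<forall>i<k. h i t = 0}" and ind: "independent_forms k (\<lambda>i. FD (h i) 0)"
  shows "codim0 Z k"
proof -
  have holo: "holo_on (h i) (ball 0 e)" if "i < k" for i
    unfolding holo_on_def using hol_on_has_derivative[OF h[OF that]] hol_on_scale[OF h[OF that]] by blast
  have 0: "0 \<in> ball (0 :: complex^'n) e" using e by simp
  obtain b where b: "\<forall>i<k. \<forall>j<k. FD (h i) 0 (b j) = (if i = j then 1 else 0)"
    using dual_vectors[OF holo_on_FD(2)[OF holo 0] ind] by (rule exE)
  have "\<forall>\<^sub>F p in nhds 0. p \<in> ball 0 e \<and> (\<forall>i\<in>{..<k}. \<forall>j\<in>{..<k}. cmod (FD (h i) p (b j) - FD (h i) 0 (b j)) < 1 / (real k + 1))"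
  proof (intro eventually_conj eventually_ball_finite finite_lessThan ballI)
    show "\<forall>\<^sub>F p in nhds 0. p \<in> ball (0 :: complex^'n) e" using eventually_nhds_in_open[OF open_ball 0] .
    fix i j assume "i \<in> {..<k}" "j \<in> {..<k}"
    then have "i < k" by simp
    have "isCont (\<lambda>p. FD (h i) p (b j)) 0"
      using C1_on_FD_continuous[OF hol_on_C1[OF h[OF \<open>i < k\<close>]]] 0 by (simp add: continuous_on_eq_continuous_at)
    then have "((\<lambda>p. FD (h i) p (b j)) \<longlongrightarrow> FD (h i) 0 (b j)) (nhds 0)"
      unfolding isCont_def by (rule tendsto_at_iff_tendsto_nhds[where g = "\<lambda>p. FD (h i) p (b j)", THEN iffD1])
    from tendstoD[OF this, of "1 / (real k + 1)"]
    show "\<forall>\<^sub>F p in nhds 0. cmod (FD (h i) p (b j) - FD (h i) 0 (b j)) < 1 / (real k + 1)"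
      by (simp add: dist_norm add_nonneg_pos)
  qed
  then obtain d where d0: "d > 0" and dd: "\<forall>p. dist p 0 < d \<longrightarrow> p \<in> ball 0 e \<and>
      (\<forall>i\<in>{..<k}. \<forall>j\<in>{..<k}. cmod (FD (h i) p (b j) - FD (h i) 0 (b j)) < 1 / (real k + 1))"
    unfolding eventually_nhds_metric by blast
  have d1: "p \<in> ball 0 e" if "norm p < d" for p :: "complex^'n" using dd that by (simp only: dist_norm diff_0_right)
  have d2: "cmod (FD (h i) p (b j) - FD (h i) 0 (b j)) < 1 / (real k + 1)" if "norm p < d" "i < k" "j < k" for p i j
    using dd that by (simp only: dist_norm diff_0_right Ball_def lessThan_iff)
  \<comment> \<open>On the dual vectors \<open>b\<close> the matrix of the differentials at
    \<open>p\<close> differs from the identity by entries below 1 / (k + 1), so it is diagonally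
    dominant; the largest coefficient of a relation must then vanish.\<close>
  have indp: "independent_forms k (\<lambda>i. FD (h i) p)" if p: "norm p < d" for p
    unfolding independent_forms_def
  proof (intro allI impI)
    fix a i assume a: "\<forall>v. (\<Sum>i<k. a i * FD (h i) p v) = 0" and i: "i < k"
    obtain l where l: "l < k" "\<And>i. i < k \<Longrightarrow> cmod (a i) \<le> cmod (a l)"
    proof -
      have "finite ((\<lambda>i. cmod (a i)) ` {..<k})" "(\<lambda>i. cmod (a i)) ` {..<k} \<noteq> {}" using i by auto
      from Max_in[OF this] obtain l where "l < k" "Max ((\<lambda>i. cmod (a i)) ` {..<k}) = cmod (a l)" by auto
      moreover then have "cmod (a i) \<le> cmod (a l)" if "i < k" for i
        using Max_ge[OF \<open>finite ((\<lambda>i. cmod (a i)) ` {..<k})\<close>, of "cmod (a i)"] that by auto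
      ultimately show thesis using that by blast
    qed
    have "(\<Sum>i<k. a i * FD (h i) 0 (b l)) = (\<Sum>i<k. if i = l then a l else 0)" using l(1) b by (intro sum.cong) auto
    then have "(\<Sum>i<k. a i * FD (h i) 0 (b l)) = a l" using l(1) by simp
    then have "a l = (\<Sum>i<k. a i * FD (h i) 0 (b l)) - (\<Sum>i<k. a i * FD (h i) p (b l))" using a by simp
    also have "\<dots> = - (\<Sum>i<k. a i * (FD (h i) p (b l) - FD (h i) 0 (b l)))" by (simp add: sum_subtractf algebra_simps)
    finally have "cmod (a l) \<le> (\<Sum>i<k. cmod (a i) * cmod (FD (h i) p (b l) - FD (h i) 0 (b l)))"
      by (metis (no_types, lifting) norm_minus_cancel norm_mult norm_sum sum.cong)
    also have "\<dots> \<le> (\<Sum>i<k. cmod (a l) * (1 / (real k + 1)))"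
      by (intro sum_mono mult_mono less_imp_le[OF d2[OF p]] l) auto
    finally have "cmod (a l) * (real k + 1) \<le> real k * cmod (a l)" by (simp add: field_simps)
    then have "cmod (a l) \<le> 0" by (simp add: algebra_simps)
    then show "a i = 0" using l(2)[OF i] by simp
  qed
  have "regular_point Z 0 k"
    unfolding regular_point_def
  proof (intro conjI exI[of _ "ball 0 e"] exI[of _ h])
    show "0 \<in> Z" using Z z 0 by blast
  qed (use 0 holo Z ind in \<open>auto simp: independent_forms_def\<close>)
  moreover have "\<not> (\<forall>\<epsilon>>0. \<exists>p\<in>ball 0 \<epsilon>. regular_point Z p j)" if "j < k" for j
  proof
    assume "\<forall>\<epsilon>>0. \<exists>p\<in>ball 0 \<epsilon>. regular_point Z p j"
    then obtain p where "norm p < d" "regular_point Z p j" using d0 by (metis mem_ball_0)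
    then have "k \<le> j" by (intro regular_codimension[OF open_ball d1 holo Z indp])
    then show False using that by simp
  qed
  ultimately show ?thesis unfolding codim0_def by (metis centre_in_ball)
qed

section \<open>Tangent spaces of germ ideals\<close>

text \<open>In the derivative of a combination at 0, every term with a derivative of a coefficient
  carries a factor \<open>F \<beta> 0\<close>, which is 0.\<close>

lemma tangent_space0_germ_ideal:
  fixes F :: "'b \<Rightarrow> complex^'n \<Rightarrow> complex"
  assumes B: "finite B" and F: "\<And>\<beta>. \<beta> \<in> B \<Longrightarrow> F \<beta> \<in> germs0" "\<And>\<beta>. \<beta> \<in> B \<Longrightarrow> F \<beta> 0 = 0"
  shows "tangent_space0 (germ_ideal B F) = {v. \<forall>\<beta>\<in>B. FD (F \<beta>) 0 v = 0}"
proof (intro equalityI subsetI)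
  have const: "(\<lambda>_. c) \<in> germs0" for c :: complex
    unfolding germs0_def holo_on_def by (auto intro!: exI[of _ UNIV] exI[of _ "\<lambda>_. 0"])
  fix v assume v: "v \<in> tangent_space0 (germ_ideal B F)"
  have "F \<beta> \<in> germ_ideal B F" if \<beta>: "\<beta> \<in> B" for \<beta>
  proof -
    have "F \<beta> t = (\<Sum>\<beta>'\<in>B. (if \<beta>' = \<beta> then 1 else 0) * F \<beta>' t)" for t
      using B \<beta> by (simp add: if_distrib[of "\<lambda>x. x * _"] cong: if_cong)
    then show ?thesis unfolding germ_ideal_def using F(1)[OF \<beta>] const
      by (intro CollectI conjI exI[of _ "\<lambda>\<beta>' _. if \<beta>' = \<beta> then 1 else 0"]) auto
  qed
  then show "v \<in> {v. \<forall>\<beta>\<in>B. FD (F \<beta>) 0 v = 0}" using v by (simp add: tangent_space0_def)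
next
  have D: "(f has_derivative FD f 0) (at 0)" if "f \<in> germs0" for f :: "complex^'n \<Rightarrow> complex"
    using that holo_on_FD(1) by (auto simp: germs0_def)
  fix v assume v: "v \<in> {v. \<forall>\<beta>\<in>B. FD (F \<beta>) 0 v = 0}"
  have "FD f 0 v = 0" if f: "f \<in> germ_ideal B F" for f
  proof -
    obtain g where g: "\<And>\<beta>. \<beta> \<in> B \<Longrightarrow> g \<beta> \<in> germs0" "\<forall>\<^sub>F t in nhds 0. f t = (\<Sum>\<beta>\<in>B. g \<beta> t * F \<beta> t)"
      using f by (auto simp: germ_ideal_def)
    have "((\<lambda>t. \<Sum>\<beta>\<in>B. g \<beta> t * F \<beta> t) has_derivative (\<lambda>v. \<Sum>\<beta>\<in>B. g \<beta> 0 * FD (F \<beta>) 0 v + FD (g \<beta>) 0 v * F \<beta> 0)) (at 0)"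
      by (intro has_derivative_sum has_derivative_mult D F(1) g(1))
    moreover obtain S where "open S" "0 \<in> S" "\<And>t. t \<in> S \<Longrightarrow> (\<Sum>\<beta>\<in>B. g \<beta> t * F \<beta> t) = f t"
      using g(2) unfolding eventually_nhds by metis
    ultimately have "(f has_derivative (\<lambda>v. \<Sum>\<beta>\<in>B. g \<beta> 0 * FD (F \<beta>) 0 v + FD (g \<beta>) 0 v * F \<beta> 0)) (at 0)"
      by (rule has_derivative_transform_within_open)
    then show ?thesis using v by (simp add: FD_eq F(2))
  qed
  then show "v \<in> tangent_space0 (germ_ideal B F)" by (simp add: tangent_space0_def)
qed

section \<open>Independence of the nine periods\<close>

text \<open>Induction on the nodes: passing to the weights d x (x - y) removes the node y at the
  cost of one moment.\<close>

lemma Vandermonde: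
  fixes d :: "complex \<Rightarrow> complex"
  assumes "finite S" "\<And>i. i < card S \<Longrightarrow> (\<Sum>x\<in>S. d x * x ^ i) = 0" "x \<in> S"
  shows "d x = 0"
  using assms
proof (induction S arbitrary: d x rule: finite_induct)
  case (insert y S)
  have "d x * (x - y) = 0" if "x \<in> S" for x
  proof (rule insert.IH[OF _ that])
    fix i assume "i < card S"
    then have "(\<Sum>x\<in>insert y S. d x * x ^ Suc i) - y * (\<Sum>x\<in>insert y S. d x * x ^ i) = 0"
      using insert.prems(1)[of "Suc i"] insert.prems(1)[of i] insert.hyps by simp
    moreover have "(\<Sum>x\<in>insert y S. d x * x ^ Suc i) - y * (\<Sum>x\<in>insert y S. d x * x ^ i) = (\<Sum>x\<in>insert y S. d x * (x - y) * x ^ i)"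
      unfolding sum_distrib_left sum_subtractf[symmetric] by (rule sum.cong) (simp_all add: algebra_simps)
    ultimately show "(\<Sum>x\<in>S. d x * (x - y) * x ^ i) = 0" using insert.hyps by simp
  qed
  then have 0: "d x = 0" if "x \<in> S" for x using that insert.hyps(2) by fastforce
  moreover have "d y = 0" using insert.prems(1)[of 0] insert.hyps 0 by simp
  ultimately show ?case using insert.prems(2) by auto
qed simp

lemma Vandermonde2:
  fixes d :: "complex \<times> complex \<Rightarrow> complex"
  assumes S: "finite S" and T: "finite T"
    and 0: "\<And>m n. m < card S \<Longrightarrow> n < card T \<Longrightarrow> (\<Sum>p\<in>S \<times> T. d p * (fst p ^ m * snd p ^ n)) = 0" and xy: "x \<in> S" "y \<in> T"
  shows "d (x, y) = 0"
proof (rule Vandermonde[OF T _ xy(2)])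
  fix n assume n: "n < card T"
  show "(\<Sum>y\<in>T. d (x, y) * y ^ n) = 0"
  proof (rule Vandermonde[OF S _ xy(1)])
    fix m assume "m < card S"
    from 0[OF this n] show "(\<Sum>x\<in>S. (\<Sum>y\<in>T. d (x, y) * y ^ n) * x ^ m) = 0"
      by (simp add: sum.cartesian_product' sum_distrib_left sum_distrib_right mult_ac)
  qed
qed

lemma polynomial_zero:
  fixes b :: "nat \<Rightarrow> complex"
  assumes "finite S" "card S = Suc k" "\<And>x. x \<in> S \<Longrightarrow> (\<Sum>m\<le>k. b m * x ^ m) = 0" "m \<le> k"
  shows "b m = 0"
proof (rule ccontr)
  assume "b m \<noteq> 0"
  with polyfun_rootbound[of k b] assms(4)
  have "finite {x. (\<Sum>m\<le>k. b m * x ^ m) = 0}" "card {x. (\<Sum>m\<le>k. b m * x ^ m) = 0} \<le> k" by auto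
  moreover have "S \<subseteq> {x. (\<Sum>m\<le>k. b m * x ^ m) = 0}" using assms(3) by blast
  ultimately have "card S \<le> k" using card_mono le_trans by blast
  then show False using assms(2) by simp
qed

text \<open>Numbers the nine exponents of degree 2 in each pair of variables by 3 times the first
  entry plus the third.\<close>

definition mid_index :: "nat \<Rightarrow> 4 \<Rightarrow> nat" where
  "mid_index n i = (if i = 0 then n div 3 else if i = 1 then 2 - n div 3 else if i = 2 then n mod 3 else 2 - n mod 3)"

lemma mid_index:
  assumes "n < 9"
  shows "mid_index n 0 + mid_index n 1 = 2" "mid_index n 2 + mid_index n 3 = 2" "mid_index n \<in> quartic_exps"
proof -
  have "n div 3 \<le> 2" "n mod 3 \<le> 2" using assms by auto
  then show "mid_index n 0 + mid_index n 1 = 2" "mid_index n 2 + mid_index n 3 = 2" "mid_index n \<in> quartic_exps"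
    by (simp_all add: mid_index_def quartic_exps_def sum_UNIV_4)
qed

lemma mid_index_surj:
  assumes "\<beta> \<in> quartic_exps" "\<beta> 0 + \<beta> 1 = 2"
  obtains n where "n < 9" "\<beta> = mid_index n"
proof
  have 2: "\<beta> 2 + \<beta> 3 = 2" using assms by (simp add: quartic_exps_def sum_UNIV_4)
  let ?n = "3 * \<beta> 0 + \<beta> 2"
  have "?n div 3 = \<beta> 0" "?n mod 3 = \<beta> 2" using 2 by auto
  then have "\<forall>i. \<beta> i = mid_index ?n i" using assms(2) 2 by (subst all_4) (simp add: mid_index_def, arith)
  then show "\<beta> = mid_index ?n" by blast
  show "?n < 9" using assms(2) 2 by simp
qed

lemma sum_9: "(\<Sum>i<9. f i) = (\<Sum>m\<le>2. \<Sum>n\<le>2. f (3 * m + n :: nat) :: complex)"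
  by (simp add: eval_nat_numeral)

lemma mid_exp_exists:
  assumes "m \<le> 4" "n \<le> 4"
  obtains \<alpha> where "expo \<alpha> 0 = m" "expo \<alpha> 2 = n"
proof
  let ?a = "\<lambda>i :: 4. if i = 0 then m else if i = 1 then 4 - m else if i = 2 then n else 4 - n"
  have "expo (Mid_exp ?a) = ?a" by (rule Mid_exp_inverse) (use assms in simp)
  then show "expo (Mid_exp ?a) 0 = m" "expo (Mid_exp ?a) 2 = n" by simp_all
qed

text \<open>A relation with coefficients \<open>a\<close>, tested on each parameter direction, says
  that the weights \<open>d\<close> on the pairs of slopes have vanishing moments up to order 4 in
  both variables; with at most 5 slopes on each side all weights are 0. On the second grid this
  means \<open>P\<close> = 0, and a polynomial of degree at most 2 in each variable that vanishes on
  a 3 by 3 grid is 0.\<close>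

lemma grid_independence:
  fixes J1 J3 :: "complex \<times> complex \<Rightarrow> complex"
  assumes fin: "finite S1" "finite S3" "finite T1" "finite T3" and S: "card (S1 \<union> S3) \<le> 5" "S1 \<inter> S3 = {}" "card S3 = 3"
    and T: "card (T1 \<union> T3) \<le> 5" "card T3 = 3" and J: "\<And>p. p \<in> S3 \<times> T3 \<Longrightarrow> J3 p \<noteq> 0" and c: "c \<noteq> 0"
    and l: "\<And>i s. i < 9 \<Longrightarrow> l i s = (\<Sum>p\<in>S1 \<times> T1. J1 p * slope_sum s (mid_index i) p)
       + c * (\<Sum>p\<in>S3 \<times> T3. J3 p * slope_sum s (mid_index i) p)"
  shows "independent_forms 9 l"
  unfolding independent_forms_def
proof (intro allI impI)
  fix a i assume a: "\<forall>s. (\<Sum>i<9. a i * l i s) = 0" and i: "i < (9 :: nat)"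
  define P where "P = (\<lambda>p. \<Sum>i<9. a i * (fst p ^ mid_index i 0 * snd p ^ mid_index i 2))"
  define d where "d = (\<lambda>p. ((if p \<in> S1 \<times> T1 then J1 p else 0) + (if p \<in> S3 \<times> T3 then c * J3 p else 0)) * P p)"
  have d0: "d (x, y) = 0" if xy: "x \<in> S1 \<union> S3" "y \<in> T1 \<union> T3" for x y
  proof (rule Vandermonde2[OF _ _ _ xy])
    fix m n assume "m < card (S1 \<union> S3)" "n < card (T1 \<union> T3)"
    then have "m \<le> 4" "n \<le> 4" using S(1) T(1) by auto
    then obtain \<alpha> where \<alpha>: "expo \<alpha> 0 = m" "expo \<alpha> 2 = n" by (rule mid_exp_exists)
    let ?w = "\<lambda>i p. fst p ^ (m + mid_index i 0) * snd p ^ (n + mid_index i 2)"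
    have ax: "slope_sum (axis \<alpha> 1) (mid_index i) p = ?w i p" for i p
    proof -
      have "slope_sum (axis \<alpha> 1) (mid_index i) p
        = (\<Sum>\<alpha>'\<in>UNIV. if \<alpha>' = \<alpha> then ?w i p else 0)"
        unfolding slope_sum_def by (rule sum.cong) (auto simp: axis_def \<alpha>)
      then show ?thesis by simp
    qed
    have "(\<Sum>i<9. a i * l i (axis \<alpha> 1)) = (\<Sum>i<9. a i * ((\<Sum>p\<in>S1 \<times> T1. J1 p * ?w i p) + c * (\<Sum>p\<in>S3 \<times> T3. J3 p * ?w i p)))"
      by (rule sum.cong) (simp_all only: lessThan_iff l ax)
    also have "\<dots> = (\<Sum>p\<in>S1 \<times> T1. \<Sum>i<9. a i * (J1 p * ?w i p)) + (\<Sum>p\<in>S3 \<times> T3. \<Sum>i<9. a i * (c * (J3 p * ?w i p)))"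
      by (simp only: distrib_left sum.distrib sum_distrib_left) (intro arg_cong2[of _ _ _ _ "(+)"] sum.swap)
    also have "\<dots> = (\<Sum>p\<in>S1 \<times> T1. J1 p * P p * (fst p ^ m * snd p ^ n)) + (\<Sum>p\<in>S3 \<times> T3. c * J3 p * P p * (fst p ^ m * snd p ^ n))"
      unfolding P_def by (simp add: sum_distrib_left sum_distrib_right power_add mult_ac)
    also have "\<dots> = (\<Sum>p\<in>(S1 \<union> S3) \<times> (T1 \<union> T3). (if p \<in> S1 \<times> T1 then J1 p * P p * (fst p ^ m * snd p ^ n) else 0))
        + (\<Sum>p\<in>(S1 \<union> S3) \<times> (T1 \<union> T3). (if p \<in> S3 \<times> T3 then c * J3 p * P p * (fst p ^ m * snd p ^ n) else 0))"
      by (intro arg_cong2[of _ _ _ _ "(+)"] sum.mono_neutral_cong_left) (use fin in auto)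
    also have "\<dots> = (\<Sum>p\<in>(S1 \<union> S3) \<times> (T1 \<union> T3). d p * (fst p ^ m * snd p ^ n))"
    proof -
      have "(if A then x * y * w else 0) + (if B then x' * y * w else 0) = ((if A then x else 0) + (if B then x' else 0)) * y * w" for A B and x x' y w :: complex
        by (simp add: distrib_right)
      then show ?thesis unfolding sum.distrib[symmetric] d_def by (intro sum.cong refl)
    qed
    finally show "(\<Sum>p\<in>(S1 \<union> S3) \<times> (T1 \<union> T3). d p * (fst p ^ m * snd p ^ n)) = 0" using a by simp
  qed (use fin in auto)
  \<comment> \<open>Disjointness of \<open>S1\<close> and \<open>S3\<close> keeps the first grid out
    of this weight.\<close>
  have P: "P (x, y) = 0" if "x \<in> S3" "y \<in> T3" for x y
  proof -
    have "x \<notin> S1" using that(1) S(2) by blast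
    then have "c * J3 (x, y) * P (x, y) = 0" using d0[of x y] that by (simp add: d_def)
    then show ?thesis using J[of "(x, y)"] c that by simp
  qed
  have mi: "mid_index (3 * m + n) 0 = m" "mid_index (3 * m + n) 2 = n" if "n \<le> 2" for m n
    using that by (auto simp: mid_index_def)
  have "(\<Sum>n\<le>2. a (3 * m + n) * y ^ n) = 0" if "y \<in> T3" "m \<le> 2" for m y
  proof (rule polynomial_zero[of S3 2 "\<lambda>m. \<Sum>n\<le>2. a (3 * m + n) * y ^ n", OF fin(2) _ _ that(2)])
    fix x assume "x \<in> S3"
    moreover have "P (x, y) = (\<Sum>m\<le>2. \<Sum>n\<le>2. a (3 * m + n) * (x ^ m * y ^ n))" for x
      unfolding P_def sum_9 by (intro sum.cong refl) (simp add: mi)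
    ultimately show "(\<Sum>m\<le>2. (\<Sum>n\<le>2. a (3 * m + n) * y ^ n) * x ^ m) = 0"
      using P[of x y] that(1) by (simp add: sum_distrib_left sum_distrib_right mult_ac)
  qed (simp add: S(3))
  then have "a (3 * m + n) = 0" if "m \<le> 2" "n \<le> 2" for m n
    using polynomial_zero[of T3 2 "\<lambda>n. a (3 * m + n)" n] fin(4) T(2) that by simp
  from this[of "i div 3" "i mod 3"] show "a i = 0" using i by auto
qed

section \<open>The pencil\<close>

theorem proposition4:
  fixes f1 f3 f4 g1 g3 g4 :: "complex \<Rightarrow> complex \<Rightarrow> complex"
  assumes "binary_form 1 f1" and "binary_form 3 f3" and "binary_form 4 f4"
    and "binary_form 1 g1" and "binary_form 3 g3" and "binary_form 4 g4"
    and "\<And>x0 x1. x0 ^ 8 + x1 ^ 8 = f1 x0 x1 * f3 x0 x1 * f4 x0 x1"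
    and "\<And>x2 x3. x2 ^ 8 + x3 ^ 8 = g1 x2 x3 * g3 x2 x3 * g4 x2 x3"
  shows "general_pencil (curve_class (octic_surface 0) (curve f1 g1))
                        (curve_class (octic_surface 0) (curve f3 g3))"
proof -
  interpret F: three_forms f1 f3 f4 by unfold_locales (fact assms)+
  interpret G: three_forms g1 g3 g4 by unfold_locales (fact assms)+
  obtain \<rho> \<delta> \<epsilon> where "nearby_octics \<rho> \<delta> \<epsilon>" by (rule nearby_octics_exist)
  then interpret nearby_octics \<rho> \<delta> \<epsilon> .
  let ?B = "ball 0 \<epsilon> :: param set"
  let ?\<delta>1 = "curve_class (octic_surface 0) (curve f1 g1)" and ?\<delta>3 = "curve_class (octic_surface 0) (curve f3 g3)"
  have fin: "finite (slopes f1)" "finite (slopes f3)" "finite (slopes g1)" "finite (slopes g3)"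
    using F.slopes(1,2) G.slopes(1,2) by (auto intro!: card_ge_0_finite)
  obtain U1 V1 where UV1: "\<And>\<zeta> \<xi>. \<zeta> \<in> slopes f1 \<Longrightarrow> \<xi> \<in> slopes g1 \<Longrightarrow> indep2 (U1 (\<zeta>, \<xi>)) (V1 (\<zeta>, \<xi>)) \<and> on_line \<zeta> \<xi> (U1 (\<zeta>, \<xi>)) \<and> on_line \<zeta> \<xi> (V1 (\<zeta>, \<xi>))"
    "\<And>t \<beta>. norm t < \<epsilon> \<Longrightarrow> \<beta> \<in> quartic_exps \<Longrightarrow> period t \<beta> (transport t ?\<delta>1) = (\<Sum>p\<in>slopes f1 \<times> slopes g1. line_period \<beta> (U1 p) (V1 p) t)"
    by (rule curve_periods[of f1 g1]) (use fin F.slopes(4) G.slopes(4) F.zeros G.zeros in auto)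
  obtain U3 V3 where UV3: "\<And>\<zeta> \<xi>. \<zeta> \<in> slopes f3 \<Longrightarrow> \<xi> \<in> slopes g3 \<Longrightarrow> indep2 (U3 (\<zeta>, \<xi>)) (V3 (\<zeta>, \<xi>)) \<and> on_line \<zeta> \<xi> (U3 (\<zeta>, \<xi>)) \<and> on_line \<zeta> \<xi> (V3 (\<zeta>, \<xi>))"
    "\<And>t \<beta>. norm t < \<epsilon> \<Longrightarrow> \<beta> \<in> quartic_exps \<Longrightarrow> period t \<beta> (transport t ?\<delta>3) = (\<Sum>p\<in>slopes f3 \<times> slopes g3. line_period \<beta> (U3 p) (V3 p) t)"
    by (rule curve_periods[of f3 g3]) (use fin F.slopes(4) G.slopes(4) F.zeros G.zeros in auto)
  \<comment> \<open>Explicit functions agreeing near 0 with the periods of the two transported curve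
    classes.\<close>
  define Q1 where "Q1 = (\<lambda>\<beta> t. \<Sum>p\<in>slopes f1 \<times> slopes g1. line_period \<beta> (U1 p) (V1 p) t)"
  define Q3 where "Q3 = (\<lambda>\<beta> t. \<Sum>p\<in>slopes f3 \<times> slopes g3. line_period \<beta> (U3 p) (V3 p) t)"
  have line: "\<exists>J. J \<noteq> 0 \<and> (\<forall>\<beta> s. \<beta> 0 + \<beta> 1 = 2 \<longrightarrow> \<beta> 2 + \<beta> 3 = 2 \<longrightarrow>
      FD (line_period \<beta> u v) 0 s = J * slope_sum s \<beta> (\<zeta>, \<xi>))"
    "vec_hol_on (line_period \<beta> u v) ?B" "line_period \<beta> u v 0 = 0"
    "\<beta> \<in> quartic_exps \<Longrightarrow> \<beta> 0 + \<beta> 1 \<noteq> 2 \<Longrightarrow> norm t < \<epsilon> \<Longrightarrow> line_period \<beta> u v t = 0"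
    if uv: "indep2 u v \<and> on_line \<zeta> \<xi> u \<and> on_line \<zeta> \<xi> v" and s: "\<zeta> \<in> slopes f1 \<union> slopes f3" "\<xi> \<in> slopes g1 \<union> slopes g3" for u v \<zeta> \<xi> \<beta> t
  proof -
    have 8: "\<zeta> ^ 8 = -1" "\<xi> ^ 8 = -1" using F.slopes(4)[OF s(1)] G.slopes(4)[OF s(2)] by auto
    have L: "line u v \<subseteq> octic_points 0" using line_subset_line_set line_set_subset_octic[OF 8] uv by blast
    show "\<exists>J. J \<noteq> 0 \<and> (\<forall>\<beta> s. \<beta> 0 + \<beta> 1 = 2 \<longrightarrow> \<beta> 2 + \<beta> 3 = 2 \<longrightarrow>
      FD (line_period \<beta> u v) 0 s = J * slope_sum s \<beta> (\<zeta>, \<xi>))"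
      by (rule line_period_derivative[OF 8 _ L]) (use uv in blast)+
    show "vec_hol_on (line_period \<beta> u v) ?B" "line_period \<beta> u v 0 = 0"
      using line_period_hol(1) line_period_0 uv L by blast+
    show "\<beta> \<in> quartic_exps \<Longrightarrow> \<beta> 0 + \<beta> 1 \<noteq> 2 \<Longrightarrow> norm t < \<epsilon> \<Longrightarrow> line_period \<beta> u v t = 0"
      using line_period_vanishes[OF _ _ 8] uv by blast
  qed
  have Q: "vec_hol_on (Q1 \<beta>) ?B" "vec_hol_on (Q3 \<beta>) ?B" "Q1 \<beta> 0 = 0" "Q3 \<beta> 0 = 0" for \<beta>
  proof -
    show "vec_hol_on (Q1 \<beta>) ?B" unfolding Q1_def by (intro hol_on_sum open_ball) (use line(2)[OF UV1(1)] in auto)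
    show "vec_hol_on (Q3 \<beta>) ?B" unfolding Q3_def by (intro hol_on_sum open_ball) (use line(2)[OF UV3(1)] in auto)
    show "Q1 \<beta> 0 = 0" unfolding Q1_def by (intro sum.neutral) (use line(3)[OF UV1(1)] in auto)
    show "Q3 \<beta> 0 = 0" unfolding Q3_def by (intro sum.neutral) (use line(3)[OF UV3(1)] in auto)
  qed
  have Q0: "Q1 \<beta> t = 0" "Q3 \<beta> t = 0" if "\<beta> \<in> quartic_exps" "\<beta> 0 + \<beta> 1 \<noteq> 2" "norm t < \<epsilon>" for \<beta> t
    unfolding Q1_def Q3_def using line(4)[OF UV1(1) _ _ that] line(4)[OF UV3(1) _ _ that] by (auto intro!: sum.neutral)
  have coef: "\<exists>J. \<forall>p\<in>A. J p \<noteq> 0 \<and> (\<forall>\<beta> s. \<beta> 0 + \<beta> 1 = 2 \<longrightarrow> \<beta> 2 + \<beta> 3 = 2 \<longrightarrow>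
      FD (line_period \<beta> (U p) (V p)) 0 s = J p * slope_sum s \<beta> p)"
    if "\<And>p. p \<in> A \<Longrightarrow> indep2 (U p) (V p) \<and> on_line (fst p) (snd p) (U p) \<and> on_line (fst p) (snd p) (V p)"
      "\<And>p. p \<in> A \<Longrightarrow> fst p \<in> slopes f1 \<union> slopes f3" "\<And>p. p \<in> A \<Longrightarrow> snd p \<in> slopes g1 \<union> slopes g3" for A U V
    by (rule bchoice, rule ballI, rule line(1)[where \<zeta> = "fst p" and \<xi> = "snd p" for p, unfolded prod.collapse]) (fact that)+
  obtain J1 where "\<forall>p\<in>slopes f1 \<times> slopes g1. J1 p \<noteq> 0 \<and> (\<forall>\<beta> s. \<beta> 0 + \<beta> 1 = 2 \<longrightarrow> \<beta> 2 + \<beta> 3 = 2 \<longrightarrow>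
      FD (line_period \<beta> (U1 p) (V1 p)) 0 s = J1 p * slope_sum s \<beta> p)"
    by (rule exE[OF coef[of "slopes f1 \<times> slopes g1" U1 V1]]) (use UV1(1) in auto)
  note J1 = this[rule_format, THEN conjunct2, rule_format]
  obtain J3 where "\<forall>p\<in>slopes f3 \<times> slopes g3. J3 p \<noteq> 0 \<and> (\<forall>\<beta> s. \<beta> 0 + \<beta> 1 = 2 \<longrightarrow> \<beta> 2 + \<beta> 3 = 2 \<longrightarrow>
      FD (line_period \<beta> (U3 p) (V3 p)) 0 s = J3 p * slope_sum s \<beta> p)"
    by (rule exE[OF coef[of "slopes f3 \<times> slopes g3" U3 V3]]) (use UV3(1) in auto)
  note J3 = this[rule_format, THEN conjunct1] this[rule_format, THEN conjunct2, rule_format]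
  have 0: "0 \<in> ?B" using pos by simp
  have FD_sum: "FD (\<lambda>t. \<Sum>p\<in>A. q p t) 0 s = (\<Sum>p\<in>A. FD (q p) 0 s)"
    if "\<And>p. p \<in> A \<Longrightarrow> vec_hol_on (q p) ?B" for A :: "(complex \<times> complex) set" and q s
    using FD_eq[OF has_derivative_sum[of A q "\<lambda>p. FD (q p) 0" "at 0"]] hol_on_has_derivative[OF that 0] by simp
  have DQ1: "FD (Q1 \<beta>) 0 s = (\<Sum>p\<in>slopes f1 \<times> slopes g1. J1 p * slope_sum s \<beta> p)"
    if \<beta>: "\<beta> 0 + \<beta> 1 = 2" "\<beta> 2 + \<beta> 3 = 2" for \<beta> s
  proof -
    have "FD (Q1 \<beta>) 0 s = (\<Sum>p\<in>slopes f1 \<times> slopes g1. FD (line_period \<beta> (U1 p) (V1 p)) 0 s)"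
      unfolding Q1_def by (rule FD_sum) (use line(2)[OF UV1(1)] in auto)
    also have "\<dots> = (\<Sum>p\<in>slopes f1 \<times> slopes g1. J1 p * slope_sum s \<beta> p)"
      by (rule sum.cong[OF refl J1[OF _ \<beta>]])
    finally show ?thesis .
  qed
  have DQ3: "FD (Q3 \<beta>) 0 s = (\<Sum>p\<in>slopes f3 \<times> slopes g3. J3 p * slope_sum s \<beta> p)"
    if \<beta>: "\<beta> 0 + \<beta> 1 = 2" "\<beta> 2 + \<beta> 3 = 2" for \<beta> s
  proof -
    have "FD (Q3 \<beta>) 0 s = (\<Sum>p\<in>slopes f3 \<times> slopes g3. FD (line_period \<beta> (U3 p) (V3 p)) 0 s)"
      unfolding Q3_def by (rule FD_sum) (use line(2)[OF UV3(1)] in auto)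
    also have "\<dots> = (\<Sum>p\<in>slopes f3 \<times> slopes g3. J3 p * slope_sum s \<beta> p)"
      by (rule sum.cong[OF refl J3(2)[OF _ \<beta>]])
    finally show ?thesis .
  qed
  \<comment> \<open>Periods of a general combination of the two classes, so that the members of the
    pencil and the two loci defining its axis are treated together.\<close>
  define H where "H = (\<lambda>a c \<beta> t. a * Q1 \<beta> t + c * Q3 \<beta> t :: complex)"
  have H: "vec_hol_on (H a c \<beta>) ?B" "H a c \<beta> 0 = 0" "FD (H a c \<beta>) 0 s = a * FD (Q1 \<beta>) 0 s + c * FD (Q3 \<beta>) 0 s" for a c \<beta> s
  proof -
    show "vec_hol_on (H a c \<beta>) ?B" unfolding H_def by (intro hol_intros Q open_ball)
    show "H a c \<beta> 0 = 0" by (simp add: H_def Q)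
    have "(H a c \<beta> has_derivative (\<lambda>s. a * FD (Q1 \<beta>) 0 s + c * FD (Q3 \<beta>) 0 s)) (at 0)"
      unfolding H_def by (intro has_derivative_add has_derivative_mult_right hol_on_has_derivative[OF Q(1) 0] hol_on_has_derivative[OF Q(2) 0])
    then show "FD (H a c \<beta>) 0 s = a * FD (Q1 \<beta>) 0 s + c * FD (Q3 \<beta>) 0 s" by (simp add: FD_eq)
  qed
  have NL: "NL_function [(1, ?\<delta>1), (r, ?\<delta>3)] \<beta> t = H 1 (of_rat r) \<beta> t" "NL_function [(1, ?\<delta>1)] \<beta> t = H 1 0 \<beta> t" "NL_function [(1, ?\<delta>3)] \<beta> t = H 0 1 \<beta> t"
    if "\<beta> \<in> quartic_exps" "norm t < \<epsilon>" for \<beta> t r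
    using UV1(2)[OF that(2,1)] UV3(2)[OF that(2,1)] by (simp_all add: NL_function_def H_def Q1_def Q3_def)
  \<comment> \<open>Agreement on the ball is enough, since only derivatives at 0 enter the tangent
    space.\<close>
  have T: "tangent_space0 (NL_ideal \<delta>s) = {v. \<forall>\<beta>\<in>quartic_exps. FD (H a c \<beta>) 0 v = 0}"
    if eq: "\<And>\<beta> t. \<beta> \<in> quartic_exps \<Longrightarrow> norm t < \<epsilon> \<Longrightarrow> NL_function \<delta>s \<beta> t = H a c \<beta> t" for \<delta>s a c
  proof -
    have D: "(NL_function \<delta>s \<beta> has_derivative FD (H a c \<beta>) t) (at t)" if "\<beta> \<in> quartic_exps" "t \<in> ?B" for \<beta> t
      by (rule has_derivative_transform_within_open[OF hol_on_has_derivative[OF H(1) that(2)] open_ball that(2)]) (use eq that in auto)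
    have "NL_function \<delta>s \<beta> \<in> germs0" if "\<beta> \<in> quartic_exps" for \<beta>
      unfolding germs0_def holo_on_def using D[OF that] hol_on_scale[OF H(1)] 0 by (intro CollectI exI[of _ ?B]) blast
    moreover have "NL_function \<delta>s \<beta> 0 = 0" if "\<beta> \<in> quartic_exps" for \<beta> using eq[OF that, of 0] pos by (simp add: H(2))
    ultimately show ?thesis unfolding NL_ideal_def
      by (subst tangent_space0_germ_ideal[OF finite_quartic_exps]) (use FD_eq[OF D[OF _ 0]] in auto)
  qed
  have T1: "tangent_space0 (NL_ideal [(1, ?\<delta>1), (r, ?\<delta>3)]) = {v. \<forall>\<beta>\<in>quartic_exps. FD (H 1 (of_rat r) \<beta>) 0 v = 0}" for r
    by (rule T) (rule NL(1))
  have T2: "tangent_space0 (NL_ideal [(1, ?\<delta>1)]) = {v. \<forall>\<beta>\<in>quartic_exps. FD (H 1 0 \<beta>) 0 v = 0}"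
    by (rule T) (rule NL(2))
  have T3: "tangent_space0 (NL_ideal [(1, ?\<delta>3)]) = {v. \<forall>\<beta>\<in>quartic_exps. FD (H 0 1 \<beta>) 0 v = 0}"
    by (rule T) (rule NL(3))
  show ?thesis unfolding general_pencil_def
  proof (intro conjI allI impI)
    fix r :: rat assume r: "r \<noteq> 0"
    let ?r = "of_rat r :: complex"
    have "codim0 (NL_support [(1, ?\<delta>1), (r, ?\<delta>3)]) 9"
    proof (rule codim0_independent[where h = "\<lambda>i. H 1 ?r (mid_index i)", OF pos(3) H(1,2)])
      have mid: "(\<forall>\<beta>\<in>quartic_exps. H 1 ?r \<beta> t = 0) \<longleftrightarrow> (\<forall>i<9. H 1 ?r (mid_index i) t = 0)" if t: "norm t < \<epsilon>" for t
      proof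
        assume m: "\<forall>i<9. H 1 ?r (mid_index i) t = 0"
        show "\<forall>\<beta>\<in>quartic_exps. H 1 ?r \<beta> t = 0"
        proof
          fix \<beta> assume \<beta>: "\<beta> \<in> quartic_exps"
          show "H 1 ?r \<beta> t = 0"
          proof (cases "\<beta> 0 + \<beta> 1 = 2")
            case True
            then obtain n where "n < 9" "\<beta> = mid_index n" using mid_index_surj[OF \<beta>] by blast
            then show ?thesis using m by simp
          next
            case False
            then show ?thesis using Q0[OF \<beta> _ t] by (simp add: H_def)
          qed
        qed
      qed (use mid_index(3) in blast)
      have "t \<in> NL_support [(1, ?\<delta>1), (r, ?\<delta>3)] \<longleftrightarrow> (\<forall>i<9. H 1 ?r (mid_index i) t = 0)" if "norm t < \<epsilon>" for t
        unfolding NL_support_def mid[OF that, symmetric] using NL(1)[OF _ that] by simp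
      then show "NL_support [(1, ?\<delta>1), (r, ?\<delta>3)] \<inter> ?B = {t \<in> ?B. \<forall>i<9. H 1 ?r (mid_index i) t = 0}"
        by auto
      have "card (slopes f1 \<union> slopes f3) \<le> 5" "card (slopes g1 \<union> slopes g3) \<le> 5"
        using card_Un_le[of "slopes f1" "slopes f3"] card_Un_le[of "slopes g1" "slopes g3"] F.slopes(1,2) G.slopes(1,2) by auto
      then show "independent_forms 9 (\<lambda>i. FD (H 1 ?r (mid_index i)) 0)"
      proof (intro grid_independence[of "slopes f1" "slopes f3" "slopes g1" "slopes g3" J3 ?r _ J1] fin)
        fix i and s :: param assume "i < (9 :: nat)"
        note m = mid_index(1,2)[OF this]
        show "FD (H 1 ?r (mid_index i)) 0 s = (\<Sum>p\<in>slopes f1 \<times> slopes g1. J1 p * slope_sum s (mid_index i) p)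
          + ?r * (\<Sum>p\<in>slopes f3 \<times> slopes g3. J3 p * slope_sum s (mid_index i) p)"
          unfolding H(3) DQ1[OF m] DQ3[OF m] by simp
      qed (use F.slopes G.slopes J3(1) r in simp_all)
    qed
    then show "general_member [(1, ?\<delta>1), (r, ?\<delta>3)]" by (simp add: general_member_def)
  next
    fix r r' :: rat assume r: "r \<noteq> 0 \<and> r' \<noteq> 0 \<and> r \<noteq> r'"
    \<comment> \<open>Two members with different coefficients determine both summands; x and y stand
      for the derivatives of the periods of the two curves.\<close>
    have "x + of_rat r * y = 0 \<and> x + of_rat r' * y = 0 \<longleftrightarrow> x = 0 \<and> y = 0" for x y :: complex
    proof
      assume "x + of_rat r * y = 0 \<and> x + of_rat r' * y = 0"
      moreover have "(of_rat r - of_rat r') * y = (x + of_rat r * y) - (x + of_rat r' * y)" by (simp add: algebra_simps)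
      ultimately have "(of_rat r - of_rat r') * y = 0" by simp
      then have "y = 0" using r by simp
      then show "x = 0 \<and> y = 0" using \<open>x + of_rat r * y = 0 \<and> x + of_rat r' * y = 0\<close> by simp
    qed simp
    then show "tangent_space0 (NL_ideal [(1, ?\<delta>1), (r, ?\<delta>3)]) \<inter> tangent_space0 (NL_ideal [(1, ?\<delta>1), (r', ?\<delta>3)])
       = tangent_space0 (NL_ideal [(1, ?\<delta>1)]) \<inter> tangent_space0 (NL_ideal [(1, ?\<delta>3)])"
      unfolding T1 T2 T3 H(3) by auto
  qed
qed

end
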